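(* Let $n\ge 3$ and $2<p\le 2^*=\frac{2n}{n-2}$. For all $v\in C_c^\infty(\mathbb{H}^n)$ there holds $$\int_{\mathbb{H}^n}|\nabla_{\mathbb{H}^n}v|^2dV\ \ge\ \Big(\frac{n-1}{2}\Big)^2\int_{\mathbb{H}^n}v^2dV+\Big(\frac{n-2}{2}\Big)^2\int_{\mathbb{H}^n}\frac{v^2}{\sinh^2\rho}dV+(n-2)^{-\frac{p+2}{p}}\,\overline{S}_{n,p}\Big(\int_{\mathbb{H}^n}(\sinh\rho)^{\frac{p(n-2)}{2}-n}\,Y^{\frac{p+2}{2}}(\rho)\,|v|^p\,dV\Big)^{2/p}.$$ Moreover the constant $(n-2)^{-\frac{p+2}{p}}\overline{S}_{n,p}$ is sharp.
   Context: $\mathbb{H}^n$ is the $n$-dimensional hyperbolic space (curvature $-1$) with Riemannian gradient $\nabla_{\mathbb{H}^n}$ and volume element $dV$; $\rho=\rho(x)$ is the hyperbolic distance from $x$ to a fixed point $x_0\in\mathbb{H}^n$. Functions are real-valued. $\overline{S}_{n,p}$ denotes the best (largest) constant in the inequality $$\int_{\mathbb{H}^n}|\nabla_{\mathbb{H}^n}v|^2dV\ge\Big(\frac{n-1}{2}\Big)^2\int_{\mathbb{H}^n}v^2dV+\overline{S}_{n,p}\Big(\int_{\mathbb{H}^n}(\sinh\rho)^{\frac{p(n-2)}{2}-n}|v|^pdV\Big)^{2/p},\qquad v\in C_c^\infty(\mathbb{H}^n).$$ The function $Y:(0,\infty)\to(0,\infty)$ is defined as follows. Let $g$ be the unique solution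 of $g''(t)+\frac{1}{4\sinh^2t}g(t)=0$, $t>0$, with $\lim_{t\to+\infty}g(t)=1$, and let $h$ be the unique solution of $h''(t)-\frac{(n-1)(n-3)}{4\sinh^2t}h(t)=0$, $t>0$, with $\lim_{t\to+\infty}h(t)=1$ (so $h\equiv1$ if $n=3$). Both are positive, and $1/g^2$ and $1/h^2$ are integrable near $0$. Define a function $t\mapsto r(t)$ on $(0,\infty)$ by $$\int_0^{r(t)}\frac{ds}{h(s)^2}=\int_0^t\frac{ds}{g(s)^2},\qquad t>0,$$ and set $$Y(t)=(n-2)\,\frac{h(r(t))^2\,\sinh t}{g(t)^2\,\sinh r(t)},\qquad t>0.$$ In the inequality, $Y^{q}(\rho)=(Y(\rho))^q$ with $Y$ evaluated at the distance $\rho=\rho(x)$. "Sharp" means that the constant cannot be replaced by a larger one. *)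

theory Defs
  imports "HOL-Analysis.Analysis"
begin

text \<open>
  Hyperbolic space of dimension \<open>DIM('a)\<close> and curvature -1 is the Poincare model: the open unit
  ball of the Euclidean space \<open>'a\<close> with the metric \<open>4 |dx|^2 / (1 - |x|^2)^2\<close>. Functions on it
  are represented by functions on \<open>'a\<close>; only their values on the ball matter.
\<close>

abbreviation hyp_space :: "'a::euclidean_space set" where
  "hyp_space \<equiv> ball 0 1"

definition conf_factor :: "'a::euclidean_space \<Rightarrow> real" where
  "conf_factor x = 2 / (1 - (norm x)\<^sup>2)"

definition hyp_inner :: "'a::euclidean_space \<Rightarrow> 'a \<Rightarrow> 'a \<Rightarrow> real" where
  "hyp_inner x u w = (conf_factor x)\<^sup>2 * (u \<bullet> w)"

definition hyp_grad :: "('a::euclidean_space \<Rightarrow> real) \<Rightarrow> 'a \<Rightarrow> 'a" where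
  "hyp_grad v x = (THE G. \<forall>w. hyp_inner x G w = frechet_derivative v (at x) w)"

definition hyp_grad_norm :: "('a::euclidean_space \<Rightarrow> real) \<Rightarrow> 'a \<Rightarrow> real" where
  "hyp_grad_norm v x = sqrt (hyp_inner x (hyp_grad v x) (hyp_grad v x))"

text \<open>
  The volume density is the square root of the determinant of the metric tensor, which is
  \<open>(conf_factor x)\<^sup>2\<close> times the identity.
\<close>

definition hyp_vol :: "'a::euclidean_space measure" where
  "hyp_vol = density lborel
     (\<lambda>x. ennreal (indicator hyp_space x * conf_factor x ^ DIM('a)))"

definition hyp_dist :: "'a::euclidean_space \<Rightarrow> 'a \<Rightarrow> real" where
  "hyp_dist x y =
     arcosh (1 + 2 * (norm (x - y))\<^sup>2 / ((1 - (norm x)\<^sup>2) * (1 - (norm y)\<^sup>2)))"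

primrec Ck_on :: "nat \<Rightarrow> 'a::euclidean_space set \<Rightarrow> ('a \<Rightarrow> real) \<Rightarrow> bool" where
  "Ck_on 0 S f \<longleftrightarrow> continuous_on S f"
| "Ck_on (Suc k) S f \<longleftrightarrow> (\<forall>x\<in>S. f differentiable (at x)) \<and>
     (\<forall>w. Ck_on k S (\<lambda>x. frechet_derivative f (at x) w))"

definition hyp_test_functions :: "('a::euclidean_space \<Rightarrow> real) set" where
  "hyp_test_functions = {v. (\<forall>k. Ck_on k hyp_space v) \<and>
     compact (closure {x. v x \<noteq> 0}) \<and> closure {x. v x \<noteq> 0} \<subseteq> hyp_space}"

text \<open>
  The greatest constant does not depend on the base point \<open>x0\<close>, since the isometry group acts
  transitively; \<open>x0\<close> is a parameter because it occurs in the weight. At \<open>x = x0\<close> the weight takes the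
  junk value \<open>0 powr a = 0\<close>, on a null set.
\<close>

definition S_bar :: "'a::euclidean_space \<Rightarrow> real \<Rightarrow> real" where
  "S_bar x0 p = (GREATEST C. \<forall>v\<in>hyp_test_functions.
     (\<integral>x. (hyp_grad_norm v x)\<^sup>2 \<partial>hyp_vol) \<ge>
       ((real DIM('a) - 1) / 2)\<^sup>2 * (\<integral>x. (v x)\<^sup>2 \<partial>hyp_vol)
       + C * (\<integral>x. sinh (hyp_dist x x0) powr (p * (real DIM('a) - 2) / 2 - real DIM('a))
                  * \<bar>v x\<bar> powr p \<partial>hyp_vol) powr (2 / p))"

text \<open>
  The solution on the positive half-line of \<open>y'' = c / (4 sinh^2 t) y\<close> with limit 1 at infinity,
  extended by 0 so that it is unique as a total function.
\<close>

definition ode_sol :: "real \<Rightarrow> real \<Rightarrow> real" where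
  "ode_sol c = (THE y.
     (\<exists>y'. \<forall>t>0. (y has_real_derivative y' t) (at t) \<and>
        (y' has_real_derivative c / (4 * (sinh t)\<^sup>2) * y t) (at t)) \<and>
     (y \<longlongrightarrow> 1) at_top \<and> (\<forall>t\<le>0. y t = 0))"

definition g_sol :: "real \<Rightarrow> real" where
  "g_sol = ode_sol (- 1)"

definition h_sol :: "nat \<Rightarrow> real \<Rightarrow> real" where
  "h_sol n = ode_sol ((real n - 1) * (real n - 3))"

definition r_fun :: "nat \<Rightarrow> real \<Rightarrow> real" where
  "r_fun n t = (THE r. r > 0 \<and>
     (LBINT s:{0<..<r}. 1 / (h_sol n s)\<^sup>2) = (LBINT s:{0<..<t}. 1 / (g_sol s)\<^sup>2))"

definition Y_fun :: "nat \<Rightarrow> real \<Rightarrow> real" where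
  "Y_fun n t = (real n - 2) * ((h_sol n (r_fun n t))\<^sup>2 * sinh t)
     / ((g_sol t)\<^sup>2 * sinh (r_fun n t))"

end

theory Submission imports Defs "HOL-Complex_Analysis.Great_Picard" begin

text \<open>
  In logarithmic polar coordinates \<open>x = e\<^sup>-\<^sup>z \<theta>\<close> the radial parts of the two quadratic forms have positive
  ground states built from Legendre functions of degree \<open>m = (n - 3) / 2\<close> (no Hardy term) and
  \<open>m = -1/2\<close> (full Hardy term); in the variable \<open>\<rho>\<close>, with \<open>sinh \<rho> = 1 / sinh z\<close>, these are \<open>h\<close> and \<open>g\<close>.
  Dividing by the ground states and matching the two resulting measures by a change of the radial
  variable transplants functions so that the radial energies agree, the weighted \<open>L\<^sup>p\<close> norms agree up to
  the factor \<open>Y\<close>, and the angular energy does not increase. This gives the inequality.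

  For sharpness the transplantation has to be inverted, which loses nothing on radial functions only. A test
  function is therefore first symmetrized: among all Lipschitz functions with the same \<open>L\<^sup>2\<close> norm, no larger
  Dirichlet energy and no smaller weighted norm, one maximizing \<open>\<integral> f (1 - |x|\<^sup>2)\<close> is invariant under
  polarization by every hyperbolic reflection and so is radial. The weight is radially decreasing exactly
  because \<open>p \<le> 2n / (n - 2)\<close>. Averaging and smoothing the radial profile produces test functions again.
\<close>

text \<open>In the coordinates \<open>z\<close>, \<open>\<theta>\<close> the metric is the cylinder
  metric divided by \<open>(sinh z)^2\<close>. Hence radial and angular energy carry the same weight
  \<open>rad_w\<close>, and volume density times \<open>L^p\<close> weight is exactly
  \<open>rad_w powr (p / 2)\<close>. Let \<open>y\<close> be the matched variable,
  \<open>t = y'\<close>, and \<open>U(z) = a(z) V(y(z))\<close> with \<open>a\<close> the quotient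
  of the ground states; then \<open>rad_w(z) a^2 = rad_w(y) / t\<close>. This leaves the radial
  energy invariant, multiplies the \<open>L^p\<close> integrand by
  \<open>t powr (- (p + 2) / 2)\<close>, whence the exponent of \<open>Y\<close>, and the angular
  energy density by \<open>t powr (- 2)\<close>. The inequality therefore rests on
  \<open>t \<ge> 1\<close>, which is a comparison of Green functions. The obstacle in the sharpness
  part is that polarization destroys smoothness and that limits destroy gradients. Energy is
  therefore carried by upper gradients along arbitrary curves, since reflections do not map rays to
  rays, and it passes to the limit only in the form of difference quotients in \<open>z\<close>,
  where Fatou's lemma applies.\<close>

section \<open>Calculus of functions of class C^k\<close>

lemma Ck_on_cong:
	assumes "open S" "!!x. x \<in> S ==> f x = g x"
	shows "Ck_on k S f \<longleftrightarrow> Ck_on k S g"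
	using assms
proof (induction k arbitrary: f g)
	case 0
	then show ?case by (auto cong: continuous_on_cong)
next
	case (Suc k)
	have D: "(f has_derivative D) (at x) \<longleftrightarrow> (g has_derivative D) (at x)" if "x \<in> S" for x D
		using Suc.prems that by (metis has_derivative_transform_within_open)
	then have "f differentiable at x \<longleftrightarrow> g differentiable at x" if "x \<in> S" for x
		using that by (auto simp: differentiable_def)
	moreover have "frechet_derivative f (at x) = frechet_derivative g (at x)" if "x \<in> S" for x
		using D that by (simp add: frechet_derivative_def)
	ultimately show ?case
		using Suc.IH[of "\<lambda>x. frechet_derivative f (at x) w" "\<lambda>x. frechet_derivative g (at x) w" for w]
			Suc.prems(1) by auto
qed

lemma Ck_on_SucI:
	assumes "open S" "!!x. x \<in> S ==> (f has_derivative D x) (at x)" "!!w. Ck_on k S (\<lambda>x. D x w)"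
	shows "Ck_on (Suc k) S f"
proof -
	have "frechet_derivative f (at x) = D x" if "x \<in> S" for x
		using assms(2)[OF that] by (simp add: frechet_derivative_at[symmetric])
	then show ?thesis
		using assms by (auto simp: differentiable_def cong: Ck_on_cong)
qed

lemma Ck_on_SucD:
	assumes "Ck_on (Suc k) S f" "x \<in> S"
	shows "(f has_derivative frechet_derivative f (at x)) (at x)"
	using assms frechet_derivative_works by auto

lemma Ck_on_imp_continuous_on: "Ck_on k S f ==> continuous_on S f"
	by (cases k) (auto intro!: continuous_at_imp_continuous_on differentiable_imp_continuous_within)

lemma Ck_on_Suc_imp: "Ck_on (Suc k) S f ==> Ck_on k S f"
proof (induction k arbitrary: f)
	case 0
	then show ?case using Ck_on_imp_continuous_on by fastforce
next
	case (Suc k)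
	then show ?case by (metis Ck_on.simps(2))
qed

lemma Ck_on_subset: "Ck_on k S f ==> T \<subseteq> S ==> Ck_on k T f"
	by (induction k arbitrary: f) (auto intro: continuous_on_subset)

lemma Ck_on_const [intro]: "Ck_on k S (\<lambda>x. c)"
	by (induction k arbitrary: c) auto

lemma Ck_on_inner_left: "open S ==> Ck_on k S (\<lambda>x. x \<bullet> b)"
proof (cases k)
	case (Suc j)
	assume "open S"
	then show ?thesis unfolding Suc
		by (rule Ck_on_SucI[where D="\<lambda>x h. h \<bullet> b"]) (auto intro!: derivative_eq_intros)
qed (auto intro!: continuous_intros)

lemma Ck_on_add:
	assumes "open S" "Ck_on k S f" "Ck_on k S g"
	shows "Ck_on k S (\<lambda>x. f x + g x)"
	using assms
proof (induction k arbitrary: f g)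
	case (Suc k)
	show ?case
	proof (rule Ck_on_SucI[OF Suc.prems(1)])
		show "((\<lambda>x. f x + g x) has_derivative
				(\<lambda>h. frechet_derivative f (at x) h + frechet_derivative g (at x) h)) (at x)" if "x \<in> S" for x
			using Ck_on_SucD[OF Suc.prems(2) that] Ck_on_SucD[OF Suc.prems(3) that] by (rule has_derivative_add)
	qed (use Suc in auto)
qed (auto intro!: continuous_intros)

lemma Ck_on_mult:
	assumes "open S" "Ck_on k S f" "Ck_on k S g"
	shows "Ck_on k S (\<lambda>x. f x * g x)"
	using assms
proof (induction k arbitrary: f g)
	case (Suc k)
	show ?case
	proof (rule Ck_on_SucI[OF Suc.prems(1)])
		show "((\<lambda>x. f x * g x) has_derivative
				(\<lambda>h. f x * frechet_derivative g (at x) h + frechet_derivative f (at x) h * g x)) (at x)" if "x \<in> S" for x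
			using Ck_on_SucD[OF Suc.prems(2) that] Ck_on_SucD[OF Suc.prems(3) that] by (rule has_derivative_mult)
		show "Ck_on k S (\<lambda>x. f x * frechet_derivative g (at x) w + frechet_derivative f (at x) w * g x)" for w
			by (intro Ck_on_add Suc.IH Suc.prems) (use Suc.prems Ck_on_Suc_imp in auto)
	qed
qed (auto intro!: continuous_intros)

lemma Ck_on_sum:
	assumes "open S" "finite B" "!!b. b \<in> B ==> Ck_on k S (f b)"
	shows "Ck_on k S (\<lambda>x. \<Sum>b\<in>B. f b x)"
	using assms(2,3) by (induction B rule: finite_induct) (auto intro!: Ck_on_add assms(1))

text \<open>\<open>Ck_on\<close> speaks of real-valued functions only, so the inner map enters
  through its coordinates. The induction varies the outer function: by the chain rule each
  derivative of the composition is a sum of products of coordinate derivatives and partial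
  derivatives of \<open>f\<close> composed with \<open>I\<close>.\<close>

lemma Ck_on_compose:
	fixes I :: "'a::euclidean_space => 'b::euclidean_space"
	assumes "open S" "open T" "I ` S \<subseteq> T" "Ck_on k T f" "!!b. b \<in> Basis ==> Ck_on k S (\<lambda>x. I x \<bullet> b)"
	shows "Ck_on k S (\<lambda>x. f (I x))"
	using assms
proof (induction k arbitrary: f)
	case 0
	then have "continuous_on S I"
		by (subst continuous_on_componentwise) simp
	then show ?case
		using continuous_on_compose2[of T f S I] 0(3,4) by simp
next
	case (Suc k)
	define D where "D x h = (\<Sum>b\<in>Basis. frechet_derivative (\<lambda>x. I x \<bullet> b) (at x) h *\<^sub>R b)" for x h
	have DI: "(I has_derivative D x) (at x)" if "x \<in> S" for x
		by (subst has_derivative_componentwise_within)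
			(use Ck_on_SucD[OF Suc.prems(5) that] in
				\<open>auto simp: D_def inner_sum_left inner_Basis if_distrib cong: if_cong\<close>)
	show ?case
	proof (rule Ck_on_SucI[OF Suc.prems(1)])
		fix x assume x: "x \<in> S"
		have "(f has_derivative frechet_derivative f (at (I x))) (at (I x))"
			using Suc.prems x by (intro Ck_on_SucD[OF Suc.prems(4)]) auto
		from has_derivative_compose[OF DI[OF x] this]
		show "((\<lambda>x. f (I x)) has_derivative (\<lambda>h. frechet_derivative f (at (I x)) (D x h))) (at x)" .
	next
		fix w
		have eq: "frechet_derivative f (at (I x)) (D x w) =
			(\<Sum>b\<in>Basis. frechet_derivative (\<lambda>x. I x \<bullet> b) (at x) w * frechet_derivative f (at (I x)) b)"
			if "x \<in> S" for x
		proof -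
			interpret linear "frechet_derivative f (at (I x))"
				using Suc.prems(3) that by (intro has_derivative_linear[OF Ck_on_SucD[OF Suc.prems(4)]]) auto
			show ?thesis by (simp add: D_def sum scale)
		qed
		have Ib: "Ck_on k S (\<lambda>x. I x \<bullet> b)" "Ck_on k S (\<lambda>x. frechet_derivative (\<lambda>x. I x \<bullet> b) (at x) w)"
			if "b \<in> Basis" for b
			using Suc.prems(5)[OF that] Ck_on_Suc_imp[OF Suc.prems(5)[OF that]] by simp_all
		have "Ck_on k S (\<lambda>x. frechet_derivative f (at (I x)) b)" for b
			by (rule Suc.IH[OF Suc.prems(1-3) _ Ib(1)]) (use Suc.prems(4) in simp_all)
		then have "Ck_on k S (\<lambda>x. \<Sum>b\<in>Basis. frechet_derivative (\<lambda>x. I x \<bullet> b) (at x) w * frechet_derivative f (at (I x)) b)"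
			by (intro Ck_on_sum Ck_on_mult Suc.prems(1) Ib(2)) auto
		then show "Ck_on k S (\<lambda>x. frechet_derivative f (at (I x)) (D x w))"
			by (subst Ck_on_cong[OF Suc.prems(1) eq]) auto
	qed
qed

lemma Ck_on_compose_real:
	fixes f :: "real => real" and I :: "'a::euclidean_space => real"
	assumes "open S" "open T" "I ` S \<subseteq> T" "Ck_on k T f" "Ck_on k S I"
	shows "Ck_on k S (\<lambda>x. f (I x))"
	by (rule Ck_on_compose[OF assms(1-4)]) (use assms(5) in simp)

lemma Ck_on_real_SucI:
	fixes f :: "real => real"
	assumes "open S" "!!x. x \<in> S ==> (f has_real_derivative f' x) (at x)" "Ck_on k S f'"
	shows "Ck_on (Suc k) S f"
	by (rule Ck_on_SucI[OF assms(1), where D="\<lambda>x h. f' x * h"])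
		(use assms in \<open>auto simp: has_field_derivative_def intro!: Ck_on_mult\<close>)

lemma Ck_on_real_SucD:
	fixes f :: "real => real"
	assumes "Ck_on (Suc k) S f" "x \<in> S"
	shows "(f has_real_derivative frechet_derivative f (at x) 1) (at x)"
proof -
	let ?D = "frechet_derivative f (at x)"
	have D: "(f has_derivative ?D) (at x)"
		by (rule Ck_on_SucD[OF assms])
	then have "?D h = ?D 1 * h" for h
		using linear_scale[OF has_derivative_linear[OF D], of h 1] by simp
	then have "?D = (*) (?D 1)" by (rule ext)
	with D show ?thesis
		unfolding has_field_derivative_def by metis
qed

lemma Ck_on_minus: "open S ==> Ck_on k S f ==> Ck_on k S (\<lambda>x. - f x)"
	using Ck_on_mult[of S k "\<lambda>_. - 1" f] by auto

lemma Ck_on_inverse: "Ck_on k (- {0}) (inverse :: real => real)"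
proof (induction k)
	case 0
	then show ?case by (auto intro!: continuous_intros)
next
	case (Suc k)
	show ?case
		by (rule Ck_on_real_SucI[where f'="\<lambda>x. - (inverse x * inverse x)"])
			(use Suc in \<open>auto intro!: derivative_eq_intros Ck_on_mult Ck_on_minus\<close>)
qed

lemma Ck_on_divide:
	assumes "open S" "Ck_on k S f" "Ck_on k S g" "!!x. x \<in> S ==> g x ~= 0"
	shows "Ck_on k S (\<lambda>x. f x / g x)"
	unfolding divide_inverse using assms
	by (intro Ck_on_mult Ck_on_compose_real[OF _ _ _ Ck_on_inverse]) auto

lemma Ck_on_powr: "Ck_on k {0<..} (\<lambda>x::real. x powr a)"
proof (induction k arbitrary: a)
	case 0
	then show ?case by (auto intro!: continuous_intros)
next
	case (Suc k)
	show ?case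
		by (rule Ck_on_real_SucI[where f'="\<lambda>x. a * x powr (a - 1)"])
			(use Suc in \<open>auto intro!: derivative_eq_intros Ck_on_mult\<close>)
qed

lemma Ck_on_ln: "Ck_on k {0<..} (ln :: real => real)"
proof (cases k)
	case (Suc j)
	show ?thesis
		unfolding Suc
		by (rule Ck_on_real_SucI[where f'="\<lambda>x. inverse x"])
			(auto intro!: derivative_eq_intros Ck_on_subset[OF Ck_on_inverse] simp: divide_inverse)
qed (auto intro!: continuous_intros)

lemma Ck_on_exp: "Ck_on k UNIV (exp :: real => real)"
proof (induction k)
	case (Suc k)
	show ?case
		by (rule Ck_on_real_SucI[where f'=exp]) (use Suc in auto)
qed (auto intro!: continuous_intros)

lemma Ck_on_sinh: "Ck_on k UNIV (sinh :: real => real)"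
	and Ck_on_cosh: "Ck_on k UNIV (cosh :: real => real)"
proof (induction k)
	case (Suc k)
	{
		case 1
		show ?case
			by (rule Ck_on_real_SucI[where f'=cosh]) (use Suc in \<open>auto intro!: derivative_eq_intros\<close>)
	next
		case 2
		show ?case
			by (rule Ck_on_real_SucI[where f'=sinh]) (use Suc in \<open>auto intro!: derivative_eq_intros\<close>)
	}
qed (auto intro!: continuous_intros)

lemma Ck_on_power: "open S ==> Ck_on k S f ==> Ck_on k S (\<lambda>x. f x ^ j)"
	by (induction j) (auto intro: Ck_on_mult)

lemma Ck_on_diff:
	assumes "open S" "Ck_on k S f" "Ck_on k S g"
	shows "Ck_on k S (\<lambda>x. f x - g x)"
	using Ck_on_add[OF assms(1,2) Ck_on_mult[OF assms(1) Ck_on_const[of k S "-1"] assms(3)]] by simp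

lemma Ck_on_norm: "Ck_on k (- {0}) (norm :: 'a::euclidean_space => real)"
proof -
	have eq: "norm x = (\<Sum>b\<in>Basis. (x \<bullet> b) ^ 2) powr (1 / 2)" for x :: 'a
		by (subst euclidean_dist_l2[of x 0, simplified dist_norm diff_zero])
			(simp add: L2_set_def powr_half_sqrt sum_nonneg)
	have "Ck_on k (- {0::'a}) (\<lambda>x. (\<Sum>b\<in>Basis. (x \<bullet> b) ^ 2) powr (1 / 2))"
	proof (rule Ck_on_compose_real[OF _ _ _ Ck_on_powr])
		show "Ck_on k (- {0::'a}) (\<lambda>x. \<Sum>b\<in>Basis. (x \<bullet> b)\<^sup>2)"
			by (intro Ck_on_sum Ck_on_power Ck_on_inner_left) auto
		have "0 < (\<Sum>b\<in>Basis. (x \<bullet> b)\<^sup>2)" if "x ~= 0" for x :: 'a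
			using that eq[of x] by (smt (verit) norm_eq_zero powr_eq_0_iff sum_nonneg zero_le_power2)
		then show "(\<lambda>x::'a. \<Sum>b\<in>Basis. (x \<bullet> b)\<^sup>2) ` (- {0}) \<subseteq> {0<..}"
			by auto
	qed auto
	then show ?thesis
		unfolding eq[abs_def] .
qed

section \<open>A smooth step function\<close>

lemma Ck_on_exp_inverse:
	"Ck_on k UNIV (\<lambda>x::real. if x <= 0 then 0 else exp (- (1 / x)) * (1 / x) ^ j)"
proof -
	define E where "E j x = (if x <= 0 then 0 else exp (- (1 / x)) * (1 / x) ^ j)" for j and x :: real
	have lim: "(E j \<longlongrightarrow> 0) (at 0)" for j
	proof (rule filterlim_split_at)
		have "((\<lambda>y::real. y ^ j / exp y) \<longlongrightarrow> 0) at_top"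
			by (rule tendsto_power_div_exp_0)
		then have "((\<lambda>x::real. (inverse x) ^ j / exp (inverse x)) \<longlongrightarrow> 0) (at_right 0)"
			by (rule filterlim_compose[OF _ filterlim_inverse_at_top_right])
		then show "(E j \<longlongrightarrow> 0) (at_right 0)"
			by (rule Lim_transform_eventually)
				(auto simp: E_def exp_minus field_simps eventually_at_filter intro!: always_eventually)
		show "(E j \<longlongrightarrow> 0) (at_left 0)"
			by (rule tendsto_eventually) (auto simp: E_def eventually_at_filter)
	qed
	\<comment> \<open>The function \<open>exp (- (1 / x))\<close> alone is not stable under
	  differentiation; the span of the family \<open>E j\<close> is, which is why the powers of
	  \<open>1 / x\<close> are carried along.\<close>
	have der: "(E j has_real_derivative E (j + 2) x - j * E (j + 1) x) (at x)" for j x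
	proof -
		consider "x < 0" | "x = 0" | "x > 0" by linarith
		then show ?thesis
		proof cases
			case 1
			then have "((\<lambda>_. 0) has_real_derivative E (j + 2) x - j * E (j + 1) x) (at x)"
				by (simp add: E_def)
			then show ?thesis
				by (rule has_field_derivative_transform_within_open[where S="{..<0}"])
					(use 1 in \<open>auto simp: E_def\<close>)
		next
			case 2
			have "((\<lambda>h. E j h / h) \<longlongrightarrow> 0) (at 0)"
				by (rule Lim_transform_eventually[OF lim[of "Suc j"]])
					(auto simp: E_def eventually_at_filter)
			then show ?thesis
				using 2 by (simp add: E_def has_field_derivative_iff)
		next
			case 3
			have "((\<lambda>x. (1 / x) ^ j) has_real_derivative - (j * (1 / x) ^ (j + 1))) (at x)"
			proof (cases j)
				case (Suc i)
				have "((\<lambda>x. 1 / x) has_real_derivative - ((1 / x) ^ 2)) (at x)"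
					using 3 by (auto intro!: derivative_eq_intros simp: power2_eq_square)
				from DERIV_power[OF this, of j] show ?thesis
					by (rule DERIV_cong) (simp add: Suc power2_eq_square)
			qed simp
			moreover have "((\<lambda>x. exp (- (1 / x))) has_real_derivative exp (- (1 / x)) * (1 / x) ^ 2) (at x)"
				using 3 by (auto intro!: derivative_eq_intros simp: power2_eq_square)
			from DERIV_mult[OF this calculation]
			have "((\<lambda>x. exp (- (1 / x)) * (1 / x) ^ j) has_real_derivative
					E (j + 2) x - j * E (j + 1) x) (at x)"
				by (rule DERIV_cong) (use 3 in \<open>simp add: E_def power2_eq_square\<close>)
			then show ?thesis
				by (rule has_field_derivative_transform_within_open[where S="{0<..}"])
					(use 3 in \<open>auto simp: E_def\<close>)
		qed
	qed
	have "Ck_on k UNIV (E j)"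
	proof (induction k arbitrary: j)
		case 0
		show ?case
			by (simp add: continuous_at_imp_continuous_on DERIV_isCont[OF der])
	next
		case (Suc k)
		show ?case
			by (rule Ck_on_real_SucI[OF _ der]) (auto intro!: Ck_on_diff Ck_on_mult Suc)
	qed
	then show ?thesis
		unfolding E_def[abs_def] .
qed

definition smooth_step :: "real => real" where
	"smooth_step = (let E = \<lambda>x. if x <= 0 then 0 else exp (- (1 / x)) in (\<lambda>x. E x / (E x + E (1 - x))))"

lemma smooth_step_eq_0: "x <= 0 ==> smooth_step x = 0"
	and smooth_step_eq_1: "x >= 1 ==> smooth_step x = 1"
	and smooth_step_nonneg: "0 <= smooth_step x"
	and smooth_step_le_1: "smooth_step x <= 1"
	by (auto simp: smooth_step_def Let_def field_simps add_pos_pos)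

lemma Ck_on_smooth_step: "Ck_on k UNIV smooth_step"
proof -
	define E where "E x = (if x <= 0 then 0 else exp (- (1 / x)))" for x :: real
	have E: "Ck_on k UNIV E"
		using Ck_on_exp_inverse[of k 0] unfolding E_def[abs_def] power_0 mult_1_right .
	have pos: "E x + E (1 - x) ~= 0" for x
	proof -
		have "E x >= 0" "E (1 - x) >= 0" "E x > 0 \<or> E (1 - x) > 0"
			by (auto simp: E_def)
		then show ?thesis by linarith
	qed
	have "Ck_on k UNIV (\<lambda>x. E (1 - x))"
		using Ck_on_inner_left[of UNIV k "1::real"]
		by (intro Ck_on_compose_real[OF _ _ _ E] Ck_on_diff) auto
	then have "Ck_on k UNIV (\<lambda>x. E x / (E x + E (1 - x)))"
		by (intro Ck_on_divide Ck_on_add E) (use pos in auto)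
	then show ?thesis
		by (simp add: smooth_step_def E_def[abs_def] Let_def)
qed

lemma smooth_step_derivative_bounded:
	obtains s' C where "!!x. (smooth_step has_real_derivative s' x) (at x)"
		"continuous_on UNIV s'" "!!x. \<bar>s' x\<bar> <= C"
proof -
	define s' where "s' x = frechet_derivative smooth_step (at x) 1" for x
	have s': "(smooth_step has_real_derivative s' x) (at x)" for x
		unfolding s'_def by (rule Ck_on_real_SucD[OF Ck_on_smooth_step UNIV_I])
	have cont: "continuous_on UNIV s'"
		using Ck_on_smooth_step[of 1] unfolding s'_def by simp
	then have "compact (s' ` {0..1})"
		by (meson compact_continuous_image compact_Icc continuous_on_subset subset_UNIV)
	then obtain C where C: "!!x. x \<in> {0..1} ==> \<bar>s' x\<bar> <= C" "C > 0"
		by (metis bounded_pos compact_imp_bounded imageI real_norm_def)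
	have "s' x = 0" if "x < 0 \<or> x > 1" for x
	proof -
		have "((\<lambda>_. if x < 0 then 0 else 1) has_real_derivative 0) (at x)"
			by simp
		then have "(smooth_step has_real_derivative 0) (at x)"
			by (rule has_field_derivative_transform_within_open[where S="if x < 0 then {..<0} else {1<..}"])
				(use that in \<open>auto simp: smooth_step_eq_0 smooth_step_eq_1\<close>)
		then show ?thesis using s' DERIV_unique by blast
	qed
	then have "\<bar>s' x\<bar> <= C" for x
		using C by (cases "x < 0 \<or> x > 1") auto
	then show ?thesis using that s' cont by blast
qed

subsection \<open>Logarithmic polar coordinates\<close>

text \<open>Surface measure of the unit sphere, obtained as a cone measure: \<open>DIM('a)\<close>
  times the volume of the cone over a set is its area. It lives on the whole space and is
  concentrated on the sphere.\<close>

definition angular :: "'a::euclidean_space measure" where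
	"angular = distr (density lborel (\<lambda>x. of_nat DIM('a) * indicator {x. 0 < norm x \<and> norm x < 1} x))
		 borel (\<lambda>x. x /\<^sub>R norm x)"

abbreviation ray :: "'a::real_vector => real => 'a" where
	"ray \<theta> z \<equiv> exp (- z) *\<^sub>R \<theta>"

definition log_polar :: "real \<times> 'a => 'a::euclidean_space" where
	"log_polar = (\<lambda>(z, \<theta>). ray \<theta> z)"

lemma sets_angular [simp, measurable_cong]: "sets angular = sets borel"
	and space_angular [simp]: "space angular = UNIV"
	by (simp_all add: angular_def)

lemma log_polar_measurable [measurable]: "log_polar \<in> borel_measurable (borel \<Otimes>\<^sub>M borel)"
	unfolding log_polar_def by measurable

lemma emeasure_angular:
	assumes [measurable]: "B \<in> sets borel"
	shows "emeasure (angular :: 'a::euclidean_space measure) B =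
		of_nat DIM('a) * emeasure lborel {x::'a. 0 < norm x \<and> norm x < 1 \<and> x /\<^sub>R norm x \<in> B}"
proof -
	have [measurable]: "(\<lambda>x::'a. x /\<^sub>R norm x) -` B \<in> sets borel"
		using measurable_sets[of "\<lambda>x::'a. x /\<^sub>R norm x" borel borel B] by simp
	have "emeasure (angular :: 'a measure) B =
			(\<integral>\<^sup>+x. of_nat DIM('a) * indicator {x. 0 < norm x \<and> norm x < 1} x *
				indicator ((\<lambda>x. x /\<^sub>R norm x) -` B \<inter> space borel) x \<partial>lborel)"
		unfolding angular_def
		by (subst emeasure_distr, measurable, subst emeasure_density) auto
	also have "... = (\<integral>\<^sup>+x. of_nat DIM('a) * indicator {x::'a. 0 < norm x \<and> norm x < 1 \<and> x /\<^sub>R norm x \<in> B} x \<partial>lborel)"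
		by (intro nn_integral_cong) (auto split: split_indicator)
	also have "... = of_nat DIM('a) * emeasure lborel {x::'a. 0 < norm x \<and> norm x < 1 \<and> x /\<^sub>R norm x \<in> B}"
		by (subst nn_integral_cmult_indicator) auto
	finally show ?thesis .
qed

lemma finite_measure_angular: "finite_measure angular"
proof (rule finite_measureI)
	have "emeasure lborel {x::'a. 0 < norm x \<and> norm x < 1 \<and> x /\<^sub>R norm x \<in> UNIV} <= emeasure lborel (ball (0::'a) 1)"
		by (intro emeasure_mono) auto
	also have "... < \<infinity>"
		using emeasure_lborel_ball_finite by blast
	finally show "emeasure (angular :: 'a measure) (space angular) ~= \<infinity>"
		by (simp add: emeasure_angular ennreal_mult_eq_top_iff)
qed

interpretation angular: finite_measure "angular :: 'a::euclidean_space measure"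
	by (rule finite_measure_angular)

lemma AE_angular_norm: "AE \<theta> in angular. norm \<theta> = 1"
proof -
	have eq: "{x::'a. 0 < norm x \<and> norm x < 1 \<and> x /\<^sub>R norm x \<in> {\<theta>. norm \<theta> ~= 1}} = {}"
		by (auto, metis left_inverse norm_eq_zero)
	have "emeasure (angular :: 'a measure) {\<theta>. norm \<theta> ~= 1} = 0"
		by (subst emeasure_angular, measurable, subst eq, simp)
	then show ?thesis
		by (intro AE_I[where N="{\<theta>. norm \<theta> ~= 1}"]) auto
qed

lemma angular_UNIV_pos: "measure (angular :: 'a::euclidean_space measure) UNIV > 0"
proof -
	have "{x::'a. 0 < norm x \<and> norm x < 1 \<and> x /\<^sub>R norm x \<in> UNIV} = ball 0 1 - {0}"
		by auto
	moreover have "emeasure lborel (ball (0::'a) 1 - {0}) = emeasure lborel (ball (0::'a) 1)"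
		by (rule emeasure_Diff_null_set) (auto simp: null_sets_def)
	moreover have "emeasure lborel (ball (0::'a) 1) ~= 0"
		using content_ball_pos[of 1 "0::'a"] by (metis emeasure_eq_ennreal_measure ennreal_0
			less_irrefl measure_def measure_lborel_cbox_eq zero_less_one enn2real_0 measure_completion sets_lborel borel_open open_ball)
	ultimately have "emeasure (angular :: 'a measure) UNIV ~= 0"
		by (simp add: emeasure_angular)
	then show ?thesis
		by (metis angular.emeasure_eq_measure ennreal_0 less_eq_real_def measure_nonneg)
qed

lemma emeasure_lborel_cone:
	fixes B :: "'a::euclidean_space set" and t :: real
	assumes [measurable]: "B \<in> sets borel"
	shows "emeasure lborel {x. x ~= 0 \<and> x /\<^sub>R norm x \<in> B \<and> t < - ln (norm x)} =
		ennreal (exp (- (DIM('a) * t))) * emeasure lborel {x. 0 < norm x \<and> norm x < 1 \<and> x /\<^sub>R norm x \<in> B}"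
		(is "emeasure _ ?E = _")
proof -
	define c where "c = exp (- t)"
	have c: "c > 0" by (simp add: c_def)
	have [measurable]: "?E \<in> sets borel" by measurable
	have E: "c *\<^sub>R x \<in> ?E \<longleftrightarrow> 0 < norm x \<and> norm x < 1 \<and> x /\<^sub>R norm x \<in> B" for x :: 'a
		using c by (auto simp: ln_mult c_def field_simps)
	have "emeasure lborel ?E = emeasure (density (distr lborel borel (\<lambda>x::'a. 0 + c *\<^sub>R x)) (\<lambda>_. \<bar>c\<bar> ^ DIM('a))) ?E"
		using lborel_affine[of c "0::'a"] c by simp
	also have "... = ennreal (\<bar>c\<bar> ^ DIM('a)) * emeasure lborel ((\<lambda>x. c *\<^sub>R x) -` ?E)"
		by (simp add: emeasure_density nn_integral_distr nn_integral_cmult_indicator emeasure_distr)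
	also have "(\<lambda>x. c *\<^sub>R x) -` ?E = {x. 0 < norm x \<and> norm x < 1 \<and> x /\<^sub>R norm x \<in> B}"
		using E by auto
	also have "\<bar>c\<bar> ^ DIM('a) = exp (- (DIM('a) * t))"
		using c by (simp add: c_def exp_of_nat_mult[symmetric])
	finally show ?thesis .
qed

text \<open>For fixed \<open>B\<close> both sides are measures in \<open>A\<close> that are finite
  on the half-lines \<open>{t<..}\<close>, so it suffices to compare them there: one side is a cone
  scaled by \<open>exp (- t)\<close>, the other an elementary integral.\<close>

lemma lborel_log_polar_cone:
	fixes B :: "'a::euclidean_space set"
	assumes [measurable]: "B \<in> sets borel" "A \<in> sets borel"
	shows "emeasure (density lborel (\<lambda>z. ennreal (exp (- (DIM('a) * z))))) A * emeasure angular B =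
		emeasure lborel {x. x ~= 0 \<and> x /\<^sub>R norm x \<in> B \<and> - ln (norm x) \<in> A}"
proof -
	let ?V = "emeasure lborel {x::'a. 0 < norm x \<and> norm x < 1 \<and> x /\<^sub>R norm x \<in> B}"
	define M where "M = distr (density lborel (\<lambda>x::'a. indicator {x. x ~= 0 \<and> x /\<^sub>R norm x \<in> B} x)) borel (\<lambda>x. - ln (norm x))"
	define N where "N = scale_measure (emeasure (angular :: 'a measure) B)
		 (density lborel (\<lambda>z. ennreal (exp (- (DIM('a) * z)))))"
	have M: "emeasure M A = emeasure lborel {x. x ~= 0 \<and> x /\<^sub>R norm x \<in> B \<and> - ln (norm x) \<in> A}"
		if [measurable]: "A \<in> sets borel" for A
	proof -
		have [measurable]: "(\<lambda>x::'a. - ln (norm x)) -` A \<in> sets borel"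
			using measurable_sets[of "\<lambda>x::'a. - ln (norm x)" borel borel A] by simp
		have "emeasure M A = (\<integral>\<^sup>+x. indicator {x. x ~= 0 \<and> x /\<^sub>R norm x \<in> B} x *
				indicator ((\<lambda>x. - ln (norm x)) -` A \<inter> space borel) x \<partial>lborel)"
			unfolding M_def by (subst emeasure_distr, measurable, subst emeasure_density) auto
		also have "... = (\<integral>\<^sup>+x. indicator {x. x ~= 0 \<and> x /\<^sub>R norm x \<in> B \<and> - ln (norm x) \<in> A} x \<partial>lborel)"
			by (intro nn_integral_cong) (auto split: split_indicator)
		finally show ?thesis by simp
	qed
	have V: "?V < \<infinity>"
	proof -
		have "?V <= emeasure lborel (ball (0::'a) 1)"
			by (intro emeasure_mono) auto
		then show ?thesis
			using emeasure_lborel_ball_finite[of "0::'a" 1] by (auto intro: le_less_trans)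
	qed
	have "M = N"
	proof (rule measure_eqI_lessThan)
		show "sets M = sets borel" "sets N = sets borel"
			by (simp_all add: M_def N_def)
		fix t :: real
		have Mt: "emeasure M {t<..} = ennreal (exp (- (DIM('a) * t))) * ?V"
			by (subst M) (simp_all add: emeasure_lborel_cone)
		then show "emeasure M {t<..} < \<infinity>"
			using V by (simp add: ennreal_mult_less_top)
		have "emeasure (density lborel (\<lambda>z. ennreal (exp (- (DIM('a) * z))))) {t<..} =
				(\<integral>\<^sup>+z. ennreal (exp (- (DIM('a) * z))) * indicator {t..} z \<partial>lborel)"
			by (subst emeasure_density, simp, simp)
				(intro nn_integral_cong_AE eventually_mono[OF AE_lborel_singleton[of t]],
					auto split: split_indicator)
		also have "... = ennreal (0 - (- (exp (- (DIM('a) * t)) / DIM('a))))"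
		proof (rule nn_integral_FTC_atLeast[where F="\<lambda>z. - (exp (- (DIM('a) * z)) / DIM('a))"])
			show "((\<lambda>z. - (exp (- (DIM('a) * z)) / DIM('a))) has_real_derivative exp (- (DIM('a) * x))) (at x)" for x :: real
				by (auto intro!: derivative_eq_intros)
			have "LIM z at_top. - (real DIM('a) * z) :> at_bot"
				using filterlim_tendsto_pos_mult_at_top[OF tendsto_const[of "real DIM('a)"] _ filterlim_ident]
				by (simp add: filterlim_uminus_at_bot)
			then have "((\<lambda>z::real. - (exp (- (DIM('a) * z)) / DIM('a))) \<longlongrightarrow> - (0 / DIM('a))) at_top"
				by (intro tendsto_intros filterlim_compose[OF exp_at_bot]) auto
			then show "((\<lambda>z::real. - (exp (- (DIM('a) * z)) / DIM('a))) \<longlongrightarrow> 0) at_top"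
				by simp
		qed auto
		finally have "emeasure N {t<..} = of_nat DIM('a) * ?V * ennreal (exp (- (DIM('a) * t)) / DIM('a))"
			unfolding N_def by (simp add: emeasure_angular)
		also have "... = ?V * (ennreal (real DIM('a)) * ennreal (exp (- (DIM('a) * t)) / DIM('a)))"
			by (simp add: ennreal_of_nat_eq_real_of_nat mult_ac)
		also have "ennreal (real DIM('a)) * ennreal (exp (- (DIM('a) * t)) / DIM('a)) = ennreal (exp (- (DIM('a) * t)))"
			by (subst ennreal_mult[symmetric]) auto
		finally show "emeasure M {t<..} = emeasure N {t<..}"
			using Mt by (simp add: mult_ac)
	qed
	then have "emeasure N A = emeasure M A" by simp
	then show ?thesis
		using M[OF assms(2)] by (simp add: N_def mult.commute)
qed

text \<open>The inverse coordinate map \<open>P\<close> sends Lebesgue measure without the origin to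
  a measure that agrees with the product measure on rectangles. Only the scaling of volume is used,
  no Jacobian.\<close>

lemma lborel_eq_log_polar:
	"lborel = distr (density (lborel \<Otimes>\<^sub>M angular) (\<lambda>(z, \<theta>). ennreal (exp (- (DIM('a) * z)))))
		 borel (log_polar :: _ => 'a::euclidean_space)"
proof -
	define M1 where "M1 = density lborel (\<lambda>z. ennreal (exp (- (DIM('a) * z))))"
	define L where "L = density lborel (indicator (- {0::'a}))"
	define P where "P x = (- ln (norm x), x /\<^sub>R norm x)" for x :: 'a
	have [measurable]: "P \<in> borel \<rightarrow>\<^sub>M borel \<Otimes>\<^sub>M borel"
		unfolding P_def[abs_def] by measurable
	have [simp, measurable_cong]: "sets L = sets borel" "sets M1 = sets borel" "space L = UNIV"
		by (simp_all add: L_def M1_def)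
	interpret M1: sigma_finite_measure M1
		unfolding M1_def
		by (subst sigma_finite_measure.sigma_finite_iff_density_finite[OF sigma_finite_lborel]) auto
	have M1': "density (lborel \<Otimes>\<^sub>M angular) (\<lambda>(z, \<theta>). ennreal (exp (- (DIM('a) * z)))) =
			M1 \<Otimes>\<^sub>M (angular :: 'a measure)"
	proof -
		have "M1 \<Otimes>\<^sub>M density angular (\<lambda>_. 1) =
				density (lborel \<Otimes>\<^sub>M (angular :: 'a measure)) (\<lambda>(z, \<theta>). ennreal (exp (- (DIM('a) * z))) * 1)"
			unfolding M1_def
			by (rule pair_measure_density)
				(auto simp: density_1 intro: angular.sigma_finite_measure_axioms lborel.sigma_finite_measure_axioms)
		then show ?thesis by (simp add: density_1)
	qed
	have "M1 \<Otimes>\<^sub>M (angular :: 'a measure) = distr L (borel \<Otimes>\<^sub>M borel) P"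
	proof (rule pair_measure_eqI)
		show "sigma_finite_measure M1" "sigma_finite_measure (angular :: 'a measure)"
			by unfold_locales
		show "sets (M1 \<Otimes>\<^sub>M (angular :: 'a measure)) = sets (distr L (borel \<Otimes>\<^sub>M borel) P)"
			by (simp cong: sets_pair_measure_cong)
		fix A and B :: "'a set" assume "A \<in> sets M1" "B \<in> sets angular"
		then have [measurable]: "A \<in> sets borel" "B \<in> sets borel" by auto
		have [measurable]: "P -` (A \<times> B) \<in> sets borel"
			using measurable_sets[of P borel "borel \<Otimes>\<^sub>M borel" "A \<times> B"] by simp
		have "emeasure (distr L (borel \<Otimes>\<^sub>M borel) P) (A \<times> B) =
				(\<integral>\<^sup>+x. indicator (- {0}) x * indicator (P -` (A \<times> B) \<inter> space borel) x \<partial>lborel)"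
			unfolding L_def by (subst emeasure_distr, measurable, subst emeasure_density) auto
		also have "... = (\<integral>\<^sup>+x. indicator {x. x ~= 0 \<and> x /\<^sub>R norm x \<in> B \<and> - ln (norm x) \<in> A} x \<partial>lborel)"
			by (intro nn_integral_cong) (auto simp: P_def split: split_indicator)
		also have "... = emeasure lborel {x. x ~= 0 \<and> x /\<^sub>R norm x \<in> B \<and> - ln (norm x) \<in> A}"
			by simp
		finally show "emeasure M1 A * emeasure angular B = emeasure (distr L (borel \<Otimes>\<^sub>M borel) P) (A \<times> B)"
			by (simp add: M1_def lborel_log_polar_cone)
	qed
	then have "distr (density (lborel \<Otimes>\<^sub>M angular) (\<lambda>(z, \<theta>). ennreal (exp (- (DIM('a) * z))))) borel
			(log_polar :: _ => 'a) = distr L borel (\<lambda>x. log_polar (P x))"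
		unfolding M1' by (simp add: distr_distr comp_def)
	also have "... = lborel"
	proof (rule measure_eqI)
		fix X assume "X \<in> sets (distr L borel (\<lambda>x. log_polar (P x)))"
		then have [measurable]: "X \<in> sets borel" by simp
		have [measurable]: "(\<lambda>x. log_polar (P x)) -` X \<in> sets borel"
			using measurable_sets[of "\<lambda>x. log_polar (P x)" borel borel X] by simp
		have "emeasure (distr L borel (\<lambda>x. log_polar (P x))) X =
				(\<integral>\<^sup>+x. indicator (- {0}) x * indicator ((\<lambda>x. log_polar (P x)) -` X \<inter> space borel) x \<partial>lborel)"
			unfolding L_def by (subst emeasure_distr, measurable, subst emeasure_density) auto
		also have "... = (\<integral>\<^sup>+x. indicator X x \<partial>lborel)"
			by (intro nn_integral_cong_AE eventually_mono[OF AE_lborel_singleton[of 0]])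
				(auto simp: P_def log_polar_def split: split_indicator)
		finally show "emeasure (distr L borel (\<lambda>x. log_polar (P x))) X = emeasure lborel X"
			by simp
	qed simp
	finally show ?thesis ..
qed

section \<open>Hyperbolic volume in logarithmic polar coordinates\<close>

definition hyp_density :: "nat => real => real" where
	"hyp_density n z = indicator {0<..} z / sinh z ^ n"

lemma hyp_density_nonneg: "hyp_density n z >= 0"
	by (auto simp: hyp_density_def split: split_indicator)

lemma borel_measurable_sinh [measurable]: "sinh \<in> borel_measurable (borel :: real measure)"
	by (intro borel_measurable_continuous_onI continuous_intros)

lemma hyp_density_measurable [measurable]: "hyp_density n \<in> borel_measurable borel"
	unfolding hyp_density_def[abs_def] by measurable

lemma conf_factor_log_polar:
	assumes "norm \<theta> = 1"
	shows "indicator hyp_space (log_polar (z, \<theta>)) * conf_factor (log_polar (z, \<theta>)) ^ n * exp (- (n * z)) = hyp_density n z"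
proof (cases "z > 0")
	case True
	have "conf_factor (log_polar (z, \<theta>)) * exp (- z) = 1 / sinh z"
	proof -
		have "exp (- z) < 1" using True by simp
		then have "(exp (- z))\<^sup>2 < 1"
			by (simp add: power_less_one_iff)
		then show ?thesis
			using assms True
			by (simp add: conf_factor_def log_polar_def sinh_field_def exp_minus field_simps power2_eq_square)
	qed
	then have "(conf_factor (log_polar (z, \<theta>)) * exp (- z)) ^ n = (1 / sinh z) ^ n" by simp
	then show ?thesis
		using True assms by (simp add: hyp_density_def log_polar_def power_mult_distrib exp_of_nat_mult[symmetric] power_one_over)
qed (use assms in \<open>auto simp: hyp_density_def log_polar_def\<close>)

lemma hyp_vol_eq_log_polar:
	"hyp_vol = distr (density (lborel \<Otimes>\<^sub>M angular) (\<lambda>y. ennreal (hyp_density DIM('a) (fst y))))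
		 borel (log_polar :: _ => 'a::euclidean_space)"
proof (rule measure_eqI)
	show "sets (hyp_vol :: 'a measure) = sets (distr (density (lborel \<Otimes>\<^sub>M angular) (\<lambda>y. ennreal (hyp_density DIM('a) (fst y))))
		 borel (log_polar :: _ => 'a))"
		by (simp add: hyp_vol_def)
	fix X assume "X \<in> sets (hyp_vol :: 'a measure)"
	then have [measurable]: "X \<in> sets borel" by (simp add: hyp_vol_def)
	have [measurable]: "conf_factor \<in> borel_measurable (borel :: 'a measure)"
		unfolding conf_factor_def[abs_def] by measurable
	have [measurable]: "hyp_space \<in> sets (borel :: 'a measure)" by simp
	let ?w = "\<lambda>x::'a. ennreal (indicator hyp_space x * conf_factor x ^ DIM('a))"
	have [measurable]: "log_polar -` X \<in> sets (borel \<Otimes>\<^sub>M borel)"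
		using measurable_sets[of log_polar "borel \<Otimes>\<^sub>M borel" borel X] by (simp add: space_pair_measure)
	have "emeasure hyp_vol X = (\<integral>\<^sup>+x. ?w x * indicator X x \<partial>lborel)"
		unfolding hyp_vol_def by (subst emeasure_density) auto
	also have "... = (\<integral>\<^sup>+y. (case y of (z, \<theta>) => ennreal (exp (- (DIM('a) * z)))) *
			 (?w (log_polar y) * indicator X (log_polar y)) \<partial>(lborel \<Otimes>\<^sub>M angular))"
		by (subst lborel_eq_log_polar, subst nn_integral_distr, measurable, subst nn_integral_density) auto
	also have "... = (\<integral>\<^sup>+y. ennreal (hyp_density DIM('a) (fst y)) * indicator X (log_polar y)
			\<partial>(lborel \<Otimes>\<^sub>M angular))"
	proof (rule nn_integral_cong_AE)
		interpret pair_sigma_finite lborel "angular :: 'a measure"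
			by unfold_locales
		have "AE y in lborel \<Otimes>\<^sub>M (angular :: 'a measure). norm (snd y) = 1"
			by (rule AE_pair_measure, measurable) (auto intro: AE_angular_norm)
		then show "AE y in lborel \<Otimes>\<^sub>M (angular :: 'a measure).
			 (case y of (z, \<theta>) => ennreal (exp (- (DIM('a) * z)))) *
			 (?w (log_polar y) * indicator X (log_polar y)) =
			 ennreal (hyp_density DIM('a) (fst y)) * indicator X (log_polar y)"
		proof eventually_elim
			case (elim y)
			obtain z \<theta> where y: "y = (z, \<theta>)" by force
			have "ennreal (exp (- (DIM('a) * z))) * ?w (log_polar y) = ennreal (hyp_density DIM('a) z)"
				using elim conf_factor_log_polar[of \<theta> z "DIM('a)"]
				by (subst ennreal_mult'[symmetric]) (auto simp: y mult_ac)
			then show ?case by (simp add: y mult.assoc[symmetric])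
		qed
	qed
	also have "... = emeasure (distr (density (lborel \<Otimes>\<^sub>M angular) (\<lambda>y. ennreal (hyp_density DIM('a) (fst y))))
		 borel (log_polar :: _ => 'a)) X"
		by (subst emeasure_distr, measurable, subst emeasure_density)
			(auto intro!: nn_integral_cong split: split_indicator simp: space_pair_measure)
	finally show "emeasure hyp_vol X = emeasure (distr (density (lborel \<Otimes>\<^sub>M angular)
			(\<lambda>y. ennreal (hyp_density DIM('a) (fst y)))) borel (log_polar :: _ => 'a)) X" .
qed

lemma sets_hyp_vol [simp, measurable_cong]: "sets hyp_vol = sets borel"
	and space_hyp_vol [simp]: "space hyp_vol = UNIV"
	by (simp_all add: hyp_vol_def)

lemma nn_integral_hyp_vol:
	fixes F :: "'a::euclidean_space => ennreal"
	assumes [measurable]: "F \<in> borel_measurable borel"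
	shows "(\<integral>\<^sup>+x. F x \<partial>hyp_vol) =
		(\<integral>\<^sup>+\<theta>. (\<integral>\<^sup>+z. ennreal (hyp_density DIM('a) z) * F (ray \<theta> z) \<partial>lborel) \<partial>angular)"
proof -
	interpret pair_sigma_finite lborel "angular :: 'a measure"
		by unfold_locales
	have "(\<integral>\<^sup>+x. F x \<partial>hyp_vol) = (\<integral>\<^sup>+y. ennreal (hyp_density DIM('a) (fst y)) * F (log_polar y)
			\<partial>(lborel \<Otimes>\<^sub>M angular))"
		by (subst hyp_vol_eq_log_polar, subst nn_integral_distr, measurable, subst nn_integral_density) auto
	also have "... = (\<integral>\<^sup>+\<theta>. (\<integral>\<^sup>+z. ennreal (hyp_density DIM('a) z) * F (log_polar (z, \<theta>)) \<partial>lborel) \<partial>angular)"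
		by (subst nn_integral_snd[symmetric]) auto
	finally show ?thesis by (simp add: log_polar_def)
qed

lemma integrable_hyp_vol_iff:
	fixes F :: "'a::euclidean_space => real"
	assumes [measurable]: "F \<in> borel_measurable borel"
	shows "integrable hyp_vol F \<longleftrightarrow>
		integrable (lborel \<Otimes>\<^sub>M angular) (\<lambda>(z, \<theta>). hyp_density DIM('a) z * F (ray \<theta> z))"
	unfolding hyp_vol_eq_log_polar
	by (subst integrable_distr_eq, simp, simp, subst integrable_density)
		(auto simp: log_polar_def case_prod_unfold hyp_density_nonneg)

lemma integral_hyp_vol:
	fixes F :: "'a::euclidean_space => real"
	assumes F: "integrable hyp_vol F"
	shows "(\<integral>x. F x \<partial>hyp_vol) =
			(\<integral>\<theta>. (\<integral>z. hyp_density DIM('a) z * F (ray \<theta> z) \<partial>lborel) \<partial>angular)"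
		and "integrable angular (\<lambda>\<theta>. \<integral>z. hyp_density DIM('a) z * F (ray \<theta> z) \<partial>lborel)"
		and "AE \<theta> in angular. integrable lborel (\<lambda>z. hyp_density DIM('a) z * F (ray \<theta> z))"
proof -
	interpret pair_sigma_finite lborel "angular :: 'a measure"
		by unfold_locales
	have [measurable]: "F \<in> borel_measurable borel"
		using F by (simp add: measurable_cong_sets[OF sets_hyp_vol[symmetric] refl])
	have int: "integrable (lborel \<Otimes>\<^sub>M angular) (\<lambda>(z, \<theta>). hyp_density DIM('a) z * F (ray \<theta> z))"
		using F by (subst (asm) integrable_hyp_vol_iff) auto
	have "(\<integral>x. F x \<partial>hyp_vol) = (\<integral>y. (case y of (z, \<theta>) => hyp_density DIM('a) z * F (ray \<theta> z))
			\<partial>(lborel \<Otimes>\<^sub>M angular))"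
		unfolding hyp_vol_eq_log_polar
		by (subst integral_distr, simp, simp, subst integral_density)
			(auto simp: log_polar_def case_prod_unfold hyp_density_nonneg)
	also have "... = (\<integral>\<theta>. (\<integral>z. hyp_density DIM('a) z * F (ray \<theta> z) \<partial>lborel) \<partial>angular)"
		using integral_snd[OF int] by simp
	finally show "(\<integral>x. F x \<partial>hyp_vol) =
			(\<integral>\<theta>. (\<integral>z. hyp_density DIM('a) z * F (ray \<theta> z) \<partial>lborel) \<partial>angular)" .
	show "integrable angular (\<lambda>\<theta>. \<integral>z. hyp_density DIM('a) z * F (ray \<theta> z) \<partial>lborel)"
		using integrable_snd[OF int] by simp
	show "AE \<theta> in angular. integrable lborel (\<lambda>z. hyp_density DIM('a) z * F (ray \<theta> z))"
		using AE_integrable_snd[OF int] by simp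
qed

subsection \<open>Test functions and gradients\<close>

definition egrad :: "('a::euclidean_space => real) => 'a => 'a" where
	"egrad v x = (\<Sum>b\<in>Basis. frechet_derivative v (at x) b *\<^sub>R b)"

lemma egrad_inner:
	assumes "v differentiable at x"
	shows "egrad v x \<bullet> w = frechet_derivative v (at x) w"
proof -
	interpret linear "frechet_derivative v (at x)"
		using assms frechet_derivative_works has_derivative_linear by blast
	have "frechet_derivative v (at x) w = frechet_derivative v (at x) (\<Sum>b\<in>Basis. (w \<bullet> b) *\<^sub>R b)"
		by (simp add: euclidean_representation)
	also have "... = (\<Sum>b\<in>Basis. (w \<bullet> b) * frechet_derivative v (at x) b)"
		by (simp add: sum scale)
	also have "... = egrad v x \<bullet> w"
		by (simp add: egrad_def inner_sum_left inner_commute[of w] mult.commute)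
	finally show ?thesis ..
qed

lemma has_derivative_egrad:
	assumes "v differentiable at x"
	shows "(v has_derivative (\<lambda>h. egrad v x \<bullet> h)) (at x)"
	using assms egrad_inner frechet_derivative_works by (metis (no_types, lifting) ext)

lemma egrad_unique:
	assumes "(v has_derivative (\<lambda>h. g \<bullet> h)) (at x)"
	shows "egrad v x = g"
proof -
	have "v differentiable at x"
		using assms differentiable_def by blast
	moreover have "frechet_derivative v (at x) = (\<lambda>h. g \<bullet> h)"
		using assms frechet_derivative_at by force
	ultimately show ?thesis
		using egrad_inner[of v x] vector_eq_rdot[of "egrad v x" g] by simp
qed

text \<open>The formula holds at every point of the space: \<open>conf_factor\<close> is negative
  outside the closed ball, hence the absolute value, and on the unit sphere it is
  \<open>2 / 0 = 0\<close>, where both sides vanish.\<close>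

lemma hyp_grad_norm_eq:
	assumes "v differentiable at x"
	shows "hyp_grad_norm v x = norm (egrad v x) / \<bar>conf_factor x\<bar>"
proof (cases "conf_factor x = 0")
	case False
	define G where "G = egrad v x /\<^sub>R (conf_factor x)\<^sup>2"
	have "hyp_grad v x = G"
		unfolding hyp_grad_def
	proof (rule the_equality)
		show "\<forall>w. hyp_inner x G w = frechet_derivative v (at x) w"
			using False by (simp add: hyp_inner_def G_def egrad_inner[OF assms, symmetric])
		fix G' assume "\<forall>w. hyp_inner x G' w = frechet_derivative v (at x) w"
		then have "\<forall>w. (conf_factor x)\<^sup>2 * (G' \<bullet> w) = egrad v x \<bullet> w"
			by (simp add: hyp_inner_def egrad_inner[OF assms])
		then have "\<forall>w. G' \<bullet> w = G \<bullet> w"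
			using False by (simp add: G_def field_simps)
		then show "G' = G" using vector_eq_rdot[of G' G] by blast
	qed
	then have "hyp_inner x (hyp_grad v x) (hyp_grad v x) = (norm (egrad v x) / \<bar>conf_factor x\<bar>)\<^sup>2"
		using False by (simp add: hyp_inner_def G_def power2_norm_eq_inner[symmetric] power_divide field_simps power2_eq_square)
	then show ?thesis
		by (simp add: hyp_grad_norm_def)
qed (simp add: hyp_grad_norm_def hyp_inner_def)

lemma conf_factor_pos: "x \<in> hyp_space ==> conf_factor x > 0"
	by (simp add: conf_factor_def abs_square_less_1)

lemma conf_factor_measurable [measurable]: "conf_factor \<in> borel_measurable borel"
	unfolding conf_factor_def[abs_def] by measurable

lemma test_support:
	assumes "v \<in> hyp_test_functions"
	obtains R where "0 < R" "R < 1" "!!x. R < norm x ==> v x = 0"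
proof -
	let ?S = "closure {x. v x ~= 0}"
	have S: "compact ?S" "?S \<subseteq> ball 0 1"
		using assms by (auto simp: hyp_test_functions_def)
	show ?thesis
	proof (cases "?S = {}")
		case True
		then show ?thesis using that[of "1/2"] by auto
	next
		case False
		have "continuous_on ?S norm" by (intro continuous_intros)
		then obtain y where y: "y \<in> ?S" "!!x. x \<in> ?S ==> norm x <= norm y"
			using continuous_attains_sup[OF S(1) False] by blast
		have "norm y < 1" using y S by auto
		moreover have "v x = 0" if "max (norm y) (1/2) < norm x" for x
			using y(2)[of x] that closure_subset[of "{x. v x ~= 0}"] by (auto simp: not_le[symmetric])
		ultimately show ?thesis using that[of "max (norm y) (1/2)"] by auto
	qed
qed

lemma test_functionI:
	assumes "!!k. Ck_on k hyp_space v" "R < 1" "!!x. R < norm x ==> v x = 0"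
	shows "v \<in> hyp_test_functions"
proof -
	have "{x. v x ~= 0} \<subseteq> cball 0 R"
		using assms(3) by (auto simp: not_less[symmetric])
	then have "closure {x. v x ~= 0} \<subseteq> cball 0 R"
		by (simp add: closure_minimal)
	moreover from this have "compact (closure {x. v x ~= 0})"
		by (meson bounded_cball bounded_subset compact_closure closure_subset subset_trans)
	ultimately show ?thesis
		using assms(1,2) by (auto simp: hyp_test_functions_def)
qed

lemma test_has_derivative_0:
	assumes "!!x. R < norm x ==> v x = (0::real)" "R < norm x"
	shows "(v has_derivative (\<lambda>h. 0)) (at x)"
proof (rule has_derivative_transform_within_open[OF has_derivative_const[of 0]])
	show "open (- cball (0::'a) R)" "x \<in> - cball 0 R"
		using assms(2) by auto
qed (use assms(1) in auto)

text \<open>The smoothness assumption concerns the ball only; away from the support \<open>v\<close>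
  is locally zero, so later arguments need no case distinction on the position of
  \<open>x\<close>.\<close>

lemma test_differentiable:
	assumes "v \<in> hyp_test_functions"
	shows "v differentiable at x"
proof -
	obtain R where R: "0 < R" "R < 1" "!!x. R < norm x ==> v x = 0"
		using test_support[OF assms] by metis
	show ?thesis
	proof (cases "R < norm x")
		case True
		then show ?thesis
			using test_has_derivative_0[of R v] R(3) differentiable_def by blast
	next
		case False
		then have "x \<in> hyp_space" using R by auto
		moreover have "Ck_on (Suc 0) hyp_space v" using assms by (auto simp: hyp_test_functions_def)
		ultimately show ?thesis by auto
	qed
qed

lemma test_egrad_continuous:
	assumes "v \<in> hyp_test_functions"
	shows "continuous_on UNIV (egrad v)"
proof -
	obtain R where R: "0 < R" "R < 1" "!!x. R < norm x ==> v x = 0"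
		using test_support[OF assms] by metis
	have "continuous_on hyp_space (egrad v)"
	proof -
		have "Ck_on (Suc 0) hyp_space v" using assms by (auto simp: hyp_test_functions_def)
		then show ?thesis
			unfolding egrad_def[abs_def] by (intro continuous_intros) auto
	qed
	moreover have "continuous_on (- cball 0 R) (egrad v)"
	proof -
		have "egrad v x = 0" if "x \<in> - cball 0 R" for x
			by (rule egrad_unique) (use test_has_derivative_0[of R v x] R that in auto)
		then show ?thesis
			using continuous_on_cong continuous_on_const by metis
	qed
	ultimately have "continuous_on (hyp_space \<union> - cball 0 R) (egrad v)"
		by (intro continuous_on_open_Un) auto
	moreover have "hyp_space \<union> - cball 0 R = (UNIV :: 'a set)"
		using R by auto
	ultimately show ?thesis by simp
qed

lemma test_egrad_eq_0:
	assumes "!!x. R < norm x ==> v x = (0::real)" "R < norm x"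
	shows "egrad v x = 0"
	by (rule egrad_unique) (use test_has_derivative_0[OF assms] in auto)

lemma test_continuous:
	assumes "v \<in> hyp_test_functions"
	shows "continuous_on UNIV v"
	using test_differentiable[OF assms]
	by (simp add: continuous_at_imp_continuous_on differentiable_imp_continuous_within)

lemma test_measurable:
	assumes "v \<in> hyp_test_functions"
	shows "v \<in> borel_measurable borel" "hyp_grad_norm v \<in> borel_measurable borel"
proof -
	show "v \<in> borel_measurable borel"
		using test_continuous[OF assms] by (rule borel_measurable_continuous_onI)
	have [measurable]: "egrad v \<in> borel_measurable borel"
		using test_egrad_continuous[OF assms] by (rule borel_measurable_continuous_onI)
	have "hyp_grad_norm v = (\<lambda>x. norm (egrad v x) / \<bar>conf_factor x\<bar>)"
		using hyp_grad_norm_eq[OF test_differentiable[OF assms]] by auto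
	then show "hyp_grad_norm v \<in> borel_measurable borel"
		by simp
qed

lemma test_bounded:
	assumes "v \<in> hyp_test_functions"
	obtains C where "C > 0" "!!x. \<bar>v x\<bar> <= C" "!!x. norm (egrad v x) <= C"
proof -
	obtain R where R: "0 < R" "R < 1" "!!x. R < norm x ==> v x = 0"
		using test_support[OF assms] by metis
	have "compact (v ` cball 0 R)" "compact (egrad v ` cball 0 R)"
		using test_continuous[OF assms] test_egrad_continuous[OF assms]
		by (auto intro!: compact_continuous_image intro: continuous_on_subset)
	then obtain A B where "A > 0" "B > 0" "!!x. x \<in> cball 0 R ==> \<bar>v x\<bar> <= A"
			"!!x. x \<in> cball 0 R ==> norm (egrad v x) <= B"
		using compact_imp_bounded[THEN bounded_pos[THEN iffD1]] by (metis image_eqI real_norm_def)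
	moreover have "v x = 0" "egrad v x = 0" if "x \<notin> cball 0 R" for x
		using that R(3) test_egrad_eq_0[of R v x] by auto
	ultimately show ?thesis
		by (intro that[of "max A B"]) (metis abs_zero le_max_iff_disj less_eq_real_def less_max_iff_disj norm_zero)+
qed

lemma AE_hyp_vol: "AE x in hyp_vol. x \<in> (hyp_space :: 'a::euclidean_space set)"
proof -
	have [measurable]: "hyp_space \<in> sets (borel :: 'a measure)" by simp
	show ?thesis
		unfolding hyp_vol_def by (subst AE_density) (auto split: split_indicator)
qed

lemma integrable_hyp_vol_measurable:
	"integrable hyp_vol F ==> F \<in> borel_measurable borel"
	by (drule borel_measurable_integrable) (simp add: measurable_cong_sets[OF sets_hyp_vol refl])

lemma integral_hyp_vol_cong:
	assumes "F \<in> borel_measurable borel" "G \<in> borel_measurable borel"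
		"!!x. x \<in> hyp_space ==> F x = (G x :: real)"
	shows "(\<integral>x. F x \<partial>hyp_vol) = (\<integral>x. G x \<partial>hyp_vol)"
	by (rule integral_cong_AE) (use assms AE_hyp_vol in \<open>auto elim!: eventually_mono\<close>)

subsection \<open>Hyperbolic reflections\<close>

text \<open>Reflection in the sphere with centre \<open>c\<close> and squared radius
  \<open>(norm c)^2 - 1\<close>. For \<open>norm c > 1\<close> this sphere meets the unit sphere
  orthogonally, so the map is a hyperbolic reflection. Division by zero makes \<open>c\<close> a
  fixed point, which keeps the map an involution of the whole space.\<close>

definition inversion :: "'a::euclidean_space => 'a => 'a" where
	"inversion c x = c + (((norm c)\<^sup>2 - 1) / (norm (x - c))\<^sup>2) *\<^sub>R (x - c)"

context
	fixes c :: "'a::euclidean_space"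
	assumes c: "norm c > 1"
begin

lemma inversion_radius_pos: "(norm c)\<^sup>2 - 1 > 0"
	using c by (simp add: one_less_power)

lemma center_neq: "x \<in> hyp_space ==> x ~= c"
	using c by auto

lemma norm_inversion_diff_center:
	"x ~= c ==> norm (inversion c x - c) = ((norm c)\<^sup>2 - 1) / norm (x - c)"
	using inversion_radius_pos by (simp add: inversion_def power2_eq_square)

lemma inversion_inversion [simp]: "inversion c (inversion c x) = x"
proof (cases "x = c")
	case False
	have "inversion c (inversion c x) =
		 c + (((norm c)\<^sup>2 - 1) / (((norm c)\<^sup>2 - 1) / norm (x - c))\<^sup>2) *\<^sub>R (inversion c x - c)"
		using norm_inversion_diff_center[OF False] by (simp add: inversion_def[of c "inversion c x"])
	also have "... = x"
		using False inversion_radius_pos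
		by (simp add: inversion_def power2_eq_square)
	finally show ?thesis .
qed (simp add: inversion_def)

text \<open>Here the orthogonality of the two spheres enters: \<open>1 - norm^2\<close> is scaled by
  the same factor as lengths near \<open>x\<close>. In the distance and in the gradient norm these
  factors cancel.\<close>

lemma one_minus_norm_inversion:
	assumes "x ~= c"
	shows "1 - (norm (inversion c x))\<^sup>2 = (1 - (norm x)\<^sup>2) * (((norm c)\<^sup>2 - 1) / (norm (x - c))\<^sup>2)"
proof -
	define y where "y = x - c"
	define s where "s = ((norm c)\<^sup>2 - 1) / (norm y)\<^sup>2"
	have x: "x = c + y" and I: "inversion c x = c + s *\<^sub>R y"
		by (simp_all add: y_def s_def inversion_def)
	have s: "s * (y \<bullet> y) = c \<bullet> c - 1"
		using assms by (simp add: s_def y_def power2_norm_eq_inner)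
	have "1 - (norm (inversion c x))\<^sup>2 = 1 - c \<bullet> c - 2 * s * (c \<bullet> y) - s * (s * (y \<bullet> y))"
		unfolding I power2_norm_eq_inner by (simp add: inner_add_left inner_add_right inner_commute algebra_simps)
	also have "... = (1 - (c \<bullet> c + 2 * (c \<bullet> y) + y \<bullet> y)) * s"
		unfolding s using s by (simp add: algebra_simps)
	also have "c \<bullet> c + 2 * (c \<bullet> y) + y \<bullet> y = (norm x)\<^sup>2"
		unfolding x power2_norm_eq_inner by (simp add: inner_add_left inner_add_right inner_commute)
	finally show ?thesis by (simp add: s_def y_def)
qed

lemma norm_inversion_diff:
	assumes "x ~= c" "y ~= c"
	shows "(norm (inversion c x - inversion c y))\<^sup>2 =
		((norm c)\<^sup>2 - 1)\<^sup>2 / ((norm (x - c))\<^sup>2 * (norm (y - c))\<^sup>2) * (norm (x - y))\<^sup>2"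
proof -
	define u w where "u = x - c" and "w = y - c"
	define k where "k = (norm c)\<^sup>2 - 1"
	have nz: "u \<bullet> u ~= 0" "w \<bullet> w ~= 0" using assms by (auto simp: u_def w_def)
	have I: "inversion c x - inversion c y = (k / (u \<bullet> u)) *\<^sub>R u - (k / (w \<bullet> w)) *\<^sub>R w"
		by (simp add: inversion_def u_def w_def k_def power2_norm_eq_inner)
	have "(norm (inversion c x - inversion c y))\<^sup>2 =
			(k / (u \<bullet> u))\<^sup>2 * (u \<bullet> u) - 2 * (k / (u \<bullet> u)) * (k / (w \<bullet> w)) * (u \<bullet> w) + (k / (w \<bullet> w))\<^sup>2 * (w \<bullet> w)"
		unfolding I power2_norm_eq_inner
		by (simp add: inner_diff_left inner_diff_right inner_commute power2_eq_square)
	also have "... = k\<^sup>2 / ((u \<bullet> u) * (w \<bullet> w)) * (u \<bullet> u - 2 * (u \<bullet> w) + w \<bullet> w)"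
		using nz by (simp add: field_simps power2_eq_square)
	also have "u \<bullet> u - 2 * (u \<bullet> w) + w \<bullet> w = (norm (x - y))\<^sup>2"
	proof -
		have "x - y = u - w" by (simp add: u_def w_def)
		then show ?thesis
			unfolding power2_norm_eq_inner by (simp add: inner_diff_left inner_diff_right inner_commute)
	qed
	finally show ?thesis by (simp add: k_def u_def w_def power2_norm_eq_inner)
qed

lemma inversion_in_hyp_space_iff: "inversion c x \<in> hyp_space \<longleftrightarrow> x \<in> hyp_space"
proof (cases "x = c")
	case False
	define s where "s = ((norm c)\<^sup>2 - 1) / (norm (x - c))\<^sup>2"
	have "s > 0"
		using False inversion_radius_pos by (simp add: s_def)
	then have "1 - (norm (inversion c x))\<^sup>2 > 0 \<longleftrightarrow> 1 - (norm x)\<^sup>2 > 0"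
		unfolding one_minus_norm_inversion[OF False] s_def[symmetric] by (simp add: zero_less_mult_iff)
	then show ?thesis by (simp add: abs_square_less_1)
qed (simp add: inversion_def)

lemma inversion_delta:
	assumes "x ~= c" "y ~= c"
	shows "(norm (inversion c x - inversion c y))\<^sup>2 /
			((1 - (norm (inversion c x))\<^sup>2) * (1 - (norm (inversion c y))\<^sup>2)) =
		(norm (x - y))\<^sup>2 / ((1 - (norm x)\<^sup>2) * (1 - (norm y)\<^sup>2))"
proof -
	define k where "k = (norm c)\<^sup>2 - 1"
	have k: "k ~= 0" using inversion_radius_pos by (simp add: k_def)
	have "norm (x - c) ~= 0" "norm (y - c) ~= 0" using assms by auto
	then show ?thesis
		unfolding one_minus_norm_inversion[OF assms(1)] one_minus_norm_inversion[OF assms(2)]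
			norm_inversion_diff[OF assms] k_def[symmetric]
		using k by (simp add: power2_eq_square)
qed

lemma hyp_dist_inversion:
	assumes "x ~= c" "y ~= c"
	shows "hyp_dist (inversion c x) (inversion c y) = hyp_dist x y"
	unfolding hyp_dist_def times_divide_eq_right[symmetric] inversion_delta[OF assms] ..

lemma conf_factor_inversion:
	assumes "x ~= c"
	shows "conf_factor (inversion c x) * (((norm c)\<^sup>2 - 1) / (norm (x - c))\<^sup>2) = conf_factor x"
	unfolding conf_factor_def one_minus_norm_inversion[OF assms]
	using assms inversion_radius_pos by simp

text \<open>A multiple of the Euclidean reflection in the hyperplane orthogonal to
  \<open>x - c\<close>, hence symmetric and conformal.\<close>

definition inversion_deriv :: "'a => 'a => 'a" where
	"inversion_deriv x h = (((norm c)\<^sup>2 - 1) / (norm (x - c))\<^sup>2) *\<^sub>R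
		(h - (2 * ((x - c) \<bullet> h) / (norm (x - c))\<^sup>2) *\<^sub>R (x - c))"

lemma inversion_has_derivative:
	assumes "x ~= c"
	shows "(inversion c has_derivative inversion_deriv x) (at x)"
proof -
	define k where "k = (norm c)\<^sup>2 - 1"
	define u where "u = x - c"
	have nz: "u \<bullet> u ~= 0" using assms by (simp add: u_def)
	have "((\<lambda>u. k / (u \<bullet> u)) has_derivative (\<lambda>h. - (k / (u \<bullet> u) * (2 * (u \<bullet> h) / (u \<bullet> u))))) (at u)"
		using nz by (auto intro!: derivative_eq_intros simp: inner_commute power2_eq_square)
	from has_derivative_scaleR[OF this has_derivative_ident]
	have "((\<lambda>u. (k / (u \<bullet> u)) *\<^sub>R u) has_derivative
			(\<lambda>h. (k / (u \<bullet> u)) *\<^sub>R (h - (2 * (u \<bullet> h) / (u \<bullet> u)) *\<^sub>R u))) (at u)"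
		by (simp add: scaleR_diff_right)
	then have "((\<lambda>u. (k / (u \<bullet> u)) *\<^sub>R u) has_derivative inversion_deriv x) (at (x - c))"
		by (simp add: inversion_deriv_def[abs_def] u_def power2_norm_eq_inner k_def)
	moreover have "((\<lambda>x. x - c) has_derivative (\<lambda>h. h)) (at x)"
		by (auto intro!: derivative_eq_intros)
	ultimately have "((\<lambda>x. (k / ((x - c) \<bullet> (x - c))) *\<^sub>R (x - c)) has_derivative inversion_deriv x) (at x)"
		using has_derivative_compose[of "\<lambda>x. x - c" "\<lambda>h. h" x UNIV] by fastforce
	from has_derivative_add[OF has_derivative_const[of c] this] show ?thesis
		by (simp add: inversion_def[abs_def] k_def power2_norm_eq_inner)
qed

lemma norm_inversion_deriv:
	assumes "x ~= c"
	shows "norm (inversion_deriv x h) = ((norm c)\<^sup>2 - 1) / (norm (x - c))\<^sup>2 * norm h"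
proof -
	define u where "u = x - c"
	have nz: "u \<bullet> u ~= 0" using assms by (simp add: u_def)
	have "(norm (h - (2 * (u \<bullet> h) / (u \<bullet> u)) *\<^sub>R u))\<^sup>2 = (norm h)\<^sup>2"
		unfolding power2_norm_eq_inner using nz
		by (simp add: inner_diff_left inner_diff_right inner_commute field_simps power2_eq_square)
	then have "norm (h - (2 * (u \<bullet> h) / (u \<bullet> u)) *\<^sub>R u) = norm h"
		by (simp add: power2_eq_iff_nonneg)
	then show ?thesis
		using inversion_radius_pos
		by (simp add: inversion_deriv_def u_def power2_norm_eq_inner[symmetric])
qed

lemma inversion_deriv_symmetric: "inversion_deriv x g \<bullet> h = g \<bullet> inversion_deriv x h"
proof -
	have "(s *\<^sub>R (g - (2 * (u \<bullet> g) / N) *\<^sub>R u)) \<bullet> h = g \<bullet> (s *\<^sub>R (h - (2 * (u \<bullet> h) / N) *\<^sub>R u))" for s N u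
		by (simp add: inner_diff_left inner_diff_right inner_commute)
	then show ?thesis unfolding inversion_deriv_def .
qed

lemma inversion_measurable [measurable]: "inversion c \<in> borel_measurable borel"
	unfolding inversion_def[abs_def] by measurable

lemma inversion_smooth: "Ck_on k (- {c}) (\<lambda>x. inversion c x \<bullet> b)"
proof -
	have lin: "Ck_on k (- {c}) (\<lambda>x. (x - c) \<bullet> b)" for b
		unfolding inner_diff_left by (intro Ck_on_diff Ck_on_inner_left) auto
	have "Ck_on k (- {c}) (\<lambda>x. norm (x - c))"
		by (rule Ck_on_compose[OF _ _ _ Ck_on_norm, where I="\<lambda>x. x - c"]) (auto intro: lin)
	then have "Ck_on k (- {c}) (\<lambda>x. c \<bullet> b + ((norm c)\<^sup>2 - 1) / (norm (x - c))\<^sup>2 * ((x - c) \<bullet> b))"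
		by (intro Ck_on_add Ck_on_mult Ck_on_divide Ck_on_power lin) auto
	then show ?thesis
		by (simp add: inversion_def inner_add_left)
qed

text \<open>In logarithmic polar coordinates about \<open>c\<close> the inversion acts on each ray
  as the affine reflection \<open>- ln k - t\<close>. The change of variables is thus
  one-dimensional, and the density matches by \<open>conf_factor_inversion\<close>.\<close>

lemma nn_integral_hyp_vol_inversion:
	fixes F :: "'a => ennreal"
	assumes [measurable]: "F \<in> borel_measurable borel"
	shows "(\<integral>\<^sup>+x. F (inversion c x) \<partial>hyp_vol) = (\<integral>\<^sup>+x. F x \<partial>hyp_vol)"
proof -
	interpret pair_sigma_finite lborel "angular :: 'a measure"
		by unfold_locales
	define k where "k = (norm c)\<^sup>2 - 1"
	have k: "k > 0" using inversion_radius_pos by (simp add: k_def)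
	let ?w = "\<lambda>x::'a. ennreal (indicator hyp_space x * conf_factor x ^ DIM('a))"
	have [measurable]: "hyp_space \<in> sets (borel :: 'a measure)" by simp
	have polar: "(\<integral>\<^sup>+x. H x \<partial>hyp_vol) = (\<integral>\<^sup>+\<theta>. (\<integral>\<^sup>+t. ennreal (exp (- (DIM('a) * t))) *
			(?w (c + ray \<theta> t) * H (c + ray \<theta> t)) \<partial>lborel) \<partial>angular)"
		if [measurable]: "H \<in> borel_measurable borel" for H :: "'a => ennreal"
	proof -
		have "(\<integral>\<^sup>+x. H x \<partial>hyp_vol) = (\<integral>\<^sup>+x. ?w x * H x \<partial>lborel)"
			unfolding hyp_vol_def by (subst nn_integral_density) auto
		also have "... = (\<integral>\<^sup>+x. ?w (c + x) * H (c + x) \<partial>lborel)"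
			by (subst lborel_distr_plus[of c, symmetric], subst nn_integral_distr) auto
		also have "... = (\<integral>\<^sup>+y. (case y of (t, \<theta>) => ennreal (exp (- (DIM('a) * t)))) *
				(?w (c + log_polar y) * H (c + log_polar y)) \<partial>(lborel \<Otimes>\<^sub>M angular))"
			by (subst lborel_eq_log_polar, subst nn_integral_distr, measurable, subst nn_integral_density) auto
		also have "... = (\<integral>\<^sup>+\<theta>. (\<integral>\<^sup>+t. ennreal (exp (- (DIM('a) * t))) *
			(?w (c + log_polar (t, \<theta>)) * H (c + log_polar (t, \<theta>))) \<partial>lborel) \<partial>angular)"
			by (subst nn_integral_snd[symmetric]) auto
		finally show ?thesis by (simp add: log_polar_def)
	qed
	have "(\<integral>\<^sup>+x. F (inversion c x) \<partial>hyp_vol) = (\<integral>\<^sup>+\<theta>. (\<integral>\<^sup>+t. ennreal (exp (- (DIM('a) * t))) *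
			(?w (c + ray \<theta> t) * F (inversion c (c + ray \<theta> t))) \<partial>lborel) \<partial>angular)"
		by (rule polar) measurable
	also have "... = (\<integral>\<^sup>+\<theta>. (\<integral>\<^sup>+t. ennreal (exp (- (DIM('a) * t))) *
			(?w (c + ray \<theta> t) * F (c + ray \<theta> t)) \<partial>lborel) \<partial>angular)"
	proof (rule nn_integral_cong_AE, rule eventually_mono[OF AE_angular_norm])
		fix \<theta> :: 'a assume \<theta>: "norm \<theta> = 1"
		have eq: "inversion c (c + ray \<theta> t) = c + ray \<theta> (- ln k + - 1 * t)" for t
		proof -
			have "(norm (ray \<theta> t))\<^sup>2 = exp (- t) * exp (- t)"
				using \<theta> by (simp add: power2_eq_square)
			then have "inversion c (c + ray \<theta> t) = c + (k / (exp (- t) * exp (- t)) * exp (- t)) *\<^sub>R \<theta>"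
				by (simp add: inversion_def k_def)
			also have "k / (exp (- t) * exp (- t)) * exp (- t) = exp (- (- ln k + - 1 * t))"
				using k by (simp add: exp_minus exp_add divide_inverse mult.commute)
			finally show ?thesis .
		qed
		have w: "ennreal (exp (- (DIM('a) * t))) * ?w (c + ray \<theta> t) =
			 ennreal (exp (- (DIM('a) * (- ln k + - 1 * t)))) * ?w (inversion c (c + ray \<theta> t))" for t :: real
		proof -
			let ?x = "c + ray \<theta> t"
			have x: "?x ~= c" using \<theta> by auto
			have "exp (- (DIM('a) * t)) * conf_factor ?x ^ DIM('a) = (exp (- t) * conf_factor ?x) ^ DIM('a)"
				by (simp add: power_mult_distrib exp_of_nat_mult[symmetric])
			also have "exp (- t) * conf_factor ?x = exp (ln k + t) * conf_factor (inversion c ?x)"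
			proof -
				have "(norm (?x - c))\<^sup>2 = exp (- t) * exp (- t)"
					using \<theta> by (simp add: power2_eq_square)
				then have "exp (- t) * conf_factor ?x = (exp (- t) * (k / (exp (- t) * exp (- t)))) * conf_factor (inversion c ?x)"
					by (simp only: conf_factor_inversion[OF x, symmetric] k_def mult_ac)
				also have "exp (- t) * (k / (exp (- t) * exp (- t))) = exp (ln k + t)"
					using k by (simp add: exp_minus exp_add divide_inverse mult.commute)
				finally show ?thesis .
			qed
			also have "(...) ^ DIM('a) = exp (- (DIM('a) * (- ln k + - 1 * t))) * conf_factor (inversion c ?x) ^ DIM('a)"
				by (simp add: power_mult_distrib exp_of_nat_mult[symmetric] algebra_simps)
			finally have "exp (- (DIM('a) * t)) * conf_factor ?x ^ DIM('a) = ..." .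
			then show ?thesis
				using inversion_in_hyp_space_iff[of ?x]
				by (subst (1 2) ennreal_mult'[symmetric]) (auto split: split_indicator simp: mult_ac)
		qed
		have "(\<integral>\<^sup>+t. ennreal (exp (- (DIM('a) * t))) *
				(?w (c + ray \<theta> t) * F (inversion c (c + ray \<theta> t))) \<partial>lborel) =
			(\<integral>\<^sup>+t. ennreal (exp (- (DIM('a) * (- ln k + - 1 * t)))) *
				(?w (c + ray \<theta> (- ln k + - 1 * t)) * F (c + ray \<theta> (- ln k + - 1 * t))) \<partial>lborel)"
		proof (intro nn_integral_cong, goal_cases)
			case (1 t)
			show ?case
				using arg_cong[OF w[of t], of "\<lambda>a. a * F (inversion c (c + ray \<theta> t))"]
				unfolding eq mult.assoc .
		qed
		also have "... = (\<integral>\<^sup>+t. ennreal (exp (- (DIM('a) * t))) *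
				(?w (c + ray \<theta> t) * F (c + ray \<theta> t)) \<partial>lborel)"
			by (subst (2) nn_integral_real_affine[where c="-1" and t="- ln k"]) auto
		finally show "(\<integral>\<^sup>+t. ennreal (exp (- (DIM('a) * t))) *
				(?w (c + ray \<theta> t) * F (inversion c (c + ray \<theta> t))) \<partial>lborel) =
			(\<integral>\<^sup>+t. ennreal (exp (- (DIM('a) * t))) *
				(?w (c + ray \<theta> t) * F (c + ray \<theta> t)) \<partial>lborel)" .
	qed
	also have "... = (\<integral>\<^sup>+x. F x \<partial>hyp_vol)"
		by (rule polar[symmetric]) measurable
	finally show ?thesis .
qed

lemma distr_hyp_vol_inversion: "distr hyp_vol borel (inversion c) = hyp_vol"
proof (rule measure_eqI)
	fix X assume "X \<in> sets (distr hyp_vol borel (inversion c))"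
	then have [measurable]: "X \<in> sets borel" by simp
	have "emeasure (distr hyp_vol borel (inversion c)) X = (\<integral>\<^sup>+x. indicator X (inversion c x) \<partial>hyp_vol)"
		by (subst nn_integral_indicator[symmetric], simp, subst nn_integral_distr) auto
	then show "emeasure (distr hyp_vol borel (inversion c)) X = emeasure hyp_vol X"
		by (subst (asm) nn_integral_hyp_vol_inversion) auto
qed simp

lemma inversion_measurable_iff:
	"(\<lambda>x. F (inversion c x)) \<in> borel_measurable borel \<longleftrightarrow> F \<in> borel_measurable borel"
proof
	assume "(\<lambda>x. F (inversion c x)) \<in> borel_measurable borel"
	from measurable_compose[OF inversion_measurable this] show "F \<in> borel_measurable borel" by simp
qed (rule measurable_compose[OF inversion_measurable])

lemma integral_hyp_vol_inversion:
	fixes F :: "'a => real"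
	shows "(\<integral>x. F (inversion c x) \<partial>hyp_vol) = (\<integral>x. F x \<partial>hyp_vol)"
proof (cases "F \<in> borel_measurable borel")
	case True
	then show ?thesis
		using integral_distr[of "inversion c" hyp_vol borel F] by (simp add: distr_hyp_vol_inversion)
next
	case False
	\<comment> \<open>Measurability, and with it integrability, fails on both sides, so both integrals
	  have the default value 0.\<close>
	then have "\<not> integrable hyp_vol F" "\<not> integrable hyp_vol (\<lambda>x. F (inversion c x))"
		using inversion_measurable_iff[of F] integrable_hyp_vol_measurable by metis+
	then show ?thesis by (simp add: not_integrable_integral_eq)
qed

lemma integrable_hyp_vol_inversion:
	fixes F :: "'a => real"
	assumes "integrable hyp_vol F"
	shows "integrable hyp_vol (\<lambda>x. F (inversion c x))"
proof -
	have "F \<in> borel_measurable borel"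
		using assms by (rule integrable_hyp_vol_measurable)
	then show ?thesis
		using integrable_distr[of "inversion c" hyp_vol borel F] assms by (simp add: distr_hyp_vol_inversion)
qed

lemma hyp_grad_norm_inversion:
	assumes v: "v differentiable at (inversion c x)" and x: "x ~= c"
	shows "(\<lambda>x. v (inversion c x)) differentiable at x"
		"hyp_grad_norm (\<lambda>x. v (inversion c x)) x = hyp_grad_norm v (inversion c x)"
proof -
	have der: "((\<lambda>x. v (inversion c x)) has_derivative (\<lambda>h. inversion_deriv x (egrad v (inversion c x)) \<bullet> h)) (at x)"
		using has_derivative_compose[OF inversion_has_derivative[OF x] has_derivative_egrad[OF v]]
		by (simp add: inversion_deriv_symmetric)
	then show *: "(\<lambda>x. v (inversion c x)) differentiable at x"
		using differentiable_def by blast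
	let ?s = "((norm c)\<^sup>2 - 1) / (norm (x - c))\<^sup>2"
	have s: "?s > 0" using x inversion_radius_pos by simp
	have "hyp_grad_norm (\<lambda>x. v (inversion c x)) x =
			?s * norm (egrad v (inversion c x)) / \<bar>conf_factor (inversion c x) * ?s\<bar>"
		unfolding hyp_grad_norm_eq[OF *] egrad_unique[OF der] norm_inversion_deriv[OF x] conf_factor_inversion[OF x] ..
	also have "... = ?s * norm (egrad v (inversion c x)) / (?s * \<bar>conf_factor (inversion c x)\<bar>)"
		using s by (simp only: abs_mult abs_of_pos mult.commute)
	also have "... = hyp_grad_norm v (inversion c x)"
		using s by (simp add: hyp_grad_norm_eq[OF v] del: divide_eq_0_iff times_divide_eq_left)
	finally show "hyp_grad_norm (\<lambda>x. v (inversion c x)) x = hyp_grad_norm v (inversion c x)" .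
qed

lemma test_inversion:
	assumes "v \<in> hyp_test_functions"
	shows "(\<lambda>x. v (inversion c x)) \<in> hyp_test_functions"
proof -
	obtain R where R: "0 < R" "R < 1" "!!x. R < norm x ==> v x = 0"
		using test_support[OF assms] by metis
	have "continuous_on (cball 0 R) (inversion c)"
	proof (intro continuous_at_imp_continuous_on ballI)
		fix x :: 'a assume "x \<in> cball 0 R"
		then have "x ~= c" using R center_neq[of x] by auto
		then show "isCont (inversion c) x"
			by (intro has_derivative_continuous[OF inversion_has_derivative])
	qed
	then have comp: "compact (inversion c ` cball 0 R)"
		by (simp add: compact_continuous_image)
	moreover have "inversion c ` cball 0 R ~= {}" using R by auto
	ultimately obtain y where y: "y \<in> inversion c ` cball 0 R" "!!x. x \<in> inversion c ` cball 0 R ==> norm x <= norm y"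
		using continuous_attains_sup[of "inversion c ` cball 0 R" norm] continuous_on_norm_id by blast
	have "norm y < 1" using y(1) inversion_in_hyp_space_iff R by (auto simp: dist_norm)
	show ?thesis
	proof (rule test_functionI)
		show "Ck_on k hyp_space (\<lambda>x. v (inversion c x))" for k
		proof (rule Ck_on_compose[where f=v and I="inversion c"])
			show "Ck_on k hyp_space v" using assms by (auto simp: hyp_test_functions_def)
			show "inversion c ` hyp_space \<subseteq> hyp_space"
				using inversion_in_hyp_space_iff by blast
			show "Ck_on k hyp_space (\<lambda>x. inversion c x \<bullet> b)" for b
				by (rule Ck_on_subset[OF inversion_smooth]) (use center_neq in auto)
		qed auto
		show "norm y < 1" by fact
		show "v (inversion c x) = 0" if "norm y < norm x" for x
		proof (rule ccontr)
			assume "v (inversion c x) ~= 0"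
			then have "inversion c x \<in> cball 0 R" using R(3) by (auto simp: not_less[symmetric])
			then have "x \<in> inversion c ` cball 0 R"
				by (metis imageI inversion_inversion)
			then show False using y(2) that by fastforce
		qed
	qed
qed

end

lemma hyp_grad_norm_integral_inversion:
	assumes "norm c > 1" "v \<in> hyp_test_functions"
	shows "(\<integral>x. (hyp_grad_norm (\<lambda>x. v (inversion c x)) x)\<^sup>2 \<partial>hyp_vol) = (\<integral>x. (hyp_grad_norm v x)\<^sup>2 \<partial>hyp_vol)"
proof -
	have [measurable]: "hyp_grad_norm v \<in> borel_measurable borel"
		"hyp_grad_norm (\<lambda>x. v (inversion c x)) \<in> borel_measurable borel"
		using assms test_inversion test_measurable by blast+
	note inversion_measurable[OF assms(1), measurable]
	have "(\<integral>x. (hyp_grad_norm (\<lambda>x. v (inversion c x)) x)\<^sup>2 \<partial>hyp_vol) =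
			(\<integral>x. (hyp_grad_norm v (inversion c x))\<^sup>2 \<partial>hyp_vol)"
		by (rule integral_hyp_vol_cong)
			(use hyp_grad_norm_inversion(2)[OF assms(1)] center_neq[OF assms(1)] test_differentiable[OF assms(2)] in auto)
	also have "... = (\<integral>x. (hyp_grad_norm v x)\<^sup>2 \<partial>hyp_vol)"
		by (rule integral_hyp_vol_inversion[OF assms(1)])
	finally show ?thesis .
qed

text \<open>The isometry property of an inversion excludes its centre \<open>c\<close>. That point
  lies outside the ball, and altering a function at one point does not affect measurability, so the
  integrals agree for arbitrary integrands.\<close>

lemma integral_hyp_vol_cong_except:
	fixes F G :: "'a::euclidean_space => real"
	assumes "!!x. x ~= c ==> F x = G x" "norm c > 1"
	shows "(\<integral>x. F x \<partial>hyp_vol) = (\<integral>x. G x \<partial>hyp_vol)"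
proof (cases "F \<in> borel_measurable borel")
	case True
	have "G = (\<lambda>x. if x = c then G c else F x)" using assms by auto
	also have "... \<in> borel_measurable borel" using True by measurable
	finally show ?thesis
		using True center_neq[OF assms(2)] by (intro integral_hyp_vol_cong assms(1)) auto
next
	case False
	have "G \<notin> borel_measurable borel"
	proof
		assume *: "G \<in> borel_measurable borel"
		have "F = (\<lambda>x. if x = c then F c else G x)" using assms by auto
		also have "... \<in> borel_measurable borel" using * by measurable
		finally show False using False by blast
	qed
	then have "\<not> integrable hyp_vol F" "\<not> integrable hyp_vol G"
		using False integrable_hyp_vol_measurable by metis+
	then show ?thesis by (simp add: not_integrable_integral_eq)
qed

text \<open>The centre of the hyperbolic reflection exchanging \<open>x0\<close> with the origin is
  the mirror point of \<open>x0\<close> in the unit sphere.\<close>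

lemma integral_weight_inversion:
	fixes x0 :: "'a::euclidean_space" and \<Psi> :: "real => real => real"
	assumes x0: "x0 \<in> hyp_space" "x0 ~= 0" and c: "c = x0 /\<^sub>R (norm x0)\<^sup>2"
	shows "norm c > 1" "inversion c 0 = x0" "inversion c x0 = 0"
		"(\<integral>x. \<Psi> (hyp_dist x x0) (v x) \<partial>hyp_vol) = (\<integral>x. \<Psi> (hyp_dist x 0) (v (inversion c x)) \<partial>hyp_vol)"
proof -
	have n: "norm c = 1 / norm x0" using x0 by (simp add: c power2_eq_square field_simps)
	then show c1: "norm c > 1" using x0 by simp
	have "((norm c)\<^sup>2 - 1) / (norm c)\<^sup>2 = 1 - (norm x0)\<^sup>2"
		using x0 by (simp add: n power2_eq_square field_simps)
	then have "inversion c 0 = (norm x0)\<^sup>2 *\<^sub>R c"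
		by (simp add: inversion_def scaleR_diff_left)
	then show I0: "inversion c 0 = x0"
		using x0 by (simp add: c)
	show "inversion c x0 = 0" using inversion_inversion[OF c1, of 0] I0 by simp
	have "(\<integral>x. \<Psi> (hyp_dist x x0) (v x) \<partial>hyp_vol) =
		 (\<integral>x. \<Psi> (hyp_dist (inversion c x) x0) (v (inversion c x)) \<partial>hyp_vol)"
		by (rule integral_hyp_vol_inversion[OF c1, symmetric])
	also have "... = (\<integral>x. \<Psi> (hyp_dist x 0) (v (inversion c x)) \<partial>hyp_vol)"
	proof (rule integral_hyp_vol_cong_except[OF _ c1])
		fix x assume "x ~= c"
		moreover have "0 ~= c" using c1 by auto
		ultimately have "hyp_dist (inversion c x) x0 = hyp_dist x 0"
			using hyp_dist_inversion[OF c1, of x 0] I0 by simp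
		then show "\<Psi> (hyp_dist (inversion c x) x0) (v (inversion c x)) = \<Psi> (hyp_dist x 0) (v (inversion c x))"
			by simp
	qed
	finally show "(\<integral>x. \<Psi> (hyp_dist x x0) (v x) \<partial>hyp_vol) = (\<integral>x. \<Psi> (hyp_dist x 0) (v (inversion c x)) \<partial>hyp_vol)" .
qed

subsection \<open>Legendre functions\<close>

definition leg_kernel :: "real => real => real" where
	"leg_kernel z \<phi> = cosh z + sinh z * cos \<phi>"

definition leg_kernel' :: "real => real => real" where
	"leg_kernel' z \<phi> = sinh z + cosh z * cos \<phi>"

text \<open>Laplace's integral for the Legendre function \<open>P\<^sub>m (cosh z)\<close>.\<close>

definition legendre :: "real => real => real" where
	"legendre m z = integral {0..pi} (\<lambda>\<phi>. leg_kernel z \<phi> powr m) / pi"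

definition legendre' :: "real => real => real" where
	"legendre' m z = integral {0..pi} (\<lambda>\<phi>. m * leg_kernel z \<phi> powr (m - 1) * leg_kernel' z \<phi>) / pi"

lemma leg_kernel_pos [simp]: "leg_kernel z \<phi> > 0"
proof -
	have "\<bar>sinh z\<bar> < cosh z"
		using sinh_less_cosh_real[of z] sinh_less_cosh_real[of "- z"] by (auto simp: abs_less_iff)
	moreover have "\<bar>sinh z * cos \<phi>\<bar> <= \<bar>sinh z\<bar> * 1"
		unfolding abs_mult by (intro mult_left_mono) auto
	ultimately show ?thesis unfolding leg_kernel_def by linarith
qed

lemma leg_kernel_neq [simp]: "leg_kernel z \<phi> ~= 0"
	using leg_kernel_pos less_imp_neq by metis

lemma continuous_on_leg_kernel [continuous_intros]:
	fixes f g :: "'a::t2_space => real"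
	assumes "continuous_on S f" "continuous_on S g"
	shows "continuous_on S (\<lambda>x. leg_kernel (f x) (g x))" "continuous_on S (\<lambda>x. leg_kernel' (f x) (g x))"
	unfolding leg_kernel_def leg_kernel'_def by (auto intro!: continuous_intros assms)

lemma DERIV_leg_kernel [derivative_intros]:
	"((\<lambda>z. leg_kernel z \<phi>) has_real_derivative leg_kernel' z \<phi>) (at z within S)"
	"((\<lambda>z. leg_kernel' z \<phi>) has_real_derivative leg_kernel z \<phi>) (at z within S)"
	unfolding leg_kernel_def leg_kernel'_def by (auto intro!: derivative_eq_intros)

lemma DERIV_leg_kernel_powr:
	"((\<lambda>z. leg_kernel z \<phi> powr m) has_real_derivative
		m * leg_kernel z \<phi> powr (m - 1) * leg_kernel' z \<phi>) (at z within S)"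
	using leg_kernel_pos[of z \<phi>] DERIV_leg_kernel(1)[of \<phi> z S]
	by (auto intro!: derivative_eq_intros)

lemma DERIV_legendre: "(legendre m has_real_derivative legendre' m z) (at z)"
proof -
	have "((\<lambda>z. integral (cbox 0 pi) (\<lambda>\<phi>. leg_kernel z \<phi> powr m)) has_field_derivative
			integral (cbox 0 pi) (\<lambda>\<phi>. m * leg_kernel z \<phi> powr (m - 1) * leg_kernel' z \<phi>)) (at z within UNIV)"
		by (rule leibniz_rule_field_derivative[OF DERIV_leg_kernel_powr])
			(auto intro!: continuous_intros integrable_continuous_interval simp: case_prod_unfold)
	then show ?thesis
		unfolding legendre_def[abs_def] legendre'_def by (auto intro!: derivative_eq_intros)
qed

definition legendre'' :: "real => real => real" where
	"legendre'' m z = integral {0..pi} (\<lambda>\<phi>. m * ((m - 1) * leg_kernel z \<phi> powr (m - 2) * (leg_kernel' z \<phi>)\<^sup>2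
		 + leg_kernel z \<phi> powr m)) / pi"

lemma DERIV_legendre': "(legendre' m has_real_derivative legendre'' m z) (at z)"
proof -
	have "((\<lambda>z. m * leg_kernel z \<phi> powr (m - 1) * leg_kernel' z \<phi>) has_real_derivative
			m * ((m - 1) * leg_kernel z \<phi> powr (m - 2) * (leg_kernel' z \<phi>)\<^sup>2
		 + leg_kernel z \<phi> powr m)) (at z within S)" for z \<phi> S
	proof -
		have "leg_kernel z \<phi> powr m = leg_kernel z \<phi> powr (m - 1) * leg_kernel z \<phi>"
			using leg_kernel_pos[of z \<phi>] by (simp add: powr_diff abs_of_pos del: leg_kernel_pos)
		then show ?thesis
			by (auto intro!: derivative_eq_intros DERIV_leg_kernel_powr simp: power2_eq_square algebra_simps)
	qed
	then have "((\<lambda>z. integral (cbox 0 pi) (\<lambda>\<phi>. m * leg_kernel z \<phi> powr (m - 1) * leg_kernel' z \<phi>)) has_field_derivative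
			integral (cbox 0 pi) (\<lambda>\<phi>. m * ((m - 1) * leg_kernel z \<phi> powr (m - 2) * (leg_kernel' z \<phi>)\<^sup>2
		 + leg_kernel z \<phi> powr m))) (at z within UNIV)"
		by (rule leibniz_rule_field_derivative)
			(auto intro!: continuous_intros integrable_continuous_interval simp: case_prod_unfold)
	then show ?thesis
		unfolding legendre'_def[abs_def] legendre''_def by (auto intro!: derivative_eq_intros)
qed

text \<open>The integrand of the Legendre equation is the \<open>\<phi>\<close>-derivative of
	\<open>m A\<^bsup>m-1\<^esup> sin \<phi>\<close>, where \<open>A\<close> is the kernel.\<close>

lemma legendre_equation:
	"sinh z * legendre'' m z + cosh z * legendre' m z = m * (m + 1) * sinh z * legendre m z"
proof -
	define A where "A = leg_kernel z"
	define B where "B = leg_kernel' z"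
	have A: "A \<phi> > 0" for \<phi> by (simp add: A_def leg_kernel_pos)
	have [continuous_intros]: "continuous_on S A" "continuous_on S B" for S
		unfolding A_def B_def by (intro continuous_intros)+
	let ?I2 = "\<lambda>\<phi>. m * ((m - 1) * A \<phi> powr (m - 2) * (B \<phi>)\<^sup>2 + A \<phi> powr m)"
	let ?I1 = "\<lambda>\<phi>. m * A \<phi> powr (m - 1) * B \<phi>"
	let ?I0 = "\<lambda>\<phi>. A \<phi> powr m"
	have int: "(?I2 has_integral pi * legendre'' m z) {0..pi}" "(?I1 has_integral pi * legendre' m z) {0..pi}"
		 "(?I0 has_integral pi * legendre m z) {0..pi}"
	proof -
		have c: "pi * (I / pi) = I" for I :: real by simp
		show "(?I2 has_integral pi * legendre'' m z) {0..pi}" "(?I1 has_integral pi * legendre' m z) {0..pi}"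
		 "(?I0 has_integral pi * legendre m z) {0..pi}"
			unfolding legendre''_def legendre'_def legendre_def A_def[symmetric] B_def[symmetric] c
			using A[THEN less_imp_neq, symmetric]
			by (intro integrable_integral integrable_continuous_interval continuous_intros; simp)+
	qed
	have "((\<lambda>\<phi>. sinh z * ?I2 \<phi> + cosh z * ?I1 \<phi> - m * (m + 1) * sinh z * ?I0 \<phi>) has_integral
			sinh z * (pi * legendre'' m z) + cosh z * (pi * legendre' m z) - m * (m + 1) * sinh z * (pi * legendre m z)) {0..pi}"
		by (intro has_integral_diff has_integral_add has_integral_mult_right int)
	moreover have "((\<lambda>\<phi>. sinh z * ?I2 \<phi> + cosh z * ?I1 \<phi> - m * (m + 1) * sinh z * ?I0 \<phi>) has_integral
			m * A pi powr (m - 1) * sin pi - m * A 0 powr (m - 1) * sin 0) {0..pi}"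
	proof (rule fundamental_theorem_of_calculus)
		fix \<phi> :: real
		have dA: "(A has_real_derivative - (sinh z * sin \<phi>)) (at \<phi> within {0..pi})"
			unfolding A_def leg_kernel_def by (auto intro!: derivative_eq_intros)
		have p1: "A \<phi> powr (m - 1) = A \<phi> powr (m - 2) * A \<phi>" and p0: "A \<phi> powr m = A \<phi> powr (m - 2) * (A \<phi>)\<^sup>2"
			using A[of \<phi>] by (simp_all add: powr_diff power2_eq_square powr_numeral)
		have alg: "sinh z * ((m - 1) * (B \<phi>)\<^sup>2 + (A \<phi>)\<^sup>2) + cosh z * A \<phi> * B \<phi> - (m + 1) * sinh z * (A \<phi>)\<^sup>2
			 = (m - 1) * (- (sinh z * sin \<phi>)) * sin \<phi> + A \<phi> * cos \<phi>"
		proof -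
			have B2: "(B \<phi>)\<^sup>2 = (A \<phi>)\<^sup>2 - (sin \<phi>)\<^sup>2"
				unfolding A_def B_def leg_kernel_def leg_kernel'_def sin_squared_eq
				using cosh_square_eq[of z] by (simp add: power2_eq_square algebra_simps)
			have "cosh z * B \<phi> - sinh z * A \<phi> = cos \<phi>"
				unfolding A_def B_def leg_kernel_def leg_kernel'_def
				using cosh_square_eq[of z] by (simp add: power2_eq_square algebra_simps)
			then have "A \<phi> * cos \<phi> = A \<phi> * (cosh z * B \<phi> - sinh z * A \<phi>)" by simp
			then show ?thesis
				unfolding B2 by (simp add: power2_eq_square algebra_simps)
		qed
		have "((\<lambda>\<phi>. m * A \<phi> powr (m - 1) * sin \<phi>) has_real_derivative
				m * ((m - 1) * A \<phi> powr (m - 1 - 1) * (- (sinh z * sin \<phi>)) * sin \<phi> + A \<phi> powr (m - 1) * cos \<phi>)) (at \<phi> within {0..pi})"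
			using A[of \<phi>] dA by (auto intro!: derivative_eq_intros simp: algebra_simps)
		also have "m * ((m - 1) * A \<phi> powr (m - 1 - 1) * (- (sinh z * sin \<phi>)) * sin \<phi> + A \<phi> powr (m - 1) * cos \<phi>)
			 = m * A \<phi> powr (m - 2) * ((m - 1) * (- (sinh z * sin \<phi>)) * sin \<phi> + A \<phi> * cos \<phi>)"
			unfolding p1 by (simp add: algebra_simps)
		also have "... = sinh z * ?I2 \<phi> + cosh z * ?I1 \<phi> - m * (m + 1) * sinh z * ?I0 \<phi>"
			unfolding alg[symmetric] p1 p0 by (simp add: algebra_simps)
		finally show "((\<lambda>\<phi>. m * A \<phi> powr (m - 1) * sin \<phi>) has_vector_derivative
				sinh z * ?I2 \<phi> + cosh z * ?I1 \<phi> - m * (m + 1) * sinh z * ?I0 \<phi>) (at \<phi> within {0..pi})"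
			by (simp add: has_real_derivative_iff_has_vector_derivative)
	qed simp
	ultimately have "sinh z * (pi * legendre'' m z) + cosh z * (pi * legendre' m z) - m * (m + 1) * sinh z * (pi * legendre m z) = 0"
		by (rule has_integral_unique[THEN trans]) simp
	then have "pi * (sinh z * legendre'' m z + cosh z * legendre' m z - m * (m + 1) * sinh z * legendre m z) = 0"
		by (simp add: algebra_simps)
	then show ?thesis by simp
qed

lemma legendre_pos: "legendre m z > 0"
proof -
	have int: "(\<lambda>\<phi>. leg_kernel z \<phi> powr m) integrable_on {0..pi}"
		by (auto intro!: integrable_continuous_interval continuous_intros)
	have "integral {0..pi} (\<lambda>\<phi>. leg_kernel z \<phi> powr m) ~= 0"
	proof
		assume "integral {0..pi} (\<lambda>\<phi>. leg_kernel z \<phi> powr m) = 0"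
		then have "\<forall>\<phi>\<in>{0..pi}. leg_kernel z \<phi> powr m = 0"
			by (subst (asm) integral_eq_0_iff) (auto intro!: continuous_intros)
		then show False using leg_kernel_pos[of z 0] by (auto dest!: bspec[of _ _ 0])
	qed
	moreover have "integral {0..pi} (\<lambda>\<phi>. leg_kernel z \<phi> powr m) >= 0"
		by (rule integral_nonneg[OF int]) simp
	ultimately show ?thesis by (simp add: legendre_def)
qed

lemma legendre_0 [simp]: "legendre m 0 = 1"
	by (simp add: legendre_def leg_kernel_def)

lemma continuous_on_legendre: "continuous_on S (legendre m)" "continuous_on S (legendre' m)"
	using DERIV_legendre DERIV_legendre' by (meson DERIV_continuous_on has_field_derivative_at_within)+

lemma legendre_smooth: "Ck_on k {0<..} (legendre m)" "Ck_on k {0<..} (legendre' m)"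
proof (induction k)
	case 0
	{
		case 1 then show ?case using continuous_on_legendre by simp
	next
		case 2 then show ?case using continuous_on_legendre by simp
	}
next
	case (Suc k)
	{
		case 1 then show ?case
			by (rule Ck_on_real_SucI[OF _ DERIV_legendre]) (use Suc in auto)
	next
		case 2
		\<comment> \<open>Away from 0 the Legendre equation expresses the second derivative through the
		  lower ones, so smoothness of all orders follows by bootstrapping.\<close>
		have eq: "legendre'' m z = m * (m + 1) * legendre m z - cosh z / sinh z * legendre' m z" if "z > 0" for z
			using legendre_equation[of z m] that by (simp add: field_simps)
		show ?case
		proof (rule Ck_on_real_SucI[OF _ DERIV_legendre'])
			have "Ck_on k {0<..} (\<lambda>z. m * (m + 1) * legendre m z - cosh z / sinh z * legendre' m z)"
				by (intro Ck_on_diff Ck_on_mult Ck_on_divide Suc Ck_on_const Ck_on_subset[OF Ck_on_cosh] Ck_on_subset[OF Ck_on_sinh]) auto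
			then show "Ck_on k {0<..} (legendre'' m)"
				by (subst Ck_on_cong[OF _ eq]) auto
		qed simp
	}
qed

text \<open>The Wronskian weighted by \<open>sinh\<close> vanishes at 0, and its derivative has the
  factor \<open>m * (m + 1) + 1/4 = (m + 1/2)^2\<close>, which is nonnegative: the value
  \<open>m = -1/2\<close> is the critical one.\<close>

lemma legendre_ratio_mono:
	assumes "0 < x" "x <= y"
	shows "legendre m x / legendre (- (1/2)) x <= legendre m y / legendre (- (1/2)) y"
proof -
	let ?g = "legendre (- (1/2))" and ?g' = "legendre' (- (1/2))"
	define W where "W z = sinh z * (legendre' m z * ?g z - legendre m z * ?g' z)" for z
	have dW: "(W has_real_derivative (m + 1/2)\<^sup>2 * sinh z * legendre m z * ?g z) (at z)" for z
	proof -
		have "(W has_real_derivative cosh z * (legendre' m z * ?g z - legendre m z * ?g' z) +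
			 sinh z * (legendre'' m z * ?g z + legendre' m z * ?g' z - (legendre m z * legendre'' (- (1/2)) z + legendre' m z * ?g' z))) (at z)"
			unfolding W_def by (auto intro!: derivative_eq_intros DERIV_legendre DERIV_legendre')
		also have "cosh z * (legendre' m z * ?g z - legendre m z * ?g' z) +
			 sinh z * (legendre'' m z * ?g z + legendre' m z * ?g' z - (legendre m z * legendre'' (- (1/2)) z + legendre' m z * ?g' z))
			 = (sinh z * legendre'' m z + cosh z * legendre' m z) * ?g z -
				 legendre m z * (sinh z * legendre'' (- (1/2)) z + cosh z * ?g' z)"
			by (simp add: algebra_simps)
		also have "... = (m + 1/2)\<^sup>2 * sinh z * legendre m z * ?g z"
			unfolding legendre_equation by (simp add: algebra_simps power2_eq_square)
		finally show ?thesis .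
	qed
	have W: "W z >= 0" if "z > 0" for z
	proof -
		have "W 0 <= W z"
			using that dW by (intro DERIV_nonneg_imp_nondecreasing[of 0 z W])
				(auto intro!: exI[of _ "(m + 1/2)\<^sup>2 * sinh _ * legendre m _ * ?g _"] mult_nonneg_nonneg less_imp_le[OF legendre_pos])
		then show ?thesis by (simp add: W_def)
	qed
	show ?thesis
	proof (rule DERIV_nonneg_imp_nondecreasing[OF assms(2)])
		fix z assume z: "x <= z" "z <= y"
		have "((\<lambda>z. legendre m z / ?g z) has_real_derivative (legendre' m z * ?g z - legendre m z * ?g' z) / (?g z)\<^sup>2) (at z)"
			using legendre_pos[of "- (1/2)" z]
			by (auto intro!: derivative_eq_intros DERIV_legendre simp: power2_eq_square)
		moreover have "legendre' m z * ?g z - legendre m z * ?g' z >= 0"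
			using W[of z] z assms by (simp add: W_def zero_le_mult_iff)
		ultimately show "\<exists>D. ((\<lambda>z. legendre m z / ?g z) has_real_derivative D) (at z) \<and> 0 <= D"
			by (intro exI conjI) auto
	qed
qed

lemma legendre_ge:
	assumes "0 < x"
	shows "legendre (- (1/2)) x <= legendre m x"
proof -
	have "((\<lambda>z. legendre m z / legendre (- (1/2)) z) \<longlongrightarrow> legendre m 0 / legendre (- (1/2)) 0) (at_right 0)"
		by (intro tendsto_divide tendsto_within_subset[OF DERIV_isCont[OF DERIV_legendre, unfolded isCont_def] subset_UNIV]) simp
	moreover have "\<forall>\<^sub>F z in at_right 0. legendre m z / legendre (- (1/2)) z <= legendre m x / legendre (- (1/2)) x"
		using assms by (auto simp: eventually_at_right intro!: exI[of _ x] legendre_ratio_mono)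
	ultimately have "legendre m 0 / legendre (- (1/2)) 0 <= legendre m x / legendre (- (1/2)) x"
		by (intro tendsto_upperbound) auto
	then show ?thesis
		using legendre_pos[of "- (1/2)" x] by (simp add: field_simps)
qed

text \<open>The factor \<open>z\<close> on the right matters: a constant lower bound would not make
  \<open>1 / leg_w\<close> integrable at infinity for \<open>m = -1/2\<close>. It comes from angles
  near \<open>pi\<close>. With \<open>\<psi> = pi - \<phi>\<close>, the kernel divided by
  \<open>sinh z\<close> is at most \<open>(3 * \<psi>)^2\<close> once \<open>\<psi>\<close> is at
  least \<open>exp (- z)\<close>, and integrating \<open>1 / (3 * \<psi>)\<close> from
  \<open>exp (- z)\<close> to 1 gives \<open>z / 3\<close>.\<close>

lemma legendre_growth:
	assumes z: "z >= 1"
	shows "sqrt (sinh z) * legendre (- (1/2)) z >= z / (3 * pi)"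
proof -
	have sz: "sinh z > 0" using z by simp
	let ?f = "\<lambda>\<phi>. (leg_kernel z \<phi> / sinh z) powr (- (1/2))"
	have int: "?f integrable_on S" if "S = {a..b}" for S a b
		unfolding that using sz by (intro integrable_continuous_interval continuous_intros) auto
	have ez: "exp (- z) <= 1" using z by simp
	have e2: "exp (- z) / sinh z <= 4 * (exp (- z))\<^sup>2"
	proof -
		have "exp z * (exp z)  >= 2"
		proof -
			have "exp z >= 1 + z" by (rule exp_ge_add_one_self)
			then have "exp z >= 2" using z by linarith
			then show ?thesis using mult_mono[of 2 "exp z" 1 "exp z"] z by simp
		qed
		then show ?thesis
			by (simp add: sinh_field_def exp_minus field_simps power2_eq_square)
	qed
	have "z / 3 = integral {pi - 1..pi - exp (- z)} (\<lambda>\<phi>. 1 / (3 * (pi - \<phi>)))"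
	proof -
		have "((\<lambda>\<phi>. 1 / (3 * (pi - \<phi>))) has_integral - ln (pi - (pi - exp (- z))) / 3 - (- ln (pi - (pi - 1)) / 3)) {pi - 1..pi - exp (- z)}"
		proof (rule fundamental_theorem_of_calculus)
			fix \<phi> assume "\<phi> \<in> {pi - 1..pi - exp (- z)}"
			then have "pi - \<phi> > 0" using exp_gt_zero[of "- z"] by (simp, linarith)
			then show "((\<lambda>\<phi>. - ln (pi - \<phi>) / 3) has_vector_derivative 1 / (3 * (pi - \<phi>))) (at \<phi> within {pi - 1..pi - exp (- z)})"
				unfolding has_real_derivative_iff_has_vector_derivative[symmetric]
				by (auto intro!: derivative_eq_intros simp: field_simps)
		qed (use ez in auto)
		then show ?thesis by (simp add: has_integral_iff)
	qed
	also have "... <= integral {pi - 1..pi - exp (- z)} ?f"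
	proof (rule integral_le)
		show "(\<lambda>\<phi>. 1 / (3 * (pi - \<phi>))) integrable_on {pi - 1..pi - exp (- z)}"
		proof (intro integrable_continuous_interval continuous_intros ballI)
			fix \<phi> assume "\<phi> \<in> {pi - 1..pi - exp (- z)}"
			then have "pi - \<phi> > 0" using exp_gt_zero[of "- z"] by (simp, linarith)
			then show "3 * (pi - \<phi>) ~= 0" by simp
		qed
		show "?f integrable_on {pi - 1..pi - exp (- z)}" by (rule int[OF refl])
		fix \<phi> assume \<phi>: "\<phi> \<in> {pi - 1..pi - exp (- z)}"
		define \<psi> where "\<psi> = pi - \<phi>"
		have \<psi>: "exp (- z) <= \<psi>" "\<psi> > 0" "\<psi> <= 1"
			using \<phi> exp_gt_zero[of "- z"] by (simp_all add: \<psi>_def, linarith)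
		have "cos \<phi> = - cos \<psi>" by (simp add: \<psi>_def)
		moreover have "cos \<psi> >= 1 - \<psi>\<^sup>2 / 2"
		proof -
			have "(sin (\<psi> / 2))\<^sup>2 <= (\<psi> / 2)\<^sup>2"
				using abs_sin_x_le_abs_x[of "\<psi> / 2"] abs_le_square_iff by blast
			moreover have "cos \<psi> = 1 - 2 * (sin (\<psi> / 2))\<^sup>2"
				using cos_double_sin[of "\<psi> / 2"] by simp
			ultimately show ?thesis by (simp add: power_divide)
		qed
		moreover have "leg_kernel z \<phi> / sinh z = 1 + exp (- z) / sinh z + cos \<phi>"
			using sz by (simp add: leg_kernel_def field_simps cosh_field_def sinh_field_def)
		moreover have "(exp (- z))\<^sup>2 <= \<psi>\<^sup>2" using \<psi> by (intro power_mono) auto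
		moreover have "(3 * \<psi>)\<^sup>2 = 9 * \<psi>\<^sup>2" by (simp add: power_mult_distrib)
		ultimately have "leg_kernel z \<phi> / sinh z <= (3 * \<psi>)\<^sup>2"
			using e2 zero_le_power2[of \<psi>] by linarith
		then have "((3 * \<psi>)\<^sup>2) powr (- (1/2)) <= ?f \<phi>"
			using leg_kernel_pos[of z \<phi>] sz \<psi> by (intro powr_mono2') auto
		moreover have "((3 * \<psi>)\<^sup>2) powr (- (1/2)) = 1 / (3 * \<psi>)"
		proof -
			have "sqrt ((3 * \<psi>)\<^sup>2) = 3 * \<psi>"
				using \<psi> by (intro real_sqrt_unique) auto
			then show ?thesis by (simp only: powr_minus_divide powr_half_sqrt zero_le_power2)
		qed
		ultimately show "1 / (3 * (pi - \<phi>)) <= ?f \<phi>"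
			by (simp add: \<psi>_def)
	qed
	also have "... <= integral {0..pi} ?f"
		by (rule integral_subset_le[OF _ int[OF refl] int[OF refl]]) (use pi_gt3 in auto)
	also have "?f = (\<lambda>\<phi>. sqrt (sinh z) * leg_kernel z \<phi> powr (- (1/2)))"
		using sz leg_kernel_pos[of z]
		by (intro ext) (simp add: powr_divide powr_minus_divide powr_half_sqrt field_simps)
	also have "integral {0..pi} (\<lambda>\<phi>. sqrt (sinh z) * leg_kernel z \<phi> powr (- (1/2))) = sqrt (sinh z) * (pi * legendre (- (1/2)) z)"
		by (simp add: legendre_def)
	finally show ?thesis by (simp add: field_simps)
qed

text \<open>The weight of the radial energy after division by the ground state. For given
  \<open>m\<close> it does not depend on the dimension.\<close>

definition leg_w :: "real => real => real" where
	"leg_w m z = sinh z * (legendre m z)\<^sup>2"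

lemma leg_w_pos: "z > 0 ==> leg_w m z > 0"
	unfolding leg_w_def by (intro mult_pos_pos zero_less_power legendre_pos) simp

lemma leg_w_lower:
	assumes "z >= 1"
	shows "leg_w m z >= (z / (3 * pi))\<^sup>2"
proof -
	have "(z / (3 * pi))\<^sup>2 <= (sqrt (sinh z) * legendre (- (1/2)) z)\<^sup>2"
		using assms by (intro power_mono legendre_growth) auto
	also have "... = sinh z * (legendre (- (1/2)) z)\<^sup>2"
		using assms by (simp add: power_mult_distrib)
	also have "... <= leg_w m z"
		unfolding leg_w_def using assms legendre_ge[of z m] legendre_pos[of "- (1/2)" z]
		by (intro mult_left_mono power_mono) auto
	finally show ?thesis .
qed

lemma leg_w_continuous: "continuous_on {0<..} (leg_w m)"
	unfolding leg_w_def[abs_def] by (intro continuous_intros continuous_on_legendre)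

text \<open>This makes \<open>1 / leg_w\<close> non-integrable at 0, so that its tail integral takes
  every positive value.\<close>

lemma leg_w_upper:
	obtains C where "C > 0" "!!z. 0 < z ==> z <= 1 ==> leg_w m z <= C * z"
proof -
	have "compact (legendre m ` {0..1})"
		by (intro compact_continuous_image continuous_on_legendre) auto
	then obtain B where B: "B > 0" "!!z. z \<in> {0..1} ==> \<bar>legendre m z\<bar> <= B"
		using compact_imp_bounded[THEN bounded_pos[THEN iffD1]] by (metis image_eqI real_norm_def)
	have s: "sinh z <= cosh 1 * z" if "0 < z" "z <= 1" for z :: real
	proof -
		have "cosh 1 * 0 - sinh 0 <= cosh 1 * z - sinh z"
		proof (rule DERIV_nonneg_imp_nondecreasing[of 0 z "\<lambda>z. cosh 1 * z - sinh z"])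
			fix x assume "0 <= x" "x <= z"
			then show "\<exists>y. ((\<lambda>z. cosh 1 * z - sinh z) has_real_derivative y) (at x) \<and> 0 <= y"
				using that by (intro exI[of _ "cosh 1 - cosh x"]) (auto intro!: derivative_eq_intros simp: cosh_real_nonneg_le_iff)
		qed (use that in simp)
		then show ?thesis by simp
	qed
	have "leg_w m z <= cosh 1 * B\<^sup>2 * z" if "0 < z" "z <= 1" for z
	proof -
		have "leg_w m z <= (cosh 1 * z) * B\<^sup>2"
			unfolding leg_w_def using that s[OF that] B legendre_pos[of m z]
			by (intro mult_mono power_mono) (auto simp: abs_le_iff)
		then show ?thesis by (simp add: mult_ac)
	qed
	then show ?thesis using that[of "cosh 1 * B\<^sup>2"] B by simp
qed

lemma leg_S_exists:
	"\<exists>S. (\<forall>z>0. (S has_real_derivative - 1 / leg_w m z) (at z)) \<and> (S \<longlongrightarrow> 0) at_top"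
proof -
	define c :: real where "c = 1"
	define F where "F z = (LBINT y=c..z. 1 / leg_w m y)" for z :: real
	have dF: "(F has_real_derivative 1 / leg_w m z) (at z)" if "z > 0" for z
	proof -
		define a b where "a = min (z / 2) (1 / 2)" and "b = max (z + 1) 2"
		have ab: "0 < a" "a < z" "z < b" "a <= 1" "1 <= b" using that by (auto simp: a_def b_def)
		have "continuous_on {a..b} (\<lambda>y. 1 / leg_w m y)"
			using ab leg_w_pos by (intro continuous_intros continuous_on_subset[OF leg_w_continuous]) (auto simp: less_imp_neq[symmetric])
		then have "((\<lambda>u. LBINT y=c..u. 1 / leg_w m y) has_vector_derivative 1 / leg_w m z) (at z within {a..b})"
			using ab by (intro interval_integral_FTC2) (auto simp: c_def)
		then have "(F has_vector_derivative 1 / leg_w m z) (at z within {a<..<b})"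
			unfolding F_def by (rule has_vector_derivative_within_subset) auto
		moreover have "at z within {a<..<b} = at z"
			using ab by (intro at_within_open) auto
		ultimately show ?thesis
			by (simp only: has_real_derivative_iff_has_vector_derivative)
	qed
	have mono: "F x <= F y" if "0 < x" "x <= y" for x y
	proof (rule DERIV_nonneg_imp_nondecreasing[OF that(2)])
		fix t assume "x <= t"
		then show "\<exists>d. (F has_real_derivative d) (at t) \<and> 0 <= d"
			using that dF[of t] leg_w_pos[of t m] by (intro exI[of _ "1 / leg_w m t"]) simp
	qed
	define C where "C = (3 * pi)\<^sup>2"
	have bound: "F z <= F 1 + C" if "z >= 1" for z
	proof -
		\<comment> \<open>By \<open>leg_w_lower\<close> the derivative of \<open>F\<close> is at most
		  \<open>C / z^2\<close>; adding \<open>C / z\<close> therefore turns \<open>F\<close> into a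
		  decreasing function, which bounds it.\<close>
		have "F z + C / z <= F 1 + C / 1"
		proof (rule DERIV_nonpos_imp_nonincreasing[OF that, of "\<lambda>z. F z + C / z"])
			fix x assume x: "1 <= x" "x <= z"
			have "((\<lambda>z. F z + C / z) has_real_derivative 1 / leg_w m x - C / x\<^sup>2) (at x)"
				using x dF[of x] by (auto intro!: derivative_eq_intros simp: power2_eq_square)
			moreover have "1 / leg_w m x <= 1 / (x / (3 * pi))\<^sup>2"
				using x leg_w_lower[of x m] leg_w_pos[of x m] by (intro divide_left_mono) auto
			ultimately show "\<exists>y. ((\<lambda>z. F z + C / z) has_real_derivative y) (at x) \<and> y <= 0"
				by (intro exI conjI) (auto simp: C_def power_divide)
		qed
		then show ?thesis
			using that by (smt (verit) C_def divide_nonneg_nonneg div_by_1 zero_le_power2)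
	qed
	define L where "L = Sup (F ` {1..})"
	have bdd: "bdd_above (F ` {1..})" using bound by (auto intro!: bdd_aboveI)
	have lim: "(F \<longlongrightarrow> L) at_top"
	proof (rule increasing_tendsto)
		show "\<forall>\<^sub>F z in at_top. F z <= L"
			using eventually_ge_at_top[of 1] by eventually_elim (auto simp: L_def intro!: cSup_upper bdd)
		fix x assume "x < L"
		then obtain y where y: "y >= 1" "x < F y"
			unfolding L_def by (subst (asm) less_cSup_iff) (auto intro: bdd)
		show "\<forall>\<^sub>F z in at_top. x < F z"
			using eventually_ge_at_top[of y] by eventually_elim (use y mono in \<open>force intro: less_le_trans\<close>)
	qed
	show ?thesis
		using dF tendsto_diff[OF tendsto_const[of L] lim]
		by (intro exI[of _ "\<lambda>z. L - F z"]) (auto intro!: derivative_eq_intros)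
qed

text \<open>The integral of \<open>1 / leg_w m\<close> from \<open>z\<close> to infinity; derivative
  and limit determine it on the positive half-line.\<close>

definition leg_S :: "real => real => real" where
	"leg_S m = (SOME S. (\<forall>z>0. (S has_real_derivative - 1 / leg_w m z) (at z)) \<and> (S \<longlongrightarrow> 0) at_top)"

lemma DERIV_leg_S: "z > 0 ==> (leg_S m has_real_derivative - 1 / leg_w m z) (at z)"
	and leg_S_at_top: "(leg_S m \<longlongrightarrow> 0) at_top"
	using someI_ex[OF leg_S_exists[of m]] unfolding leg_S_def by auto

text \<open>The comparison tool for tail integrals: two functions with limit 0 at infinity are
  ordered once their derivatives are ordered the other way round.\<close>

lemma decreasing_to_0_nonneg:
	fixes D :: "real => real"
	assumes "!!x. x >= z ==> \<exists>d. (D has_real_derivative d) (at x) \<and> d <= 0" "(D \<longlongrightarrow> 0) at_top"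
	shows "D z >= 0"
proof (rule tendsto_upperbound[OF assms(2)])
	show "\<forall>\<^sub>F x in at_top. D x <= D z"
		using eventually_ge_at_top[of z]
		by eventually_elim (rule DERIV_nonpos_imp_nonincreasing, auto intro: assms(1))
qed simp

lemma leg_S_strict: "0 < x ==> x < y ==> leg_S m y < leg_S m x"
proof (rule DERIV_neg_imp_decreasing[of x y "leg_S m"])
	fix t assume "0 < x" "x <= t"
	then show "\<exists>d. (leg_S m has_real_derivative d) (at t) \<and> d < 0"
		using DERIV_leg_S[of t m] leg_w_pos[of t m] by (intro exI[of _ "- 1 / leg_w m t"]) simp
qed

lemma leg_S_pos: assumes "z > 0" shows "leg_S m z > 0"
proof -
	have "leg_S m (z + 1) >= 0"
	proof (rule decreasing_to_0_nonneg[OF _ leg_S_at_top])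
		fix x assume "x >= z + 1"
		then show "\<exists>d. (leg_S m has_real_derivative d) (at x) \<and> d <= 0"
			using assms DERIV_leg_S[of x m] leg_w_pos[of x m] by (intro exI[of _ "- 1 / leg_w m x"]) simp
	qed
	then show ?thesis using leg_S_strict[of z "z + 1" m] assms by simp
qed

lemma leg_S_surj:
	assumes "s > 0"
	obtains z where "z > 0" "leg_S m z = s"
proof -
	obtain C where C: "C > 0" "!!z. 0 < z ==> z <= 1 ==> leg_w m z <= C * z"
		using leg_w_upper by blast
	define a where "a = min 1 (exp (- (C * s)))"
	have a: "0 < a" "a <= 1" by (auto simp: a_def)
	have "leg_S m 1 + ln 1 / C <= leg_S m a + ln a / C"
	proof (rule DERIV_nonpos_imp_nonincreasing[OF a(2), of "\<lambda>z. leg_S m z + ln z / C"])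
		fix x assume x: "a <= x" "x <= 1"
		have "((\<lambda>z. leg_S m z + ln z / C) has_real_derivative - 1 / leg_w m x + 1 / (C * x)) (at x)"
			using x a C(1) DERIV_leg_S[of x m] by (auto intro!: derivative_eq_intros simp: field_simps)
		moreover have "1 / (C * x) <= 1 / leg_w m x"
			using x a C(2)[of x] leg_w_pos[of x m] C(1) by (intro divide_left_mono) auto
		ultimately show "\<exists>y. ((\<lambda>z. leg_S m z + ln z / C) has_real_derivative y) (at x) \<and> y <= 0"
			by (intro exI conjI) auto
	qed
	moreover have "ln a <= - (C * s)"
		using ln_mono[of a "exp (- (C * s))"] a by (simp add: a_def)
	then have "ln a / C <= - s" using C(1) by (simp add: field_simps)
	ultimately have hi: "leg_S m a > s" using leg_S_pos[of 1 m] by simp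
	have "\<forall>\<^sub>F z in at_top. leg_S m z < s \<and> z >= a"
		using order_tendstoD(2)[OF leg_S_at_top assms, of m] eventually_ge_at_top[of a] by eventually_elim auto
	then obtain b where b: "leg_S m b < s" "b >= a"
		using eventually_happens by fastforce
	have "\<exists>x\<ge>a. x <= b \<and> leg_S m x = s"
		using hi b a by (intro IVT2) (auto intro!: DERIV_isCont[OF DERIV_leg_S])
	then obtain x where "a <= x" "leg_S m x = s" by blast
	then show ?thesis using that[of x] a by simp
qed

lemma leg_S_inj: "0 < x ==> 0 < y ==> leg_S m x = leg_S m y ==> x = y"
	using leg_S_strict[of x y m] leg_S_strict[of y x m] by (cases x y rule: linorder_cases) auto

subsection \<open>The change of radial variable\<close>

text \<open>A transport map: the tail beyond \<open>leg_tr a b z\<close> for the measure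
  \<open>1 / leg_w a\<close> has the same mass as the tail beyond \<open>z\<close> for
  \<open>1 / leg_w b\<close>.\<close>

definition leg_tr :: "real => real => real => real" where
	"leg_tr a b z = (THE y. y > 0 \<and> leg_S a y = leg_S b z)"

lemma leg_tr_unique: "y > 0 ==> leg_S a y = leg_S b z ==> leg_tr a b z = y"
	unfolding leg_tr_def by (rule the_equality) (auto intro: leg_S_inj[of _ y a])

lemma
	assumes "z > 0"
	shows leg_tr_pos: "leg_tr a b z > 0" and leg_S_leg_tr: "leg_S a (leg_tr a b z) = leg_S b z"
proof -
	obtain y where "y > 0" "leg_S a y = leg_S b z"
		using leg_S_surj[of "leg_S b z" a] leg_S_pos[OF assms] by blast
	then show "leg_tr a b z > 0" "leg_S a (leg_tr a b z) = leg_S b z"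
		using leg_tr_unique[of y a b z] by auto
qed

lemma leg_tr_inverse: "z > 0 ==> leg_tr a b (leg_tr b a z) = z"
	by (rule leg_tr_unique) (auto simp: leg_S_leg_tr)

lemma DERIV_leg_tr:
	assumes z: "z > 0"
	shows "(leg_tr a b has_real_derivative leg_w a (leg_tr a b z) / leg_w b z) (at z)"
proof -
	define T where "T s = (THE y. y > 0 \<and> leg_S a y = s)" for s
	have T: "T (leg_S a y) = y" if "y > 0" for y
		unfolding T_def using that by (intro the_equality) (auto intro: leg_S_inj)
	define y where "y = leg_tr a b z"
	have y: "y > 0" "leg_S a y = leg_S b z"
		using leg_tr_pos[OF z] leg_S_leg_tr[OF z] by (auto simp: y_def)
	have "(T has_derivative (*) (- leg_w a y)) (at (leg_S a y))"
	proof (rule has_derivative_inverse_strong[of "{0<..}" y "leg_S a" T "(*) (- 1 / leg_w a y)"])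
		show "(leg_S a has_derivative (*) (- 1 / leg_w a y)) (at y)"
			using DERIV_leg_S[OF y(1)] by (simp add: has_field_derivative_def)
		show "continuous_on {0<..} (leg_S a)"
			by (auto intro!: continuous_at_imp_continuous_on DERIV_isCont[OF DERIV_leg_S])
		show "(*) (- 1 / leg_w a y) \<circ> (*) (- leg_w a y) = id"
			using leg_w_pos[OF y(1), of a] by (auto simp: fun_eq_iff)
	qed (use y T in auto)
	then have "DERIV T (leg_S b z) :> - leg_w a y"
		by (simp add: y has_field_derivative_def)
	from DERIV_chain2[OF this DERIV_leg_S[OF z]]
	have "((\<lambda>z. T (leg_S b z)) has_real_derivative leg_w a y / leg_w b z) (at z)"
		by simp
	then show ?thesis
		unfolding y_def
		by (rule has_field_derivative_transform_within_open[where S="{0<..}"])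
			(use z T[OF leg_tr_pos, of _ a b] in \<open>auto simp: leg_S_leg_tr\<close>)
qed

lemma leg_w_smooth: "Ck_on k {0<..} (leg_w m)"
	unfolding leg_w_def[abs_def]
	by (intro Ck_on_mult Ck_on_power legendre_smooth Ck_on_subset[OF Ck_on_sinh]) auto

lemma leg_tr_smooth: "Ck_on k {0<..} (leg_tr a b)"
proof (induction k)
	case 0
	show ?case
		by (auto intro!: continuous_at_imp_continuous_on DERIV_isCont[OF DERIV_leg_tr])
next
	case (Suc k)
	show ?case
	proof (rule Ck_on_real_SucI[OF _ DERIV_leg_tr])
		\<comment> \<open>The derivative is a smooth expression in \<open>z\<close> and the map itself, so
		  one order of regularity yields the next.\<close>
		show "Ck_on k {0<..} (\<lambda>z. leg_w a (leg_tr a b z) / leg_w b z)"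
			using leg_w_pos leg_tr_pos
			by (intro Ck_on_divide leg_w_smooth Ck_on_compose_real[OF _ _ _ leg_w_smooth] Suc)
				(auto simp: less_imp_neq[symmetric])
	qed auto
qed

lemma leg_tr_image: "leg_tr a b ` {0<..} = {0<..}"
	using leg_tr_pos leg_tr_inverse by (auto simp: image_iff) (metis greaterThan_iff)

lemma leg_tr_inj: "inj_on (leg_tr a b) {0<..}"
	by (metis inj_on_inverseI leg_tr_inverse greaterThan_iff)

text \<open>With \<open>q\<^sub>m = w\<^sub>m S\<^sub>m\<close> the diagonal of a Green function, the next two lemmas say that
	\<open>q\<^sub>m\<close> is largest for \<open>m = -1/2\<close>, and that \<open>q\<close> is increasing for this value of \<open>m\<close>.\<close>

lemma leg_q_le:
	assumes z: "z > 0"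
	shows "leg_w m z * leg_S m z <= leg_w (- (1/2)) z * leg_S (- (1/2)) z"
proof -
	let ?g = "legendre (- (1/2))"
	\<comment> \<open>The claim divided by \<open>leg_w m z\<close> is \<open>D z >= 0\<close>. The
	  function \<open>D\<close> decreases to 0 because \<open>leg_w m / leg_w (- (1/2))\<close> is
	  increasing.\<close>
	define D where "D x = leg_w (- (1/2)) z / leg_w m z * leg_S (- (1/2)) x - leg_S m x" for x
	have "D z >= 0"
	proof (rule decreasing_to_0_nonneg[where D=D])
		show "(D \<longlongrightarrow> 0) at_top"
			unfolding D_def using leg_w_pos[OF z, of m] by (auto intro!: tendsto_eq_intros leg_S_at_top)
		fix x assume x: "z <= x"
		then have "(D has_real_derivative leg_w (- (1/2)) z / leg_w m z * (- 1 / leg_w (- (1/2)) x) - (- 1 / leg_w m x)) (at x)"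
			unfolding D_def using z leg_w_pos[OF z, of m] by (auto intro!: derivative_eq_intros DERIV_leg_S)
		moreover have ratio: "leg_w m z / leg_w (- (1/2)) z <= leg_w m x / leg_w (- (1/2)) x"
		proof -
			have "(legendre m z / ?g z)\<^sup>2 <= (legendre m x / ?g x)\<^sup>2"
				using legendre_ratio_mono[OF z x] by (intro power_mono) (auto simp: legendre_pos less_imp_le)
			then show ?thesis using x z by (simp add: leg_w_def power_divide)
		qed
		have "leg_w (- (1/2)) z / leg_w m z * (- 1 / leg_w (- (1/2)) x) - (- 1 / leg_w m x) <= 0"
		proof -
			have "a / b * (- 1 / c) - (- 1 / d) <= 0" if "b / a <= d / c" "a > 0" "b > 0" "c > 0" "d > 0" for a b c d :: real
				using that by (simp add: field_simps)
			then show ?thesis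
				using ratio x z by (simp add: leg_w_pos)
		qed
		ultimately show "\<exists>d. (D has_real_derivative d) (at x) \<and> d <= 0" by blast
	qed
	then show ?thesis
		using leg_w_pos[OF z, of m] by (simp add: D_def field_simps)
qed

lemma DERIV_leg_w:
	"(leg_w m has_real_derivative cosh z * (legendre m z)\<^sup>2 + sinh z * (2 * legendre m z * legendre' m z)) (at z)"
	unfolding leg_w_def[abs_def] by (auto intro!: derivative_eq_intros DERIV_legendre simp: algebra_simps)

text \<open>The function differentiated here is the logarithmic derivative of
  \<open>u = sqrt (leg_w m)\<close>, and the identity is the Riccati form of the Schroedinger
  equation \<open>u'' = ((m + 1/2)^2 - 1 / (4 * sinh^2)) u\<close>.\<close>

lemma leg_log_deriv:
	assumes "z > 0"
	shows "((\<lambda>z. cosh z / (2 * sinh z) + legendre' m z / legendre m z) has_real_derivative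
		(m + 1/2)\<^sup>2 - 1 / (4 * (sinh z)\<^sup>2) - (cosh z / (2 * sinh z) + legendre' m z / legendre m z)\<^sup>2) (at z)"
proof -
	have s: "sinh z ~= 0" "legendre m z ~= 0" using assms legendre_pos[of m z] by auto
	have l2: "legendre'' m z = m * (m + 1) * legendre m z - cosh z / sinh z * legendre' m z"
		using legendre_equation[of z m] s by (simp add: field_simps)
	have "((\<lambda>z. cosh z / (2 * sinh z) + legendre' m z / legendre m z) has_real_derivative
		 (sinh z * (2 * sinh z) - cosh z * (2 * cosh z)) / (2 * sinh z)\<^sup>2 +
		 (legendre'' m z * legendre m z - legendre' m z * legendre' m z) / (legendre m z)\<^sup>2) (at z)"
		using s by (auto intro!: derivative_eq_intros DERIV_legendre DERIV_legendre' simp: power2_eq_square)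
	moreover have "(sinh z * (2 * sinh z) - cosh z * (2 * cosh z)) / (2 * sinh z)\<^sup>2 = - 1 / (2 * (sinh z)\<^sup>2)"
	proof -
		have "sinh z * (2 * sinh z) - cosh z * (2 * cosh z) = - 2"
			using cosh_square_eq[of z] by (simp add: power2_eq_square)
		then show ?thesis by (simp add: power2_eq_square)
	qed
	moreover have "(legendre'' m z * legendre m z - legendre' m z * legendre' m z) / (legendre m z)\<^sup>2 =
		 m * (m + 1) - cosh z / sinh z * (legendre' m z / legendre m z) - (legendre' m z / legendre m z)\<^sup>2"
		unfolding l2 using s by (simp add: power2_eq_square field_simps)
	moreover have "(cosh z / (2 * sinh z))\<^sup>2 = 1 / 4 + 1 / (4 * (sinh z)\<^sup>2)"
		using cosh_square_eq[of z] s by (simp add: power_mult_distrib power_divide add_divide_distrib)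
	moreover have alg: "A + B = (m + 1/2)\<^sup>2 - 1 / (4 * s) - (x + y)\<^sup>2"
		if "A = - 1 / (2 * s)" "B = m * (m + 1) - 2 * x * y - y\<^sup>2" "x\<^sup>2 = 1 / 4 + 1 / (4 * s)" for A B x y s :: real
		unfolding power2_sum that by (simp add: power2_eq_square algebra_simps)
	ultimately show ?thesis
		by (elim DERIV_cong, intro alg) simp_all
qed

lemma leg_q_mono:
	assumes xy: "0 < x" "x <= y"
	shows "leg_w (- (1/2)) x * leg_S (- (1/2)) x <= leg_w (- (1/2)) y * leg_S (- (1/2)) y"
proof -
	let ?w = "leg_w (- (1/2))" and ?S = "leg_S (- (1/2))"
	\<comment> \<open>This is half the logarithmic derivative of \<open>?w\<close>. For
	  \<open>m = -1/2\<close> its Riccati equation has no positive term, so \<open>l\<close> decreases,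
	  that is, \<open>?w\<close> is log-concave. Hence \<open>?w (t + d) / ?w t\<close> decreases in
	  \<open>t\<close>, which compares the tail integrals of \<open>1 / ?w\<close> from
	  \<open>x\<close> and from \<open>x + d\<close>.\<close>
	define l where "l z = cosh z / (2 * sinh z) + legendre' (- (1/2)) z / legendre (- (1/2)) z" for z
	have l: "l b <= l a" if "0 < a" "a <= b" for a b
	proof (rule DERIV_nonpos_imp_nonincreasing[OF that(2)])
		fix z assume "a <= z"
		then have "(l has_real_derivative (- (1/2) + 1/2)\<^sup>2 - 1 / (4 * (sinh z)\<^sup>2) - (l z)\<^sup>2) (at z)"
			unfolding l_def using that by (intro leg_log_deriv) auto
		moreover have "(- (1/2) + 1/2)\<^sup>2 - 1 / (4 * (sinh z)\<^sup>2) - (l z)\<^sup>2 <= 0"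
		proof -
			have "0 <= 1 / (4 * (sinh z)\<^sup>2)" by simp
			moreover have "(- (1/2) + 1/2 :: real)\<^sup>2 = 0" by simp
			ultimately show ?thesis using zero_le_power2[of "l z"] by linarith
		qed
		ultimately show "\<exists>d. (l has_real_derivative d) (at z) \<and> d <= 0"
			by blast
	qed
	have dw: "(?w has_real_derivative 2 * l z * ?w z) (at z)" if "z > 0" for z
	proof -
		have "cosh z * (legendre (- (1/2)) z)\<^sup>2 + sinh z * (2 * legendre (- (1/2)) z * legendre' (- (1/2)) z) = 2 * l z * ?w z"
			using that legendre_pos[of "- (1/2)" z] by (simp add: l_def leg_w_def field_simps power2_eq_square)
		then show ?thesis using DERIV_leg_w[of "- (1/2)" z] by simp
	qed
	define d where "d = y - x"
	have ratio: "?w (t + d) / ?w t <= ?w (x + d) / ?w x" if "x <= t" for t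
	proof (rule DERIV_nonpos_imp_nonincreasing[OF that, of "\<lambda>t. ?w (t + d) / ?w t"])
		fix z assume z: "x <= z" "z <= t"
		have pos: "z > 0" "z + d > 0" "?w z > 0" "?w (z + d) > 0" "z <= z + d"
			using z xy by (auto simp: d_def intro!: leg_w_pos)
		have "((\<lambda>t. ?w (t + d)) has_real_derivative 2 * l (z + d) * ?w (z + d)) (at z)"
			using dw[OF pos(2)] by (simp only: DERIV_shift)
		then have dR: "((\<lambda>t. ?w (t + d) / ?w t) has_real_derivative
				(2 * l (z + d) * ?w (z + d) * ?w z - ?w (z + d) * (2 * l z * ?w z)) / (?w z * ?w z)) (at z)"
			using dw[OF pos(1)] pos by (auto intro!: derivative_eq_intros)
		have "2 * l (z + d) * ?w (z + d) * ?w z - ?w (z + d) * (2 * l z * ?w z) = 2 * (l (z + d) - l z) * (?w (z + d) * ?w z)"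
			by (simp add: algebra_simps)
		also have "... <= 0"
			using l[OF pos(1) pos(5)] pos by (intro mult_nonpos_nonneg[of "2 * (l (z + d) - l z)"]) auto
		finally have "(2 * l (z + d) * ?w (z + d) * ?w z - ?w (z + d) * (2 * l z * ?w z)) / (?w z * ?w z) <= 0"
			using pos by (intro divide_nonpos_pos) auto
		with dR show "\<exists>D. ((\<lambda>t. ?w (t + d) / ?w t) has_real_derivative D) (at z) \<and> D <= 0"
			by blast
	qed
	define D where "D t = ?w y / ?w x * ?S (t + d) - ?S t" for t
	have "D x >= 0"
	proof (rule decreasing_to_0_nonneg[where D=D])
		have "((\<lambda>t. ?S (t + d)) \<longlongrightarrow> 0) at_top"
			by (rule filterlim_compose[OF leg_S_at_top])
				(auto intro!: filterlim_tendsto_add_at_top[OF tendsto_const filterlim_ident] simp: add.commute[of _ d])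
		then show "(D \<longlongrightarrow> 0) at_top"
			unfolding D_def using leg_w_pos[OF xy(1), of "- (1/2)"] by (auto intro!: tendsto_eq_intros leg_S_at_top)
		fix t assume t: "x <= t"
		have pos: "t > 0" "t + d > 0" using t xy by (auto simp: d_def)
		have "((\<lambda>t. ?S (t + d)) has_real_derivative - 1 / ?w (t + d)) (at t)"
			using DERIV_leg_S[OF pos(2)] by (simp only: DERIV_shift)
		then have "(D has_real_derivative ?w y / ?w x * (- 1 / ?w (t + d)) - (- 1 / ?w t)) (at t)"
			unfolding D_def using pos leg_w_pos[OF xy(1), of "- (1/2)"] by (auto intro!: derivative_eq_intros DERIV_leg_S)
		moreover have "?w y / ?w x * (- 1 / ?w (t + d)) - (- 1 / ?w t) <= 0"
			using ratio[OF t] leg_w_pos[OF pos(1), of "- (1/2)"] leg_w_pos[OF pos(2), of "- (1/2)"] leg_w_pos[OF xy(1), of "- (1/2)"]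
		proof -
			have "Y / X * (- 1 / B) - (- 1 / A) <= 0" if "B / A <= Y / X" "A > 0" "B > 0" "X > 0" for A B X Y :: real
				using that by (simp add: field_simps)
			then show ?thesis
				using ratio[OF t] pos xy(1) by (simp add: d_def leg_w_pos)
		qed
		ultimately show "\<exists>D'. (D has_real_derivative D') (at t) \<and> D' <= 0" by blast
	qed
	then show ?thesis
		using leg_w_pos[OF xy(1), of "- (1/2)"] by (simp add: D_def d_def field_simps)
qed

lemma leg_S_le:
	assumes "z > 0"
	shows "leg_S m z <= leg_S (- (1/2)) z"
proof -
	have "leg_S (- (1/2)) z - leg_S m z >= 0"
	proof (rule decreasing_to_0_nonneg[where D="\<lambda>z. leg_S (- (1/2)) z - leg_S m z"])
		show "((\<lambda>z. leg_S (- (1/2)) z - leg_S m z) \<longlongrightarrow> 0) at_top"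
			by (auto intro!: tendsto_eq_intros leg_S_at_top)
		fix x assume x: "z <= x"
		have "((\<lambda>z. leg_S (- (1/2)) z - leg_S m z) has_real_derivative - 1 / leg_w (- (1/2)) x - (- 1 / leg_w m x)) (at x)"
			using x assms by (auto intro!: derivative_eq_intros DERIV_leg_S)
		moreover have "leg_w (- (1/2)) x <= leg_w m x"
			unfolding leg_w_def using x assms legendre_ge[of x m] legendre_pos[of "- (1/2)" x]
			by (intro mult_left_mono power_mono) auto
		then have "1 / leg_w m x <= 1 / leg_w (- (1/2)) x"
			using leg_w_pos[of x "- (1/2)"] x assms by (intro divide_left_mono) (auto simp: leg_w_pos)
		ultimately show "\<exists>d. ((\<lambda>z. leg_S (- (1/2)) z - leg_S m z) has_real_derivative d) (at x) \<and> d <= 0"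
			by (intro exI conjI) auto
	qed
	then show ?thesis by simp
qed

text \<open>This is the inequality \<open>t \<ge> 1\<close> for the derivative of the transport map,
  on which the decrease of the angular energy rests. The matched point \<open>y\<close> lies beyond
  \<open>z\<close> because \<open>leg_S (- (1/2))\<close> dominates \<open>leg_S m\<close>. In the
  chain from \<open>q\<close> of index \<open>m\<close> at \<open>z\<close> to \<open>q\<close> of
  index \<open>-1/2\<close> at \<open>y\<close> the factors \<open>leg_S\<close> at both ends
  coincide and cancel.\<close>

lemma leg_w_leg_tr_ge:
	assumes z: "z > 0"
	shows "leg_w m z <= leg_w (- (1/2)) (leg_tr (- (1/2)) m z)"
proof -
	let ?w = "leg_w (- (1/2))" and ?S = "leg_S (- (1/2))"
	define y where "y = leg_tr (- (1/2)) m z"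
	have y: "y > 0" "?S y = leg_S m z"
		using leg_tr_pos[OF z] leg_S_leg_tr[OF z] by (auto simp: y_def)
	have "z <= y"
	proof (rule ccontr)
		assume "\<not> z <= y"
		then have "?S z < ?S y" using y by (intro leg_S_strict) auto
		then show False using leg_S_le[OF z, of m] y by simp
	qed
	have "leg_w m z * leg_S m z <= ?w z * ?S z" by (rule leg_q_le[OF z])
	also have "... <= ?w y * ?S y" by (rule leg_q_mono[OF z \<open>z <= y\<close>])
	finally show ?thesis
		using y leg_S_pos[OF z, of m] by (simp add: y_def)
qed

subsection \<open>The functions \<open>g\<close>, \<open>h\<close>, \<open>r\<close> and \<open>Y\<close>\<close>

text \<open>The passage between \<open>z\<close> and the distance from the origin is a decreasing
  involution. Conditions at infinite distance become conditions at \<open>z = 0\<close>, and the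
  origin corresponds to \<open>z\<close> tending to infinity.\<close>

definition radius_of_log :: "real => real" where
	"radius_of_log z = arsinh (1 / sinh z)"

lemma radius_of_log_pos: "z > 0 ==> radius_of_log z > 0"
	by (simp add: radius_of_log_def)

lemma sinh_radius_of_log [simp]: "sinh (radius_of_log z) = 1 / sinh z"
	by (simp add: radius_of_log_def)

lemma radius_of_log_involution [simp]: "radius_of_log (radius_of_log z) = z"
	by (simp add: radius_of_log_def arsinh_sinh_real)

lemma cosh_radius_of_log:
	assumes "z > 0"
	shows "cosh (radius_of_log z) = cosh z / sinh z"
proof (rule power2_eq_imp_eq)
	show "(cosh (radius_of_log z))\<^sup>2 = (cosh z / sinh z)\<^sup>2"
		using assms by (simp add: cosh_square_eq power_divide add_divide_distrib)
qed (use assms in auto)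

lemma DERIV_radius_of_log:
	assumes "z > 0"
	shows "(radius_of_log has_real_derivative - 1 / sinh z) (at z)"
proof -
	have s: "sinh z > 0" using assms by simp
	have "sqrt ((1 / sinh z)\<^sup>2 + 1) = cosh z / sinh z"
		using s by (intro real_sqrt_unique) (auto simp: cosh_square_eq power_divide field_simps)
	moreover have "((\<lambda>z. 1 / sinh z) has_real_derivative - cosh z / (sinh z)\<^sup>2) (at z)"
		using s by (auto intro!: derivative_eq_intros simp: power2_eq_square)
	from DERIV_chain2[OF arsinh_real_has_field_derivative this]
	have "(radius_of_log has_real_derivative 1 / sqrt ((1 / sinh z)\<^sup>2 + 1) * (- cosh z / (sinh z)\<^sup>2)) (at z)"
		by (simp add: radius_of_log_def[abs_def])
	ultimately show ?thesis
		using s by (simp add: power2_eq_square)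
qed

lemma radius_of_log_at_top: "(radius_of_log \<longlongrightarrow> 0) at_top"
proof -
	have "((\<lambda>z. inverse (sinh z)) \<longlongrightarrow> 0) (at_top :: real filter)"
		by (rule tendsto_inverse_0_at_top[OF sinh_real_at_top])
	from tendsto_arsinh[OF this] show ?thesis
		by (simp add: radius_of_log_def[abs_def] divide_inverse)
qed

lemma radius_of_log_at_right_0: "filterlim radius_of_log at_top (at_right 0)"
proof -
	have "(sinh \<longlongrightarrow> sinh 0) (at_right (0::real))"
		by (intro tendsto_intros)
	then have "filterlim (\<lambda>z. inverse (sinh z)) at_top (at_right (0::real))"
		by (intro filterlim_inverse_at_top) (auto simp: eventually_at_filter)
	from filterlim_compose[OF arsinh_real_at_top this] show ?thesis
		by (simp add: radius_of_log_def[abs_def] divide_inverse)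
qed

section \<open>Uniqueness of the normalized solutions of the differential equations\<close>

lemma not_tendsto_if_deriv_ge:
	fixes f :: "real => real"
	assumes "(f \<longlongrightarrow> L) at_top" "c > 0" "!!t. t >= T ==> \<exists>d. (f has_real_derivative d) (at t) \<and> c <= d"
	shows False
proof -
	have lin: "f T + c * (t - T) <= f t" if "t >= T" for t
	proof -
		have "f T - c * T <= f t - c * t"
		proof (rule DERIV_nonneg_imp_nondecreasing[OF that])
			fix x assume "T <= x"
			then obtain d where "(f has_real_derivative d) (at x)" "c <= d" using assms(3) by blast
			then show "\<exists>y. ((\<lambda>t. f t - c * t) has_real_derivative y) (at x) \<and> 0 <= y"
				by (intro exI[of _ "d - c"]) (auto intro!: derivative_eq_intros)
		qed
		then show ?thesis by (simp add: algebra_simps)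
	qed
	have "\<forall>\<^sub>F t in at_top. f t < L + 1 \<and> t >= max T (T + (L + 1 - f T) / c)"
		using order_tendstoD(2)[OF assms(1), of "L + 1"] eventually_ge_at_top[of "max T (T + (L + 1 - f T) / c)"]
		by (auto intro: eventually_conj)
	then obtain t where t: "f t < L + 1" "t >= T" "t >= T + (L + 1 - f T) / c"
		using eventually_happens'[OF trivial_limit_at_top_linorder] by fastforce
	have "L + 1 - f T <= c * (t - T)" using t(3) assms(2) by (simp add: field_simps)
	then show False using lin[OF t(2)] t(1) by linarith
qed

definition ode_solves :: "real => (real => real) => bool" where
	"ode_solves c y \<longleftrightarrow> (\<exists>y'. \<forall>t>0. (y has_real_derivative y' t) (at t) \<and>
				(y' has_real_derivative c / (4 * (sinh t)\<^sup>2) * y t) (at t)) \<and>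
		 (y \<longlongrightarrow> 1) at_top \<and> (\<forall>t\<le>0. y t = 0)"

text \<open>The Wronskian of the two solutions is a constant \<open>w\<close>, and
  \<open>y / u\<close> has derivative \<open>w / u^2\<close>. Since \<open>u\<close> stays bounded,
  a nonzero \<open>w\<close> would force linear growth of the quotient, whose limit is 1.\<close>

lemma ode_unique:
	assumes y: "ode_solves c y" and u: "ode_solves c u" and pos: "!!t. t > 0 ==> u t > 0"
	shows "y = u"
proof -
	obtain y' where y': "!!t. t > 0 ==> (y has_real_derivative y' t) (at t)"
				"!!t. t > 0 ==> (y' has_real_derivative c / (4 * (sinh t)\<^sup>2) * y t) (at t)"
		using y by (auto simp: ode_solves_def)
	obtain u' where u': "!!t. t > 0 ==> (u has_real_derivative u' t) (at t)"
				"!!t. t > 0 ==> (u' has_real_derivative c / (4 * (sinh t)\<^sup>2) * u t) (at t)"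
		using u by (auto simp: ode_solves_def)
	have lim: "(y \<longlongrightarrow> 1) at_top" "(u \<longlongrightarrow> 1) at_top" using y u by (auto simp: ode_solves_def)
	define W where "W t = y' t * u t - y t * u' t" for t
	have "\<exists>w. \<forall>t\<in>{0<..}. W t = w"
	proof (rule has_field_derivative_zero_constant)
		fix t :: real assume "t \<in> {0<..}"
		then have "(W has_real_derivative c / (4 * (sinh t)\<^sup>2) * y t * u t + u' t * y' t
			 - (y' t * u' t + c / (4 * (sinh t)\<^sup>2) * u t * y t)) (at t)"
			unfolding W_def using y' u' by (auto intro!: derivative_eq_intros)
		then show "(W has_real_derivative 0) (at t within {0<..})"
			by (simp add: has_field_derivative_at_within mult_ac)
	qed simp
	then obtain w where w: "!!t. t > 0 ==> W t = w" by auto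
	define q where "q t = y t / u t" for t
	have dq: "(q has_real_derivative w / (u t)\<^sup>2) (at t)" if "t > 0" for t
		unfolding q_def using that y'(1)[OF that] u'(1)[OF that] pos[OF that] w[OF that]
		by (auto intro!: derivative_eq_intros simp: W_def power2_eq_square)
	have limq: "(q \<longlongrightarrow> 1) at_top"
		unfolding q_def using tendsto_divide[OF lim] by simp
	have "\<forall>\<^sub>F t in at_top. u t < 2 \<and> t >= 1"
		using order_tendstoD(2)[OF lim(2), of 2] eventually_ge_at_top[of 1] by (auto intro: eventually_conj)
	then obtain T where T: "T >= 1" "!!t. t >= T ==> u t < 2"
		unfolding eventually_at_top_linorder by (metis order_refl)
	have inv: "1 / 4 <= 1 / (u t)\<^sup>2" if "t >= T" for t
		using T(2)[OF that] pos[of t] T(1) that power_strict_mono[of "u t" 2 2]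
		by (intro divide_left_mono) auto
	have "w = 0"
	proof (rule linorder_cases[of w 0])
		assume "w > 0"
		have False
		proof (rule not_tendsto_if_deriv_ge[OF limq, of "w / 4" T])
			fix t assume t: "t >= T"
			show "\<exists>d. (q has_real_derivative d) (at t) \<and> w / 4 <= d"
				using dq[of t] T(1) t mult_left_mono[OF inv[OF t], of w] \<open>w > 0\<close> by (intro exI conjI) auto
		qed (use \<open>w > 0\<close> in auto)
		then show ?thesis ..
	next
		assume "w < 0"
		have False
		proof (rule not_tendsto_if_deriv_ge[OF tendsto_minus[OF limq], of "- w / 4" T])
			fix t assume t: "t >= T"
			show "\<exists>d. ((\<lambda>x. - q x) has_real_derivative d) (at t) \<and> - w / 4 <= d"
				using DERIV_minus[OF dq[of t]] T(1) t mult_left_mono[OF inv[OF t], of "- w"] \<open>w < 0\<close>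
				by (intro exI conjI) auto
		qed (use \<open>w < 0\<close> in auto)
		then show ?thesis ..
	qed simp
	have "\<exists>d. \<forall>t\<in>{0<..}. q t = d"
		by (rule has_field_derivative_zero_constant)
			(use dq \<open>w = 0\<close> in \<open>auto intro: has_field_derivative_at_within\<close>)
	then obtain d where d: "!!t. t > 0 ==> q t = d" by auto
	have "\<forall>\<^sub>F t in at_top. q t = d"
		using eventually_gt_at_top[of 0] by eventually_elim (rule d)
	then have "(q \<longlongrightarrow> d) at_top" by (rule tendsto_eventually)
	then have "d = 1" using limq tendsto_unique trivial_limit_at_top_linorder by blast
	have "y t = u t" if "t > 0" for t
		using d[OF that] pos[OF that] \<open>d = 1\<close> by (simp add: q_def)
	moreover have "y t = u t" if "t <= 0" for t
		using y u that by (auto simp: ode_solves_def)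
	ultimately show ?thesis by (metis ext not_le)
qed

text \<open>Since the derivative of \<open>radius_of_log t\<close> is \<open>- 1 / sinh t\<close>
  and \<open>cosh t\<close> is the hyperbolic cotangent of the corresponding \<open>z\<close>, the
  first-order term of the Legendre equation is absorbed when passing to the distance variable. The
  normalization at infinity is \<open>legendre m 0 = 1\<close>.\<close>

lemma legendre_ode_solves:
	"ode_solves (4 * (m * (m + 1))) (\<lambda>t. if t <= 0 then 0 else legendre m (radius_of_log t))"
	(is "ode_solves _ ?u")
	unfolding ode_solves_def
proof (intro conjI exI allI impI)
	fix t :: real assume t: "t > 0"
	have s: "sinh t > 0" using t by simp
	show "(?u has_real_derivative - legendre' m (radius_of_log t) / sinh t) (at t)"
	proof (rule has_field_derivative_transform_within_open[where S="{0<..}"])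
		show "((\<lambda>t. legendre m (radius_of_log t)) has_real_derivative - legendre' m (radius_of_log t) / sinh t) (at t)"
			using DERIV_chain2[OF DERIV_legendre DERIV_radius_of_log[OF t]] by simp
	qed (use t in auto)
	let ?r = "radius_of_log t"
	have l2: "legendre'' m ?r + cosh t * legendre' m ?r = m * (m + 1) * legendre m ?r"
		using legendre_equation[of ?r m] cosh_radius_of_log[OF t] s by (simp add: field_simps)
	have "((\<lambda>t. - legendre' m (radius_of_log t) / sinh t) has_real_derivative
			(- (legendre'' m ?r * (- 1 / sinh t)) * sinh t - (- legendre' m ?r) * cosh t) / (sinh t * sinh t)) (at t)"
		using s by (intro DERIV_divide DERIV_minus DERIV_chain2[OF DERIV_legendre' DERIV_radius_of_log[OF t]]) (auto intro!: derivative_eq_intros)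
	also have "(- (legendre'' m ?r * (- 1 / sinh t)) * sinh t - (- legendre' m ?r) * cosh t) / (sinh t * sinh t)
		 = (legendre'' m ?r + cosh t * legendre' m ?r) / (sinh t)\<^sup>2"
		using s by (simp add: power2_eq_square mult.commute)
	also have "... = 4 * (m * (m + 1)) / (4 * (sinh t)\<^sup>2) * ?u t"
		unfolding l2 using t by simp
	finally show "((\<lambda>t. - legendre' m (radius_of_log t) / sinh t) has_real_derivative
		 4 * (m * (m + 1)) / (4 * (sinh t)\<^sup>2) * ?u t) (at t)" .
next
	have "((\<lambda>t. legendre m (radius_of_log t)) \<longlongrightarrow> legendre m 0) at_top"
		using isCont_tendsto_compose[OF DERIV_isCont[OF DERIV_legendre] radius_of_log_at_top] .
	moreover have "\<forall>\<^sub>F t in at_top. legendre m (radius_of_log t) = ?u t"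
		using eventually_gt_at_top[of 0] by eventually_elim auto
	ultimately show "(?u \<longlongrightarrow> 1) at_top"
		by (simp add: Lim_transform_eventually)
qed auto

lemma ode_sol_eq:
	assumes "t > 0"
	shows "ode_sol (4 * (m * (m + 1))) t = legendre m (radius_of_log t)"
proof -
	have "ode_sol (4 * (m * (m + 1))) = (\<lambda>t. if t <= 0 then 0 else legendre m (radius_of_log t))"
		unfolding ode_sol_def ode_solves_def[symmetric]
	proof (rule the_equality)
		show "ode_solves (4 * (m * (m + 1))) (\<lambda>t. if t <= 0 then 0 else legendre m (radius_of_log t))"
			by (rule legendre_ode_solves)
		fix y assume "ode_solves (4 * (m * (m + 1))) y"
		then show "y = (\<lambda>t. if t <= 0 then 0 else legendre m (radius_of_log t))"
			by (rule ode_unique[OF _ legendre_ode_solves]) (simp add: legendre_pos)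
	qed
	then show ?thesis using assms by simp
qed

lemma g_sol_eq: "t > 0 ==> g_sol t = legendre (- (1/2)) (radius_of_log t)"
	using ode_sol_eq[of t "- (1/2)"] by (simp add: g_sol_def)

lemma h_sol_eq: "t > 0 ==> h_sol n t = legendre ((real n - 3) / 2) (radius_of_log t)"
proof -
	have "4 * (a / 2 * (a / 2 + 1)) = (a + 2) * a" for a :: real
		by (simp add: field_simps)
	from this[of "real n - 3"] have "4 * ((real n - 3) / 2 * ((real n - 3) / 2 + 1)) = (real n - 1) * (real n - 3)"
		by (simp only: diff_add_eq[symmetric]) (simp add: algebra_simps)
	then show "t > 0 ==> ?thesis"
		using ode_sol_eq[of t "(real n - 3) / 2"] unfolding h_sol_def by (simp only:)
qed

text \<open>With \<open>ds = - dz / sinh z\<close> the integrand becomes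
  \<open>dz / leg_w m\<close>, and the interval up to \<open>r\<close> becomes a tail in
  \<open>z\<close>. So the equation defining \<open>r_fun\<close> is the matching of tail
  masses.\<close>

lemma LBINT_inverse_square:
	assumes r: "r > 0"
	shows "(LBINT s:{0<..<r}. 1 / (legendre m (radius_of_log s))\<^sup>2) = leg_S m (radius_of_log r)"
proof -
	have "(LBINT s=ereal 0..ereal r. 1 / (legendre m (radius_of_log s))\<^sup>2) = leg_S m (radius_of_log r) - 0"
	proof (rule interval_integral_FTC_nonneg(2)[where F="\<lambda>s. leg_S m (radius_of_log s)"])
		show "ereal 0 < ereal r" using r by simp
		fix s assume "ereal 0 < ereal s"
		then have s: "s > 0" "sinh s > 0" by simp_all
		have "((\<lambda>s. leg_S m (radius_of_log s)) has_real_derivative - 1 / leg_w m (radius_of_log s) * (- 1 / sinh s)) (at s)"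
			by (rule DERIV_chain2[OF DERIV_leg_S DERIV_radius_of_log]) (use s radius_of_log_pos in auto)
		then show "((\<lambda>s. leg_S m (radius_of_log s)) has_real_derivative 1 / (legendre m (radius_of_log s))\<^sup>2) (at s)"
			using s by (simp add: leg_w_def)
		show "isCont (\<lambda>s. 1 / (legendre m (radius_of_log s))\<^sup>2) s"
			using legendre_pos[of m "radius_of_log s"]
			by (intro continuous_intros isCont_o2[OF DERIV_isCont[OF DERIV_radius_of_log[OF s(1)]] DERIV_isCont[OF DERIV_legendre]]) auto
	next
		have "((\<lambda>s. leg_S m (radius_of_log s)) \<longlongrightarrow> 0) (at_right 0)"
			by (rule filterlim_compose[OF leg_S_at_top radius_of_log_at_right_0])
		then show "(((\<lambda>s. leg_S m (radius_of_log s)) \<circ> real_of_ereal) \<longlongrightarrow> 0) (at_right (ereal 0))"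
			by (simp add: ereal_tendsto_simps)
		have "isCont (\<lambda>s. leg_S m (radius_of_log s)) r"
			using r radius_of_log_pos by (intro isCont_o2[OF DERIV_isCont[OF DERIV_radius_of_log] DERIV_isCont[OF DERIV_leg_S]]) auto
		then have "((\<lambda>s. leg_S m (radius_of_log s)) \<longlongrightarrow> leg_S m (radius_of_log r)) (at_left r)"
			unfolding isCont_def by (rule tendsto_within_subset) simp
		then show "(((\<lambda>s. leg_S m (radius_of_log s)) \<circ> real_of_ereal) \<longlongrightarrow> leg_S m (radius_of_log r)) (at_left (ereal r))"
			by (simp add: ereal_tendsto_simps)
	qed simp
	then show ?thesis
		using r by (simp add: interval_lebesgue_integral_def einterval_eq)
qed

lemma r_fun_eq:
	assumes z: "z > 0"
	shows "r_fun n (radius_of_log z) = radius_of_log (leg_tr ((real n - 3) / 2) (- (1/2)) z)"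
proof -
	let ?m = "(real n - 3) / 2"
	have *: "(LBINT s:{0<..<r}. 1 / (h_sol n s)\<^sup>2) = leg_S ?m (radius_of_log r)"
		"(LBINT s:{0<..<r}. 1 / (g_sol s)\<^sup>2) = leg_S (- (1/2)) (radius_of_log r)" if "r > 0" for r
		by (subst LBINT_inverse_square[OF that, symmetric], rule set_lebesgue_integral_cong, auto simp: h_sol_eq g_sol_eq)+
	show ?thesis
		unfolding r_fun_def
	proof (rule the_equality)
		show "radius_of_log (leg_tr ?m (- (1/2)) z) > 0 \<and>
			(LBINT s:{0<..<radius_of_log (leg_tr ?m (- (1/2)) z)}. 1 / (h_sol n s)\<^sup>2) = (LBINT s:{0<..<radius_of_log z}. 1 / (g_sol s)\<^sup>2)"
			using z by (simp add: * radius_of_log_pos leg_tr_pos leg_S_leg_tr)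
		fix r assume "r > 0 \<and> (LBINT s:{0<..<r}. 1 / (h_sol n s)\<^sup>2) = (LBINT s:{0<..<radius_of_log z}. 1 / (g_sol s)\<^sup>2)"
		then have "r > 0" "leg_S ?m (radius_of_log r) = leg_S (- (1/2)) z"
			using z by (auto simp: * radius_of_log_pos)
		then have "leg_tr ?m (- (1/2)) z = radius_of_log r"
			by (intro leg_tr_unique radius_of_log_pos)
		then show "r = radius_of_log (leg_tr ?m (- (1/2)) z)" by simp
	qed
qed

lemma Y_fun_eq:
	assumes z: "z > 0"
	shows "Y_fun n (radius_of_log z) =
		(real n - 2) * leg_w ((real n - 3) / 2) (leg_tr ((real n - 3) / 2) (- (1/2)) z) / leg_w (- (1/2)) z"
proof -
	let ?y = "leg_tr ((real n - 3) / 2) (- (1/2)) z"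
	have "sinh z > 0" "sinh ?y > 0" using z leg_tr_pos[OF z] by auto
	then show ?thesis
		unfolding Y_fun_def r_fun_eq[OF z]
		using z by (simp add: h_sol_eq g_sol_eq radius_of_log_pos leg_tr_pos leg_w_def mult_ac)
qed

lemma hyp_dist_origin:
	assumes "norm \<theta> = 1" "z > 0"
	shows "hyp_dist (ray \<theta> z) 0 = radius_of_log z"
proof -
	have e: "(exp (- z))\<^sup>2 < 1" using assms(2) by (simp add: power_less_one_iff)
	have "1 + 2 * (exp (- z))\<^sup>2 / (1 - (exp (- z))\<^sup>2) = (1 + (exp (- z))\<^sup>2) / (1 - (exp (- z))\<^sup>2)"
		using e by (simp add: field_simps)
	also have "... = cosh z / sinh z"
		using e assms(2) by (simp add: cosh_field_def sinh_field_def exp_minus field_simps power2_eq_square)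
	also have "... = cosh (radius_of_log z)" by (simp add: cosh_radius_of_log assms)
	finally have "hyp_dist (ray \<theta> z) 0 = arcosh (cosh (radius_of_log z))"
		using assms(1) by (simp add: hyp_dist_def)
	then show ?thesis
		using radius_of_log_pos[OF assms(2)] by (simp add: arcosh_cosh_real)
qed

subsection \<open>The one-dimensional ground state representation\<close>

text \<open>For positive \<open>z\<close> this is \<open>hyp_density n z * (sinh z)^2\<close>:
  volume density times the inverse of the metric coefficient, hence the weight of the Dirichlet
  energy.\<close>

definition rad_w :: "nat => real => real" where
	"rad_w n z = 1 / sinh z ^ (n - 2)"

text \<open>For positive \<open>z\<close> this equals
  \<open>sinh z powr ((real n - 1) / 2) * legendre m z\<close>. Written with \<open>leg_w\<close>,
  it shows directly that \<open>rad_w\<close> times its square is \<open>leg_w m\<close>.\<close>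

definition ground :: "nat => real => real => real" where
	"ground n m z = sinh z powr ((real n - 2) / 2) * sqrt (leg_w m z)"

definition ground_log :: "nat => real => real => real" where
	"ground_log n m z = (real n - 2) / 2 * (cosh z / sinh z) + (cosh z / (2 * sinh z) + legendre' m z / legendre m z)"

lemma rad_w_pos: "z > 0 ==> rad_w n z > 0"
	by (simp add: rad_w_def)

lemma ground_pos: "z > 0 ==> ground n m z > 0"
	by (simp add: ground_def leg_w_pos)

lemma hyp_density_rad_w: "z > 0 ==> n >= 2 ==> hyp_density n z * (sinh z)\<^sup>2 = rad_w n z"
	by (simp add: hyp_density_def rad_w_def power_diff field_simps)

lemma ground_square:
	assumes "z > 0" "n >= 2"
	shows "rad_w n z * (ground n m z)\<^sup>2 = leg_w m z"
proof -
	have "(sinh z powr ((real n - 2) / 2))\<^sup>2 = sinh z powr (real (n - 2))"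
	proof -
		have "(real n - 2) / 2 + (real n - 2) / 2 = real (n - 2)"
			using assms by (simp add: of_nat_diff)
		then show ?thesis by (simp only: power2_eq_square powr_add[symmetric])
	qed
	also have "... = sinh z ^ (n - 2)" using assms by (intro powr_realpow) simp
	finally show ?thesis
		using assms leg_w_pos[of z m] by (simp add: rad_w_def ground_def power_mult_distrib)
qed

lemma DERIV_ground:
	assumes z: "z > 0"
	shows "(ground n m has_real_derivative ground_log n m z * ground n m z) (at z)"
proof -
	have s: "sinh z > 0" using z by simp
	have w: "leg_w m z > 0" by (rule leg_w_pos[OF z])
	have F: "legendre m z > 0" by (rule legendre_pos)
	have "((\<lambda>z. sinh z powr ((real n - 2) / 2)) has_real_derivative
			(real n - 2) / 2 * (cosh z / sinh z) * sinh z powr ((real n - 2) / 2)) (at z)"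
		using s by (auto intro!: derivative_eq_intros simp: powr_diff)
	moreover have "((\<lambda>z. sqrt (leg_w m z)) has_real_derivative
			(cosh z / (2 * sinh z) + legendre' m z / legendre m z) * sqrt (leg_w m z)) (at z)"
	proof -
		have "((\<lambda>z. sqrt (leg_w m z)) has_real_derivative
			(cosh z * (legendre m z)\<^sup>2 + sinh z * (2 * legendre m z * legendre' m z)) * (inverse (sqrt (leg_w m z)) / 2)) (at z)"
			using DERIV_chain2[OF DERIV_real_sqrt[OF w] DERIV_leg_w] by (simp add: mult.commute)
		also have "(cosh z * (legendre m z)\<^sup>2 + sinh z * (2 * legendre m z * legendre' m z)) =
			2 * (cosh z / (2 * sinh z) + legendre' m z / legendre m z) * leg_w m z"
			using s F by (simp add: leg_w_def field_simps power2_eq_square)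
		also have "2 * (cosh z / (2 * sinh z) + legendre' m z / legendre m z) * leg_w m z * (inverse (sqrt (leg_w m z)) / 2)
			 = (cosh z / (2 * sinh z) + legendre' m z / legendre m z) * (leg_w m z / sqrt (leg_w m z))"
		proof -
			have "2 * A * W * (inverse R / 2) = A * (W / R)" for A W R :: real
				by (simp add: field_simps)
			then show ?thesis .
		qed
		also have "leg_w m z / sqrt (leg_w m z) = sqrt (leg_w m z)"
			using w by (simp add: real_div_sqrt)
		finally show ?thesis .
	qed
	ultimately have "(ground n m has_real_derivative
			(real n - 2) / 2 * (cosh z / sinh z) * sinh z powr ((real n - 2) / 2) * sqrt (leg_w m z) +
			(cosh z / (2 * sinh z) + legendre' m z / legendre m z) * sqrt (leg_w m z) * sinh z powr ((real n - 2) / 2)) (at z)"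
		unfolding ground_def[abs_def] by (rule DERIV_mult)
	moreover have "A * S * R + B * R * S = (A + B) * (S * R)" for A B S R :: real
		by (simp add: algebra_simps)
	ultimately show ?thesis
		unfolding ground_def ground_log_def by metis
qed

lemma DERIV_rad_w:
	assumes "z > 0" "n >= 2"
	shows "(rad_w n has_real_derivative - ((real n - 2) * (cosh z / sinh z) * rad_w n z)) (at z)"
proof -
	have h1: "((\<lambda>z. inverse (sinh z ^ (n - 2))) has_real_derivative
			- (real (n - 2) * cosh z * sinh z ^ (n - 2 - 1) * inverse ((sinh z ^ (n - 2)) ^ 2))) (at z)"
		using assms by (auto intro!: derivative_eq_intros simp: power2_eq_square)
	have h2: "real (n - 2) * cosh z * sinh z ^ (n - 2 - 1) * inverse ((sinh z ^ (n - 2)) ^ 2)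
			= (real n - 2) * (cosh z / sinh z) * rad_w n z"
	proof (cases "n - 2")
		case 0
		then show ?thesis using assms by simp
	next
		case (Suc k)
		then have "n = k + 3" by simp
		then show ?thesis
			using assms by (simp add: rad_w_def power2_eq_square field_simps)
	qed
	have "rad_w n = (\<lambda>z. inverse (sinh z ^ (n - 2)))"
		by (auto simp: rad_w_def divide_inverse)
	then show ?thesis
		using h1 h2 by metis
qed

text \<open>The Riccati equation for \<open>ground_log\<close> produces both the spectral gap and the Hardy term.\<close>

lemma DERIV_rad_w_ground_log:
	assumes z: "z > 0" and n: "n >= 2"
	shows "((\<lambda>z. rad_w n z * ground_log n m z) has_real_derivative
		- (rad_w n z * ((ground_log n m z)\<^sup>2 + ((real n - 1) / 2)\<^sup>2 / (sinh z)\<^sup>2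
				+ (((real n - 2) / 2)\<^sup>2 - (m + 1/2)\<^sup>2)))) (at z)"
proof -
	define b where "b = (real n - 2) / 2"
	define l where "l = cosh z / (2 * sinh z) + legendre' m z / legendre m z"
	define k where "k = cosh z / sinh z"
	define S where "S = 1 / (sinh z)\<^sup>2"
	have s: "sinh z > 0" using z by simp
	have k2: "k\<^sup>2 = 1 + S"
		using s cosh_square_eq[of z] by (simp add: k_def S_def power_divide add_divide_distrib)
	have "((\<lambda>z. cosh z / sinh z) has_real_derivative (sinh z * sinh z - cosh z * cosh z) / (sinh z * sinh z)) (at z)"
		using s by (auto intro!: derivative_eq_intros)
	also have "(sinh z * sinh z - cosh z * cosh z) / (sinh z * sinh z) = - S"
		using cosh_square_eq[of z] s by (simp add: S_def power2_eq_square)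
	finally have dk: "((\<lambda>z. cosh z / sinh z) has_real_derivative - S) (at z)" .
	have dl: "((\<lambda>z. cosh z / (2 * sinh z) + legendre' m z / legendre m z) has_real_derivative
			(m + 1/2)\<^sup>2 - S / 4 - l\<^sup>2) (at z)"
	proof -
		have "S / 4 = 1 / (4 * (sinh z)\<^sup>2)" by (simp add: S_def)
		then show ?thesis using leg_log_deriv[OF z, of m] by (simp only: l_def)
	qed
	have "(ground_log n m has_real_derivative b * (- S) + ((m + 1/2)\<^sup>2 - S / 4 - l\<^sup>2)) (at z)"
		unfolding ground_log_def[abs_def] b_def by (intro DERIV_add DERIV_cmult dk dl)
	from DERIV_mult[OF DERIV_rad_w[OF z n] this]
	show ?thesis
	proof (rule DERIV_cong)
		have g: "ground_log n m z = b * k + l" by (simp add: ground_log_def b_def k_def l_def)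
		have r: "real n - 2 = 2 * b" "(real n - 1) / 2 = b + 1/2" "X / (sinh z)\<^sup>2 = X * S" for X
			by (simp_all add: b_def S_def field_simps)
		have "- (2 * b * k) * (b * k + l) + (b * (- S) + ((m + 1/2)\<^sup>2 - S / 4 - l\<^sup>2)) =
			- ((b * k + l)\<^sup>2 + (b + 1/2)\<^sup>2 * S + (b\<^sup>2 - (m + 1/2)\<^sup>2)) + b\<^sup>2 * (1 + S - k\<^sup>2)"
			by (simp add: power2_eq_square algebra_simps)
		then have "- (2 * b * k) * (b * k + l) + (b * (- S) + ((m + 1/2)\<^sup>2 - S / 4 - l\<^sup>2)) =
			- ((b * k + l)\<^sup>2 + (b + 1/2)\<^sup>2 * S + (b\<^sup>2 - (m + 1/2)\<^sup>2))"
			by (simp add: k2)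
		from arg_cong[OF this, of "\<lambda>x. rad_w n z * x"]
		show "- ((real n - 2) * (cosh z / sinh z) * rad_w n z) * ground_log n m z +
			 (b * - S + ((m + 1/2)\<^sup>2 - S / 4 - l\<^sup>2)) * rad_w n z =
			 - (rad_w n z * ((ground_log n m z)\<^sup>2 + ((real n - 1) / 2)\<^sup>2 / (sinh z)\<^sup>2
				+ (((real n - 2) / 2)\<^sup>2 - (m + 1/2)\<^sup>2)))"
			unfolding g r k_def[symmetric] by (simp add: b_def[symmetric] algebra_simps)
	qed
qed

lemma ground_log_continuous: "continuous_on {0<..} (ground_log n m)"
proof -
	have "\<forall>z\<in>{0<..}. legendre m z ~= 0" "\<forall>z\<in>{0<..}. sinh z ~= (0::real)"
		using legendre_pos[of m] by (auto simp: less_imp_neq[symmetric])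
	then show ?thesis
		unfolding ground_log_def[abs_def]
		by (intro continuous_intros continuous_on_legendre) auto
qed

lemma rad_w_continuous: "continuous_on {0<..} (rad_w n)"
	unfolding rad_w_def[abs_def] by (intro continuous_intros) auto

lemma lborel_integral_compact:
	fixes f :: "real => real"
	assumes f: "continuous_on {0<..} f" and ab: "0 < a" and z: "!!z. z \<notin> {a..b} ==> f z = 0"
	shows "integrable lborel f" "(\<integral>z. f z \<partial>lborel) = integral {a..b} f"
proof -
	have "continuous_on {a..b} f" using f ab by (auto intro: continuous_on_subset)
	then have "set_integrable lborel {a..b} f"
		by (rule borel_integrable_atLeastAtMost')
	moreover have eq: "(\<lambda>z. indicator {a..b} z *\<^sub>R f z) = f"
		using z by (auto simp: fun_eq_iff split: split_indicator)
	ultimately show "integrable lborel f"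
		by (simp add: set_integrable_def)
	have "(\<integral>z. f z \<partial>lborel) = (LBINT z:{a..b}. f z)"
		unfolding set_lebesgue_integral_def eq ..
	also have "... = integral {a..b} f"
		using \<open>set_integrable lborel {a..b} f\<close> by (rule set_borel_integral_eq_integral)
	finally show "(\<integral>z. f z \<partial>lborel) = integral {a..b} f" .
qed

text \<open>The derivative is carried as a separate function, and both functions vanish outside
  \<open>{a..b}\<close> on the whole line, so that integrals over \<open>lborel\<close> need no
  restriction to the half-line.\<close>

definition C1c :: "real => real => (real => real) => (real => real) => bool" where
	"C1c a b V V' \<longleftrightarrow> 0 < a \<and> a < b \<and> (\<forall>z>0. (V has_real_derivative V' z) (at z)) \<and> continuous_on {0<..} V' \<and>
		 (\<forall>z. z \<notin> {a..b} --> V z = 0 \<and> V' z = 0)"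

lemma C1cD:
	assumes "C1c a b V V'"
	shows "0 < a" "a < b" "!!z. z > 0 ==> (V has_real_derivative V' z) (at z)" "continuous_on {0<..} V'"
		"!!z. z \<notin> {a..b} ==> V z = 0" "!!z. z \<notin> {a..b} ==> V' z = 0"
		"continuous_on {0<..} V"
	using assms unfolding C1c_def
	by (auto intro!: continuous_at_imp_continuous_on DERIV_isCont)

text \<open>The index \<open>m\<close> parametrizes the Hardy coefficient
  \<open>((real n - 2) / 2)^2 - (m + 1/2)^2\<close>: it vanishes for \<open>m = (n - 3) / 2\<close>
  and is maximal for \<open>m = -1/2\<close>. One identity thus serves both quadratic forms.\<close>

definition rad_form :: "nat => real => (real => real) => (real => real) => real => real" where
	"rad_form n m V V' z = rad_w n z * ((V' z)\<^sup>2 - ((real n - 1) / 2)\<^sup>2 * (V z)\<^sup>2 / (sinh z)\<^sup>2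
		- (((real n - 2) / 2)\<^sup>2 - (m + 1/2)\<^sup>2) * (V z)\<^sup>2)"

lemma rad_form_integrable:
	assumes V: "C1c a b V V'"
	shows "integrable lborel (rad_form n m V V')"
		"integrable lborel (\<lambda>z. rad_w n z * (V' z - ground_log n m z * V z)\<^sup>2)"
proof -
	note V = C1cD[OF V]
	have nz: "\<forall>z\<in>{0<..}. (sinh z)\<^sup>2 ~= (0::real)" by auto
	show "integrable lborel (rad_form n m V V')"
		by (rule lborel_integral_compact(1)[of _ a b])
			(use nz V in \<open>auto simp: rad_form_def intro!: continuous_intros rad_w_continuous simp: rad_form_def[abs_def]\<close>)
	show "integrable lborel (\<lambda>z. rad_w n z * (V' z - ground_log n m z * V z)\<^sup>2)"
		by (rule lborel_integral_compact(1)[of _ a b])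
			(use V in \<open>auto intro!: continuous_intros rad_w_continuous ground_log_continuous\<close>)
qed

text \<open>By the Riccati equation the difference of the two integrands is the derivative of
  \<open>rad_w * ground_log * V^2\<close>, which vanishes at both ends.\<close>

lemma ground_state_representation:
	assumes C: "C1c a b V V'" and n: "n >= 2"
	shows "(\<integral>z. rad_form n m V V' z \<partial>lborel) = (\<integral>z. rad_w n z * (V' z - ground_log n m z * V z)\<^sup>2 \<partial>lborel)"
proof -
	note V = C1cD[OF C]
	let ?P = "\<lambda>z. rad_w n z * ground_log n m z * (V z)\<^sup>2"
	let ?D = "\<lambda>z. rad_form n m V V' z - rad_w n z * (V' z - ground_log n m z * V z)\<^sup>2"
	have dP: "(?P has_real_derivative ?D z) (at z)" if "z > 0" for z
	proof -
		have "((\<lambda>z. (V z)\<^sup>2) has_real_derivative 2 * V z * V' z) (at z)"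
			using V(3)[OF that] by (auto intro!: derivative_eq_intros)
		from DERIV_mult[OF DERIV_rad_w_ground_log[OF that n, of m] this]
		show ?thesis
			by (rule DERIV_cong) (simp add: rad_form_def power2_eq_square algebra_simps)
	qed
	\<comment> \<open>Points strictly outside \<open>{a..b}\<close>, where \<open>V\<close> is zero by
	  assumption, so that the boundary terms drop out.\<close>
	define a' b' where "a' = a / 2" and "b' = b + 1"
	have ab': "0 < a'" "a' < a" "b < b'" "a' <= b'" using V(1,2) by (auto simp: a'_def b'_def)
	have int: "integrable lborel ?D"
		using rad_form_integrable[OF C] by (intro Bochner_Integration.integrable_diff)
	have nz: "\<forall>z\<in>{0<..}. (sinh z)\<^sup>2 ~= (0::real)" by auto
	have cont: "continuous_on {0<..} ?D"
		using nz V(4,7) unfolding rad_form_def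
		by (intro continuous_intros rad_w_continuous ground_log_continuous)
	have "(?D has_integral ?P b' - ?P a') {a'..b'}"
	proof (rule fundamental_theorem_of_calculus[OF ab'(4)])
		fix x assume "x \<in> {a'..b'}"
		then show "(?P has_vector_derivative ?D x) (at x within {a'..b'})"
			using dP[of x] ab' by (simp add: has_real_derivative_iff_has_vector_derivative has_vector_derivative_at_within)
	qed
	then have "integral {a'..b'} ?D = 0"
		using V(5)[of a'] V(5)[of b'] ab' by (simp add: has_integral_iff)
	moreover have "?D z = 0" if "z \<notin> {a'..b'}" for z
		using V(5,6)[of z] that ab' by (auto simp: rad_form_def)
	ultimately have "(\<integral>z. ?D z \<partial>lborel) = 0"
		using lborel_integral_compact(2)[OF cont ab'(1), of b'] by simp
	then show ?thesis
		using rad_form_integrable[OF C] by (simp add: Bochner_Integration.integral_diff)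
qed

subsection \<open>Transplantation between the two ground states\<close>

abbreviation hm :: "nat => real" where "hm n \<equiv> (real n - 3) / 2"

abbreviation tr_y :: "nat => real => real" where "tr_y n \<equiv> leg_tr (- (1/2)) (hm n)"

definition tr_y' :: "nat => real => real" where
	"tr_y' n z = leg_w (- (1/2)) (tr_y n z) / leg_w (hm n) z"

definition tr_a :: "nat => real => real" where
	"tr_a n z = ground n (hm n) z / ground n (- (1/2)) (tr_y n z)"

lemma tr_y'_pos: "z > 0 ==> tr_y' n z > 0"
	by (simp add: tr_y'_def leg_w_pos leg_tr_pos)

lemma DERIV_tr_y: "z > 0 ==> (tr_y n has_real_derivative tr_y' n z) (at z)"
	unfolding tr_y'_def by (rule DERIV_leg_tr)

lemma tr_a_pos: "z > 0 ==> tr_a n z > 0"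
	by (simp add: tr_a_def ground_pos leg_tr_pos)

text \<open>The squared ground states are \<open>leg_w / rad_w\<close>, and \<open>tr_y'\<close> is
  the quotient of the two functions \<open>leg_w\<close>, so these cancel. The behaviour of the
  radial energy, of the angular energy and of the weighted norm under transplantation is read off
  from this identity.\<close>

lemma tr_a_square:
	assumes "z > 0" "n >= 2"
	shows "rad_w n z * (tr_a n z)\<^sup>2 = rad_w n (tr_y n z) / tr_y' n z"
proof -
	define y where "y = tr_y n z"
	have y: "y > 0" using leg_tr_pos[OF assms(1)] by (simp add: y_def)
	define G where "G = (ground n (- (1/2)) y)\<^sup>2"
	have G: "G > 0" "rad_w n y > 0" "rad_w n y * G = leg_w (- (1/2)) y"
		using ground_pos[OF y, of n "- (1/2)"] rad_w_pos[OF y] ground_square[OF y assms(2), of "- (1/2)"]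
		by (auto simp: G_def)
	have "rad_w n z * (tr_a n z)\<^sup>2 = leg_w (hm n) z / G"
		using ground_square[OF assms, of "hm n"] by (simp add: tr_a_def y_def G_def power_divide)
	also have "... = rad_w n y / (rad_w n y * G / leg_w (hm n) z)"
		using G(1,2) leg_w_pos[OF assms(1), of "hm n"] by simp
	finally show ?thesis
		unfolding tr_y'_def y_def[symmetric] G(3)[symmetric] .
qed

lemma DERIV_tr_a:
	assumes z: "z > 0"
	shows "(tr_a n has_real_derivative
		tr_a n z * (ground_log n (hm n) z - tr_y' n z * ground_log n (- (1/2)) (tr_y n z))) (at z)"
proof -
	let ?y = "tr_y n z"
	have y: "?y > 0" by (rule leg_tr_pos[OF z])
	have "((\<lambda>z. ground n (- (1/2)) (tr_y n z)) has_real_derivative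
			ground_log n (- (1/2)) ?y * ground n (- (1/2)) ?y * tr_y' n z) (at z)"
		by (rule DERIV_chain2[OF DERIV_ground[OF y] DERIV_tr_y[OF z]])
	from DERIV_divide[OF DERIV_ground[OF z] this, of n "hm n"]
	have "(tr_a n has_real_derivative
		 (ground_log n (hm n) z * ground n (hm n) z * ground n (- (1/2)) ?y -
			 ground n (hm n) z * (ground_log n (- (1/2)) ?y * ground n (- (1/2)) ?y * tr_y' n z)) /
		 (ground n (- (1/2)) ?y * ground n (- (1/2)) ?y)) (at z)"
		using ground_pos[OF y, of n "- (1/2)"] by (simp add: tr_a_def[abs_def])
	then show ?thesis
		by (rule DERIV_cong) (use ground_pos[OF y, of n "- (1/2)"] in \<open>simp add: tr_a_def field_simps\<close>)
qed

text \<open>Since \<open>tr_a\<close> is the quotient of the ground states, all logarithmic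
  derivatives cancel and the reduced derivative of the transplanted function is
  \<open>tr_a * tr_y'\<close> times the reduced derivative of \<open>V\<close>. Squaring and
  \<open>tr_a_square\<close> leave exactly the Jacobian \<open>tr_y'\<close>.\<close>

lemma transplant_square:
	assumes z: "z > 0" and n: "n >= 2"
		and V: "(V has_real_derivative V') (at (tr_y n z))"
		and U: "((\<lambda>z. tr_a n z * V (tr_y n z)) has_real_derivative U') (at z)"
	shows "rad_w n z * (U' - ground_log n (hm n) z * (tr_a n z * V (tr_y n z)))\<^sup>2 =
		tr_y' n z * (rad_w n (tr_y n z) * (V' - ground_log n (- (1/2)) (tr_y n z) * V (tr_y n z))\<^sup>2)"
proof -
	let ?y = "tr_y n z"
	let ?X = "V' - ground_log n (- (1/2)) ?y * V ?y"
	have "((\<lambda>z. tr_a n z * V (tr_y n z)) has_real_derivative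
		 tr_a n z * (ground_log n (hm n) z - tr_y' n z * ground_log n (- (1/2)) ?y) * V ?y + V' * tr_y' n z * tr_a n z) (at z)"
		by (rule DERIV_mult[OF DERIV_tr_a[OF z] DERIV_chain2[OF V DERIV_tr_y[OF z]]])
	then have "U' = tr_a n z * (ground_log n (hm n) z - tr_y' n z * ground_log n (- (1/2)) ?y) * V ?y + V' * tr_y' n z * tr_a n z"
		using U DERIV_unique by blast
	then have "U' - ground_log n (hm n) z * (tr_a n z * V ?y) = tr_a n z * tr_y' n z * ?X"
		by (simp add: algebra_simps)
	then have "rad_w n z * (U' - ground_log n (hm n) z * (tr_a n z * V ?y))\<^sup>2 =
			(rad_w n z * (tr_a n z)\<^sup>2) * (tr_y' n z)\<^sup>2 * ?X\<^sup>2"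
		by (simp add: power_mult_distrib)
	also have "... = tr_y' n z * (rad_w n ?y * ?X\<^sup>2)"
		unfolding tr_a_square[OF z n] using tr_y'_pos[OF z, of n] by (simp add: power2_eq_square)
	finally show ?thesis .
qed

lemma transplant_angular_le:
	assumes z: "z > 0" and n: "n >= 2"
	shows "rad_w n z * (tr_a n z)\<^sup>2 <= tr_y' n z * rad_w n (tr_y n z)"
proof -
	have "1 <= tr_y' n z"
		using leg_w_leg_tr_ge[OF z, of "hm n"] leg_w_pos[OF z, of "hm n"] by (simp add: tr_y'_def)
	then have "1 / tr_y' n z <= tr_y' n z"
		by (smt (verit) divide_le_eq_1 mult_mono' mult.right_neutral)
	then show ?thesis
		unfolding tr_a_square[OF z n]
		using mult_left_mono[of "1 / tr_y' n z" "tr_y' n z" "rad_w n (tr_y n z)"]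
			rad_w_pos[OF leg_tr_pos[OF z, of "- (1/2)" "hm n"], of n]
		by (simp add: mult.commute)
qed

lemma lborel_integral_leg_tr:
	fixes f :: "real => real"
	assumes f: "integrable lborel f" "!!z. z <= 0 ==> f z = 0"
	shows "integrable lborel (\<lambda>z. indicator {0<..} z * (leg_w a (leg_tr a b z) / leg_w b z * f (leg_tr a b z)))"
		"(\<integral>z. indicator {0<..} z * (leg_w a (leg_tr a b z) / leg_w b z * f (leg_tr a b z)) \<partial>lborel) = (\<integral>z. f z \<partial>lborel)"
proof -
	let ?g = "\<lambda>z. leg_w a (leg_tr a b z) / leg_w b z"
	have [measurable]: "f \<in> borel_measurable borel" using f(1) by simp
	have f_eq: "indicator {0<..} z *\<^sub>R f z = f z" for z
		using f(2)[of z] by (auto split: split_indicator)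
	have "set_integrable lebesgue {0<..} f"
		using f(1) unfolding set_integrable_def f_eq by (simp add: integrable_completion)
	moreover have intf: "integral {0<..} f = (\<integral>z. f z \<partial>lborel)"
		using set_lebesgue_integral_eq_integral(2)[OF \<open>set_integrable lebesgue {0<..} f\<close>]
		unfolding set_lebesgue_integral_def f_eq by (simp add: integral_completion)
	moreover have "((\<lambda>x. \<bar>?g x\<bar> * f (leg_tr a b x)) absolutely_integrable_on {0<..} \<and>
			integral {0<..} (\<lambda>x. \<bar>?g x\<bar> * f (leg_tr a b x)) = (\<integral>z. f z \<partial>lborel)) \<longleftrightarrow>
			f absolutely_integrable_on leg_tr a b ` {0<..} \<and> integral (leg_tr a b ` {0<..}) f = (\<integral>z. f z \<partial>lborel)"
		by (rule has_absolute_integral_change_of_variables_1')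
			(auto intro: leg_tr_inj has_field_derivative_at_within DERIV_leg_tr)
	ultimately have *: "set_integrable lebesgue {0<..} (\<lambda>x. \<bar>?g x\<bar> * f (leg_tr a b x))"
			"integral {0<..} (\<lambda>x. \<bar>?g x\<bar> * f (leg_tr a b x)) = (\<integral>z. f z \<partial>lborel)"
		by (simp_all add: leg_tr_image)
	have eq: "indicator {0<..} z *\<^sub>R (\<bar>?g z\<bar> * f (leg_tr a b z)) = indicator {0<..} z * (?g z * f (leg_tr a b z))" for z
		using leg_w_pos[of z b] leg_w_pos[OF leg_tr_pos[of z a b], of a]
		by (auto split: split_indicator simp: abs_of_pos)
	have meas: "(\<lambda>z. indicator {0<..} z * (?g z * f (leg_tr a b z))) \<in> borel_measurable borel"
	proof -
		have [measurable]: "(\<lambda>z. indicator {0<..} z *\<^sub>R leg_tr a b z) \<in> borel_measurable borel"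
			using leg_tr_smooth[of 0 a b] by (intro borel_measurable_continuous_on_indicator) auto
		have "continuous_on {0<..} ?g"
			using leg_w_pos[of _ b] leg_tr_smooth[of 0 a b] leg_tr_pos
			by (intro continuous_intros continuous_on_compose2[OF leg_w_continuous] leg_w_continuous)
				(auto simp: less_imp_neq[symmetric])
		then have [measurable]: "(\<lambda>z. indicator {0<..} z *\<^sub>R ?g z) \<in> borel_measurable borel"
			by (intro borel_measurable_continuous_on_indicator) auto
		have "(\<lambda>z. (indicator {0<..} z *\<^sub>R ?g z) * f (indicator {0<..} z *\<^sub>R leg_tr a b z)) \<in> borel_measurable borel"
			by measurable
		also have "(\<lambda>z. (indicator {0<..} z *\<^sub>R ?g z) * f (indicator {0<..} z *\<^sub>R leg_tr a b z)) =
				(\<lambda>z. indicator {0<..} z * (?g z * f (leg_tr a b z)))"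
			by (auto split: split_indicator)
		finally show ?thesis .
	qed
	show "integrable lborel (\<lambda>z. indicator {0<..} z * (?g z * f (leg_tr a b z)))"
		using *(1) meas unfolding set_integrable_def eq by (subst (asm) integrable_completion) auto
	show "(\<integral>z. indicator {0<..} z * (?g z * f (leg_tr a b z)) \<partial>lborel) = (\<integral>z. f z \<partial>lborel)"
		using set_lebesgue_integral_eq_integral(2)[OF *(1)] *(2) meas
		unfolding set_lebesgue_integral_def eq by (simp add: integral_completion)
qed

subsection \<open>Functions in polar coordinates\<close>

text \<open>The radial function with profile \<open>\<omega>\<close> in the logarithmic radius. Its
  value 0 at the origin agrees with the default values \<open>0 powr a = 0\<close> and
  \<open>x / 0 = 0\<close> of the weights, so the rewriting of the weights holds at every
  point.\<close>

definition rwt :: "(real => real) => 'a::euclidean_space => real" where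
	"rwt \<omega> x = (if x ~= 0 \<and> norm x < 1 then \<omega> (- ln (norm x)) else 0)"

lemma rwt_polar: "norm \<theta> = 1 ==> z > 0 ==> rwt \<omega> (ray \<theta> z) = \<omega> z"
	by (auto simp: rwt_def)

lemma rwt_measurable:
	assumes "continuous_on {0<..} \<omega>"
	shows "rwt \<omega> \<in> borel_measurable (borel :: 'a::euclidean_space measure)"
proof -
	have [measurable]: "(\<lambda>z. indicator {0<..} z *\<^sub>R \<omega> z) \<in> borel_measurable borel"
		by (rule borel_measurable_continuous_on_indicator[OF _ assms]) simp
	have "(\<lambda>x::'a. if x ~= 0 \<and> norm x < 1 then indicator {0<..} (- ln (norm x)) *\<^sub>R \<omega> (- ln (norm x)) else 0) \<in> borel_measurable borel"
		by measurable
	also have "(\<lambda>x::'a. if x ~= 0 \<and> norm x < 1 then indicator {0<..} (- ln (norm x)) *\<^sub>R \<omega> (- ln (norm x)) else 0) = rwt \<omega>"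
		by (auto simp: rwt_def fun_eq_iff)
	finally show ?thesis .
qed

text \<open>The bound \<open>z0\<close> keeps the support away from the ideal boundary
  \<open>z = 0\<close>. For larger \<open>z\<close>, that is towards the origin,
  \<open>sinh z\<close> is at least a multiple of \<open>exp z\<close>, so any negative power of it
  is integrable.\<close>

lemma integrable_hyp_vol_decay:
	fixes F :: "'a::euclidean_space => real"
	assumes [measurable]: "F \<in> borel_measurable borel" and z0: "z0 > 0" and d: "d > 0"
		and small: "!!z \<theta>. norm \<theta> = 1 ==> 0 < z ==> z < z0 ==> F (ray \<theta> z) = 0"
		and bound: "!!z \<theta>. norm \<theta> = 1 ==> z0 <= z ==> hyp_density DIM('a) z * \<bar>F (ray \<theta> z)\<bar> <= C * sinh z powr (- d)"
	shows "integrable hyp_vol F"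
proof -
	define k where "k = (1 - exp (- 2 * z0)) / 2"
	have k: "k > 0" using z0 by (simp add: k_def)
	have sinh_ge: "sinh z >= k * exp z" if "z >= z0" for z
	proof -
		have "exp (- 2 * z) <= exp (- 2 * z0)" using that by simp
		then have "k * exp z <= (1 - exp (- 2 * z)) / 2 * exp z"
			unfolding k_def by (intro mult_right_mono) auto
		also have "... = sinh z"
			by (simp add: sinh_field_def field_simps exp_add[symmetric])
		finally show ?thesis .
	qed
	define B where "B = \<bar>C\<bar> * k powr (- d)"
	have pw: "hyp_density DIM('a) z * \<bar>F (ray \<theta> z)\<bar> <= B * exp (- d * z) * indicator {0..} z" if "norm \<theta> = 1" for z \<theta>
	proof -
		consider "z <= 0" | "0 < z" "z < z0" | "z0 <= z" by linarith
		then show ?thesis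
		proof cases
			case 3
			have "hyp_density DIM('a) z * \<bar>F (ray \<theta> z)\<bar> <= \<bar>C\<bar> * sinh z powr (- d)"
				using bound[OF that 3] by (smt (verit) mult_right_mono powr_ge_zero)
			also have "sinh z powr (- d) <= (k * exp z) powr (- d)"
				using k sinh_ge[OF 3] d by (intro powr_mono2') auto
			also have "(k * exp z) powr (- d) = k powr (- d) * exp (- d * z)"
				using k by (simp add: powr_mult exp_powr_real mult.commute)
			finally show ?thesis
				using 3 z0 by (simp add: B_def mult_left_mono mult.assoc)
		qed (use small[OF that, of z] in \<open>auto simp: hyp_density_def B_def\<close>)
	qed
	have "(\<integral>\<^sup>+x. ennreal (norm (F x)) \<partial>hyp_vol) =
			(\<integral>\<^sup>+\<theta>. (\<integral>\<^sup>+z. ennreal (hyp_density DIM('a) z) * ennreal (norm (F (ray \<theta> z))) \<partial>lborel) \<partial>angular)"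
		by (rule nn_integral_hyp_vol) measurable
	also have "... <= (\<integral>\<^sup>+(\<theta>::'a). ennreal (B / d) \<partial>angular)"
	proof (rule nn_integral_mono_AE, rule eventually_mono[OF AE_angular_norm])
		fix \<theta> :: 'a assume \<theta>: "norm \<theta> = 1"
		have "(\<integral>\<^sup>+z. ennreal (hyp_density DIM('a) z) * ennreal (norm (F (ray \<theta> z))) \<partial>lborel) <=
				(\<integral>\<^sup>+z. ennreal (B * exp (- d * z)) * indicator {0..} z \<partial>lborel)"
		proof (rule nn_integral_mono)
			fix z :: real
			have "ennreal (hyp_density DIM('a) z) * ennreal (norm (F (ray \<theta> z))) =
					ennreal (hyp_density DIM('a) z * \<bar>F (ray \<theta> z)\<bar>)"
				by (simp add: ennreal_mult' hyp_density_nonneg)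
			also have "... <= ennreal (B * exp (- d * z) * indicator {0..} z)"
				by (intro ennreal_leI pw \<theta>)
			also have "... = ennreal (B * exp (- d * z)) * indicator {0..} z"
				by (auto split: split_indicator)
			finally show "ennreal (hyp_density DIM('a) z) * ennreal (norm (F (ray \<theta> z))) <=
					ennreal (B * exp (- d * z)) * indicator {0..} z" .
		qed
		also have "... = ennreal (0 - - (B * exp (- d * 0) / d))"
		proof (rule nn_integral_FTC_atLeast[where F="\<lambda>z. - (B * exp (- d * z) / d)"])
			show "((\<lambda>z. - (B * exp (- d * z) / d)) has_real_derivative B * exp (- d * x)) (at x)" for x :: real
				using d by (auto intro!: derivative_eq_intros)
			show "0 <= B * exp (- d * x)" for x :: real by (simp add: B_def)
			have "LIM z at_top. - (d * z) :> at_bot"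
				using filterlim_tendsto_pos_mult_at_top[OF tendsto_const[of d] d filterlim_ident]
				by (simp add: filterlim_uminus_at_bot)
			then have "((\<lambda>z::real. - (B * exp (- (d * z)) / d)) \<longlongrightarrow> - (B * 0 / d)) at_top"
				using d by (intro tendsto_intros filterlim_compose[OF exp_at_bot]) auto
			then show "((\<lambda>z::real. - (B * exp (- d * z) / d)) \<longlongrightarrow> 0) at_top"
				by simp
		qed simp
		finally show "(\<integral>\<^sup>+z. ennreal (hyp_density DIM('a) z) * ennreal (norm (F (ray \<theta> z))) \<partial>lborel) <= ennreal (B / d)"
			by simp
	qed
	also have "... < \<infinity>"
	proof -
		have "emeasure angular (UNIV :: 'a set) < \<infinity>"
			by (metis angular.emeasure_finite infinity_ennreal_def top.not_eq_extremum)
		then show ?thesis by (simp add: ennreal_mult_less_top)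
	qed
	finally show ?thesis
		by (intro integrableI_bounded) auto
qed

lemma hyp_dist_origin':
	fixes x :: "'a::euclidean_space"
	assumes "x ~= 0" "norm x < 1"
	shows "hyp_dist x 0 = radius_of_log (- ln (norm x))"
proof -
	have "- ln (norm x) > 0" using assms by simp
	moreover have "exp (- (- ln (norm x))) *\<^sub>R (x /\<^sub>R norm x) = x"
		using assms by simp
	moreover have "norm (x /\<^sub>R norm x) = 1" using assms by simp
	ultimately show ?thesis
		using hyp_dist_origin[of "x /\<^sub>R norm x" "- ln (norm x)"] by simp
qed

lemma hyp_dist_0_0: "hyp_dist 0 0 = 0"
	by (simp add: hyp_dist_def)

definition Y_log :: "nat => real => real" where
	"Y_log n z = (real n - 2) * leg_w (hm n) (leg_tr (hm n) (- (1/2)) z) / leg_w (- (1/2)) z"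

lemma hardy_weight_eq:
	assumes "!!x. norm x >= 1 ==> v x = 0"
	shows "(v x)\<^sup>2 / (sinh (hyp_dist x 0))\<^sup>2 = rwt (\<lambda>z. (sinh z)\<^sup>2) x * (v x)\<^sup>2"
proof (cases "x = 0")
	case True
	then show ?thesis by (simp add: hyp_dist_0_0 rwt_def)
next
	case False
	then show ?thesis
		using assms[of x] by (cases "norm x < 1") (simp_all add: hyp_dist_origin' rwt_def power_divide)
qed

lemma weight_eq:
	assumes "!!x. norm x >= 1 ==> v x = 0"
	shows "sinh (hyp_dist x 0) powr \<alpha> * \<bar>v x\<bar> powr p = rwt (\<lambda>z. sinh z powr (- \<alpha>)) x * \<bar>v x\<bar> powr p"
		"sinh (hyp_dist x 0) powr \<alpha> * Y_fun n (hyp_dist x 0) powr q * \<bar>v x\<bar> powr p =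
			rwt (\<lambda>z. sinh z powr (- \<alpha>) * Y_log n z powr q) x * \<bar>v x\<bar> powr p"
proof -
	have *: "sinh (hyp_dist x 0) powr \<alpha> = sinh (- ln (norm x)) powr (- \<alpha>)"
		"Y_fun n (hyp_dist x 0) = Y_log n (- ln (norm x))" if "x ~= 0" "norm x < 1"
	proof -
		have z: "- ln (norm x) > 0" using that by simp
		then have "sinh (- ln (norm x)) > 0" by (subst sinh_real_pos_iff)
		then show "sinh (hyp_dist x 0) powr \<alpha> = sinh (- ln (norm x)) powr (- \<alpha>)"
			unfolding hyp_dist_origin'[OF that] sinh_radius_of_log
			by (simp add: powr_divide powr_minus_divide del: sinh_minus)
		show "Y_fun n (hyp_dist x 0) = Y_log n (- ln (norm x))"
			unfolding hyp_dist_origin'[OF that] Y_fun_eq[OF z] Y_log_def ..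
	qed
	show "sinh (hyp_dist x 0) powr \<alpha> * \<bar>v x\<bar> powr p = rwt (\<lambda>z. sinh z powr (- \<alpha>)) x * \<bar>v x\<bar> powr p"
		using * assms[of x] by (cases "x = 0"; cases "norm x < 1") (simp_all add: hyp_dist_0_0 rwt_def del: sinh_minus)
	show "sinh (hyp_dist x 0) powr \<alpha> * Y_fun n (hyp_dist x 0) powr q * \<bar>v x\<bar> powr p =
			rwt (\<lambda>z. sinh z powr (- \<alpha>) * Y_log n z powr q) x * \<bar>v x\<bar> powr p"
		using * assms[of x] by (cases "x = 0"; cases "norm x < 1") (simp_all add: hyp_dist_0_0 rwt_def del: sinh_minus)
qed

lemma Y_log_pos: "z > 0 ==> n >= 3 ==> Y_log n z > 0"
	by (simp add: Y_log_def leg_w_pos leg_tr_pos)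

text \<open>This is the meaning of \<open>Y\<close>: at matched points it is \<open>n - 2\<close>
  times the reciprocal of the Jacobian. Powers of the Jacobian are thus compensated by powers of
  \<open>Y\<close>, and the factor \<open>n - 2\<close> is the source of the power of
  \<open>n - 2\<close> in the sharp constant.\<close>

lemma Y_log_tr_y: "z > 0 ==> Y_log n (tr_y n z) = (real n - 2) / tr_y' n z"
	by (simp add: Y_log_def tr_y'_def leg_tr_inverse)

lemma Y_log_le:
	assumes "z > 0" "n >= 3"
	shows "Y_log n z <= real n - 2"
proof -
	define y where "y = leg_tr (hm n) (- (1/2)) z"
	have y: "y > 0" "tr_y n y = z"
		using assms leg_tr_pos leg_tr_inverse by (auto simp: y_def)
	have "leg_w (hm n) y <= leg_w (- (1/2)) z"
		using leg_w_leg_tr_ge[OF y(1), of "hm n"] y(2) by simp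
	then show ?thesis
		using assms leg_w_pos[of z "- (1/2)"] by (simp add: Y_log_def y_def[symmetric] pos_divide_le_eq mult_left_mono)
qed

lemma Y_log_continuous: "continuous_on {0<..} (Y_log n)"
	unfolding Y_log_def[abs_def]
	using leg_w_pos[of _ "- (1/2)"] leg_tr_smooth[of 0] leg_tr_pos
	by (intro continuous_intros continuous_on_compose2[OF leg_w_continuous] leg_w_continuous)
		(auto simp: less_imp_neq[symmetric])

subsection \<open>Restriction of gradients to rays\<close>

lemma exp_ray_deriv: "((\<lambda>z. ray \<theta> z) has_vector_derivative - (ray \<theta> z)) (at z)"
	by (auto intro!: derivative_eq_intros simp: scaleR_minus_left)

lemma DERIV_ray:
	assumes "v differentiable at (ray \<theta> z)"
	shows "((\<lambda>z. v (ray \<theta> z)) has_real_derivative - (exp (- z) * (egrad v (ray \<theta> z) \<bullet> \<theta>))) (at z)"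
proof -
	have "((\<lambda>z. ray \<theta> z) has_derivative (\<lambda>h. h *\<^sub>R (- (ray \<theta> z)))) (at z)"
		using exp_ray_deriv by (simp add: has_vector_derivative_def)
	from has_derivative_compose[OF this has_derivative_egrad[OF assms]]
	show ?thesis
		unfolding has_field_derivative_def by (rule has_derivative_eq_rhs) (simp add: fun_eq_iff)
qed

definition tang :: "'a::euclidean_space => 'a => real" where
	"tang \<theta> g = (norm g)\<^sup>2 - (g \<bullet> \<theta>)\<^sup>2"

lemma tang_eq: "norm \<theta> = 1 ==> tang \<theta> g = (norm (g - (g \<bullet> \<theta>) *\<^sub>R \<theta>))\<^sup>2"
	unfolding tang_def power2_norm_eq_inner
	by (simp add: inner_diff_left inner_diff_right inner_commute power2_eq_square norm_eq_1)

lemma tang_nonneg: "norm \<theta> = 1 ==> tang \<theta> g >= 0"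
	by (simp add: tang_eq)

text \<open>The difference \<open>d\<close> of the tangential parts is itself orthogonal to
  \<open>\<theta>\<close>, so testing the hypothesis with \<open>h = d\<close> gives
  \<open>d = 0\<close>. Radial derivatives need not be known.\<close>

lemma tang_scale:
	assumes \<theta>: "norm \<theta> = 1" and h: "!!h. h \<bullet> \<theta> = 0 ==> g \<bullet> h = s * (g' \<bullet> h)"
	shows "tang \<theta> g = s\<^sup>2 * tang \<theta> g'"
proof -
	define u u' where "u = g - (g \<bullet> \<theta>) *\<^sub>R \<theta>" and "u' = g' - (g' \<bullet> \<theta>) *\<^sub>R \<theta>"
	define d where "d = u - s *\<^sub>R u'"
	have tt: "\<theta> \<bullet> \<theta> = 1" using \<theta> by (simp add: norm_eq_1)
	have d\<theta>: "d \<bullet> \<theta> = 0"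
		by (simp add: d_def u_def u'_def inner_diff_left tt)
	have "u \<bullet> d = g \<bullet> d" "u' \<bullet> d = g' \<bullet> d"
		using d\<theta> by (simp_all add: u_def u'_def inner_diff_left inner_commute[of \<theta> d])
	moreover have "d \<bullet> d = u \<bullet> d - s * (u' \<bullet> d)"
		by (subst (1) d_def) (simp add: inner_diff_left)
	ultimately have "d \<bullet> d = g \<bullet> d - s * (g' \<bullet> d)" by simp
	then have "d = 0" using h[OF d\<theta>] by simp
	then show ?thesis
		unfolding tang_eq[OF \<theta>] u_def[symmetric] u'_def[symmetric] by (simp add: d_def power_mult_distrib)
qed

definition ray' :: "('a::euclidean_space => real) => 'a => real => real" where
	"ray' v \<theta> z = - (exp (- z) * (egrad v (ray \<theta> z) \<bullet> \<theta>))"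

definition ray_tang :: "('a::euclidean_space => real) => 'a => real => real" where
	"ray_tang v \<theta> z = (exp (- z))\<^sup>2 * tang \<theta> (egrad v (ray \<theta> z))"

lemma conf_factor_ray:
	assumes "norm \<theta> = 1" "z > 0"
	shows "conf_factor (ray \<theta> z) = 1 / (exp (- z) * sinh z)"
proof -
	have "exp (- z) < 1" using assms by simp
	then have "(exp (- z))\<^sup>2 < 1" by (simp add: power_less_one_iff)
	then show ?thesis
		using assms by (simp add: conf_factor_def sinh_field_def exp_minus field_simps power2_eq_square)
qed

lemma hyp_grad_norm_ray:
	assumes "v differentiable at (ray \<theta> z)" "norm \<theta> = 1" "z > 0"
	shows "(hyp_grad_norm v (ray \<theta> z))\<^sup>2 = (sinh z)\<^sup>2 * ((ray' v \<theta> z)\<^sup>2 + ray_tang v \<theta> z)"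
proof -
	have "exp (- z) * sinh z > 0" using assms by simp
	then have "hyp_grad_norm v (ray \<theta> z) = norm (egrad v (ray \<theta> z)) * (exp (- z) * sinh z)"
		using assms by (simp add: hyp_grad_norm_eq conf_factor_ray)
	then show ?thesis
		by (simp add: ray'_def ray_tang_def tang_def power_mult_distrib algebra_simps)
qed

lemma hyp_grad_norm_le:
	assumes "v differentiable at (ray \<theta> z)" "norm \<theta> = 1" "z > 0" "norm (egrad v (ray \<theta> z)) <= K * exp z"
	shows "(hyp_grad_norm v (ray \<theta> z))\<^sup>2 <= K\<^sup>2 * (sinh z)\<^sup>2"
proof -
	have "exp (- z) * sinh z > 0" using assms by simp
	then have "hyp_grad_norm v (ray \<theta> z) = norm (egrad v (ray \<theta> z)) * (exp (- z) * sinh z)"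
		using assms by (simp add: hyp_grad_norm_eq conf_factor_ray)
	also have "... <= K * exp z * (exp (- z) * sinh z)"
		using assms(4) \<open>exp (- z) * sinh z > 0\<close> by (intro mult_right_mono) auto
	also have "... = K * sinh z" by (simp add: exp_minus)
	finally have "\<bar>hyp_grad_norm v (ray \<theta> z)\<bar> <= \<bar>K * sinh z\<bar>"
		using assms(1) by (simp add: hyp_grad_norm_eq)
	then have "(hyp_grad_norm v (ray \<theta> z))\<^sup>2 <= (K * sinh z)\<^sup>2"
		by (simp add: abs_le_square_iff)
	then show ?thesis by (simp add: power_mult_distrib)
qed

text \<open>The origin lies at \<open>z\<close> equal to infinity; only functions vanishing near it
  have profiles of compact support on the rays, as integration by parts requires.\<close>

definition punctured_test :: "('a::euclidean_space => real) => bool" where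
	"punctured_test v \<longleftrightarrow> v \<in> hyp_test_functions \<and> (\<exists>r>0. \<forall>x. norm x < r --> v x = 0)"

lemma punctured_test_C1c:
	assumes "punctured_test v"
	obtains a b where "!!\<theta>. norm \<theta> = 1 ==> C1c a b (\<lambda>z. v (ray \<theta> z)) (ray' v \<theta>)"
		"!!\<theta> z. norm \<theta> = 1 ==> z \<notin> {a..b} ==> ray_tang v \<theta> z = 0"
		"!!\<theta>. norm \<theta> = 1 ==> continuous_on {0<..} (ray_tang v \<theta>)" "0 < a"
proof -
	have v: "v \<in> hyp_test_functions" using assms by (simp add: punctured_test_def)
	obtain r where r: "r > 0" "!!x. norm x < r ==> v x = 0" using assms by (auto simp: punctured_test_def)
	obtain R where R: "0 < R" "R < 1" "!!x. R < norm x ==> v x = 0"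
		using test_support[OF v] by metis
	define s where "s = min r R / 2"
	have s: "0 < s" "s < R" "s < r" using r R by (auto simp: s_def)
	define a b where "a = - ln R" and "b = - ln s"
	have ab: "0 < a" "a < b" using R s by (auto simp: a_def b_def)
	have v0: "v (ray \<theta> z) = 0" "egrad v (ray \<theta> z) = 0" if "norm \<theta> = 1" "z \<notin> {a..b}" for \<theta> z
	proof -
		have n: "norm (ray \<theta> z) = exp (- z)" using that by simp
		have "z < a \<or> z > b" using that(2) by auto
		then consider "z < a" | "z > b" by blast
		then have "v (ray \<theta> z) = 0 \<and> egrad v (ray \<theta> z) = 0"
		proof cases
			case 1
			then have "R < exp (- z)" using R ln_less_cancel_iff[of R "exp (- z)"] by (simp add: a_def)
			then show ?thesis using R(3) test_egrad_eq_0[of R v] n by metis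
		next
			case 2
			then have "exp (- z) < r" using s ln_less_cancel_iff[of "exp (- z)" s] by (simp add: b_def)
			then have x: "ray \<theta> z \<in> ball 0 r" using n by simp
			have "(v has_derivative (\<lambda>h. 0)) (at (ray \<theta> z))"
				by (rule has_derivative_transform_within_open[OF has_derivative_const[of 0] open_ball x]) (use r in auto)
			then have "egrad v (ray \<theta> z) = 0" by (intro egrad_unique) simp
			then show ?thesis using r(2) x by simp
		qed
		then show "v (ray \<theta> z) = 0" "egrad v (ray \<theta> z) = 0" by auto
	qed
	have cont: "continuous_on S (\<lambda>z. egrad v (ray \<theta> z))" for S \<theta>
		by (rule continuous_on_compose2[OF test_egrad_continuous[OF v]]) (auto intro!: continuous_intros)
	show ?thesis
	proof (rule that[of a b])
		fix \<theta> :: 'a assume \<theta>: "norm \<theta> = 1"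
		show "C1c a b (\<lambda>z. v (ray \<theta> z)) (ray' v \<theta>)"
			unfolding C1c_def
			using ab v0[OF \<theta>] DERIV_ray[OF test_differentiable[OF v]]
			by (auto simp: ray'_def[abs_def] intro!: continuous_intros cont)
		show "ray_tang v \<theta> z = 0" if "z \<notin> {a..b}" for z
			using v0[OF \<theta> that] by (simp add: ray_tang_def tang_def)
		show "continuous_on {0<..} (ray_tang v \<theta>)"
			unfolding ray_tang_def[abs_def] tang_def by (intro continuous_intros cont)
	qed (use ab in simp)
qed

definition hyp_form :: "real => ('a::euclidean_space => real) => 'a => real" where
	"hyp_form m v x = (hyp_grad_norm v x)\<^sup>2 - ((real DIM('a) - 1) / 2)\<^sup>2 * (v x)\<^sup>2
		- (((real DIM('a) - 2) / 2)\<^sup>2 - (m + 1/2)\<^sup>2) * (rwt (\<lambda>z. (sinh z)\<^sup>2) x * (v x)\<^sup>2)"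

abbreviation total_form :: "real => ('a::euclidean_space => real) => real" where
	"total_form m v \<equiv> \<integral>x. hyp_form m v x \<partial>hyp_vol"

lemma hyp_form_ray:
	fixes v :: "'a::euclidean_space => real"
	assumes v: "v \<in> hyp_test_functions" and \<theta>: "norm \<theta> = 1" and n: "DIM('a) >= 2"
	shows "hyp_density DIM('a) z * hyp_form m v (ray \<theta> z) =
		(if z > 0 then rad_form DIM('a) m (\<lambda>z. v (ray \<theta> z)) (ray' v \<theta>) z + rad_w DIM('a) z * ray_tang v \<theta> z else 0)"
proof (cases "z > 0")
	case True
	have "hyp_form m v (ray \<theta> z) = (sinh z)\<^sup>2 * ((ray' v \<theta> z)\<^sup>2 + ray_tang v \<theta> z
			- ((real DIM('a) - 1) / 2)\<^sup>2 * (v (ray \<theta> z))\<^sup>2 / (sinh z)\<^sup>2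
			- (((real DIM('a) - 2) / 2)\<^sup>2 - (m + 1/2)\<^sup>2) * (v (ray \<theta> z))\<^sup>2)"
		unfolding hyp_form_def hyp_grad_norm_ray[OF test_differentiable[OF v] \<theta> True] rwt_polar[OF \<theta> True]
		using True by (simp add: right_diff_distrib distrib_left mult_ac)
	then have "hyp_density DIM('a) z * hyp_form m v (ray \<theta> z) = rad_w DIM('a) z * ((ray' v \<theta> z)\<^sup>2 + ray_tang v \<theta> z
			- ((real DIM('a) - 1) / 2)\<^sup>2 * (v (ray \<theta> z))\<^sup>2 / (sinh z)\<^sup>2
			- (((real DIM('a) - 2) / 2)\<^sup>2 - (m + 1/2)\<^sup>2) * (v (ray \<theta> z))\<^sup>2)"
		unfolding hyp_density_rad_w[OF True n, symmetric] by (simp only: mult.assoc)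
	then show ?thesis
		using True by (simp add: rad_form_def algebra_simps)
qed (simp add: hyp_density_def)

lemma hyp_form_ray_integral:
	fixes v :: "'a::euclidean_space => real"
	assumes v: "punctured_test v" and \<theta>: "norm \<theta> = 1" and n: "DIM('a) >= 2"
	shows "integrable lborel (\<lambda>z. hyp_density DIM('a) z * hyp_form m v (ray \<theta> z))"
		"integrable lborel (\<lambda>z. rad_w DIM('a) z * (ray' v \<theta> z - ground_log DIM('a) m z * v (ray \<theta> z))\<^sup>2 + rad_w DIM('a) z * ray_tang v \<theta> z)"
		"(\<integral>z. hyp_density DIM('a) z * hyp_form m v (ray \<theta> z) \<partial>lborel) =
		 (\<integral>z. rad_w DIM('a) z * (ray' v \<theta> z - ground_log DIM('a) m z * v (ray \<theta> z))\<^sup>2 + rad_w DIM('a) z * ray_tang v \<theta> z \<partial>lborel)"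
		"!!z. z <= 0 ==> rad_w DIM('a) z * (ray' v \<theta> z - ground_log DIM('a) m z * v (ray \<theta> z))\<^sup>2 + rad_w DIM('a) z * ray_tang v \<theta> z = 0"
proof -
	obtain a b where ab: "C1c a b (\<lambda>z. v (ray \<theta> z)) (ray' v \<theta>)"
		"!!z. z \<notin> {a..b} ==> ray_tang v \<theta> z = 0" "continuous_on {0<..} (ray_tang v \<theta>)" "0 < a"
		using punctured_test_C1c[OF v] \<theta> by metis
	have v': "v \<in> hyp_test_functions" using v by (simp add: punctured_test_def)
	have eq: "hyp_density DIM('a) z * hyp_form m v (ray \<theta> z) =
		rad_form DIM('a) m (\<lambda>z. v (ray \<theta> z)) (ray' v \<theta>) z + rad_w DIM('a) z * ray_tang v \<theta> z" for z
		using hyp_form_ray[OF v' \<theta> n, of z m] C1cD(5,6)[OF ab(1), of z] ab(2)[of z] ab(4)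
		by (auto simp: rad_form_def split: if_splits)
	have it: "integrable lborel (\<lambda>z. rad_w DIM('a) z * ray_tang v \<theta> z)"
		by (rule lborel_integral_compact(1)[OF _ ab(4), of _ b])
			(use ab in \<open>auto intro!: continuous_intros rad_w_continuous\<close>)
	note i = rad_form_integrable[OF ab(1), of "DIM('a)" m]
	show "integrable lborel (\<lambda>z. hyp_density DIM('a) z * hyp_form m v (ray \<theta> z))"
		unfolding eq using i it by simp
	show "integrable lborel (\<lambda>z. rad_w DIM('a) z * (ray' v \<theta> z - ground_log DIM('a) m z * v (ray \<theta> z))\<^sup>2 + rad_w DIM('a) z * ray_tang v \<theta> z)"
		using i it by simp
	show "(\<integral>z. hyp_density DIM('a) z * hyp_form m v (ray \<theta> z) \<partial>lborel) =
		 (\<integral>z. rad_w DIM('a) z * (ray' v \<theta> z - ground_log DIM('a) m z * v (ray \<theta> z))\<^sup>2 + rad_w DIM('a) z * ray_tang v \<theta> z \<partial>lborel)"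
		unfolding eq using i it ground_state_representation[OF ab(1) n, of m] by simp
	show "rad_w DIM('a) z * (ray' v \<theta> z - ground_log DIM('a) m z * v (ray \<theta> z))\<^sup>2 + rad_w DIM('a) z * ray_tang v \<theta> z = 0" if "z <= 0" for z
		using C1cD(5,6)[OF ab(1), of z] ab(2)[of z] ab(4) that by simp
qed

subsection \<open>Radial transformations of test functions\<close>

text \<open>A radial multiplier combined with a radial change of variable. Both the transplantation
  and the cutoff at the origin have this form.\<close>

definition radial_tr :: "(real => real) => (real => real) => ('a::euclidean_space => real) => 'a => real" where
	"radial_tr A B v x = A (norm x) * v (B (norm x) *\<^sub>R x)"

lemma Ck_on_Un:
	"open S ==> open T ==> Ck_on k S f ==> Ck_on k T f ==> Ck_on k (S \<union> T) f"
	by (induction k arbitrary: f) (auto intro: continuous_on_open_Un)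

lemma radial_tr_test:
	fixes v :: "'a::euclidean_space => real"
	assumes v: "v \<in> hyp_test_functions"
		and A: "!!k. Ck_on k {0<..<1} A" and B: "!!k. Ck_on k {0<..<1} B"
		and B1: "!!r. 0 < r ==> r < 1 ==> \<bar>B r\<bar> * r < 1"
		and r: "0 < r" "R < 1" and near: "!!x. norm x < r ==> radial_tr A B v x = 0"
		and far: "!!x. R < norm x ==> radial_tr A B v x = 0"
	shows "punctured_test (radial_tr A B v)"
proof -
	have "radial_tr A B v \<in> hyp_test_functions"
	proof (rule test_functionI[OF _ r(2) far])
		fix k
		let ?S = "hyp_space - {0::'a}"
		have S: "open ?S" by auto
		have nrm: "Ck_on k ?S norm" by (rule Ck_on_subset[OF Ck_on_norm]) auto
		have AN: "Ck_on k ?S (\<lambda>x. A (norm x))" "Ck_on k ?S (\<lambda>x. B (norm x))"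
			by (rule Ck_on_compose_real[OF S _ _ A nrm]; force)
				 (rule Ck_on_compose_real[OF S _ _ B nrm]; force)
		have "Ck_on k ?S (\<lambda>x. v (B (norm x) *\<^sub>R x))"
		proof (rule Ck_on_compose[where T=hyp_space and f=v and I="\<lambda>x. B (norm x) *\<^sub>R x"])
			show "Ck_on k hyp_space v" using v by (simp add: hyp_test_functions_def)
			show "Ck_on k ?S (\<lambda>x. (B (norm x) *\<^sub>R x) \<bullet> b)" for b
				using AN(2) S by (simp add: Ck_on_mult Ck_on_inner_left)
			show "(\<lambda>x. B (norm x) *\<^sub>R x) ` ?S \<subseteq> hyp_space"
			proof (rule image_subsetI)
				fix x :: 'a assume "x \<in> ?S"
				then show "B (norm x) *\<^sub>R x \<in> hyp_space" using B1[of "norm x"] by simp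
			qed
		qed (use S in auto)
		then have 1: "Ck_on k ?S (radial_tr A B v)"
			unfolding radial_tr_def[abs_def] by (intro Ck_on_mult S AN(1))
		have "Ck_on k (ball 0 r) (\<lambda>x. 0)" by (rule Ck_on_const)
		then have 2: "Ck_on k (ball 0 r) (radial_tr A B v)"
			by (subst Ck_on_cong[of _ _ "\<lambda>x. 0"]) (auto simp: near)
		show "Ck_on k hyp_space (radial_tr A B v)"
			by (rule Ck_on_subset[OF Ck_on_Un[OF S open_ball 1 2]]) (use r in auto)
	qed
	then show ?thesis using near r by (auto simp: punctured_test_def)
qed

lemma radial_tr_tangential:
	fixes \<theta> :: "'a::euclidean_space"
	assumes \<theta>: "norm \<theta> = 1" and r: "r > 0"
		and A: "(A has_real_derivative A') (at r)" and B: "(B has_real_derivative B') (at r)"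
		and v: "v differentiable at ((B r * r) *\<^sub>R \<theta>)" and h: "h \<bullet> \<theta> = 0"
	shows "egrad (radial_tr A B v) (r *\<^sub>R \<theta>) \<bullet> h = A r * B r * (egrad v ((B r * r) *\<^sub>R \<theta>) \<bullet> h)"
proof -
	let ?x = "r *\<^sub>R \<theta>" and ?g = "egrad v ((B r * r) *\<^sub>R \<theta>)"
	have nx: "norm ?x = r" using \<theta> r by simp
	have dn: "(norm has_derivative (\<lambda>h. h \<bullet> \<theta>)) (at ?x)"
	proof -
		have "sgn ?x = \<theta>" using \<theta> r by (simp add: sgn_div_norm)
		moreover have "?x ~= 0" using \<theta> r by auto
		ultimately show ?thesis using has_derivative_norm[of ?x] by simp
	qed
	have dA: "((\<lambda>x. A (norm x)) has_derivative (\<lambda>h. A' * (h \<bullet> \<theta>))) (at ?x)"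
		using has_derivative_compose[OF dn, of A "(*) A'"] A unfolding nx has_field_derivative_def by simp
	have dB: "((\<lambda>x. B (norm x)) has_derivative (\<lambda>h. B' * (h \<bullet> \<theta>))) (at ?x)"
		using has_derivative_compose[OF dn, of B "(*) B'"] B unfolding nx has_field_derivative_def by simp
	have dI: "((\<lambda>x. B (norm x) *\<^sub>R x) has_derivative (\<lambda>h. B r *\<^sub>R h + (B' * (h \<bullet> \<theta>)) *\<^sub>R ?x)) (at ?x)"
		using has_derivative_scaleR[OF dB has_derivative_ident] unfolding nx .
	have e: "B (norm ?x) *\<^sub>R ?x = (B r * r) *\<^sub>R \<theta>"
		unfolding nx by simp
	have "(v has_derivative (\<lambda>h. ?g \<bullet> h)) (at (B (norm ?x) *\<^sub>R ?x))"
		unfolding e by (rule has_derivative_egrad[OF v])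
	from has_derivative_mult[OF dA has_derivative_compose[OF dI this]]
	have d: "(radial_tr A B v has_derivative (\<lambda>h. A r * (?g \<bullet> (B r *\<^sub>R h + (B' * (h \<bullet> \<theta>)) *\<^sub>R ?x))
			+ A' * (h \<bullet> \<theta>) * v (B r *\<^sub>R ?x))) (at ?x)"
		unfolding radial_tr_def[abs_def] nx .
	then have diff: "radial_tr A B v differentiable (at ?x)"
		unfolding differentiable_def by blast
	have "egrad (radial_tr A B v) ?x \<bullet> h = A r * (?g \<bullet> (B r *\<^sub>R h + (B' * (h \<bullet> \<theta>)) *\<^sub>R ?x))
			+ A' * (h \<bullet> \<theta>) * v (B r *\<^sub>R ?x)"
		by (simp only: egrad_inner[OF diff] frechet_derivative_at[OF d, symmetric])
	then show ?thesis using h by (simp add: inner_commute)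
qed

text \<open>The second function moves radius \<open>exp (- z)\<close> to
  \<open>exp (- tr_y z)\<close>. The multiplier is set to 0 for \<open>r >= 1\<close>, where
  \<open>- ln r\<close> leaves the domain of the transport map.\<close>

definition transplant :: "('a::euclidean_space => real) => 'a => real" where
	"transplant = radial_tr (\<lambda>r. if r < 1 then tr_a DIM('a) (- ln r) else 0) (\<lambda>r. exp (- tr_y DIM('a) (- ln r)) / r)"

lemma transplant_polar:
	assumes "norm \<theta> = 1" "z > 0"
	shows "transplant v (exp (- z) *\<^sub>R (\<theta>::'a::euclidean_space)) = tr_a DIM('a) z * v (exp (- tr_y DIM('a) z) *\<^sub>R \<theta>)"
	using assms by (simp add: transplant_def radial_tr_def)

lemma ground_smooth: "Ck_on k {0<..} (ground n m)"
	unfolding ground_def[abs_def]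
proof (intro Ck_on_mult)
	show "Ck_on k {0<..} (\<lambda>z. sinh z powr ((real n - 2) / 2))"
		by (rule Ck_on_compose_real[OF _ _ _ Ck_on_powr Ck_on_subset[OF Ck_on_sinh]]) auto
	have "Ck_on k {0<..} (\<lambda>z. leg_w m z powr (1/2))"
		by (rule Ck_on_compose_real[OF _ _ _ Ck_on_powr leg_w_smooth]) (auto simp: leg_w_pos)
	then show "Ck_on k {0<..} (\<lambda>z. sqrt (leg_w m z))"
		by (rule Ck_on_cong[THEN iffD1, rotated 2]) (auto simp: powr_half_sqrt leg_w_pos less_imp_le)
qed simp

lemma tr_a_smooth: "Ck_on k {0<..} (tr_a n)"
	unfolding tr_a_def[abs_def]
proof (intro Ck_on_divide ground_smooth Ck_on_compose_real[OF _ _ _ ground_smooth leg_tr_smooth])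
	show "ground n (- (1/2)) (tr_y n z) ~= 0" if "z \<in> {0<..}" for z
		using ground_pos[OF leg_tr_pos, of z n "- (1/2)" "- (1/2)" "hm n"] that by auto
qed (auto intro: leg_tr_pos)

lemma transplant_punctured:
	fixes v :: "'a::euclidean_space => real"
	assumes v: "punctured_test v"
	shows "punctured_test (transplant v)"
proof -
	obtain a b where ab: "!!\<theta>. norm \<theta> = 1 ==> C1c a b (\<lambda>z. v (ray \<theta> z)) (ray' v \<theta>)"
		using punctured_test_C1c[OF v] by metis
	obtain e :: 'a where "norm e = 1" by (metis norm_Basis nonempty_Basis ex_in_conv)
	then have a: "0 < a" "a < b" using C1cD[OF ab] by auto
	let ?n = "DIM('a)"
	have v': "v \<in> hyp_test_functions" using v by (simp add: punctured_test_def)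
	obtain z1 z2 where z: "0 < z1" "tr_y ?n z1 = a" "0 < z2" "tr_y ?n z2 = b"
		using that[OF leg_tr_pos leg_tr_inverse leg_tr_pos leg_tr_inverse] a by simp
	have mono: "tr_y ?n x <= tr_y ?n y" if "0 < x" "x <= y" for x y
	proof (rule DERIV_nonneg_imp_nondecreasing[OF that(2)])
		fix t assume "x <= t"
		then show "\<exists>d. (tr_y ?n has_real_derivative d) (at t) \<and> 0 <= d"
			using DERIV_tr_y[of t ?n] tr_y'_pos[of t ?n] that by (intro exI conjI) auto
	qed
	have ln_smooth: "Ck_on k {0<..<1} (\<lambda>r. - ln r)" for k
		by (intro Ck_on_minus Ck_on_subset[OF Ck_on_ln]) auto
	let ?A = "\<lambda>r. if r < 1 then tr_a ?n (- ln r) else 0"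
	have "Ck_on k {0<..<1} (\<lambda>r. tr_a ?n (- ln r))" for k
		by (rule Ck_on_compose_real[OF _ _ _ tr_a_smooth ln_smooth]) auto
	then have Asm: "Ck_on k {0<..<1} ?A" for k
		by (rule Ck_on_cong[THEN iffD1, rotated 2]) auto
	have tsm: "Ck_on k {0<..<1} (\<lambda>r. tr_y ?n (- ln r))" for k
		by (rule Ck_on_compose_real[OF _ _ _ leg_tr_smooth ln_smooth]) auto
	have idsm: "Ck_on k {0<..<1} (\<lambda>r::real. r)" for k
		using Ck_on_inner_left[of "{0<..<1}" k "1::real"] by simp
	have Bsm: "Ck_on k {0<..<1} (\<lambda>r. exp (- tr_y ?n (- ln r)) / r)" for k
		by (intro Ck_on_divide idsm Ck_on_compose_real[OF _ _ _ Ck_on_exp] Ck_on_minus tsm) auto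
	have van: "transplant v x = 0" if "x ~= 0" "- ln (norm x) < z1 \<or> - ln (norm x) > z2" "norm x < 1" for x :: 'a
	proof -
		define zz where "zz = - ln (norm x)"
		have zz: "zz > 0" using that by (simp add: zz_def)
		have x: "x = exp (- zz) *\<^sub>R (x /\<^sub>R norm x)" using that by (simp add: zz_def)
		have zz': "zz < z1 \<or> z2 < zz" using that(2) by (simp add: zz_def)
		have "tr_y ?n zz \<notin> {a..b}"
		proof
			assume t: "tr_y ?n zz \<in> {a..b}"
			consider "zz < z1" | "z2 < zz" using zz' by blast
			then show False
			proof cases
				case 1
				then have "tr_y ?n zz <= a" using mono[OF zz, of z1] z by simp
				then have "tr_y ?n zz = tr_y ?n z1" using t z by simp
				then show False using inj_onD[OF leg_tr_inj] zz z 1 by (metis greaterThan_iff order_less_irrefl)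
			next
				case 2
				then have "b <= tr_y ?n zz" using mono[OF z(3), of zz] z by simp
				then have "tr_y ?n zz = tr_y ?n z2" using t z by simp
				then show False using inj_onD[OF leg_tr_inj] zz z 2 by (metis greaterThan_iff order_less_irrefl)
			qed
		qed
		then have "v (exp (- tr_y ?n zz) *\<^sub>R (x /\<^sub>R norm x)) = 0"
			using C1cD(5)[OF ab[of "x /\<^sub>R norm x"]] that by simp
		then show ?thesis
			by (subst x, subst transplant_polar) (use that zz in auto)
	qed
	have v0: "v 0 = 0" using v by (auto simp: punctured_test_def)
	have t0: "transplant v 0 = 0" by (simp add: transplant_def radial_tr_def v0)
	have far1: "transplant v x = 0" if "norm x >= 1" for x :: 'a
		using that by (simp add: transplant_def radial_tr_def)
	show ?thesis
		unfolding transplant_def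
	proof (rule radial_tr_test[OF v' Asm Bsm, of "min (exp (- z2)) (1/2)" "exp (- z1)"])
		show "\<bar>exp (- tr_y ?n (- ln r)) / r\<bar> * r < 1" if "0 < r" "r < 1" for r
			using that leg_tr_pos[of "- ln r" "- (1/2)" "hm ?n"] by simp
		show "radial_tr ?A (\<lambda>r. exp (- tr_y ?n (- ln r)) / r) v x = 0"
			if "norm x < min (exp (- z2)) (1/2)" for x :: 'a
		proof (cases "x = 0")
			case False
			then have "- ln (norm x) > z2" using that ln_less_cancel_iff[of "norm x" "exp (- z2)"] by simp
			then show ?thesis using van[of x] False that by (simp add: transplant_def)
		qed (use t0 in \<open>simp add: transplant_def\<close>)
		show "radial_tr ?A (\<lambda>r. exp (- tr_y ?n (- ln r)) / r) v x = 0"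
			if "exp (- z1) < norm x" for x :: 'a
		proof (cases "norm x < 1")
			case True
			have "x ~= 0" using that by auto
			moreover from this have "- ln (norm x) < z1" using that ln_less_cancel_iff[of "exp (- z1)" "norm x"] by simp
			ultimately show ?thesis using van[of x] True by (simp add: transplant_def)
		qed (use far1 in \<open>simp add: transplant_def\<close>)
	qed (use z in auto)
qed


subsection \<open>Integrability\<close>

lemma hyp_density_powr: "z > 0 ==> hyp_density n z = sinh z powr (- real n)"
	by (simp add: hyp_density_def powr_minus powr_realpow divide_inverse)

text \<open>The exponent \<open>e\<close> may be negative. For the Hardy weight
  \<open>(sinh z)^2\<close> one has \<open>e = -2\<close>, and the condition becomes dimension
  greater than 2.\<close>

lemma integrable_rwt:
	fixes f :: "'a::euclidean_space => real"
	assumes [measurable]: "f \<in> borel_measurable borel" and bd: "!!x. \<bar>f x\<bar> <= C" and R: "R < 1" "!!x. R < norm x ==> f x = 0"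
		and \<omega>: "continuous_on {0<..} \<omega>" "!!z. z > 0 ==> \<bar>\<omega> z\<bar> <= K * sinh z powr (- e)" and e: "real DIM('a) + e > 0"
	shows "integrable hyp_vol (\<lambda>x. rwt \<omega> x * f x)"
proof -
	define R' where "R' = max R (1/2)"
	have R': "0 < R'" "R' < 1" "!!x. R' < norm x ==> f x = 0" using R by (auto simp: R'_def)
	note [measurable] = rwt_measurable[OF \<omega>(1)]
	show ?thesis
	proof (rule integrable_hyp_vol_decay[where ?z0.0="- ln R'" and d="real DIM('a) + e" and C="K * C"])
		show "(\<lambda>x. rwt \<omega> x * f x) \<in> borel_measurable borel" by measurable
		show "- ln R' > 0" using R' by simp
		fix z and \<theta> :: 'a assume \<theta>: "norm \<theta> = 1"
		{
			assume "0 < z" "z < - ln R'"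
			then have "R' < exp (- z)" using R' ln_less_cancel_iff[of R' "exp (- z)"] by simp
			then show "rwt \<omega> (ray \<theta> z) * f (ray \<theta> z) = 0"
				using R'(3)[of "ray \<theta> z"] \<theta> by simp
		}
		assume "- ln R' <= z"
		then have z: "z > 0" using R' by (smt (verit) ln_less_zero)
		have "\<bar>\<omega> z\<bar> * \<bar>f (ray \<theta> z)\<bar> <= (K * sinh z powr (- e)) * C"
			using \<omega>(2)[OF z] bd by (intro mult_mono) (auto intro: order_trans[OF abs_ge_zero])
		then have "hyp_density DIM('a) z * \<bar>rwt \<omega> (ray \<theta> z) * f (ray \<theta> z)\<bar> <=
				sinh z powr (- real DIM('a)) * ((K * sinh z powr (- e)) * C)"
			unfolding hyp_density_powr[OF z] rwt_polar[OF \<theta> z] abs_mult by (intro mult_left_mono) auto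
		also have "... = K * C * (sinh z powr (- real DIM('a)) * sinh z powr (- e))"
			by (simp only: mult_ac)
		also have "sinh z powr (- real DIM('a)) * sinh z powr (- e) = sinh z powr (- (real DIM('a) + e))"
			by (simp add: powr_add[symmetric])
		finally show "hyp_density DIM('a) z * \<bar>rwt \<omega> (ray \<theta> z) * f (ray \<theta> z)\<bar> <=
				K * C * sinh z powr (- (real DIM('a) + e))" .
	qed (use e in simp)
qed

lemma AE_hyp_vol_nonzero: "AE x in hyp_vol. x ~= (0::'a::euclidean_space)"
proof -
	have [measurable]: "hyp_space \<in> sets (borel :: 'a measure)" by simp
	show ?thesis
		unfolding hyp_vol_def
		by (subst AE_density) (auto intro: eventually_mono[OF AE_lborel_singleton[of 0]])
qed

lemma integrable_hyp_vol_bounded: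
	fixes f :: "'a::euclidean_space => real"
	assumes [measurable]: "f \<in> borel_measurable borel" and bd: "!!x. \<bar>f x\<bar> <= C" and R: "R < 1" "!!x. R < norm x ==> f x = 0"
	shows "integrable hyp_vol f"
proof -
	have "integrable hyp_vol (\<lambda>x. rwt (\<lambda>z. 1) x * f x)"
		by (rule integrable_rwt[OF assms, where K=1 and e=0]) auto
	moreover have "AE x in hyp_vol. rwt (\<lambda>z. 1) x * f x = f x"
		using AE_hyp_vol_nonzero AE_hyp_vol by eventually_elim (auto simp: rwt_def)
	moreover have [measurable]: "(\<lambda>x::'a. rwt (\<lambda>z. 1) x) \<in> borel_measurable borel"
		by (rule rwt_measurable) simp
	ultimately show ?thesis
		by (subst integrable_cong_AE[where g="\<lambda>x. rwt (\<lambda>z. 1) x * f x"]) auto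
qed

lemma integrable_hyp_grad_norm:
	assumes v: "v \<in> hyp_test_functions"
	shows "integrable hyp_vol (\<lambda>x. (hyp_grad_norm v x)\<^sup>2)"
proof -
	obtain R where R: "0 < R" "R < 1" "!!x. R < norm x ==> v x = 0"
		using test_support[OF v] by metis
	obtain C where C: "C > 0" "!!x. norm (egrad v x) <= C" using test_bounded[OF v] by metis
	note [measurable] = test_measurable[OF v]
	have g0: "hyp_grad_norm v x = 0" if "R < norm x" for x
		using hyp_grad_norm_eq[OF test_differentiable[OF v], of x] test_egrad_eq_0[of R v x] R(3) that by simp
	show ?thesis
	proof (rule integrable_hyp_vol_bounded[OF _ _ R(2)])
		fix x :: 'a
		show "\<bar>(hyp_grad_norm v x)\<^sup>2\<bar> <= C\<^sup>2"
		proof (cases "R < norm x")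
			case False
			then have nx: "(norm x)\<^sup>2 < 1" using R by (simp add: abs_square_less_1)
			have "\<bar>conf_factor x\<bar> >= 1"
				unfolding conf_factor_def using nx
				by (simp add: pos_le_divide_eq) (rule order_trans[OF _ zero_le_power2], simp)
			then have "norm (egrad v x) / \<bar>conf_factor x\<bar> <= C"
				using C(2)[of x] C(1) by (smt (verit) divide_le_eq mult_le_cancel_left1 norm_ge_zero)
			then show ?thesis
				using hyp_grad_norm_eq[OF test_differentiable[OF v], of x] by (simp add: power_mono)
		qed (use g0 in simp)
	qed (use g0 in simp_all)
qed

lemma hardy_weight_bound: "(z::real) > 0 ==> \<bar>(sinh z)\<^sup>2\<bar> <= 1 * sinh z powr (- (- 2))"
	by (simp add: powr_numeral)

lemma integrable_hyp_form:
	fixes v :: "'a::euclidean_space => real"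
	assumes v: "v \<in> hyp_test_functions" and n: "DIM('a) >= 3"
	shows "integrable hyp_vol (\<lambda>x. (v x)\<^sup>2)" "integrable hyp_vol (\<lambda>x. rwt (\<lambda>z. (sinh z)\<^sup>2) x * (v x)\<^sup>2)"
		"integrable hyp_vol (hyp_form m v)"
		"(total_form m v) = (\<integral>x. (hyp_grad_norm v x)\<^sup>2 \<partial>hyp_vol)
			- ((real DIM('a) - 1) / 2)\<^sup>2 * (\<integral>x. (v x)\<^sup>2 \<partial>hyp_vol)
			- (((real DIM('a) - 2) / 2)\<^sup>2 - (m + 1/2)\<^sup>2) * (\<integral>x. rwt (\<lambda>z. (sinh z)\<^sup>2) x * (v x)\<^sup>2 \<partial>hyp_vol)"
proof -
	obtain R where R: "0 < R" "R < 1" "!!x. R < norm x ==> v x = 0"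
		using test_support[OF v] by metis
	obtain C where C: "C > 0" "!!x. \<bar>v x\<bar> <= C" using test_bounded[OF v] by metis
	note [measurable] = test_measurable[OF v]
	have b: "\<bar>(v x)\<^sup>2\<bar> <= C\<^sup>2" for x using C by (simp add: abs_le_square_iff[symmetric])
	show 1: "integrable hyp_vol (\<lambda>x. (v x)\<^sup>2)"
		by (rule integrable_hyp_vol_bounded[OF _ b R(2)]) (use R in auto)
	show 2: "integrable hyp_vol (\<lambda>x. rwt (\<lambda>z. (sinh z)\<^sup>2) x * (v x)\<^sup>2)"
		by (rule integrable_rwt[OF _ b R(2) _ _ hardy_weight_bound]) (use R n in \<open>auto intro!: continuous_intros\<close>)
	note 3 = integrable_hyp_grad_norm[OF v]
	show "integrable hyp_vol (hyp_form m v)"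
		unfolding hyp_form_def[abs_def] using 1 2 3 by simp
	show "(total_form m v) = (\<integral>x. (hyp_grad_norm v x)\<^sup>2 \<partial>hyp_vol)
			- ((real DIM('a) - 1) / 2)\<^sup>2 * (\<integral>x. (v x)\<^sup>2 \<partial>hyp_vol)
			- (((real DIM('a) - 2) / 2)\<^sup>2 - (m + 1/2)\<^sup>2) * (\<integral>x. rwt (\<lambda>z. (sinh z)\<^sup>2) x * (v x)\<^sup>2 \<partial>hyp_vol)"
		unfolding hyp_form_def using 1 2 3 by simp
qed

lemma integrable_weight:
	fixes v :: "'a::euclidean_space => real"
	assumes v: "v \<in> hyp_test_functions" and p: "p > 0"
		and \<omega>: "continuous_on {0<..} \<omega>" "!!z. z > 0 ==> \<bar>\<omega> z\<bar> <= K * sinh z powr (- e)" "real DIM('a) + e > 0"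
	shows "integrable hyp_vol (\<lambda>x. rwt \<omega> x * \<bar>v x\<bar> powr p)"
proof -
	obtain R where R: "0 < R" "R < 1" "!!x. R < norm x ==> v x = 0"
		using test_support[OF v] by metis
	obtain C where C: "C > 0" "!!x. \<bar>v x\<bar> <= C" using test_bounded[OF v] by metis
	note [measurable] = test_measurable[OF v]
	show ?thesis
		by (rule integrable_rwt[OF _ _ R(2) _ \<omega>, where C="C powr p"]) (use R C p in \<open>auto intro!: powr_mono2\<close>)
qed

subsection \<open>Comparison of the energies\<close>

lemma transplant_form_le:
	fixes v :: "'a::euclidean_space => real"
	assumes v: "punctured_test v" and n: "DIM('a) >= 3"
	shows "(total_form (hm DIM('a)) (transplant v)) <= (total_form (- (1/2)) v)"
proof -
	let ?n = "DIM('a)"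
	let ?U = "transplant v"
	have U: "punctured_test ?U" by (rule transplant_punctured[OF v])
	have v': "v \<in> hyp_test_functions" and U': "?U \<in> hyp_test_functions"
		using v U by (auto simp: punctured_test_def)
	have n2: "?n >= 2" using n by simp
	have "(\<integral>z. hyp_density ?n z * hyp_form (hm ?n) ?U (ray \<theta> z) \<partial>lborel) <=
			(\<integral>z. hyp_density ?n z * hyp_form (- (1/2)) v (ray \<theta> z) \<partial>lborel)" if \<theta>: "norm \<theta> = 1" for \<theta>
	proof -
		define f where "f z = rad_w ?n z * (ray' v \<theta> z - ground_log ?n (- (1/2)) z * v (ray \<theta> z))\<^sup>2 + rad_w ?n z * ray_tang v \<theta> z" for z
		define g where "g z = rad_w ?n z * (ray' ?U \<theta> z - ground_log ?n (hm ?n) z * ?U (ray \<theta> z))\<^sup>2 + rad_w ?n z * ray_tang ?U \<theta> z" for z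
		note F = hyp_form_ray_integral[OF v \<theta> n2, where m="- (1/2)", folded f_def]
		note G = hyp_form_ray_integral[OF U \<theta> n2, where m="hm ?n", folded g_def]
		\<comment> \<open>The comparison is pointwise in \<open>z\<close>: the radial square is carried
		  over with equality by \<open>transplant_square\<close>, while the tangential part is estimated
		  by \<open>transplant_angular_le\<close>.\<close>
		have le: "g z <= indicator {0<..} z * (leg_w (- (1/2)) (tr_y ?n z) / leg_w (hm ?n) z * f (tr_y ?n z))" for z
		proof (cases "z > 0")
			case True
			define y where "y = tr_y ?n z"
			have y: "y > 0" using leg_tr_pos[OF True] by (simp add: y_def)
			have "((\<lambda>z. tr_a ?n z * v (exp (- tr_y ?n z) *\<^sub>R \<theta>)) has_real_derivative ray' ?U \<theta> z) (at z)"
			proof (rule has_field_derivative_transform_within_open[where S="{0<..}"])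
				show "((\<lambda>z. ?U (ray \<theta> z)) has_real_derivative ray' ?U \<theta> z) (at z)"
					unfolding ray'_def by (rule DERIV_ray[OF test_differentiable[OF U']])
			qed (use True transplant_polar[OF \<theta>, of _ v] in auto)
			moreover have "((\<lambda>z. v (ray \<theta> z)) has_real_derivative ray' v \<theta> y) (at y)"
				unfolding ray'_def by (rule DERIV_ray[OF test_differentiable[OF v']])
			ultimately have sq: "rad_w ?n z * (ray' ?U \<theta> z - ground_log ?n (hm ?n) z * (tr_a ?n z * v (ray \<theta> y)))\<^sup>2 =
				 tr_y' ?n z * (rad_w ?n y * (ray' v \<theta> y - ground_log ?n (- (1/2)) y * v (ray \<theta> y))\<^sup>2)"
				unfolding y_def by (intro transplant_square[OF True n2, of "\<lambda>z. v (ray \<theta> z)"])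
			have ang: "ray_tang ?U \<theta> z = (tr_a ?n z)\<^sup>2 * ray_tang v \<theta> y"
			proof -
				let ?A = "\<lambda>r. if r < 1 then tr_a ?n (- ln r) else 0" and ?B = "\<lambda>r. exp (- tr_y ?n (- ln r)) / r"
				let ?r = "exp (- z)"
				have r: "?r > 0" "?r < 1" using True by auto
				have ml: "((\<lambda>r. - ln r) has_real_derivative - (1 / ?r)) (at ?r)"
					using r by (auto intro!: derivative_eq_intros simp: divide_inverse)
				have z': "- ln ?r > 0" using True by simp
				obtain A' where "(?A has_real_derivative A') (at ?r)"
				proof
					show "(?A has_real_derivative
						(tr_a ?n (- ln ?r) * (ground_log ?n (hm ?n) (- ln ?r) - tr_y' ?n (- ln ?r) * ground_log ?n (- (1/2)) (tr_y ?n (- ln ?r)))) * - (1 / ?r)) (at ?r)"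
						by (rule has_field_derivative_transform_within_open[OF DERIV_chain2[OF DERIV_tr_a[OF z'] ml], of "{..<1}"])
							(use r in auto)
				qed
				moreover obtain B' where "(?B has_real_derivative B') (at ?r)"
				proof
					have "((\<lambda>r. - tr_y ?n (- ln r)) has_real_derivative - (tr_y' ?n (- ln ?r) * - (1 / ?r))) (at ?r)"
						by (rule DERIV_minus[OF DERIV_chain2[OF DERIV_tr_y[OF z'] ml]])
					from DERIV_divide[OF DERIV_chain2[OF DERIV_exp this] DERIV_ident]
					show "(?B has_real_derivative (exp (- tr_y ?n (- ln ?r)) * - (tr_y' ?n (- ln ?r) * - (1 / ?r)) * ?r
							- exp (- tr_y ?n (- ln ?r)) * 1) / (?r * ?r)) (at ?r)"
						using r by simp
				qed
				ultimately have "egrad ?U (?r *\<^sub>R \<theta>) \<bullet> h = tr_a ?n z * (exp (- y) / ?r) * (egrad v (ray \<theta> y) \<bullet> h)"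
					if "h \<bullet> \<theta> = 0" for h
					using radial_tr_tangential[OF \<theta> r(1), of ?A A' ?B B' v h] test_differentiable[OF v'] that r
					by (simp add: transplant_def y_def)
				from tang_scale[OF \<theta> this]
				have "tang \<theta> (egrad ?U (?r *\<^sub>R \<theta>)) = (tr_a ?n z * (exp (- y) / ?r))\<^sup>2 * tang \<theta> (egrad v (ray \<theta> y))" .
				then show ?thesis
					by (simp add: ray_tang_def power_mult_distrib power_divide)
			qed
			have "rad_w ?n z * ray_tang ?U \<theta> z = (rad_w ?n z * (tr_a ?n z)\<^sup>2) * ray_tang v \<theta> y"
				by (simp add: ang)
			also have "... <= (tr_y' ?n z * rad_w ?n y) * ray_tang v \<theta> y"
				unfolding y_def by (intro mult_right_mono transplant_angular_le[OF True n2])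
					(simp add: ray_tang_def tang_nonneg[OF \<theta>])
			finally have "g z <= tr_y' ?n z * f y"
				unfolding g_def f_def transplant_polar[OF \<theta> True] y_def[symmetric] sq by (simp add: algebra_simps)
			then show ?thesis using True by (simp add: tr_y'_def y_def)
		qed (use G(4) in auto)
		have "(\<integral>z. g z \<partial>lborel) <=
				(\<integral>z. indicator {0<..} z * (leg_w (- (1/2)) (tr_y ?n z) / leg_w (hm ?n) z * f (tr_y ?n z)) \<partial>lborel)"
			by (rule integral_mono[OF G(2) lborel_integral_leg_tr(1)[OF F(2,4)] le])
		also have "... = (\<integral>z. f z \<partial>lborel)"
			by (rule lborel_integral_leg_tr(2)[OF F(2,4)])
		finally show ?thesis using F(3) G(3) by simp
	qed
	note le = this
	show ?thesis
		unfolding integral_hyp_vol(1)[OF integrable_hyp_form(3)[OF v' n]] integral_hyp_vol(1)[OF integrable_hyp_form(3)[OF U' n]]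
		by (rule integral_mono_AE[OF integral_hyp_vol(2)[OF integrable_hyp_form(3)[OF U' n]]
					integral_hyp_vol(2)[OF integrable_hyp_form(3)[OF v' n]]],
				rule eventually_mono[OF AE_angular_norm], rule le)
qed

text \<open>After the ground state representation every term of the integrand is nonnegative,
  whatever \<open>m\<close> is. The index \<open>(n - 3) / 2\<close> gives the spectral gap
  inequality, the index \<open>-1/2\<close> its Hardy improvement.\<close>

lemma poincare_punctured:
	fixes v :: "'a::euclidean_space => real"
	assumes v: "punctured_test v" and n: "DIM('a) >= 3"
	shows "(total_form m v) >= 0"
proof -
	have v': "v \<in> hyp_test_functions" and n2: "DIM('a) >= 2" using v n by (auto simp: punctured_test_def)
	have "(\<integral>z. hyp_density DIM('a) z * hyp_form m v (ray \<theta> z) \<partial>lborel) >= 0" if \<theta>: "norm \<theta> = 1" for \<theta>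
		unfolding hyp_form_ray_integral(3)[OF v \<theta> n2]
	proof (rule integral_nonneg_AE, rule AE_I2)
		fix z :: real
		show "0 <= rad_w DIM('a) z * (ray' v \<theta> z - ground_log DIM('a) m z * v (ray \<theta> z))\<^sup>2 + rad_w DIM('a) z * ray_tang v \<theta> z"
			using hyp_form_ray_integral(4)[OF v \<theta> n2, where z=z and m=m] rad_w_pos[of z "DIM('a)"]
			by (cases "z > 0") (auto simp: ray_tang_def tang_nonneg[OF \<theta>] intro!: add_nonneg_nonneg mult_nonneg_nonneg)
	qed
	note nonneg = this
	show ?thesis
		unfolding integral_hyp_vol(1)[OF integrable_hyp_form(3)[OF v' n]]
		by (rule integral_nonneg_AE, rule eventually_mono[OF AE_angular_norm], rule nonneg)
qed

text \<open>This explains the power of \<open>sinh\<close> in the inequality: together with the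
  volume density it is a pure power of the energy weight, so the transplantation acts on the norm
  and on the energy through the same quantity.\<close>

lemma rad_w_powr:
	assumes "z > 0" "n >= 2"
	shows "hyp_density n z * sinh z powr (- (p * (real n - 2) / 2 - real n)) = rad_w n z powr (p / 2)"
proof -
	have "rad_w n z = sinh z powr (- real (n - 2))"
		using assms powr_realpow[of "sinh z" "n - 2"]
		by (simp add: rad_w_def powr_minus_divide del: of_nat_diff)
	then have "rad_w n z powr (p / 2) = sinh z powr (- (p * (real n - 2) / 2))"
		using assms by (simp add: powr_powr of_nat_diff mult.commute right_diff_distrib diff_divide_distrib)
	then show ?thesis
		using assms by (simp add: hyp_density_powr powr_add[symmetric])
qed

lemma transplant_weight:
	fixes v :: "'a::euclidean_space => real"
	assumes v: "punctured_test v" and n: "DIM('a) >= 3" and p: "p > 2"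
		and \<alpha>: "\<alpha> = p * (real DIM('a) - 2) / 2 - real DIM('a)" and q: "q = (p + 2) / 2"
		and I: "integrable hyp_vol (\<lambda>x. rwt (\<lambda>z. sinh z powr (- \<alpha>) * Y_log DIM('a) z powr q) x * \<bar>v x\<bar> powr p)"
			"integrable hyp_vol (\<lambda>x. rwt (\<lambda>z. sinh z powr (- \<alpha>)) x * \<bar>transplant v x\<bar> powr p)"
	shows "(\<integral>x. rwt (\<lambda>z. sinh z powr (- \<alpha>) * Y_log DIM('a) z powr q) x * \<bar>v x\<bar> powr p \<partial>hyp_vol) =
		(real DIM('a) - 2) powr q * (\<integral>x. rwt (\<lambda>z. sinh z powr (- \<alpha>)) x * \<bar>transplant v x\<bar> powr p \<partial>hyp_vol)"
proof -
	let ?n = "DIM('a)"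
	let ?U = "transplant v"
	have n2: "?n >= 2" using n by simp
	have "(\<integral>z. hyp_density ?n z * (rwt (\<lambda>z. sinh z powr (- \<alpha>) * Y_log ?n z powr q) (ray \<theta> z) * \<bar>v (ray \<theta> z)\<bar> powr p) \<partial>lborel)
		= (\<integral>z. (real ?n - 2) powr q * (hyp_density ?n z * (rwt (\<lambda>z. sinh z powr (- \<alpha>)) (ray \<theta> z) * \<bar>?U (ray \<theta> z)\<bar> powr p)) \<partial>lborel)"
		if \<theta>: "norm \<theta> = 1" for \<theta>
	proof -
		define f where "f z = hyp_density ?n z * (rwt (\<lambda>z. sinh z powr (- \<alpha>) * Y_log ?n z powr q) (ray \<theta> z) * \<bar>v (ray \<theta> z)\<bar> powr p)" for z
		obtain a b where ab: "C1c a b (\<lambda>z. v (ray \<theta> z)) (ray' v \<theta>)"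
			using punctured_test_C1c[OF v] \<theta> by metis
		note V = C1cD[OF ab]
		have f0: "f z = 0" if "z <= 0" for z using that by (simp add: f_def hyp_density_def)
		have fpos: "f z = rad_w ?n z powr (p / 2) * Y_log ?n z powr q * \<bar>v (ray \<theta> z)\<bar> powr p" if "z > 0" for z
			unfolding f_def rwt_polar[OF \<theta> that] rad_w_powr[OF that n2, symmetric] \<alpha> by simp
		have "integrable lborel f"
		proof (rule lborel_integral_compact(1)[of _ a b])
			have "continuous_on {0<..} (\<lambda>z. rad_w ?n z powr (p / 2) * Y_log ?n z powr q * \<bar>v (ray \<theta> z)\<bar> powr p)"
				using p V(7) rad_w_pos[of _ ?n] Y_log_pos[OF _ n]
				by (intro continuous_on_mult continuous_on_powr' rad_w_continuous Y_log_continuous continuous_on_rabs continuous_on_const)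
					(auto intro: less_imp_le simp: q)
			then show "continuous_on {0<..} f"
				by (rule continuous_on_eq) (simp add: fpos)
			show "f z = 0" if "z \<notin> {a..b}" for z
				using V(5)[OF that] by (simp add: f_def)
		qed (use V in auto)
		from lborel_integral_leg_tr(2)[OF this f0, of "- (1/2)" "hm ?n"]
		have "(\<integral>z. f z \<partial>lborel) = (\<integral>z. indicator {0<..} z * (tr_y' ?n z * f (tr_y ?n z)) \<partial>lborel)"
			by (simp add: tr_y'_def)
		also have "... = (\<integral>z. (real ?n - 2) powr q * (hyp_density ?n z * (rwt (\<lambda>z. sinh z powr (- \<alpha>)) (ray \<theta> z) * \<bar>?U (ray \<theta> z)\<bar> powr p)) \<partial>lborel)"
		proof (rule Bochner_Integration.integral_cong[OF refl])
			fix z :: real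
			show "indicator {0<..} z * (tr_y' ?n z * f (tr_y ?n z)) =
				(real ?n - 2) powr q * (hyp_density ?n z * (rwt (\<lambda>z. sinh z powr (- \<alpha>)) (ray \<theta> z) * \<bar>?U (ray \<theta> z)\<bar> powr p))"
			proof (cases "z > 0")
				case True
				define y where "y = tr_y ?n z"
				have y: "y > 0" using leg_tr_pos[OF True] by (simp add: y_def)
				define t where "t = tr_y' ?n z"
				have t: "t > 0" using tr_y'_pos[OF True] by (simp add: t_def)
				define X where "X = \<bar>v (ray \<theta> y)\<bar> powr p"
				have a: "tr_a ?n z > 0" by (rule tr_a_pos[OF True])
				have "hyp_density ?n z * (rwt (\<lambda>z. sinh z powr (- \<alpha>)) (ray \<theta> z) * \<bar>?U (ray \<theta> z)\<bar> powr p)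
					= rad_w ?n z powr (p / 2) * (tr_a ?n z powr p * X)"
					unfolding rwt_polar[OF \<theta> True] transplant_polar[OF \<theta> True] rad_w_powr[OF True n2, symmetric] \<alpha>
					using a by (simp add: abs_mult powr_mult X_def y_def)
				also have "... = (rad_w ?n z * (tr_a ?n z)\<^sup>2) powr (p / 2) * X"
				proof -
					have "((tr_a ?n z)\<^sup>2) powr (p / 2) = tr_a ?n z powr p"
						using a by (simp add: powr_powr flip: powr_numeral)
					then show ?thesis using rad_w_pos[OF True, of ?n] by (simp add: powr_mult)
				qed
				also have "... = rad_w ?n y powr (p / 2) / t powr (p / 2) * X"
					unfolding tr_a_square[OF True n2] y_def[symmetric] t_def[symmetric]
					using t rad_w_pos[OF y, of ?n] by (simp add: powr_divide)
				finally have R: "hyp_density ?n z * (rwt (\<lambda>z. sinh z powr (- \<alpha>)) (ray \<theta> z) * \<bar>?U (ray \<theta> z)\<bar> powr p)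
					= rad_w ?n y powr (p / 2) / t powr (p / 2) * X" .
				\<comment> \<open>One factor \<open>t\<close> is the Jacobian of the change of variable, the
				  other \<open>p / 2\<close> powers come from \<open>tr_a_square\<close>; together they form the
				  exponent \<open>(p + 2) / 2\<close> of \<open>Y\<close>.\<close>
				have "t powr q = t * t powr (p / 2)"
				proof -
					have "q = 1 + p / 2" by (simp add: q add_divide_distrib)
					then show ?thesis using t by (simp add: powr_add)
				qed
				then have "t * ((real ?n - 2) / t) powr q = (real ?n - 2) powr q / t powr (p / 2)"
					using t n by (simp add: powr_divide)
				moreover have "t * (Rw * ((real ?n - 2) / t) powr q * X) = t * ((real ?n - 2) / t) powr q * (Rw * X)" for Rw
					by (simp only: mult_ac)
				ultimately have "t * f y = (real ?n - 2) powr q * (rad_w ?n y powr (p / 2) / t powr (p / 2) * X)"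
					unfolding fpos[OF y] X_def[symmetric]
					using Y_log_tr_y[OF True, of ?n] by (simp add: y_def[symmetric] t_def[symmetric])
				then show ?thesis
					using True R by (simp add: t_def y_def)
			qed (simp add: hyp_density_def)
		qed
		finally show ?thesis unfolding f_def .
	qed
	note eq = this
	let ?P = "\<lambda>\<theta>. \<integral>z. hyp_density ?n z * (rwt (\<lambda>z. sinh z powr (- \<alpha>) * Y_log ?n z powr q) (ray \<theta> z) * \<bar>v (ray \<theta> z)\<bar> powr p) \<partial>lborel"
	let ?Q = "\<lambda>\<theta>. \<integral>z. hyp_density ?n z * (rwt (\<lambda>z. sinh z powr (- \<alpha>)) (ray \<theta> z) * \<bar>?U (ray \<theta> z)\<bar> powr p) \<partial>lborel"
	have "(\<integral>\<theta>. ?P \<theta> \<partial>angular) = (\<integral>\<theta>. (real ?n - 2) powr q * ?Q \<theta> \<partial>angular)"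
	proof (rule integral_cong_AE)
		show "?P \<in> borel_measurable angular"
			by (rule borel_measurable_integrable[OF integral_hyp_vol(2)[OF I(1)]])
		show "(\<lambda>\<theta>. (real ?n - 2) powr q * ?Q \<theta>) \<in> borel_measurable angular"
			by (intro borel_measurable_times borel_measurable_const borel_measurable_integrable[OF integral_hyp_vol(2)[OF I(2)]])
		show "AE \<theta> in angular. ?P \<theta> = (real ?n - 2) powr q * ?Q \<theta>"
			by (rule eventually_mono[OF AE_angular_norm]) (simp only: eq integral_mult_right_zero)
	qed
	then show ?thesis
		unfolding integral_hyp_vol(1)[OF I(1)] integral_hyp_vol(1)[OF I(2)] by simp
qed

subsection \<open>Removing a point\<close>

text \<open>The transition happens for \<open>z\<close> between \<open>j\<close> and
  \<open>j + 1\<close>. Its width in the variable \<open>z\<close> is fixed, so the slope in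
  \<open>z\<close> is bounded uniformly in \<open>j\<close>.\<close>

definition cutoff :: "nat => ('a::euclidean_space => real) => 'a => real" where
	"cutoff j = radial_tr (\<lambda>r. if r <= 0 then 0 else smooth_step (real j + 1 + ln r)) (\<lambda>_. 1)"

lemma cutoff_apply: "x ~= 0 ==> cutoff j v x = smooth_step (real j + 1 + ln (norm x)) * v x"
	and cutoff_0: "cutoff j v 0 = 0"
	by (simp_all add: cutoff_def radial_tr_def)

lemma cutoff_le: "\<bar>cutoff j v x\<bar> <= \<bar>v x\<bar>"
	using smooth_step_nonneg smooth_step_le_1
	by (cases "x = 0") (auto simp: cutoff_0 cutoff_apply abs_mult intro!: mult_left_le_one_le)

lemma cutoff_eq:
	assumes "x ~= 0" "- ln (norm x) < real j" "v differentiable at x"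
	shows "cutoff j v x = v x" "egrad (cutoff j v) x = egrad v x"
proof -
	define S where "S = {y::'a. y ~= 0 \<and> norm y > exp (- real j)}"
	have "S = - cball 0 (exp (- real j))"
		by (auto simp: S_def not_le)
	then have S: "open S" by (simp add: open_Compl)
	have "exp (- real j) < norm x"
		using assms ln_less_cancel_iff[of "exp (- real j)" "norm x"] by simp
	then have x: "x \<in> S" using assms by (simp add: S_def)
	have eq: "cutoff j v y = v y" if "y \<in> S" for y
	proof -
		have y: "y ~= 0" "exp (- real j) < norm y" using that by (auto simp: S_def)
		then have "- real j < ln (norm y)"
			using ln_less_cancel_iff[of "exp (- real j)" "norm y"] by simp
		then show ?thesis using y by (simp add: cutoff_apply smooth_step_eq_1)
	qed
	show "cutoff j v x = v x" by (rule eq[OF x])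
	have "(cutoff j v has_derivative (\<lambda>h. egrad v x \<bullet> h)) (at x)"
		by (rule has_derivative_transform_within_open[OF has_derivative_egrad[OF assms(3)] S x]) (simp add: eq)
	then show "egrad (cutoff j v) x = egrad v x" by (rule egrad_unique)
qed

lemma cutoff_punctured:
	assumes v: "v \<in> hyp_test_functions"
	shows "punctured_test (cutoff j v)"
proof -
	obtain R where R: "0 < R" "R < 1" "!!x. R < norm x ==> v x = 0"
		using test_support[OF v] by metis
	show ?thesis
		unfolding cutoff_def
	proof (rule radial_tr_test[OF v _ Ck_on_const _ _ R(2)])
		fix k
		have "Ck_on k {0<..<1} (\<lambda>r. smooth_step (real j + 1 + ln r))"
			by (intro Ck_on_compose_real[OF _ _ _ Ck_on_smooth_step] Ck_on_add Ck_on_subset[OF Ck_on_ln]) auto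
		then show "Ck_on k {0<..<1} (\<lambda>r. if r <= 0 then 0 else smooth_step (real j + 1 + ln r))"
			by (rule Ck_on_cong[THEN iffD1, rotated 2]) auto
		show "radial_tr (\<lambda>r. if r <= 0 then 0 else smooth_step (real j + 1 + ln r)) (\<lambda>_. 1) v x = 0"
			if "norm x < exp (- (real j + 1))" for x
		proof (cases "x = 0")
			case False
			then have "ln (norm x) < - (real j + 1)"
				using that ln_less_cancel_iff[of "norm x" "exp (- (real j + 1))"] by simp
			then show ?thesis by (simp add: radial_tr_def smooth_step_eq_0)
		qed (simp add: radial_tr_def)
	qed (use R in \<open>auto simp: radial_tr_def\<close>)
qed

lemma cutoff_grad_bound:
	fixes v :: "'a::euclidean_space => real"
	assumes v: "v \<in> hyp_test_functions"
	obtains K where "!!j \<theta> z. norm \<theta> = 1 ==> z > 0 ==> norm (egrad (cutoff j v) (ray \<theta> z)) <= K * exp z"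
proof -
	obtain C where C: "C > 0" "!!x. \<bar>v x\<bar> <= C" "!!x. norm (egrad v x) <= C"
		using test_bounded[OF v] by metis
	obtain s' D where s': "!!x. (smooth_step has_real_derivative s' x) (at x)" "!!x. \<bar>s' x\<bar> <= D"
		using smooth_step_derivative_bounded by metis
	have D: "D >= 0" using s'(2)[of 0] by simp
	show ?thesis
	proof (rule that[of "C + D * C"])
		fix j and \<theta> :: 'a and z :: real assume \<theta>: "norm \<theta> = 1" and z: "z > 0"
		let ?x = "ray \<theta> z"
		have x: "?x ~= 0" "norm ?x = exp (- z)" using \<theta> by auto
		let ?a = "real j + 1 + ln (norm ?x)"
		have dn: "(norm has_derivative (\<lambda>h. h \<bullet> sgn ?x)) (at ?x)" by (rule has_derivative_norm[OF x(1)])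
		have "((\<lambda>r. smooth_step (real j + 1 + ln r)) has_real_derivative s' ?a * (1 / norm ?x)) (at (norm ?x))"
			by (rule DERIV_chain2[OF s'(1)]) (use x in \<open>auto intro!: derivative_eq_intros simp: divide_inverse\<close>)
		then have "((\<lambda>x. smooth_step (real j + 1 + ln (norm x))) has_derivative (\<lambda>h. s' ?a * (1 / norm ?x) * (h \<bullet> sgn ?x))) (at ?x)"
			unfolding has_field_derivative_def by (rule has_derivative_compose[OF dn])
		from has_derivative_mult[OF this has_derivative_egrad[OF test_differentiable[OF v]]]
		have "((\<lambda>x. smooth_step (real j + 1 + ln (norm x)) * v x) has_derivative
			 (\<lambda>h. smooth_step ?a * (egrad v ?x \<bullet> h) + s' ?a * (1 / norm ?x) * (h \<bullet> sgn ?x) * v ?x)) (at ?x)" .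
		then have "(cutoff j v has_derivative
			 (\<lambda>h. smooth_step ?a * (egrad v ?x \<bullet> h) + s' ?a * (1 / norm ?x) * (h \<bullet> sgn ?x) * v ?x)) (at ?x)"
			by (rule has_derivative_transform_within_open[where s="- {0}"]) (use x in \<open>auto simp: cutoff_apply\<close>)
		also have "(\<lambda>h. smooth_step ?a * (egrad v ?x \<bullet> h) + s' ?a * (1 / norm ?x) * (h \<bullet> sgn ?x) * v ?x) =
			 (\<lambda>h. (smooth_step ?a *\<^sub>R egrad v ?x + (s' ?a * (1 / norm ?x) * v ?x) *\<^sub>R sgn ?x) \<bullet> h)"
		proof -
			have "(\<lambda>h. s * (g \<bullet> h) + a * (h \<bullet> t) * w) = (\<lambda>h. (s *\<^sub>R g + (a * w) *\<^sub>R t) \<bullet> h)" for s a w :: real and g t :: 'a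
				by (simp add: fun_eq_iff inner_add_left inner_commute[of t])
			then show ?thesis .
		qed
		finally have "egrad (cutoff j v) ?x = smooth_step ?a *\<^sub>R egrad v ?x + (s' ?a * (1 / norm ?x) * v ?x) *\<^sub>R sgn ?x"
			by (rule egrad_unique)
		also have "norm ... <= \<bar>smooth_step ?a\<bar> * norm (egrad v ?x) + \<bar>s' ?a * (1 / norm ?x) * v ?x\<bar> * norm (sgn ?x)"
			by (rule order_trans[OF norm_triangle_ineq]) simp
		also have "norm (sgn ?x) = 1" using x by (simp add: norm_sgn)
		also have "\<bar>smooth_step ?a\<bar> * norm (egrad v ?x) <= 1 * C"
			using smooth_step_nonneg[of ?a] smooth_step_le_1[of ?a] C by (intro mult_mono) auto
		also have "\<bar>s' ?a * (1 / norm ?x) * v ?x\<bar> <= D * exp z * C"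
			unfolding abs_mult using C s' D x(2) by (intro mult_mono) (auto simp: exp_minus divide_inverse)
		also have "1 * C + D * exp z * C * 1 <= (C + D * C) * exp z"
			using C z by (simp add: algebra_simps)
		finally show "norm (egrad (cutoff j v) ?x) <= (C + D * C) * exp z" by simp
	qed
qed

lemma polar_decomposition:
	assumes "x ~= 0" "norm (x::'a::euclidean_space) < 1"
	obtains z \<theta> where "z > 0" "norm \<theta> = 1" "x = ray \<theta> z"
proof (rule that[of "- ln (norm x)" "x /\<^sub>R norm x"])
	show "- ln (norm x) > 0" "norm (x /\<^sub>R norm x) = 1" "x = exp (- (- ln (norm x))) *\<^sub>R (x /\<^sub>R norm x)"
		using assms by auto
qed

lemma eventually_cutoff:
	assumes "x ~= 0"
	shows "\<forall>\<^sub>F j in sequentially. - ln (norm x) < real j"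
	using filterlim_real_sequentially unfolding filterlim_at_top_dense by blast

lemma cutoff_weight_tendsto:
	fixes v :: "'a::euclidean_space => real"
	assumes v: "v \<in> hyp_test_functions" and p: "p > 0"
		and \<omega>: "continuous_on {0<..} \<omega>" "!!z. z > 0 ==> \<bar>\<omega> z\<bar> <= K * sinh z powr (- e)" "real DIM('a) + e > 0"
	shows "(\<lambda>j. \<integral>x. rwt \<omega> x * \<bar>cutoff j v x\<bar> powr p \<partial>hyp_vol) \<longlonglongrightarrow> (\<integral>x. rwt \<omega> x * \<bar>v x\<bar> powr p \<partial>hyp_vol)"
proof (rule integral_dominated_convergence[where w="\<lambda>x. \<bar>rwt \<omega> x * \<bar>v x\<bar> powr p\<bar>"])
	note int = integrable_weight[OF _ p \<omega>]
	have vj: "cutoff j v \<in> hyp_test_functions" for j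
		using cutoff_punctured[OF v] by (simp add: punctured_test_def)
	show "(\<lambda>x. rwt \<omega> x * \<bar>v x\<bar> powr p) \<in> borel_measurable hyp_vol"
		"(\<lambda>x. rwt \<omega> x * \<bar>cutoff j v x\<bar> powr p) \<in> borel_measurable hyp_vol" for j
		using int[OF v] int[OF vj] by (auto dest: borel_measurable_integrable)
	show "integrable hyp_vol (\<lambda>x. \<bar>rwt \<omega> x * \<bar>v x\<bar> powr p\<bar>)"
		using int[OF v] by simp
	show "AE x in hyp_vol. (\<lambda>j. rwt \<omega> x * \<bar>cutoff j v x\<bar> powr p) \<longlonglongrightarrow> rwt \<omega> x * \<bar>v x\<bar> powr p"
		using AE_hyp_vol_nonzero
	proof eventually_elim
		case (elim x)
		have "\<forall>\<^sub>F j in sequentially. rwt \<omega> x * \<bar>cutoff j v x\<bar> powr p = rwt \<omega> x * \<bar>v x\<bar> powr p"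
			using eventually_cutoff[OF elim]
			by eventually_elim (simp add: cutoff_eq(1)[OF elim] test_differentiable[OF v])
		then show ?case by (rule tendsto_eventually)
	qed
	show "AE x in hyp_vol. norm (rwt \<omega> x * \<bar>cutoff j v x\<bar> powr p) <= \<bar>rwt \<omega> x * \<bar>v x\<bar> powr p\<bar>" for j
		using cutoff_le[of j v] p by (intro AE_I2) (auto simp: abs_mult intro!: mult_left_mono powr_mono2)
qed

text \<open>Removing a point costs no energy from dimension 3 on: the uniform gradient bound
  \<open>K * exp z\<close> bounds the energy density by a multiple of the Hardy weight
  \<open>(sinh z)^2\<close>, which is integrable over the support. At each point other than the
  origin the cutoff is eventually without effect, so dominated convergence applies.\<close>

lemma cutoff_form_tendsto:
	fixes v :: "'a::euclidean_space => real"
	assumes v: "v \<in> hyp_test_functions" and n: "DIM('a) >= 3"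
	shows "(\<lambda>j. \<integral>x. hyp_form m (cutoff j v) x \<partial>hyp_vol) \<longlonglongrightarrow> (total_form m v)"
proof -
	obtain R where R: "0 < R" "R < 1" "!!x. R < norm x ==> v x = 0"
		using test_support[OF v] by metis
	obtain K where K: "!!j \<theta> z. norm (\<theta>::'a) = 1 ==> z > 0 ==> norm (egrad (cutoff j v) (ray \<theta> z)) <= K * exp z"
		using cutoff_grad_bound[OF v] by blast
	define c where "c = ((real DIM('a) - 1) / 2)\<^sup>2"
	define e where "e = ((real DIM('a) - 2) / 2)\<^sup>2 - (m + 1/2)\<^sup>2"
	let ?h = "rwt (\<lambda>z. (sinh z)\<^sup>2) :: 'a => real"
	define w where "w x = ?h x * (K\<^sup>2 * indicator (cball 0 R) x) + c * (v x)\<^sup>2 + \<bar>e\<bar> * (?h x * (v x)\<^sup>2)" for x :: 'a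
	have h0: "?h x >= 0" for x by (simp add: rwt_def)
	have form: "hyp_form m u x = (hyp_grad_norm u x)\<^sup>2 - c * (u x)\<^sup>2 - e * (?h x * (u x)\<^sup>2)" for u :: "'a => real" and x
		by (simp add: hyp_form_def c_def e_def)
	have vj: "cutoff j v \<in> hyp_test_functions" for j
		using cutoff_punctured[OF v] by (simp add: punctured_test_def)
	show ?thesis
	proof (rule integral_dominated_convergence[where w=w])
		show "hyp_form m v \<in> borel_measurable hyp_vol" "hyp_form m (cutoff j v) \<in> borel_measurable hyp_vol" for j
			using integrable_hyp_form(3)[OF v n] integrable_hyp_form(3)[OF vj n] by (auto dest: borel_measurable_integrable)
		have [measurable]: "cball (0::'a) R \<in> sets borel" by simp
		have "integrable hyp_vol (\<lambda>x. ?h x * (K\<^sup>2 * indicator (cball 0 R) x))"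
			by (rule integrable_rwt[OF _ _ R(2) _ _ hardy_weight_bound, where C="K\<^sup>2"])
				(use n in \<open>auto intro!: continuous_intros split: split_indicator\<close>)
		then show "integrable hyp_vol w"
			unfolding w_def[abs_def] using integrable_hyp_form(1,2)[OF v n] by simp
		show "AE x in hyp_vol. (\<lambda>j. hyp_form m (cutoff j v) x) \<longlonglongrightarrow> hyp_form m v x"
			using AE_hyp_vol_nonzero
		proof eventually_elim
			case (elim x)
			have "\<forall>\<^sub>F j in sequentially. hyp_form m (cutoff j v) x = hyp_form m v x"
				using eventually_cutoff[OF elim]
				by eventually_elim (simp add: form hyp_grad_norm_eq test_differentiable v vj cutoff_eq[OF elim])
			then show ?case by (rule tendsto_eventually)
		qed
		show "AE x in hyp_vol. norm (hyp_form m (cutoff j v) x) <= w x" for j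
			using AE_hyp_vol_nonzero AE_hyp_vol
		proof eventually_elim
			case (elim x)
			have g: "(hyp_grad_norm (cutoff j v) x)\<^sup>2 <= ?h x * (K\<^sup>2 * indicator (cball 0 R) x)"
			proof (cases "R < norm x")
				case True
				have "egrad (cutoff j v) x = 0"
					by (rule test_egrad_eq_0[OF _ True]) (use cutoff_le[of j v] R(3) in \<open>metis abs_le_zero_iff abs_zero\<close>)
				then show ?thesis
					using h0[of x] hyp_grad_norm_eq[OF test_differentiable[OF vj[of j]], of x] by simp
			next
				case False
				obtain z \<theta> where z: "z > 0" "norm \<theta> = 1" "x = ray \<theta> z"
					using polar_decomposition[of x] elim by auto
				have "(hyp_grad_norm (cutoff j v) x)\<^sup>2 <= K\<^sup>2 * (sinh z)\<^sup>2"
					unfolding z(3) by (rule hyp_grad_norm_le[OF test_differentiable[OF vj] z(2,1) K[OF z(2,1)]])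
				then show ?thesis
					using False z rwt_polar[OF z(2,1), of "\<lambda>z. (sinh z)\<^sup>2"] by (simp add: mult.commute)
			qed
			have s: "(cutoff j v x)\<^sup>2 <= (v x)\<^sup>2" using cutoff_le[of j v x] by (simp add: abs_le_square_iff)
			have a1: "c * (cutoff j v x)\<^sup>2 <= c * (v x)\<^sup>2" "0 <= c * (cutoff j v x)\<^sup>2"
				using s by (auto intro!: mult_left_mono simp: c_def)
			have "\<bar>e * (?h x * (cutoff j v x)\<^sup>2)\<bar> <= \<bar>e\<bar> * (?h x * (v x)\<^sup>2)"
				using s h0[of x] by (simp add: abs_mult mult_left_mono)
			then show ?case
				using g a1 unfolding form w_def real_norm_def by (smt (verit) zero_le_power2)
		qed
	qed
qed

lemma poincare:
	fixes v :: "'a::euclidean_space => real"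
	assumes v: "v \<in> hyp_test_functions" and n: "DIM('a) >= 3"
	shows "(total_form m v) >= 0"
	by (rule tendsto_lowerbound[OF cutoff_form_tendsto[OF v n]])
		(auto intro!: always_eventually poincare_punctured[OF cutoff_punctured[OF v] n])

subsection \<open>Radial functions\<close>

lemma rwt_test:
	fixes \<psi> :: "real => real"
	assumes \<psi>: "!!k. Ck_on k {0<..} \<psi>" and ab: "0 < a" "!!z. z \<notin> {a..b} ==> \<psi> z = 0"
	shows "punctured_test (rwt \<psi> :: 'a::euclidean_space => real)"
proof -
	have near: "rwt \<psi> x = 0" if "norm x < exp (- b)" for x :: 'a
	proof (cases "x = 0")
		case False
		then have "- ln (norm x) > b" using that ln_less_cancel_iff[of "norm x" "exp (- b)"] by simp
		then show ?thesis using ab(2) by (simp add: rwt_def)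
	qed (simp add: rwt_def)
	have far: "rwt \<psi> x = 0" if "exp (- a) < norm x" for x :: 'a
	proof -
		have "x ~= 0" using that by auto
		then have "- ln (norm x) < a" using that ln_less_cancel_iff[of "exp (- a)" "norm x"] by simp
		then show ?thesis using ab(2) by (simp add: rwt_def)
	qed
	have "(rwt \<psi> :: 'a => real) \<in> hyp_test_functions"
	proof (rule test_functionI[OF _ _ far])
		fix k
		let ?S = "hyp_space - {0::'a}"
		have S: "open ?S" by auto
		have neg: "ln (norm x) < 0" if "x \<in> ?S" for x :: 'a
			using that by (intro ln_less_zero) auto
		have "Ck_on k ?S (\<lambda>x. - ln (norm x))"
			by (intro Ck_on_minus S Ck_on_compose_real[OF S _ _ Ck_on_ln Ck_on_subset[OF Ck_on_norm]]) auto
		then have "Ck_on k ?S (\<lambda>x. \<psi> (- ln (norm x)))"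
			by (rule Ck_on_compose_real[OF S _ _ \<psi>, rotated 2]) (simp_all add: image_subset_iff neg del: Diff_iff)
		then have 1: "Ck_on k ?S (rwt \<psi>)"
			by (rule Ck_on_cong[THEN iffD1, OF S, rotated]) (auto simp: rwt_def)
		have "Ck_on k (ball 0 (exp (- b))) (\<lambda>x::'a. 0)" by (rule Ck_on_const)
		then have 2: "Ck_on k (ball 0 (exp (- b))) (rwt \<psi> :: 'a => real)"
			by (rule Ck_on_cong[THEN iffD1, rotated 2]) (auto simp: near)
		show "Ck_on k hyp_space (rwt \<psi> :: 'a => real)"
			by (rule Ck_on_subset[OF Ck_on_Un[OF S open_ball 1 2]]) auto
	qed (use ab(1) in auto)
	then show ?thesis
		using near by (auto simp: punctured_test_def intro!: exI[of _ "exp (- b)"])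
qed

lemma integral_rwt:
	assumes "integrable hyp_vol (rwt F :: 'a::euclidean_space => real)"
	shows "(\<integral>x. rwt F (x::'a) \<partial>hyp_vol) =
		measure (angular :: 'a measure) UNIV * (\<integral>z. hyp_density DIM('a) z * F z \<partial>lborel)"
proof -
	have "(\<integral>x. rwt F (x::'a) \<partial>hyp_vol) = (\<integral>(\<theta>::'a). (\<integral>z. hyp_density DIM('a) z * F z \<partial>lborel) \<partial>angular)"
		unfolding integral_hyp_vol(1)[OF assms]
	proof (rule integral_cong_AE)
		show "(\<lambda>\<theta>. \<integral>z. hyp_density DIM('a) z * rwt F (exp (- z) *\<^sub>R (\<theta>::'a)) \<partial>lborel) \<in> borel_measurable angular"
			by (rule borel_measurable_integrable[OF integral_hyp_vol(2)[OF assms]])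
		show "AE \<theta> in angular. (\<integral>z. hyp_density DIM('a) z * rwt F (exp (- z) *\<^sub>R (\<theta>::'a)) \<partial>lborel) =
				(\<integral>z. hyp_density DIM('a) z * F z \<partial>lborel)"
		proof (rule eventually_mono[OF AE_angular_norm])
			fix \<theta> :: 'a assume \<theta>: "norm \<theta> = 1"
			have "hyp_density DIM('a) z * rwt F (ray \<theta> z) = hyp_density DIM('a) z * F z" for z
				using rwt_polar[OF \<theta>, of z F] by (cases "z > 0") (auto simp: hyp_density_def)
			then show "(\<integral>z. hyp_density DIM('a) z * rwt F (ray \<theta> z) \<partial>lborel) = (\<integral>z. hyp_density DIM('a) z * F z \<partial>lborel)"
				by (simp only:)
		qed
	qed simp
	then show ?thesis by simp
qed

subsection \<open>The sharp constant\<close>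

definition S_weight :: "nat => real => real => real" where
	"S_weight n p z = sinh z powr (- (p * (real n - 2) / 2 - real n))"

definition Y_weight :: "nat => real => real => real" where
	"Y_weight n p z = sinh z powr (- (p * (real n - 2) / 2 - real n)) * Y_log n z powr ((p + 2) / 2)"

abbreviation weighted_norm :: "nat => real => (real => real) => real" where
	"weighted_norm n p f \<equiv> \<integral>z. hyp_density n z * (S_weight n p z * \<bar>f z\<bar> powr p) \<partial>lborel"

abbreviation square_norm :: "nat => (real => real) => real" where
	"square_norm n f \<equiv> \<integral>z. hyp_density n z * (f z)\<^sup>2 \<partial>lborel"

lemma S_weight_props:
	assumes "n >= 3" "p > 2"
	shows "continuous_on {0<..} (S_weight n p)"
		"z > 0 ==> \<bar>S_weight n p z\<bar> <= 1 * sinh z powr (- (p * (real n - 2) / 2 - real n))"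
		"real n + (p * (real n - 2) / 2 - real n) > 0"
	using assms by (auto simp: S_weight_def[abs_def] intro!: continuous_intros)

lemma Y_weight_props:
	assumes "n >= 3" "p > 2"
	shows "continuous_on {0<..} (Y_weight n p)"
		"z > 0 ==> \<bar>Y_weight n p z\<bar> <= (real n - 2) powr ((p + 2) / 2) * sinh z powr (- (p * (real n - 2) / 2 - real n))"
proof -
	show "continuous_on {0<..} (Y_weight n p)"
		unfolding Y_weight_def[abs_def] using Y_log_pos[OF _ assms(1)] assms
		by (intro continuous_on_mult continuous_on_powr' Y_log_continuous continuous_intros) (auto intro: less_imp_le)
	show "\<bar>Y_weight n p z\<bar> <= (real n - 2) powr ((p + 2) / 2) * sinh z powr (- (p * (real n - 2) / 2 - real n))" if "z > 0"
	proof -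
		have "Y_log n z powr ((p + 2) / 2) <= (real n - 2) powr ((p + 2) / 2)"
			using Y_log_pos[OF that assms(1)] Y_log_le[OF that assms(1)] assms by (intro powr_mono2) auto
		then show ?thesis
			by (simp add: Y_weight_def abs_mult mult.commute[of "sinh z powr _"] mult_right_mono)
	qed
qed

definition S_ineq :: "'a::euclidean_space itself => real => real => bool" where
	"S_ineq _ p C \<longleftrightarrow> (\<forall>v\<in>(hyp_test_functions :: ('a => real) set).
		 (total_form (hm DIM('a)) v) >= C * (\<integral>x. rwt (S_weight DIM('a) p) x * \<bar>v x\<bar> powr p \<partial>hyp_vol) powr (2 / p))"

definition Y_ineq :: "'a::euclidean_space itself => real => real => bool" where
	"Y_ineq _ p C \<longleftrightarrow> (\<forall>v\<in>(hyp_test_functions :: ('a => real) set).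
		 (total_form (- (1/2)) v) >= C * (\<integral>x. rwt (Y_weight DIM('a) p) x * \<bar>v x\<bar> powr p \<partial>hyp_vol) powr (2 / p))"

lemma bump_exists:
	obtains \<psi> :: "real => real" where "!!k. Ck_on k UNIV \<psi>" "!!z. z \<notin> {1..4} ==> \<psi> z = 0" "\<psi> 2 = 1" "!!z. \<psi> z >= 0"
proof
	let ?p = "\<lambda>z. smooth_step (z - 1) * smooth_step (4 - z)"
	have "Ck_on k UNIV (\<lambda>z::real. z)" for k using Ck_on_inner_left[of UNIV k "1::real"] by simp
	then show "Ck_on k UNIV ?p" for k
		by (intro Ck_on_mult Ck_on_compose_real[OF _ _ _ Ck_on_smooth_step] Ck_on_diff) auto
	show "?p z = 0" if "z \<notin> {1..4}" for z
		using that by (auto simp: not_le smooth_step_eq_0)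
qed (auto simp: smooth_step_eq_1 smooth_step_nonneg)

text \<open>One test function with positive norm is needed to bound the valid constants from
  above.\<close>

lemma S_weight_integral_pos:
	fixes T :: "'a::euclidean_space itself"
	assumes n: "DIM('a) >= 3" and p: "p > 2"
	obtains v :: "'a => real" where "v \<in> hyp_test_functions"
		"(\<integral>x. rwt (S_weight DIM('a) p) x * \<bar>v x\<bar> powr p \<partial>hyp_vol) > 0"
proof -
	obtain \<psi> :: "real => real" where \<psi>: "!!k. Ck_on k UNIV \<psi>" "!!z. z \<notin> {1..4} ==> \<psi> z = 0" "\<psi> 2 = 1" "!!z. \<psi> z >= 0"
		using bump_exists by blast
	let ?v = "rwt \<psi> :: 'a => real"
	have v: "?v \<in> hyp_test_functions"
		using rwt_test[OF Ck_on_subset[OF \<psi>(1)], of 1 4] \<psi>(2) by (auto simp: punctured_test_def)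
	define F where "F z = S_weight DIM('a) p z * \<psi> z powr p" for z
	have eq: "rwt (S_weight DIM('a) p) x * \<bar>?v x\<bar> powr p = rwt F x" for x :: 'a
		using \<psi>(4) by (simp add: rwt_def F_def)
	have int: "integrable hyp_vol (rwt F :: 'a => real)"
		using integrable_weight[OF v, where p=p, OF _ S_weight_props[OF n p]] p unfolding eq by simp
	let ?f = "\<lambda>z. hyp_density DIM('a) z * F z"
	have cont: "continuous_on {0<..} ?f"
	proof -
		have "continuous_on {0<..} (\<lambda>z. 1 / sinh z ^ DIM('a) * (S_weight DIM('a) p z * \<psi> z powr p))"
			using Ck_on_imp_continuous_on[OF \<psi>(1)] \<psi>(4) p
			by (intro continuous_on_mult S_weight_props(1)[OF n p] continuous_on_powr' continuous_intros)
				(auto intro: continuous_on_subset)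
		then show ?thesis
			by (rule continuous_on_eq) (simp add: hyp_density_def F_def)
	qed
	have f0: "?f z = 0" if "z \<notin> {1..4}" for z using \<psi>(2)[OF that] by (simp add: F_def)
	have "(\<integral>z. ?f z \<partial>lborel) = integral {1..4} ?f"
		by (rule lborel_integral_compact(2)[OF cont _ f0]) simp
	moreover have "integral {1..4} ?f > 0"
	proof -
		have c: "continuous_on {1..4} ?f" using cont by (rule continuous_on_subset) auto
		have nn: "?f z >= 0" for z
			using hyp_density_nonneg by (simp add: F_def S_weight_def)
		have "integral {1..4} ?f ~= 0"
		proof
			assume "integral {1..4} ?f = 0"
			then have "\<forall>z\<in>{1..4}. ?f z = 0"
				using c nn by (subst (asm) integral_eq_0_iff) auto
			moreover have "?f 2 > 0"
				using \<psi>(3) by (simp add: F_def S_weight_def hyp_density_def)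
			moreover have "(2::real) \<in> {1..4}" by simp
			ultimately show False by fastforce
		qed
		moreover have "integral {1..4} ?f >= 0"
			using nn c by (intro integral_nonneg integrable_continuous_interval) auto
		ultimately show ?thesis by simp
	qed
	ultimately have "(\<integral>x. rwt (S_weight DIM('a) p) x * \<bar>?v x\<bar> powr p \<partial>hyp_vol) > 0"
		unfolding eq integral_rwt[OF int] using mult_pos_pos[OF angular_UNIV_pos] by simp
	then show ?thesis using that v by blast
qed

text \<open>The valid constants contain 0 by the Poincare inequality and are bounded by the quotient
  of a single test function. Each condition is closed in the constant, so the supremum is itself
  valid, and \<open>Greatest\<close> denotes it.\<close>

lemma greatest_S_ineq:
	fixes T :: "'a::euclidean_space itself"
	assumes n: "DIM('a) >= 3" and p: "p > 2"
	obtains L where "Greatest (S_ineq T p) = L" "S_ineq T p L" "!!C. S_ineq T p C ==> C <= L" "L >= 0"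
proof -
	let ?P = "S_ineq T p"
	let ?E = "\<lambda>v::'a => real. \<integral>x. hyp_form (hm DIM('a)) v x \<partial>hyp_vol"
	let ?N = "\<lambda>v::'a => real. (\<integral>x. rwt (S_weight DIM('a) p) x * \<bar>v x\<bar> powr p \<partial>hyp_vol) powr (2 / p)"
	have P0: "?P 0" using poincare[OF _ n] by (simp add: S_ineq_def)
	obtain u :: "'a => real" where u: "u \<in> hyp_test_functions"
		"(\<integral>x. rwt (S_weight DIM('a) p) x * \<bar>u x\<bar> powr p \<partial>hyp_vol) > 0"
		using S_weight_integral_pos[OF n p] by blast
	have Nu: "?N u > 0" using u(2) by simp
	have bdd: "C <= ?E u / ?N u" if "?P C" for C
		using that u(1) Nu by (simp add: S_ineq_def pos_le_divide_eq)
	define L where "L = Sup (Collect ?P)"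
	have bdd': "bdd_above (Collect ?P)" using bdd by (auto intro!: bdd_aboveI)
	have up: "C <= L" if "?P C" for C
		unfolding L_def using that bdd' by (intro cSup_upper) auto
	have PL: "?P L"
		unfolding S_ineq_def
	proof
		fix v :: "'a => real" assume v: "v \<in> hyp_test_functions"
		show "L * ?N v <= ?E v"
		proof (cases "?N v > 0")
			case True
			have "L <= ?E v / ?N v"
				unfolding L_def
			proof (rule cSup_least)
				show "Collect ?P ~= {}" using P0 by blast
			qed (use True v in \<open>auto simp: S_ineq_def pos_le_divide_eq\<close>)
			then show ?thesis using True by (simp add: pos_le_divide_eq)
		next
			\<comment> \<open>With a vanishing norm there is no condition on the constant, and what remains
			  is the Poincare inequality.\<close>
			case False
			then have "?N v = 0" by (simp add: not_less powr_eq_0_iff[symmetric] order_antisym)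
			then show ?thesis using poincare[OF v n] by simp
		qed
	qed
	show ?thesis
		using that[of L] Greatest_equality[of ?P, OF PL up] PL up up[OF P0] by blast
qed

lemma transplant_Y_weight:
	fixes u :: "'a::euclidean_space => real"
	assumes u: "punctured_test u" and n: "DIM('a) >= 3" and p: "p > 2"
	shows "(\<integral>x. rwt (Y_weight DIM('a) p) x * \<bar>u x\<bar> powr p \<partial>hyp_vol) =
		(real DIM('a) - 2) powr ((p + 2) / 2) * (\<integral>x. rwt (S_weight DIM('a) p) x * \<bar>transplant u x\<bar> powr p \<partial>hyp_vol)"
proof -
	have p0: "p > 0" using p by simp
	have U: "transplant u \<in> hyp_test_functions" "u \<in> hyp_test_functions"
		using transplant_punctured[OF u] u by (auto simp: punctured_test_def)
	show ?thesis
		unfolding Y_weight_def[abs_def] S_weight_def[abs_def]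
		using integrable_weight[OF U(2) p0 Y_weight_props[OF n p] S_weight_props(3)[OF n p]]
			integrable_weight[OF U(1) p0 S_weight_props[OF n p]]
		unfolding Y_weight_def[abs_def] S_weight_def[abs_def]
		by (rule transplant_weight[OF u n p refl refl])
qed

lemma Y_ineq_of_S_ineq:
	fixes T :: "'a::euclidean_space itself"
	assumes n: "DIM('a) >= 3" and p: "p > 2" and S: "S_ineq T p S"
	shows "Y_ineq T p ((real DIM('a) - 2) powr (- ((p + 2) / p)) * S)"
	unfolding Y_ineq_def
proof
	fix v :: "'a => real" assume v: "v \<in> hyp_test_functions"
	let ?n = "DIM('a)"
	define c where "c = real ?n - 2"
	have c: "c > 0" using n by (simp add: c_def)
	let ?N = "\<lambda>v::'a => real. \<integral>x. rwt (S_weight ?n p) x * \<bar>v x\<bar> powr p \<partial>hyp_vol"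
	let ?Y = "\<lambda>v::'a => real. \<integral>x. rwt (Y_weight ?n p) x * \<bar>v x\<bar> powr p \<partial>hyp_vol"
	have p0: "p > 0" using p by simp
	have nonneg: "?Y u >= 0" "?N u >= 0" for u :: "'a => real"
		by (auto intro!: integral_nonneg_AE AE_I2 simp: rwt_def Y_weight_def S_weight_def)
	\<comment> \<open>The transplantation acts on functions vanishing near the origin. The general case
	  follows by applying this to the cutoffs of \<open>v\<close> and passing to the limit.\<close>
	have step: "c powr (- ((p + 2) / p)) * S * ?Y u powr (2 / p) <= (total_form (- (1/2)) u)"
		if u: "punctured_test u" for u :: "'a => real"
	proof -
		have U: "transplant u \<in> hyp_test_functions" "u \<in> hyp_test_functions"
			using transplant_punctured[OF u] u by (auto simp: punctured_test_def)
		have "?Y u = c powr ((p + 2) / 2) * ?N (transplant u)"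
			unfolding c_def by (rule transplant_Y_weight[OF u n p])
		then have "?Y u powr (2 / p) = c powr ((p + 2) / 2 * (2 / p)) * ?N (transplant u) powr (2 / p)"
			using nonneg(2)[of "transplant u"] by (simp add: powr_mult powr_powr)
		also have "(p + 2) / 2 * (2 / p) = (p + 2) / p" using p0 by (simp add: field_simps)
		finally have "c powr (- ((p + 2) / p)) * S * ?Y u powr (2 / p) =
				(c powr (- ((p + 2) / p)) * c powr ((p + 2) / p)) * (S * ?N (transplant u) powr (2 / p))"
			by (simp only: mult_ac)
		also have "c powr (- ((p + 2) / p)) * c powr ((p + 2) / p) = 1"
			using c by (simp add: powr_add[symmetric])
		also have "1 * (S * ?N (transplant u) powr (2 / p)) <= (total_form (hm ?n) (transplant u))"
			using S U(1) by (simp add: S_ineq_def)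
		also have "... <= (total_form (- (1/2)) u)"
			by (rule transplant_form_le[OF u n])
		finally show ?thesis .
	qed
	have "(\<lambda>j. ?Y (cutoff j v)) \<longlonglongrightarrow> ?Y v"
		by (rule cutoff_weight_tendsto[OF v p0 Y_weight_props[OF n p] S_weight_props(3)[OF n p]])
	then have "(\<lambda>j. ?Y (cutoff j v) powr (2 / p)) \<longlonglongrightarrow> ?Y v powr (2 / p)"
		using p0 nonneg(1) by (intro tendsto_powr' tendsto_const) (auto intro!: always_eventually)
	then have "(\<lambda>j. c powr (- ((p + 2) / p)) * S * ?Y (cutoff j v) powr (2 / p)) \<longlonglongrightarrow>
			c powr (- ((p + 2) / p)) * S * ?Y v powr (2 / p)"
		by (rule tendsto_mult_left)
	then show "(real ?n - 2) powr (- ((p + 2) / p)) * S * ?Y v powr (2 / p) <= (total_form (- (1/2)) v)"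
		unfolding c_def[symmetric]
		by (rule LIMSEQ_le[OF _ cutoff_form_tendsto[OF v n]]) (auto intro!: exI[of _ 0] step cutoff_punctured[OF v])
qed

subsection \<open>Differentiation off countable sets\<close>

text \<open>Each isolated point is singled out by a member of a countable base. It shows that the
  exceptional parameters of a selection between two branches are countably many.\<close>

lemma countable_isolated_points:
	fixes A :: "'b::second_countable_topology set"
	shows "countable {t\<in>A. \<not> t islimpt A}"
proof -
	obtain \<B> :: "'b set set" where B: "countable \<B>" "!!C. C \<in> \<B> ==> open C" "!!S. open S ==> \<exists>U. U \<subseteq> \<B> \<and> S = \<Union>U"
		using univ_second_countable by metis
	have "\<exists>b\<in>\<B>. A \<inter> b = {t}" if t: "t \<in> A" "\<not> t islimpt A" for t
	proof -
		obtain T where T: "open T" "t \<in> T" "!!y. y \<in> A ==> y \<in> T ==> y = t"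
			using t(2) unfolding islimpt_def by blast
		obtain b where "b \<in> \<B>" "t \<in> b" "b \<subseteq> T" using B(3)[OF T(1)] T(2) by blast
		then show ?thesis using T(3) t(1) by (intro bexI[of _ b]) auto
	qed
	then obtain b where b: "!!t. t \<in> {t\<in>A. \<not> t islimpt A} ==> b t \<in> \<B> \<and> A \<inter> b t = {t}"
		by (metis (mono_tags, lifting) mem_Collect_eq)
	have "inj_on b {t\<in>A. \<not> t islimpt A}"
		by (rule inj_onI) (metis b singleton_inject)
	moreover have "countable (b ` {t\<in>A. \<not> t islimpt A})"
		by (rule countable_subset[OF _ B(1)]) (use b in auto)
	ultimately show ?thesis by (rule countable_image_inj_on[rotated])
qed

text \<open>At a point where the two branches meet and which is not isolated among such points, both branches
	have the same derivative, so it does not matter how the selection switches between them.\<close>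

lemma selection_deriv:
	fixes \<phi> \<psi> F :: "real => real"
	assumes \<phi>: "(\<phi> has_real_derivative \<phi>') (at t)" and \<psi>: "(\<psi> has_real_derivative \<psi>') (at t)"
		and F: "isCont F t" "!!s. F s = \<phi> s \<or> F s = \<psi> s"
		and t: "\<phi> t ~= \<psi> t \<or> t islimpt {s. \<phi> s = \<psi> s}"
	shows "\<exists>d. (F has_real_derivative d) (at t) \<and> (F t = \<phi> t --> d = \<phi>') \<and> (F t = \<psi> t --> d = \<psi>')"
proof -
	have branch: "(F has_real_derivative b') (at t)"
		if b: "(b has_real_derivative b') (at t)" and b2: "(b2 has_real_derivative b2') (at t)"
			and sel: "!!s. F s = b s \<or> F s = b2 s" and ne: "F t ~= b2 t" for b b2 b' b2'
	proof -
		have "((\<lambda>s. F s - b2 s) \<longlongrightarrow> F t - b2 t) (at t)"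
			using F(1) DERIV_isCont[OF b2] by (intro tendsto_diff) (auto simp: isCont_def)
		then have "\<forall>\<^sub>F s in at t. F s - b2 s ~= 0"
			using ne by (intro tendsto_imp_eventually_ne) auto
		then have "\<forall>\<^sub>F s in at t. F s = b s"
			by eventually_elim (use sel in force)
		then have "\<forall>\<^sub>F s in nhds t. F s = b s"
			unfolding eventually_at_filter by eventually_elim (use sel[of t] ne in auto)
		then show ?thesis using DERIV_cong_ev[OF refl _ refl, of F b t b'] b by blast
	qed
	show ?thesis
	proof (cases "\<phi> t = \<psi> t")
		case False
		show ?thesis
		proof (cases "F t = \<phi> t")
			case True
			then show ?thesis using branch[OF \<phi> \<psi> F(2)] False by metis
		next
			case False
			then show ?thesis using branch[OF \<psi> \<phi>] F(2) by metis
		qed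
	next
		case True
		have lim: "t islimpt {s. \<phi> s = \<psi> s}" using t True by simp
		have eq: "\<phi>' = \<psi>'"
		proof -
			let ?A = "{s. \<phi> s = \<psi> s}"
			have "((\<lambda>s. ((\<phi> s - \<psi> s) - (\<phi> t - \<psi> t)) / (s - t)) \<longlongrightarrow> \<phi>' - \<psi>') (at t within ?A)"
				using DERIV_diff[OF \<phi> \<psi>] unfolding has_field_derivative_iff by (rule tendsto_within_subset) simp
			moreover have "((\<lambda>s. ((\<phi> s - \<psi> s) - (\<phi> t - \<psi> t)) / (s - t)) \<longlongrightarrow> 0) (at t within ?A)"
				by (rule tendsto_eventually) (auto simp: eventually_at_filter True)
			ultimately have "\<phi>' - \<psi>' = 0"
				using lim by (intro tendsto_unique[of "at t within ?A"]) (auto simp: trivial_limit_within)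
			then show ?thesis by simp
		qed
		have "((\<lambda>s. (F s - F t) / (s - t)) \<longlongrightarrow> \<phi>') (at t)"
		proof (rule LIM_zero_cancel, rule Lim_null_comparison)
			show "\<forall>\<^sub>F s in at t. norm ((F s - F t) / (s - t) - \<phi>') <=
					\<bar>(\<phi> s - \<phi> t) / (s - t) - \<phi>'\<bar> + \<bar>(\<psi> s - \<psi> t) / (s - t) - \<psi>'\<bar>"
			proof (rule always_eventually, rule allI)
				fix s
				have "F t = \<phi> t" "F t = \<psi> t" using F(2)[of t] True by auto
				then show "norm ((F s - F t) / (s - t) - \<phi>') <=
					\<bar>(\<phi> s - \<phi> t) / (s - t) - \<phi>'\<bar> + \<bar>(\<psi> s - \<psi> t) / (s - t) - \<psi>'\<bar>"
					using F(2)[of s] eq by auto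
			qed
			have "((\<lambda>s. \<bar>(\<phi> s - \<phi> t) / (s - t) - \<phi>'\<bar> + \<bar>(\<psi> s - \<psi> t) / (s - t) - \<psi>'\<bar>) \<longlongrightarrow> \<bar>\<phi>' - \<phi>'\<bar> + \<bar>\<psi>' - \<psi>'\<bar>) (at t)"
				using \<phi> \<psi> unfolding has_field_derivative_iff by (intro tendsto_intros)
			then show "((\<lambda>s. \<bar>(\<phi> s - \<phi> t) / (s - t) - \<phi>'\<bar> + \<bar>(\<psi> s - \<psi> t) / (s - t) - \<psi>'\<bar>) \<longlongrightarrow> 0) (at t)" by simp
		qed
		then have "(F has_real_derivative \<phi>') (at t)" by (simp add: has_field_derivative_iff)
		then show ?thesis using F(2)[of t] True eq by metis
	qed
qed

text \<open>A replacement for absolute continuity. The difference quotients \<open>q j\<close> of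
  \<open>\<phi>\<close> are continuous and are the derivatives of the window averages
  \<open>?P j\<close>, so the fundamental theorem applies to them. They are bounded by
  \<open>L\<close> and converge to the derivative of \<open>\<phi>\<close> off \<open>K\<close>;
  dominated convergence then represents the increment by that derivative.\<close>

lemma lipschitz_increment_le:
	fixes \<phi> :: "real => real"
	assumes lip: "!!s t. s >= a0 ==> t >= a0 ==> \<bar>\<phi> s - \<phi> t\<bar> <= L * \<bar>s - t\<bar>"
		and ab: "a0 < a" "a <= b" and K: "countable K"
		and d: "!!t. t > a0 ==> t \<notin> K ==> \<exists>d. (\<phi> has_real_derivative d) (at t) \<and> \<bar>d\<bar> <= H t"
	shows "ennreal \<bar>\<phi> b - \<phi> a\<bar> <= (\<integral>\<^sup>+t. ennreal (H t) * indicator {a..b} t \<partial>lborel)"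
proof -
	define \<epsilon> :: "nat => real" where "\<epsilon> j = inverse (real (Suc j))" for j
	have \<epsilon>: "\<epsilon> j > 0" "\<epsilon> \<longlonglongrightarrow> 0" for j
		unfolding \<epsilon>_def[abs_def] using LIMSEQ_inverse_real_of_nat by auto
	have L: "L >= 0" using lip[of a0 "a0 + 1"] by simp
	have cont: "continuous_on {a0..} \<phi>"
		by (rule lipschitz_on_continuous_on[of L], rule lipschitz_onI) (use lip L in \<open>auto simp: dist_real_def\<close>)
	then have isc: "isCont \<phi> t" if "t > a0" for t
		using that by (intro continuous_on_interior[OF cont]) (auto simp: interior_Ici)
	define P where "P x = integral {a0..x} \<phi>" for x
	have P: "(P has_real_derivative \<phi> t) (at t)" if "t > a0" for t
	proof -
		have "((\<lambda>x. integral {a0..x} \<phi>) has_real_derivative \<phi> t) (at t within {a0..t + 1})"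
			using that by (intro integral_has_real_derivative continuous_on_subset[OF cont]) auto
		moreover have "at t within {a0..t + 1} = at t"
			using that by (intro at_within_interior) (auto simp: interior_atLeastAtMost_real)
		ultimately show ?thesis by (simp add: P_def[abs_def])
	qed
	define q where "q j t = (\<phi> (t + \<epsilon> j) - \<phi> t) / \<epsilon> j" for j t
	let ?P = "\<lambda>j t. (P (t + \<epsilon> j) - P t) / \<epsilon> j"
	have shift: "((\<lambda>t. f (t + \<epsilon> j)) has_real_derivative f') (at t)"
		if "(f has_real_derivative f') (at (t + \<epsilon> j))" for f f' j t
		using that by (subst DERIV_shift[symmetric]) simp
	have dP: "(?P j has_real_derivative q j t) (at t)" if "t > a0" for j t
		unfolding q_def using that \<epsilon>(1)[of j] by (intro DERIV_cdivide DERIV_diff shift P) auto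
	have cq: "isCont (q j) t" if "t > a0" for j t
	proof -
		have "isCont (\<lambda>t. \<phi> (t + \<epsilon> j)) t"
			by (rule isCont_o2[where g=\<phi>]) (use that \<epsilon>(1)[of j] in \<open>auto intro!: isc\<close>)
		then show ?thesis unfolding q_def[abs_def] using isc[OF that] \<epsilon>(1)[of j] by (intro continuous_intros) auto
	qed
	have ftc: "(\<integral>t. q j t * indicator {a..b} t \<partial>lborel) = ?P j b - ?P j a" for j
		by (rule integral_FTC_Icc_real[OF ab(2)]) (use ab dP cq in auto)
	have lim: "(\<lambda>j. ?P j t) \<longlonglongrightarrow> \<phi> t" if "t > a0" for t
	proof -
		have "((\<lambda>h. (P (t + h) - P t) / h) \<longlongrightarrow> \<phi> t) (at 0)"
			using P[OF that] by (simp add: DERIV_def)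
		moreover have "filterlim \<epsilon> (at 0) sequentially"
			unfolding filterlim_at using \<epsilon> by (auto intro!: always_eventually simp: less_imp_neq[symmetric])
		ultimately show ?thesis by (rule filterlim_compose)
	qed
	have q_meas: "(\<lambda>t. q j t * indicator {a..b} t) \<in> borel_measurable lborel" for j
	proof -
		have "continuous_on {a..b} (q j)"
			using cq ab by (intro continuous_at_imp_continuous_on) auto
		then have "(\<lambda>t. indicator {a..b} t *\<^sub>R q j t) \<in> borel_measurable borel"
			by (rule borel_measurable_continuous_on_indicator[rotated]) simp
		then show ?thesis by (simp add: mult.commute)
	qed
	\<comment> \<open>Taking the limit with \<open>lim\<close> at every point, including the
	  exceptional set, makes measurability immediate.\<close>
	define d' where "d' t = lim (\<lambda>j. q j t * indicator {a..b} t)" for t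
	have d'_meas [measurable]: "d' \<in> borel_measurable lborel"
		unfolding d'_def[abs_def] by (rule borel_measurable_lim_metric[OF q_meas])
	have q_le: "\<bar>q j t * indicator {a..b} t\<bar> <= L * indicator {a..b} t" for j t
		using lip[of "t + \<epsilon> j" t] \<epsilon>(1)[of j] ab
		by (auto simp: q_def abs_mult pos_divide_le_eq split: split_indicator)
	have lim_q: "(\<lambda>j. q j t * indicator {a..b} t) \<longlonglongrightarrow> d' t \<and> \<bar>d' t\<bar> <= H t * indicator {a..b} t" if t: "t \<notin> K" for t
	proof (cases "t \<in> {a..b}")
		case True
		then obtain d where d: "(\<phi> has_real_derivative d) (at t)" "\<bar>d\<bar> <= H t"
			using d[of t] t ab by auto
		have "((\<lambda>h. (\<phi> (t + h) - \<phi> t) / h) \<longlongrightarrow> d) (at 0)"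
			using d(1) by (simp add: DERIV_def)
		moreover have "filterlim \<epsilon> (at 0) sequentially"
			unfolding filterlim_at using \<epsilon> by (auto intro!: always_eventually simp: less_imp_neq[symmetric])
		ultimately have "(\<lambda>j. q j t) \<longlonglongrightarrow> d" unfolding q_def by (rule filterlim_compose)
		then have *: "(\<lambda>j. q j t * indicator {a..b} t) \<longlonglongrightarrow> d" using True by simp
		from limI[OF this] show ?thesis using * True d(2) by (simp add: d'_def)
	next
		case False
		then show ?thesis by (simp add: d'_def)
	qed
	have AE: "AE t in lborel. t \<notin> K"
		by (intro AE_not_in countable_imp_null_set_lborel K)
	have w: "integrable lborel (\<lambda>t. L * indicator {a..b} t)"
		by (intro integrable_mult_right integrable_real_indicator) (use ab in auto)
	have AE1: "AE t in lborel. (\<lambda>j. q j t * indicator {a..b} t) \<longlonglongrightarrow> d' t"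
		using AE by eventually_elim (use lim_q in blast)
	have AE2: "AE t in lborel. norm (q j t * indicator {a..b} t) <= L * indicator {a..b} t" for j
		using q_le by (intro AE_I2) simp
	note dc = integral_dominated_convergence[OF d'_meas q_meas w AE1 AE2]
	note int = integrable_dominated_convergence[OF d'_meas q_meas w AE1 AE2]
	have "(\<lambda>j. \<integral>t. q j t * indicator {a..b} t \<partial>lborel) \<longlonglongrightarrow> \<phi> b - \<phi> a"
		unfolding ftc using ab by (intro tendsto_diff lim) auto
	from LIMSEQ_unique[OF this dc]
	have "ennreal \<bar>\<phi> b - \<phi> a\<bar> = ennreal (norm (\<integral>t. d' t \<partial>lborel))" by simp
	also have "... <= (\<integral>\<^sup>+t. ennreal (norm (d' t)) \<partial>lborel)"
		by (rule integral_norm_bound_ennreal[OF int])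
	also have "... <= (\<integral>\<^sup>+t. ennreal (H t) * indicator {a..b} t \<partial>lborel)"
	proof (rule nn_integral_mono_AE)
		show "AE t in lborel. ennreal (norm (d' t)) <= ennreal (H t) * indicator {a..b} t"
			using AE
		proof eventually_elim
			case (elim t)
			then show ?case using lim_q[OF elim] by (auto split: split_indicator simp: ennreal_leI)
		qed
	qed
	finally show ?thesis .
qed

text \<open>Tonelli: every point \<open>t\<close> lies in the windows \<open>{z..z + \<delta>}\<close> of a set of \<open>z\<close> of measure at most \<open>\<delta>\<close>,
	and on each of them the decreasing weight at \<open>z + \<delta>\<close> is at most its value at \<open>t\<close>.\<close>

lemma difference_quotient_energy_le:
	fixes \<phi> H w :: "real => real"
	assumes [measurable]: "H \<in> borel_measurable borel" "w \<in> borel_measurable borel"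
		and inc: "!!a b. 0 < a ==> a <= b ==> ennreal \<bar>\<phi> b - \<phi> a\<bar> <= (\<integral>\<^sup>+t. ennreal (H t) * indicator {a..b} t \<partial>lborel)"
		and w: "!!s t. 0 < s ==> s <= t ==> w t <= w s" "!!t. 0 < t ==> w t >= 0" and \<delta>: "\<delta> > 0"
	shows "(\<integral>\<^sup>+z. ennreal (indicator {0<..} z * (w (z + \<delta>) * ((\<phi> (z + \<delta>) - \<phi> z) / \<delta>)\<^sup>2)) \<partial>lborel) <=
		(\<integral>\<^sup>+t. indicator {0<..} t * (ennreal (w t) * (ennreal (H t))\<^sup>2) \<partial>lborel)"
proof -
	let ?k = "\<lambda>z t. indicator {0<..} t * (ennreal (w t) * (ennreal (H t))\<^sup>2) * (ennreal (1 / \<delta>) * indicator {t - \<delta>..t} z)"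
	have "ennreal (indicator {0<..} z * (w (z + \<delta>) * ((\<phi> (z + \<delta>) - \<phi> z) / \<delta>)\<^sup>2)) <= (\<integral>\<^sup>+t. ?k z t \<partial>lborel)" for z
	proof (cases "z > 0")
		case z: True
		let ?D = "\<phi> (z + \<delta>) - \<phi> z" and ?I = "indicator {z..z + \<delta>} :: real => ennreal"
		have "(ennreal \<bar>?D\<bar>)\<^sup>2 <= (\<integral>\<^sup>+t. ennreal (H t) * ?I t \<partial>lborel)\<^sup>2"
			using inc[of z "z + \<delta>"] z \<delta> by (intro power_mono) auto
		also have "(\<integral>\<^sup>+t. ennreal (H t) * ?I t \<partial>lborel) = (\<integral>\<^sup>+t. (ennreal (H t) * ?I t) * ?I t \<partial>lborel)"
			by (intro nn_integral_cong) (auto split: split_indicator)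
		also have "...\<^sup>2 <= (\<integral>\<^sup>+t. (ennreal (H t) * ?I t)\<^sup>2 \<partial>lborel) * (\<integral>\<^sup>+t. (?I t)\<^sup>2 \<partial>lborel)"
			by (rule Cauchy_Schwarz_nn_integral) measurable
		also have "(\<integral>\<^sup>+t. (?I t)\<^sup>2 \<partial>lborel) = (\<integral>\<^sup>+t. ?I t \<partial>lborel)"
			by (intro nn_integral_cong) (auto split: split_indicator)
		also have "... = ennreal \<delta>" using \<delta> by simp
		also have "(\<integral>\<^sup>+t. (ennreal (H t) * ?I t)\<^sup>2 \<partial>lborel) = (\<integral>\<^sup>+t. (ennreal (H t))\<^sup>2 * ?I t \<partial>lborel)"
			by (intro nn_integral_cong) (auto split: split_indicator)
		finally have cs: "ennreal (?D\<^sup>2) <= (\<integral>\<^sup>+t. (ennreal (H t))\<^sup>2 * ?I t \<partial>lborel) * ennreal \<delta>"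
			by (simp add: ennreal_power)
		have "ennreal (indicator {0<..} z * (w (z + \<delta>) * (?D / \<delta>)\<^sup>2)) = ennreal (w (z + \<delta>) / \<delta>\<^sup>2) * ennreal (?D\<^sup>2)"
			using z \<delta> w(2)[of "z + \<delta>"] by (simp add: ennreal_mult[symmetric] power_divide)
		also have "... <= ennreal (w (z + \<delta>) / \<delta>\<^sup>2) * ((\<integral>\<^sup>+t. (ennreal (H t))\<^sup>2 * ?I t \<partial>lborel) * ennreal \<delta>)"
			by (rule mult_left_mono[OF cs]) simp
		also have "... = ennreal (w (z + \<delta>) / \<delta>\<^sup>2 * \<delta>) * (\<integral>\<^sup>+t. (ennreal (H t))\<^sup>2 * ?I t \<partial>lborel)"
			using z \<delta> w(2)[of "z + \<delta>"] by (subst ennreal_mult) (simp_all add: mult_ac)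
		also have "w (z + \<delta>) / \<delta>\<^sup>2 * \<delta> = w (z + \<delta>) * (1 / \<delta>)"
			using \<delta> by (simp add: power2_eq_square)
		also have "ennreal (w (z + \<delta>) * (1 / \<delta>)) * (\<integral>\<^sup>+t. (ennreal (H t))\<^sup>2 * ?I t \<partial>lborel) =
				(\<integral>\<^sup>+t. ennreal (w (z + \<delta>) * (1 / \<delta>)) * ((ennreal (H t))\<^sup>2 * ?I t) \<partial>lborel)"
			by (rule nn_integral_cmult[symmetric]) measurable
		also have "... <= (\<integral>\<^sup>+t. ?k z t \<partial>lborel)"
		proof (rule nn_integral_mono)
			fix t
			show "ennreal (w (z + \<delta>) * (1 / \<delta>)) * ((ennreal (H t))\<^sup>2 * ?I t) <= ?k z t"
			proof (cases "t \<in> {z..z + \<delta>}")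
				case True
				then have t: "t > 0" "z \<in> {t - \<delta>..t}" using z by auto
				have "ennreal (w (z + \<delta>) * (1 / \<delta>)) <= ennreal (w t * (1 / \<delta>))"
					using w(1)[of t "z + \<delta>"] t True \<delta> by (intro ennreal_leI mult_right_mono) auto
				also have "... = ennreal (w t) * ennreal (1 / \<delta>)"
					using w(2)[OF t(1)] \<delta> by (intro ennreal_mult) auto
				finally have "ennreal (w (z + \<delta>) * (1 / \<delta>)) * (ennreal (H t))\<^sup>2 <= ennreal (w t) * ennreal (1 / \<delta>) * (ennreal (H t))\<^sup>2"
					by (rule mult_right_mono) simp
				then show ?thesis using True t by (simp only: indicator_simps mult_1_left mult_1_right greaterThan_iff) (simp add: mult_ac)
			qed simp
		qed
		finally show ?thesis .
	qed simp
	then have "(\<integral>\<^sup>+z. ennreal (indicator {0<..} z * (w (z + \<delta>) * ((\<phi> (z + \<delta>) - \<phi> z) / \<delta>)\<^sup>2)) \<partial>lborel) <=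
			(\<integral>\<^sup>+z. (\<integral>\<^sup>+t. ?k z t \<partial>lborel) \<partial>lborel)"
		by (rule nn_integral_mono)
	also have "... = (\<integral>\<^sup>+t. (\<integral>\<^sup>+z. ?k z t \<partial>lborel) \<partial>lborel)"
	proof (rule lborel_pair.Fubini'[of "?k", symmetric])
		let ?A = "{p :: real \<times> real. snd p - \<delta> <= fst p \<and> fst p <= snd p}"
		have "?A \<in> sets borel"
			by (rule borel_closed) (auto intro!: closed_Collect_conj closed_Collect_le continuous_intros)
		then have "(indicator ?A :: _ => ennreal) \<in> borel_measurable (borel \<Otimes>\<^sub>M borel)"
			unfolding borel_prod by (rule borel_measurable_indicator)
		moreover have "indicator ?A p = (indicator {snd p - \<delta>..snd p} (fst p) :: ennreal)" for p
			by (simp add: indicator_def)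
		ultimately have [measurable]: "(\<lambda>p::real \<times> real. indicator {snd p - \<delta>..snd p} (fst p) :: ennreal) \<in> borel_measurable (borel \<Otimes>\<^sub>M borel)"
			by (simp cong: measurable_cong)
		show "(\<lambda>(z, t). ?k z t) \<in> borel_measurable (lborel \<Otimes>\<^sub>M lborel)"
			unfolding case_prod_beta by measurable
	qed
	also have "... = (\<integral>\<^sup>+t. indicator {0<..} t * (ennreal (w t) * (ennreal (H t))\<^sup>2) \<partial>lborel)"
	proof (rule nn_integral_cong)
		fix t
		have "(\<integral>\<^sup>+z. ?k z t \<partial>lborel) = indicator {0<..} t * (ennreal (w t) * (ennreal (H t))\<^sup>2) *
				(ennreal (1 / \<delta>) * (\<integral>\<^sup>+z. indicator {t - \<delta>..t} z \<partial>lborel))"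
			by (simp add: nn_integral_cmult del: nn_integral_indicator)
		also have "ennreal (1 / \<delta>) * (\<integral>\<^sup>+z. indicator {t - \<delta>..t} z \<partial>lborel) = 1"
			using \<delta> by (simp add: ennreal_mult[symmetric])
		finally show "(\<integral>\<^sup>+z. ?k z t \<partial>lborel) = indicator {0<..} t * (ennreal (w t) * (ennreal (H t))\<^sup>2)" by simp
	qed
	finally show ?thesis .
qed

subsection \<open>Polarization\<close>

text \<open>For points of the ball this is the square of \<open>sinh\<close> of half the hyperbolic
  distance. Being rational in the coordinates, it can be estimated by algebra alone.\<close>

definition hyp_delta :: "'a::euclidean_space => 'a => real" where
	"hyp_delta x y = (norm (x - y))\<^sup>2 / ((1 - (norm x)\<^sup>2) * (1 - (norm y)\<^sup>2))"

lemma one_minus_norm_pos: "x \<in> hyp_space ==> 1 - (norm x)\<^sup>2 > 0"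
	by (simp add: abs_square_less_1)

text \<open>The two-point rearrangement at a mirror. Comparing the norms of \<open>x\<close> and its
  mirror image decides on which side \<open>x\<close> lies, and the larger value goes to the side of
  the origin.\<close>

definition polarize :: "'a::euclidean_space => ('a => real) => 'a => real" where
	"polarize c f x = (if norm x <= norm (inversion c x) then max (f x) (f (inversion c x)) else min (f x) (f (inversion c x)))"

definition polarize_grad :: "'a::euclidean_space => ('a => real) => ('a => real) => 'a => real" where
	"polarize_grad c f G x = (if polarize c f x = f x then G x else G (inversion c x))"

lemma polarize_cases: "polarize c f x = f x \<or> polarize c f x = f (inversion c x)"
	by (auto simp: polarize_def max_def min_def)

text \<open>Uniform bounds that survive polarization and give compactness. Continuity is measured by
  \<open>hyp_delta\<close>, which the reflections leave invariant.\<close>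

definition lip_class :: "real => real => real => ('a::euclidean_space => real) => bool" where
	"lip_class R M L f \<longleftrightarrow> (\<forall>x. 0 <= f x \<and> f x <= M) \<and> (\<forall>x. R < norm x --> f x = 0) \<and>
		(\<forall>x\<in>hyp_space. \<forall>y\<in>hyp_space. \<bar>f x - f y\<bar> <= L * sqrt (hyp_delta x y))"

lemma lip_classD:
	assumes "lip_class R M L f"
	shows "0 <= f x" "f x <= M" "R < norm x ==> f x = 0"
		"x \<in> hyp_space ==> y \<in> hyp_space ==> \<bar>f x - f y\<bar> <= L * sqrt (hyp_delta x y)"
	using assms by (auto simp: lip_class_def)

lemma lip_class_isCont:
	assumes f: "lip_class R M L f" and x: "x \<in> hyp_space"
	shows "isCont f x"
	unfolding isCont_def
proof (rule LIM_zero_cancel, rule Lim_null_comparison)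
	have "\<forall>\<^sub>F y in at x. y \<in> hyp_space"
		using x by (intro eventually_at_in_open' open_ball)
	then show "\<forall>\<^sub>F y in at x. norm (f y - f x) <= L * sqrt (hyp_delta y x)"
		by eventually_elim (use lip_classD(4)[OF f _ x] in simp)
	have "((\<lambda>y. L * sqrt (hyp_delta y x)) \<longlongrightarrow> L * sqrt (hyp_delta x x)) (at x)"
		unfolding hyp_delta_def using one_minus_norm_pos[OF x] by (intro tendsto_intros) auto
	then show "((\<lambda>y. L * sqrt (hyp_delta y x)) \<longlongrightarrow> 0) (at x)" by (simp add: hyp_delta_def)
qed

lemma lip_class_measurable:
	assumes f: "lip_class R M L f" and R: "R < 1"
	shows "f \<in> borel_measurable borel"
proof -
	have "(\<lambda>x. indicator hyp_space x *\<^sub>R f x) \<in> borel_measurable borel"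
		by (rule borel_measurable_continuous_on_indicator)
			(auto intro!: continuous_at_imp_continuous_on lip_class_isCont[OF f])
	moreover have "(\<lambda>x. indicator hyp_space x *\<^sub>R f x) = f"
		using lip_classD(3)[OF f] R by (auto simp: fun_eq_iff not_less split: split_indicator)
	ultimately show ?thesis by simp
qed

definition upper_grad :: "('a::euclidean_space => real) => ('a => real) => bool" where
	"upper_grad f G \<longleftrightarrow> (\<forall>\<gamma> \<gamma>'. (\<forall>t>0. \<gamma> t \<in> hyp_space \<and> (\<gamma> has_vector_derivative \<gamma>' t) (at t)) -->
		 (\<exists>K. countable K \<and> (\<forall>t>0. t \<notin> K --> (\<exists>d. ((\<lambda>t. f (\<gamma> t)) has_real_derivative d) (at t) \<and>
				\<bar>d\<bar> <= G (\<gamma> t) * (conf_factor (\<gamma> t) * norm (\<gamma>' t))))))"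

definition admissible :: "real => real => real => ('a::euclidean_space => real) => real => ('a => real) => ('a => real) => bool" where
	"admissible R M L W p v f \<longleftrightarrow> lip_class R M L f \<and>
		(\<exists>G. G \<in> borel_measurable borel \<and> (\<forall>x. 0 <= G x) \<and> upper_grad f G \<and>
			 (\<integral>\<^sup>+x. ennreal ((G x)\<^sup>2) \<partial>hyp_vol) <= (\<integral>\<^sup>+x. ennreal ((hyp_grad_norm v x)\<^sup>2) \<partial>hyp_vol)) \<and>
		(\<integral>\<^sup>+x. ennreal ((f x)\<^sup>2) \<partial>hyp_vol) = (\<integral>\<^sup>+x. ennreal ((v x)\<^sup>2) \<partial>hyp_vol) \<and>
		(\<integral>\<^sup>+x. ennreal (W x * \<bar>v x\<bar> powr p) \<partial>hyp_vol) <= (\<integral>\<^sup>+x. ennreal (W x * f x powr p) \<partial>hyp_vol)"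

lemma AE_hyp_vol_neq: "AE x in hyp_vol. x ~= (a::'a::euclidean_space)"
	unfolding hyp_vol_def
proof (subst AE_density)
	have [measurable]: "(hyp_space :: 'a set) \<in> sets borel" by simp
	show "(\<lambda>x. ennreal (indicator hyp_space x * conf_factor x ^ DIM('a))) \<in> borel_measurable (lborel :: 'a measure)"
		by measurable
qed (auto intro: eventually_mono[OF AE_lborel_singleton[of a]])

context
	fixes c :: "'a::euclidean_space"
	assumes c: "norm c > 1"
begin

lemma norm_le_inversion_iff:
	assumes x: "x \<in> hyp_space"
	shows "norm x <= norm (inversion c x) \<longleftrightarrow> (norm c)\<^sup>2 - 1 <= (norm (x - c))\<^sup>2"
proof -
	have u: "(norm (x - c))\<^sup>2 > 0" using center_neq[OF c x] by simp
	have e: "1 - (norm (inversion c x))\<^sup>2 = (1 - (norm x)\<^sup>2) * (((norm c)\<^sup>2 - 1) / (norm (x - c))\<^sup>2)"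
		by (rule one_minus_norm_inversion[OF c center_neq[OF c x]])
	have "norm x <= norm (inversion c x) \<longleftrightarrow> (1 - (norm x)\<^sup>2) * (((norm c)\<^sup>2 - 1) / (norm (x - c))\<^sup>2) <= (1 - (norm x)\<^sup>2) * 1"
		unfolding e[symmetric] by (simp add: abs_le_square_iff[symmetric])
	also have "... \<longleftrightarrow> ((norm c)\<^sup>2 - 1) / (norm (x - c))\<^sup>2 <= 1"
		using one_minus_norm_pos[OF x] by (rule mult_le_cancel_left_pos)
	also have "... \<longleftrightarrow> (norm c)\<^sup>2 - 1 <= (norm (x - c))\<^sup>2" using u by (simp add: pos_divide_le_eq)
	finally show ?thesis .
qed

lemma norm_inversion_eq_imp:
	assumes x: "x \<in> hyp_space" and eq: "norm (inversion c x) = norm x"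
	shows "inversion c x = x"
proof -
	have u: "(norm (x - c))\<^sup>2 > 0" using center_neq[OF c x] by simp
	have "(1 - (norm x)\<^sup>2) * (((norm c)\<^sup>2 - 1) / (norm (x - c))\<^sup>2) = (1 - (norm x)\<^sup>2) * 1"
		using one_minus_norm_inversion[OF c center_neq[OF c x]] eq by simp
	then have "((norm c)\<^sup>2 - 1) / (norm (x - c))\<^sup>2 = 1"
		using one_minus_norm_pos[OF x] by (metis less_irrefl mult_left_cancel)
	then show ?thesis unfolding inversion_def by (simp only: scaleR_one) simp
qed

lemma inversion_in_hyp_space: "x \<in> hyp_space ==> inversion c x \<in> hyp_space"
	using inversion_in_hyp_space_iff[OF c] by blast

lemma polarize_pair:
	assumes x: "x \<in> hyp_space"
	shows "polarize c f x = f x \<and> polarize c f (inversion c x) = f (inversion c x) \<or>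
		polarize c f x = f (inversion c x) \<and> polarize c f (inversion c x) = f x"
	using norm_inversion_eq_imp[OF x] inversion_inversion[OF c, of x]
	by (cases "norm (inversion c x)" "norm x" rule: linorder_cases) (auto simp: polarize_def max_def min_def)

lemma hyp_delta_inversion:
	assumes "x \<in> hyp_space" "y \<in> hyp_space"
	shows "hyp_delta (inversion c x) (inversion c y) = hyp_delta x y"
	unfolding hyp_delta_def by (rule inversion_delta[OF c center_neq[OF c assms(1)] center_neq[OF c assms(2)]])

text \<open>Reflecting \<open>y\<close> to the side of \<open>x\<close> brings it closer. The mirror
  is the sphere of squared radius \<open>k\<close> about \<open>c\<close>; the two points lie on
  different sides of it, so \<open>((norm u)^2 - k) * (k - (norm w)^2)\<close> is nonnegative, and
  this product is what separates the two values of \<open>hyp_delta\<close>.\<close>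

lemma hyp_delta_opposite:
	assumes x: "x \<in> hyp_space" and y: "y \<in> hyp_space"
		and sx: "norm x <= norm (inversion c x)" and sy: "norm (inversion c y) <= norm y"
	shows "hyp_delta x (inversion c y) <= hyp_delta x y"
proof -
	define k where "k = (norm c)\<^sup>2 - 1"
	have k: "k > 0" using inversion_radius_pos[OF c] by (simp add: k_def)
	define u w where "u = x - c" and "w = y - c"
	have w: "norm w > 0" using center_neq[OF c y] by (simp add: w_def)
	have su: "k <= (norm u)\<^sup>2" using norm_le_inversion_iff[OF x] sx by (simp add: k_def u_def)
	have sw: "(norm w)\<^sup>2 <= k"
	proof (cases "norm (inversion c y) = norm y")
		case True
		have "(1 - (norm y)\<^sup>2) * (k / (norm w)\<^sup>2) = (1 - (norm y)\<^sup>2) * 1"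
			using one_minus_norm_inversion[OF c center_neq[OF c y]] True by (simp add: k_def w_def)
		then have "k / (norm w)\<^sup>2 = 1"
			using one_minus_norm_pos[OF y] by (metis less_irrefl mult_left_cancel)
		then show ?thesis using w by (simp add: divide_eq_1_iff)
	next
		case False
		then show ?thesis using norm_le_inversion_iff[OF y] sy by (simp add: k_def w_def)
	qed
	let ?a = "1 - (norm x)\<^sup>2" and ?b = "1 - (norm y)\<^sup>2"
	have ab: "?a > 0" "?b > 0" using one_minus_norm_pos x y by auto
	have Iy: "1 - (norm (inversion c y))\<^sup>2 = ?b * (k / (norm w)\<^sup>2)"
		using one_minus_norm_inversion[OF c center_neq[OF c y]] by (simp add: k_def w_def)
	have xIy: "x - inversion c y = u - (k / (norm w)\<^sup>2) *\<^sub>R w"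
		by (simp add: inversion_def k_def u_def w_def)
	have "(norm (u - s *\<^sub>R w))\<^sup>2 = (norm u)\<^sup>2 - 2 * s * (u \<bullet> w) + s\<^sup>2 * (norm w)\<^sup>2" for s
		by (simp only: power2_norm_eq_inner) (simp add: inner_diff inner_commute power2_eq_square algebra_simps)
	then have "(norm (u - (k / (norm w)\<^sup>2) *\<^sub>R w))\<^sup>2 = (norm u)\<^sup>2 - 2 * (k / (norm w)\<^sup>2) * (u \<bullet> w) + (k / (norm w)\<^sup>2)\<^sup>2 * (norm w)\<^sup>2" .
	also have "(k / (norm w)\<^sup>2)\<^sup>2 * (norm w)\<^sup>2 = k / (norm w)\<^sup>2 * k"
		using w by (simp add: power2_eq_square)
	finally have e1: "(norm (x - inversion c y))\<^sup>2 = (k / (norm w)\<^sup>2) * ((norm u)\<^sup>2 * (norm w)\<^sup>2 / k - 2 * (u \<bullet> w) + k)"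
		unfolding xIy using w k by (simp add: algebra_simps)
	have e2: "(norm (x - y))\<^sup>2 = (norm u)\<^sup>2 - 2 * (u \<bullet> w) + (norm w)\<^sup>2"
	proof -
		have "x - y = u - w" by (simp add: u_def w_def)
		then show ?thesis unfolding \<open>x - y = u - w\<close> power2_norm_eq_inner by (simp add: inner_diff inner_commute)
	qed
	have "((norm u)\<^sup>2 - k) * (k - (norm w)\<^sup>2) >= 0" using su sw by simp
	then have "(norm u)\<^sup>2 * (norm w)\<^sup>2 <= ((norm u)\<^sup>2 + (norm w)\<^sup>2 - k) * k"
		by (simp add: algebra_simps)
	then have le: "(norm u)\<^sup>2 * (norm w)\<^sup>2 / k - 2 * (u \<bullet> w) + k <= (norm (x - y))\<^sup>2"
		unfolding e2 using pos_divide_le_eq[OF k, of "(norm u)\<^sup>2 * (norm w)\<^sup>2" "(norm u)\<^sup>2 + (norm w)\<^sup>2 - k"] by linarith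
	have "hyp_delta x (inversion c y) = ((norm u)\<^sup>2 * (norm w)\<^sup>2 / k - 2 * (u \<bullet> w) + k) / (?a * ?b)"
	proof -
		have s: "k / (norm w)\<^sup>2 > 0" using k w by simp
		have "s * A / (a * (b * s)) = A / (a * b)" if "s > 0" for s A a b :: real
			using that by simp
		from this[OF s] show ?thesis unfolding hyp_delta_def e1 Iy .
	qed
	also have "... <= (norm (x - y))\<^sup>2 / (?a * ?b)"
		using le ab by (intro divide_right_mono) auto
	finally show ?thesis by (simp add: hyp_delta_def)
qed

text \<open>On the same side of the mirror, maximum and minimum inherit the bound from the two pairs
  of corresponding points. On opposite sides the cross comparisons are needed as well, and
  \<open>hyp_delta_opposite\<close> supplies them.\<close>

lemma polarize_lip_class:
	assumes f: "lip_class R M L f" and R: "R < 1" and L: "L >= 0"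
	shows "lip_class R M L (polarize c f)"
	unfolding lip_class_def
proof (intro conjI allI impI ballI)
	fix x
	show "0 <= polarize c f x" "polarize c f x <= M"
		using polarize_cases[of c f x] lip_classD(1,2)[OF f] by metis+
next
	fix x :: 'a assume x: "R < norm x"
	show "polarize c f x = 0"
	proof (cases "norm x <= norm (inversion c x)")
		case True
		then show ?thesis using x lip_classD(3)[OF f, of x] lip_classD(3)[OF f, of "inversion c x"]
			by (simp add: polarize_def)
	next
		case False
		then show ?thesis using lip_classD(3)[OF f x] lip_classD(1)[OF f, of "inversion c x"]
			by (simp add: polarize_def)
	qed
next
	have D: "\<bar>f u - f w\<bar> <= B" if "u \<in> hyp_space" "w \<in> hyp_space" "L * sqrt (hyp_delta u w) <= B" for u w B
		using lip_classD(4)[OF f that(1,2)] that(3) by simp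
	have opp: "\<bar>max (f x) (f (inversion c x)) - min (f y) (f (inversion c y))\<bar> <= L * sqrt (hyp_delta x y)"
		if x: "x \<in> hyp_space" and y: "y \<in> hyp_space"
			and sx: "norm x <= norm (inversion c x)" and sy: "norm (inversion c y) <= norm y" for x y
	proof -
		have le: "L * sqrt (hyp_delta x (inversion c y)) <= L * sqrt (hyp_delta x y)"
			using hyp_delta_opposite[OF x y sx sy] L by (intro mult_left_mono) auto
		have le': "L * sqrt (hyp_delta (inversion c x) y) <= L * sqrt (hyp_delta x y)"
			using le hyp_delta_inversion[OF x inversion_in_hyp_space[OF y]] inversion_inversion[OF c, of y] by simp
		have eq: "L * sqrt (hyp_delta (inversion c x) (inversion c y)) <= L * sqrt (hyp_delta x y)"
			using hyp_delta_inversion[OF x y] by simp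
		note X = inversion_in_hyp_space[OF x] and Y = inversion_in_hyp_space[OF y]
		show ?thesis
			using D[OF x y order_refl] D[OF x Y le] D[OF X y le'] D[OF X Y eq]
			by (auto simp: max_def min_def)
	qed
	fix x y :: 'a assume x: "x \<in> hyp_space" and y: "y \<in> hyp_space"
	have eq: "L * sqrt (hyp_delta (inversion c x) (inversion c y)) <= L * sqrt (hyp_delta x y)"
		using hyp_delta_inversion[OF x y] by simp
	note same = D[OF x y order_refl] D[OF inversion_in_hyp_space[OF x] inversion_in_hyp_space[OF y] eq]
	have sym: "hyp_delta y x = hyp_delta x y" by (simp add: hyp_delta_def norm_minus_commute mult.commute)
	consider "norm x <= norm (inversion c x) \<longleftrightarrow> norm y <= norm (inversion c y)"
		| "norm x <= norm (inversion c x)" "\<not> norm y <= norm (inversion c y)"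
		| "norm y <= norm (inversion c y)" "\<not> norm x <= norm (inversion c x)" by blast
	then show "\<bar>polarize c f x - polarize c f y\<bar> <= L * sqrt (hyp_delta x y)"
	proof cases
		case 1
		then show ?thesis using same by (auto simp: polarize_def max_def min_def)
	next
		case 2
		then show ?thesis using opp[OF x y] by (simp add: polarize_def)
	next
		case 3
		then show ?thesis using opp[OF y x] sym by (simp add: polarize_def abs_minus_commute)
	qed
qed

text \<open>The reflection preserves volume, so twice an integral is the integral of the sum over a
  point and its mirror image. Integral comparisons under polarization thus reduce to two-point
  inequalities.\<close>

lemma nn_integral_pair_le:
	fixes F F' :: "'a => ennreal"
	assumes [measurable]: "F \<in> borel_measurable borel" "F' \<in> borel_measurable borel"
		and le: "AE x in hyp_vol. F x + F (inversion c x) <= F' x + F' (inversion c x)"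
	shows "(\<integral>\<^sup>+x. F x \<partial>hyp_vol) <= (\<integral>\<^sup>+x. F' x \<partial>hyp_vol)"
proof -
	note [measurable] = inversion_measurable[OF c]
	have pair: "(\<integral>\<^sup>+x. F x + F (inversion c x) \<partial>hyp_vol) = 2 * (\<integral>\<^sup>+x. F x \<partial>hyp_vol)"
		if [measurable]: "F \<in> borel_measurable borel" for F
		by (subst nn_integral_add) (simp_all add: nn_integral_hyp_vol_inversion[OF c] mult_2)
	have "2 * (\<integral>\<^sup>+x. F x \<partial>hyp_vol) <= 2 * (\<integral>\<^sup>+x. F' x \<partial>hyp_vol)"
		unfolding pair[OF assms(1), symmetric] pair[OF assms(2), symmetric] by (rule nn_integral_mono_AE[OF le])
	then show ?thesis by (simp add: ennreal_mult_le_mult_iff)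
qed

lemma AE_inversion_pair: "AE x in hyp_vol. x \<in> hyp_space \<and> x ~= 0 \<and> inversion c x ~= 0"
	using AE_hyp_vol AE_hyp_vol_neq[of 0] AE_hyp_vol_neq[of "inversion c 0"]
	by eventually_elim (use inversion_inversion[OF c] in metis)

text \<open>The rearrangement inequality for two numbers: the sum of products is largest when the
  larger value meets the larger weight, which is the one nearer to the origin.\<close>

lemma weighted_pair_le:
	fixes w :: "'a => real" and \<Psi> :: "real => real"
	assumes x: "x \<in> hyp_space" "x ~= 0" "inversion c x ~= 0"
		and w: "!!x y. x \<in> hyp_space ==> y \<in> hyp_space ==> x ~= 0 ==> y ~= 0 ==> norm x <= norm y ==> w y <= w x"
		and \<Psi>: "mono_on {0..} \<Psi>" and f: "!!x. f x >= 0"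
	shows "w x * \<Psi> (f x) + w (inversion c x) * \<Psi> (f (inversion c x)) <=
		w x * \<Psi> (polarize c f x) + w (inversion c x) * \<Psi> (polarize c f (inversion c x))" (is "?l <= ?r")
proof -
	let ?y = "inversion c x"
	have y: "?y \<in> hyp_space" by (rule inversion_in_hyp_space[OF x(1)])
	have m: "\<Psi> (f a) <= \<Psi> (f b)" if "f a <= f b" for a b
		using \<Psi> f that by (auto simp: mono_on_def)
	have rearr: "a * s + b * t <= a * t + b * s" if "b <= a" "s <= t" for a b s t :: real
		using mult_nonneg_nonneg[of "a - b" "t - s"] that by (simp add: algebra_simps)
	consider "norm x < norm ?y" | "norm x = norm ?y" | "norm ?y < norm x" by linarith
	then show ?thesis
	proof cases
		case 1
		then have "polarize c f x = max (f x) (f ?y)" "polarize c f ?y = min (f x) (f ?y)"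
			by (auto simp: polarize_def inversion_inversion[OF c] min.commute)
		then show ?thesis
			using rearr[of "w ?y" "w x" "\<Psi> (f x)" "\<Psi> (f ?y)"] w[OF x(1) y x(2,3)] m[of x ?y] 1
			by (cases "f x <= f ?y") (auto simp: max_def min_def)
	next
		case 2
		then show ?thesis using norm_inversion_eq_imp[OF x(1)] by (simp add: polarize_def)
	next
		case 3
		then have "polarize c f x = min (f x) (f ?y)" "polarize c f ?y = max (f x) (f ?y)"
			by (auto simp: polarize_def inversion_inversion[OF c] max.commute)
		then show ?thesis
			using rearr[of "w x" "w ?y" "\<Psi> (f ?y)" "\<Psi> (f x)"] w[OF y x(1,3,2)] m[of ?y x] 3
			by (cases "f ?y <= f x") (auto simp: max_def min_def add.commute)
	qed
qed

lemma polarize_measurable: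
	assumes [measurable]: "f \<in> borel_measurable borel"
	shows "polarize c f \<in> borel_measurable borel"
proof -
	note [measurable] = inversion_measurable[OF c]
	show ?thesis unfolding polarize_def[abs_def] by measurable
qed

lemma nn_integral_polarize_le:
	assumes [measurable]: "f \<in> borel_measurable borel" "w \<in> borel_measurable borel" "\<Psi> \<in> borel_measurable borel"
		and w: "!!x y. x \<in> hyp_space ==> y \<in> hyp_space ==> x ~= 0 ==> y ~= 0 ==> norm x <= norm y ==> w y <= w x"
		and w0: "!!x. x \<in> hyp_space ==> w x >= 0"
		and \<Psi>: "mono_on {0..} \<Psi>" "!!t. t >= 0 ==> \<Psi> t >= 0" and f: "!!x. f x >= 0"
	shows "(\<integral>\<^sup>+x. ennreal (w x * \<Psi> (f x)) \<partial>hyp_vol) <= (\<integral>\<^sup>+x. ennreal (w x * \<Psi> (polarize c f x)) \<partial>hyp_vol)"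
proof (rule nn_integral_pair_le)
	note [measurable] = polarize_measurable[OF assms(1)]
	show "(\<lambda>x. ennreal (w x * \<Psi> (f x))) \<in> borel_measurable borel"
		"(\<lambda>x. ennreal (w x * \<Psi> (polarize c f x))) \<in> borel_measurable borel" by measurable
	show "AE x in hyp_vol. ennreal (w x * \<Psi> (f x)) + ennreal (w (inversion c x) * \<Psi> (f (inversion c x)))
			<= ennreal (w x * \<Psi> (polarize c f x)) + ennreal (w (inversion c x) * \<Psi> (polarize c f (inversion c x)))"
		using AE_inversion_pair
	proof eventually_elim
		case (elim x)
		have p: "polarize c f z >= 0" for z using polarize_cases[of c f z] f by metis
		have nn: "w z * \<Psi> s >= 0" if "z \<in> hyp_space" "s >= 0" for z s using that w0 \<Psi>(2) by simp
		have "x \<in> hyp_space" "inversion c x \<in> hyp_space" using elim inversion_in_hyp_space by auto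
		note nn = nn[OF this(1)] nn[OF this(2)]
		have "w x * \<Psi> (f x) + w (inversion c x) * \<Psi> (f (inversion c x)) <=
			w x * \<Psi> (polarize c f x) + w (inversion c x) * \<Psi> (polarize c f (inversion c x))"
			by (rule weighted_pair_le[where w=w and \<Psi>=\<Psi> and f=f]) (use elim w \<Psi>(1) f in blast)+
		then show ?case
			using nn(1)[OF f] nn(2)[OF f] nn(1)[OF p] nn(2)[OF p]
			by (simp only: ennreal_plus[symmetric] ennreal_leI)
	qed
qed

text \<open>Along a curve the polarized function selects between \<open>f\<close> on the curve and
  \<open>f\<close> on its mirror image. Both curves have the same hyperbolic speed, and
  \<open>selection_deriv\<close> provides the derivative off the exceptional sets of both and the
  isolated points where the branches meet.\<close>

lemma polarize_upper_grad:
	assumes f: "lip_class R M L f" and R: "R < 1" and L: "L >= 0" and G: "upper_grad f G"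
	shows "upper_grad (polarize c f) (polarize_grad c f G)"
	unfolding upper_grad_def
proof (intro allI impI)
	fix \<gamma> \<gamma>' :: "real => 'a"
	assume \<gamma>: "\<forall>t>0. \<gamma> t \<in> hyp_space \<and> (\<gamma> has_vector_derivative \<gamma>' t) (at t)"
	define \<eta> \<eta>' where "\<eta> t = inversion c (\<gamma> t)" and "\<eta>' t = inversion_deriv c (\<gamma> t) (\<gamma>' t)" for t
	have neq: "\<gamma> t ~= c" if "t > 0" for t using \<gamma> center_neq[OF c] that by blast
	have \<eta>: "\<eta> t \<in> hyp_space \<and> (\<eta> has_vector_derivative \<eta>' t) (at t)" if t: "t > 0" for t
	proof
		show "\<eta> t \<in> hyp_space" unfolding \<eta>_def using \<gamma> t by (intro inversion_in_hyp_space) auto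
		have "(inversion c has_derivative inversion_deriv c (\<gamma> t)) (at (\<gamma> t))"
			by (rule inversion_has_derivative[OF c neq[OF t]])
		moreover have "(\<gamma> has_derivative (\<lambda>h. h *\<^sub>R \<gamma>' t)) (at t)"
			using \<gamma> t by (simp add: has_vector_derivative_def)
		ultimately have "((\<lambda>t. inversion c (\<gamma> t)) has_derivative (\<lambda>h. inversion_deriv c (\<gamma> t) (h *\<^sub>R \<gamma>' t))) (at t)"
			by (rule has_derivative_compose[rotated])
		then show "(\<eta> has_vector_derivative \<eta>' t) (at t)"
			unfolding has_vector_derivative_def \<eta>_def[abs_def] \<eta>'_def
			using linear_scale[OF has_derivative_linear[OF inversion_has_derivative[OF c neq[OF t]]]] by simp
	qed
	have speed: "conf_factor (\<eta> t) * norm (\<eta>' t) = conf_factor (\<gamma> t) * norm (\<gamma>' t)" if t: "t > 0" for t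
		unfolding \<eta>_def \<eta>'_def norm_inversion_deriv[OF c neq[OF t]] conf_factor_inversion[OF c neq[OF t], symmetric]
		by simp
	obtain K1 where K1: "countable K1" "!!t. t > 0 ==> t \<notin> K1 ==>
			\<exists>d. ((\<lambda>t. f (\<gamma> t)) has_real_derivative d) (at t) \<and> \<bar>d\<bar> <= G (\<gamma> t) * (conf_factor (\<gamma> t) * norm (\<gamma>' t))"
		using G \<gamma> unfolding upper_grad_def by metis
	obtain K2 where K2: "countable K2" "!!t. t > 0 ==> t \<notin> K2 ==>
			\<exists>d. ((\<lambda>t. f (\<eta> t)) has_real_derivative d) (at t) \<and> \<bar>d\<bar> <= G (\<eta> t) * (conf_factor (\<eta> t) * norm (\<eta>' t))"
		using G \<eta> unfolding upper_grad_def by metis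
	define A where "A = {s. f (\<gamma> s) = f (\<eta> s)}"
	show "\<exists>K. countable K \<and> (\<forall>t>0. t \<notin> K --> (\<exists>d. ((\<lambda>t. polarize c f (\<gamma> t)) has_real_derivative d) (at t) \<and>
			\<bar>d\<bar> <= polarize_grad c f G (\<gamma> t) * (conf_factor (\<gamma> t) * norm (\<gamma>' t))))"
	proof (rule exI[of _ "K1 \<union> K2 \<union> {t\<in>A. \<not> t islimpt A}"], intro conjI allI impI)
		show "countable (K1 \<union> K2 \<union> {t\<in>A. \<not> t islimpt A})"
			using K1(1) K2(1) countable_isolated_points by auto
		fix t :: real assume t: "t > 0" and tK: "t \<notin> K1 \<union> K2 \<union> {t\<in>A. \<not> t islimpt A}"
		obtain d1 where d1: "((\<lambda>t. f (\<gamma> t)) has_real_derivative d1) (at t)" "\<bar>d1\<bar> <= G (\<gamma> t) * (conf_factor (\<gamma> t) * norm (\<gamma>' t))"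
			using K1(2)[OF t] tK by auto
		obtain d2 where d2: "((\<lambda>t. f (\<eta> t)) has_real_derivative d2) (at t)" "\<bar>d2\<bar> <= G (\<eta> t) * (conf_factor (\<eta> t) * norm (\<eta>' t))"
			using K2(2)[OF t] tK by auto
		have "isCont \<gamma> t" using \<gamma> t has_vector_derivative_continuous by blast
		then have "isCont (\<lambda>t. polarize c f (\<gamma> t)) t"
			by (rule isCont_o2) (use lip_class_isCont[OF polarize_lip_class[OF f R L]] \<gamma> t in blast)
		moreover have "polarize c f (\<gamma> s) = f (\<gamma> s) \<or> polarize c f (\<gamma> s) = f (\<eta> s)" for s
			using polarize_cases[of c f "\<gamma> s"] by (simp add: \<eta>_def)
		moreover have "f (\<gamma> t) ~= f (\<eta> t) \<or> t islimpt {s. f (\<gamma> s) = f (\<eta> s)}"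
			using tK by (auto simp: A_def)
		ultimately obtain d where d: "((\<lambda>t. polarize c f (\<gamma> t)) has_real_derivative d) (at t)"
			"polarize c f (\<gamma> t) = f (\<gamma> t) ==> d = d1" "polarize c f (\<gamma> t) = f (\<eta> t) ==> d = d2"
			using selection_deriv[OF d1(1) d2(1), of "\<lambda>t. polarize c f (\<gamma> t)"] by blast
		have "\<bar>d\<bar> <= polarize_grad c f G (\<gamma> t) * (conf_factor (\<gamma> t) * norm (\<gamma>' t))"
		proof (cases "polarize c f (\<gamma> t) = f (\<gamma> t)")
			case True
			then show ?thesis using d(2) d1(2) by (simp add: polarize_grad_def)
		next
			case False
			then have "polarize c f (\<gamma> t) = f (\<eta> t)" using polarize_cases[of c f "\<gamma> t"] by (simp add: \<eta>_def)
			then show ?thesis using d(3) d2(2) False speed[OF t] by (simp add: polarize_grad_def \<eta>_def)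
		qed
		then show "\<exists>d. ((\<lambda>t. polarize c f (\<gamma> t)) has_real_derivative d) (at t) \<and>
				\<bar>d\<bar> <= polarize_grad c f G (\<gamma> t) * (conf_factor (\<gamma> t) * norm (\<gamma>' t))"
			using d(1) by blast
	qed
qed

lemma polarize_grad_pair:
	assumes x: "x \<in> hyp_space"
	shows "polarize_grad c f G x = G x \<and> polarize_grad c f G (inversion c x) = G (inversion c x) \<or>
		polarize_grad c f G x = G (inversion c x) \<and> polarize_grad c f G (inversion c x) = G x"
	using polarize_pair[OF x, of f] inversion_inversion[OF c, of x] by (auto simp: polarize_grad_def)

lemma polarize_grad_measurable:
	assumes [measurable]: "f \<in> borel_measurable borel" "G \<in> borel_measurable borel"
	shows "polarize_grad c f G \<in> borel_measurable borel"
proof -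
	note [measurable] = inversion_measurable[OF c] polarize_measurable[OF assms(1)]
	show ?thesis unfolding polarize_grad_def[abs_def] by measurable
qed

lemma polarize_admissible:
	assumes f: "admissible R M L W p v f" and R: "R < 1" and L: "L >= 0" and p: "p > 0"
		and W [measurable]: "W \<in> borel_measurable borel" and W0: "!!x. W x >= 0"
		and Wm: "!!x y. x \<in> hyp_space ==> y \<in> hyp_space ==> x ~= 0 ==> y ~= 0 ==> norm x <= norm y ==> W y <= W x"
	shows "admissible R M L W p v (polarize c f)"
proof -
	note fD = f[unfolded admissible_def]
	have lc: "lip_class R M L f" using fD by blast
	obtain G where G [measurable]: "G \<in> borel_measurable borel" and G0: "!!x. G x >= 0" and Gu: "upper_grad f G"
		and GE: "(\<integral>\<^sup>+x. ennreal ((G x)\<^sup>2) \<partial>hyp_vol) <= (\<integral>\<^sup>+x. ennreal ((hyp_grad_norm v x)\<^sup>2) \<partial>hyp_vol)"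
		using fD by blast
	have fm [measurable]: "f \<in> borel_measurable borel" by (rule lip_class_measurable[OF lc R])
	have f0: "f x >= 0" for x by (rule lip_classD(1)[OF lc])
	note [measurable] = polarize_measurable[OF fm] polarize_grad_measurable[OF fm G]
	have "(\<integral>\<^sup>+x. ennreal ((polarize_grad c f G x)\<^sup>2) \<partial>hyp_vol) <= (\<integral>\<^sup>+x. ennreal ((G x)\<^sup>2) \<partial>hyp_vol)"
		by (rule nn_integral_pair_le)
			(measurable, rule eventually_mono[OF AE_hyp_vol], use polarize_grad_pair[of _ f G] in \<open>force simp: add.commute\<close>)
	moreover have "\<exists>H. H \<in> borel_measurable borel \<and> (\<forall>x. 0 <= H x) \<and> upper_grad (polarize c f) H \<and>
			(\<integral>\<^sup>+x. ennreal ((H x)\<^sup>2) \<partial>hyp_vol) <= (\<integral>\<^sup>+x. ennreal ((hyp_grad_norm v x)\<^sup>2) \<partial>hyp_vol)"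
	proof (rule exI[of _ "polarize_grad c f G"], intro conjI allI)
		show "0 <= polarize_grad c f G x" for x using G0 by (simp add: polarize_grad_def)
		show "(\<integral>\<^sup>+x. ennreal ((polarize_grad c f G x)\<^sup>2) \<partial>hyp_vol) <= (\<integral>\<^sup>+x. ennreal ((hyp_grad_norm v x)\<^sup>2) \<partial>hyp_vol)"
			using calculation GE by (rule order_trans)
	qed (use polarize_upper_grad[OF lc R L Gu] polarize_grad_measurable[OF fm G] in simp_all)
	moreover have "(\<integral>\<^sup>+x. ennreal ((polarize c f x)\<^sup>2) \<partial>hyp_vol) = (\<integral>\<^sup>+x. ennreal ((f x)\<^sup>2) \<partial>hyp_vol)"
		by (rule antisym; rule nn_integral_pair_le)
			(measurable, rule eventually_mono[OF AE_hyp_vol], use polarize_pair[of _ f] in \<open>force simp: add.commute\<close>)+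
	moreover have "(\<integral>\<^sup>+x. ennreal (W x * f x powr p) \<partial>hyp_vol) <= (\<integral>\<^sup>+x. ennreal (W x * polarize c f x powr p) \<partial>hyp_vol)"
		by (rule nn_integral_polarize_le[where \<Psi>="\<lambda>t. t powr p"])
			(use p W0 Wm f0 in \<open>auto simp: mono_on_def intro!: powr_mono2\<close>)
	moreover have "(\<integral>\<^sup>+x. ennreal ((f x)\<^sup>2) \<partial>hyp_vol) = (\<integral>\<^sup>+x. ennreal ((v x)\<^sup>2) \<partial>hyp_vol)"
		"(\<integral>\<^sup>+x. ennreal (W x * \<bar>v x\<bar> powr p) \<partial>hyp_vol) <= (\<integral>\<^sup>+x. ennreal (W x * f x powr p) \<partial>hyp_vol)"
		using fD by blast+
	ultimately show ?thesis
		using polarize_lip_class[OF lc R L] unfolding admissible_def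
		by - (intro conjI; (assumption | (erule trans, assumption) | (rule order_trans, assumption, assumption)))
qed

end

subsection \<open>Symmetrization\<close>

lemma norm_diff_le_hyp_delta:
	assumes "x \<in> hyp_space" "y \<in> hyp_space"
	shows "norm (x - y) <= sqrt (hyp_delta x y)"
proof -
	have ab: "0 < 1 - (norm x)\<^sup>2" "0 < 1 - (norm y)\<^sup>2" using one_minus_norm_pos assms by auto
	have "(1 - (norm x)\<^sup>2) * (1 - (norm y)\<^sup>2) <= 1 * 1" using ab by (intro mult_mono) auto
	then have "(norm (x - y))\<^sup>2 / 1 <= (norm (x - y))\<^sup>2 / ((1 - (norm x)\<^sup>2) * (1 - (norm y)\<^sup>2))"
		using ab by (intro divide_left_mono) auto
	then show ?thesis by (simp add: hyp_delta_def real_le_rsqrt)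
qed

lemma hyp_delta_le:
	assumes R: "R < 1" and x: "norm x <= R" and y: "norm y <= R"
	shows "sqrt (hyp_delta x y) <= norm (x - y) / (1 - R\<^sup>2)"
proof -
	have "0 <= R" using x norm_ge_zero[of x] by linarith
	then have R2: "1 - R\<^sup>2 > 0" using R by (simp add: power_less_one_iff abs_square_less_1)
	have *: "1 - R\<^sup>2 <= 1 - (norm x)\<^sup>2" "1 - R\<^sup>2 <= 1 - (norm y)\<^sup>2" using x y by (simp_all add: power_mono)
	have "hyp_delta x y <= (norm (x - y))\<^sup>2 / ((1 - R\<^sup>2) * (1 - R\<^sup>2))"
		unfolding hyp_delta_def using * R2 by (intro divide_left_mono mult_mono mult_pos_pos) auto
	also have "... = (norm (x - y) / (1 - R\<^sup>2))\<^sup>2" by (simp add: power2_eq_square)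
	finally show ?thesis using R2 by (intro real_le_lsqrt) auto
qed

text \<open>The starting point of the symmetrization. The absolute value is a selection between
  \<open>v\<close> and \<open>- v\<close>, so its zeros are handled by
  \<open>selection_deriv\<close> as well.\<close>

lemma admissible_abs:
	fixes v :: "'a::euclidean_space => real"
	assumes v: "v \<in> hyp_test_functions"
	obtains R M L where "0 < R" "R < 1" "L >= 0" "M > 0" "admissible R M L W p v (\<lambda>x. \<bar>v x\<bar>)"
proof -
	obtain R where R: "0 < R" "R < 1" "!!x. R < norm x ==> v x = 0"
		using test_support[OF v] by metis
	obtain C where C: "C > 0" "!!x. \<bar>v x\<bar> <= C" "!!x. norm (egrad v x) <= C"
		using test_bounded[OF v] by metis
	have dv: "(v has_derivative (\<lambda>h. egrad v x \<bullet> h)) (at x)" for x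
		by (rule has_derivative_egrad[OF test_differentiable[OF v]])
	have lip: "lip_class R C C (\<lambda>x. \<bar>v x\<bar>)"
		unfolding lip_class_def
	proof (intro conjI allI impI ballI)
		fix x y :: 'a assume xy: "x \<in> hyp_space" "y \<in> hyp_space"
		have on: "onorm (\<lambda>h. egrad v x \<bullet> h) <= C" for x
		proof (rule onorm_le)
			fix h show "norm (egrad v x \<bullet> h) <= C * norm h"
				using Cauchy_Schwarz_ineq2[of "egrad v x" h] mult_right_mono[OF C(3)[of x] norm_ge_zero[of h]] by simp
		qed
		have "norm (v x - v y) <= C * norm (x - y)"
			by (rule differentiable_bound[OF convex_UNIV has_derivative_at_withinI[OF dv] on]) auto
		also have "... <= C * sqrt (hyp_delta x y)"
			using norm_diff_le_hyp_delta[OF xy] C(1) by (intro mult_left_mono) auto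
		finally show "\<bar>\<bar>v x\<bar> - \<bar>v y\<bar>\<bar> <= C * sqrt (hyp_delta x y)" by simp
	qed (use C R in auto)
	have ug: "upper_grad (\<lambda>x. \<bar>v x\<bar>) (hyp_grad_norm v)"
		unfolding upper_grad_def
	proof (intro allI impI)
		fix \<gamma> \<gamma>' :: "real => 'a"
		assume \<gamma>: "\<forall>t>0. \<gamma> t \<in> hyp_space \<and> (\<gamma> has_vector_derivative \<gamma>' t) (at t)"
		define A where "A = {s. v (\<gamma> s) = - v (\<gamma> s)}"
		show "\<exists>K. countable K \<and> (\<forall>t>0. t \<notin> K --> (\<exists>d. ((\<lambda>t. \<bar>v (\<gamma> t)\<bar>) has_real_derivative d) (at t) \<and>
				\<bar>d\<bar> <= hyp_grad_norm v (\<gamma> t) * (conf_factor (\<gamma> t) * norm (\<gamma>' t))))"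
		proof (rule exI[of _ "{t\<in>A. \<not> t islimpt A}"], intro conjI allI impI countable_isolated_points)
			fix t :: real assume t: "t > 0" and tK: "t \<notin> {t\<in>A. \<not> t islimpt A}"
			have "(\<gamma> has_derivative (\<lambda>h. h *\<^sub>R \<gamma>' t)) (at t)"
				using \<gamma> t by (simp add: has_vector_derivative_def)
			from has_derivative_compose[OF this dv]
			have d: "((\<lambda>t. v (\<gamma> t)) has_real_derivative egrad v (\<gamma> t) \<bullet> \<gamma>' t) (at t)"
				by (simp add: has_field_derivative_def mult.commute[of _ "_ \<bullet> _"])
			have "isCont \<gamma> t" using \<gamma> t has_vector_derivative_continuous by blast
			then have "isCont (\<lambda>t. \<bar>v (\<gamma> t)\<bar>) t"
				using DERIV_isCont[OF d] by (intro continuous_intros)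
			moreover have "\<bar>v (\<gamma> s)\<bar> = v (\<gamma> s) \<or> \<bar>v (\<gamma> s)\<bar> = - v (\<gamma> s)" for s by linarith
			moreover have "v (\<gamma> t) ~= - v (\<gamma> t) \<or> t islimpt {s. v (\<gamma> s) = - v (\<gamma> s)}"
				using tK by (auto simp: A_def)
			ultimately obtain e where e: "((\<lambda>t. \<bar>v (\<gamma> t)\<bar>) has_real_derivative e) (at t)"
				"\<bar>v (\<gamma> t)\<bar> = v (\<gamma> t) ==> e = egrad v (\<gamma> t) \<bullet> \<gamma>' t" "\<bar>v (\<gamma> t)\<bar> = - v (\<gamma> t) ==> e = - (egrad v (\<gamma> t) \<bullet> \<gamma>' t)"
				using selection_deriv[OF d DERIV_minus[OF d], of "\<lambda>t. \<bar>v (\<gamma> t)\<bar>"] by blast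
			then have "\<bar>e\<bar> = \<bar>egrad v (\<gamma> t) \<bullet> \<gamma>' t\<bar>" by (cases "v (\<gamma> t) >= 0") auto
			also have "... <= norm (egrad v (\<gamma> t)) * norm (\<gamma>' t)" by (rule Cauchy_Schwarz_ineq2)
			also have "... = hyp_grad_norm v (\<gamma> t) * (conf_factor (\<gamma> t) * norm (\<gamma>' t))"
				using conf_factor_pos[of "\<gamma> t"] \<gamma> t
				by (simp add: hyp_grad_norm_eq[OF test_differentiable[OF v]])
			finally show "\<exists>d. ((\<lambda>t. \<bar>v (\<gamma> t)\<bar>) has_real_derivative d) (at t) \<and>
				\<bar>d\<bar> <= hyp_grad_norm v (\<gamma> t) * (conf_factor (\<gamma> t) * norm (\<gamma>' t))"
				using e(1) by blast
		qed
	qed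
	have "admissible R C C W p v (\<lambda>x. \<bar>v x\<bar>)"
		unfolding admissible_def
	proof (intro conjI lip exI[of _ "hyp_grad_norm v"] ug allI)
		show "0 <= hyp_grad_norm v x" for x
			by (simp add: hyp_grad_norm_eq[OF test_differentiable[OF v]])
	qed (use test_measurable(2)[OF v] in auto)
	then show ?thesis using that R C(1) by (metis less_imp_le)
qed

text \<open>The bound \<open>B\<close> is uniform over the whole class; it yields the dominating
  function when a sequence in the class converges.\<close>

lemma lip_class_integrable:
	fixes f k :: "'a::euclidean_space => real"
	assumes f: "lip_class R M L f" and R: "R < 1" and M: "M >= 0"
		and k: "integrable hyp_vol (\<lambda>x. k x * indicator (cball 0 R) x)" and [measurable]: "k \<in> borel_measurable borel"
		and \<Psi>: "continuous_on {0..M} \<Psi>" "\<Psi> 0 = 0" and [measurable]: "\<Psi> \<in> borel_measurable borel"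
	shows "\<exists>B. integrable hyp_vol (\<lambda>x. B * \<bar>k x * indicator (cball 0 R) x\<bar>) \<and>
			(\<forall>x f. lip_class R M L f --> \<bar>k x * \<Psi> (f x)\<bar> <= B * \<bar>k x * indicator (cball 0 R) x\<bar>)"
		and "integrable hyp_vol (\<lambda>x. k x * \<Psi> (f x))"
proof -
	have "compact (\<Psi> ` {0..M})" by (rule compact_continuous_image[OF \<Psi>(1)]) simp
	then obtain B where B: "!!t. t \<in> {0..M} ==> \<bar>\<Psi> t\<bar> <= B"
		using compact_imp_bounded[of "\<Psi> ` {0..M}"] unfolding bounded_iff real_norm_def ball_simps by blast
	have B0: "B >= 0" using B[of 0] M by simp
	have bd: "\<bar>k x * \<Psi> (f x)\<bar> <= B * \<bar>k x * indicator (cball 0 R) x\<bar>" if f: "lip_class R M L f" for x f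
	proof (cases "R < norm x")
		case True
		then show ?thesis using lip_classD(3)[OF f True] \<Psi>(2) by simp
	next
		case False
		have "\<bar>\<Psi> (f x)\<bar> <= B" using B[of "f x"] lip_classD(1,2)[OF f] by simp
		then have "\<bar>k x\<bar> * \<bar>\<Psi> (f x)\<bar> <= \<bar>k x\<bar> * B" by (rule mult_left_mono) simp
		then show ?thesis using False by (simp add: abs_mult mult.commute)
	qed
	have [measurable]: "cball (0::'a) R \<in> sets borel" by simp
	have int: "integrable hyp_vol (\<lambda>x. B * \<bar>k x * indicator (cball 0 R) x\<bar>)" using k by simp
	note [measurable] = lip_class_measurable[OF f R]
	show "integrable hyp_vol (\<lambda>x. k x * \<Psi> (f x))"
		by (rule Bochner_Integration.integrable_bound[OF int]) (use bd[OF f] B0 in auto)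
	show "\<exists>B. integrable hyp_vol (\<lambda>x. B * \<bar>k x * indicator (cball 0 R) x\<bar>) \<and>
			(\<forall>x f. lip_class R M L f --> \<bar>k x * \<Psi> (f x)\<bar> <= B * \<bar>k x * indicator (cball 0 R) x\<bar>)"
		using int bd by blast
qed

lemma lip_class_integral_tendsto:
	fixes f :: "nat => 'a::euclidean_space => real" and k :: "'a => real"
	assumes f: "!!j. lip_class R M L (f j)" and g: "lip_class R M L g" and lim: "!!x. (\<lambda>j. f j x) \<longlonglongrightarrow> g x"
		and R: "R < 1" and M: "M >= 0"
		and k: "integrable hyp_vol (\<lambda>x. k x * indicator (cball 0 R) x)" and [measurable]: "k \<in> borel_measurable borel"
		and \<Psi>: "continuous_on {0..M} \<Psi>" "\<Psi> 0 = 0" and [measurable]: "\<Psi> \<in> borel_measurable borel"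
	shows "(\<lambda>j. \<integral>x. k x * \<Psi> (f j x) \<partial>hyp_vol) \<longlonglongrightarrow> (\<integral>x. k x * \<Psi> (g x) \<partial>hyp_vol)"
proof -
	obtain B where B: "integrable hyp_vol (\<lambda>x. B * \<bar>k x * indicator (cball 0 R) x\<bar>)"
		"!!x f. lip_class R M L f ==> \<bar>k x * \<Psi> (f x)\<bar> <= B * \<bar>k x * indicator (cball 0 R) x\<bar>"
		using lip_class_integrable(1)[OF g R M k assms(7) \<Psi> assms(10)] by blast
	note [measurable] = lip_class_measurable[OF f R] lip_class_measurable[OF g R]
	show ?thesis
	proof (rule integral_dominated_convergence[OF _ _ B(1)])
		show "AE x in hyp_vol. (\<lambda>j. k x * \<Psi> (f j x)) \<longlonglongrightarrow> k x * \<Psi> (g x)"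
		proof (intro AE_I2 tendsto_mult tendsto_const)
			fix x
			show "(\<lambda>j. \<Psi> (f j x)) \<longlonglongrightarrow> \<Psi> (g x)"
				by (rule continuous_on_tendsto_compose[OF \<Psi>(1) lim])
					(use lip_classD(1,2)[OF g] lip_classD(1,2)[OF f] in \<open>auto intro!: always_eventually\<close>)
		qed
		show "AE x in hyp_vol. norm (k x * \<Psi> (f j x)) <= B * \<bar>k x * indicator (cball 0 R) x\<bar>" for j
			using B(2)[OF f] by (intro AE_I2) simp
	qed measurable
qed

lemma AE_hyp_vol_eqD:
	fixes f g :: "'a::euclidean_space => real"
	assumes ae: "AE x in hyp_vol. f x = g x"
		and f: "!!x. x \<in> hyp_space ==> isCont f x" and g: "!!x. x \<in> hyp_space ==> isCont g x"
		and x: "x \<in> hyp_space"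
	shows "f x = g x"
proof (rule ccontr)
	assume ne: "f x ~= g x"
	define N where "N = {y\<in>hyp_space. f y - g y \<in> - {0}}"
	have "continuous_on hyp_space (\<lambda>y. f y - g y)"
		by (intro continuous_at_imp_continuous_on) (auto intro!: continuous_intros f g)
	then have N: "open N"
		using continuous_open_preimage[of hyp_space "\<lambda>y. f y - g y" "- {0}"]
		by (auto simp: N_def vimage_def Int_def)
	have [measurable]: "(hyp_space :: 'a set) \<in> sets borel" by simp
	have "AE x in lborel. indicator hyp_space x * conf_factor x ^ DIM('a) > 0 --> f x = g x"
		using ae unfolding hyp_vol_def by (subst (asm) AE_density) auto
	then have "AE y in lborel. y \<notin> N"
	proof (rule eventually_mono)
		fix y assume y: "0 < indicator hyp_space y * conf_factor y ^ DIM('a) --> f y = g y"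
		show "y \<notin> N"
		proof
			assume "y \<in> N"
			then have yN: "y \<in> hyp_space" "f y ~= g y" by (auto simp: N_def)
			then show False using y conf_factor_pos[OF yN(1)] by simp
		qed
	qed
	then have "N \<in> null_sets lborel"
		using N by (subst (asm) AE_iff_null_sets[symmetric]) auto
	then have "negligible N"
		unfolding negligible_iff_null_sets by (rule null_sets_completionI)
	moreover have "x \<in> N" using x ne by (simp add: N_def)
	ultimately show False using open_not_negligible[OF N] by auto
qed

text \<open>Admissibility is kept for the approximants \<open>f j\<close> only, since a limit may
  fail to be differentiable off a countable set along some curve. This is enough: polarization and
  the functional \<open>\<Phi>\<close> are continuous for pointwise convergence in the class, and
  the polarized approximants are admissible again, so the polarized limit cannot exceed the supremum
  attained by \<open>g\<close>.\<close>

lemma symmetric_extremal: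
	fixes v :: "'a::euclidean_space => real"
	assumes f0: "admissible R M L W p v f0" and R: "0 < R" "R < 1" and L: "L >= 0" and M: "M > 0" and p: "p > 0"
		and W: "W \<in> borel_measurable borel" "!!x. W x >= 0"
			"!!x y. x \<in> hyp_space ==> y \<in> hyp_space ==> x ~= 0 ==> y ~= 0 ==> norm x <= norm y ==> W y <= W x"
	obtains f g where "!!j::nat. admissible R M L W p v (f j)" "lip_class R M L g" "!!x. (\<lambda>j. f j x) \<longlonglongrightarrow> g x"
		"!!c x. norm c > 1 ==> x \<in> hyp_space ==> polarize c g x = g x"
proof -
	define w :: "'a => real" where "w x = 1 - (norm x)\<^sup>2" for x
	have wm [measurable]: "w \<in> borel_measurable borel" unfolding w_def[abs_def] by measurable
	have [measurable]: "cball (0::'a) R \<in> sets borel" by simp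
	have wi: "integrable hyp_vol (\<lambda>x. w x * indicator (cball 0 R) x)"
		by (rule integrable_hyp_vol_bounded[where C=1 and R=R])
			(use R in \<open>auto simp: w_def abs_square_le_1 split: split_indicator\<close>)
	define \<Phi> where "\<Phi> f = (\<integral>x. w x * f x \<partial>hyp_vol)" for f
	have lc: "lip_class R M L f" if "admissible R M L W p v f" for f
		using that by (simp add: admissible_def)
	have \<Phi>_int: "integrable hyp_vol (\<lambda>x. w x * f x)" if "lip_class R M L f" for f
		by (rule lip_class_integrable(2)[OF that R(2) _ wi wm, of "\<lambda>t. t"]) (use M in auto)
	have \<Phi>_tendsto: "(\<lambda>j. \<Phi> (f j)) \<longlonglongrightarrow> \<Phi> g"
		if "!!j. lip_class R M L (f j)" "lip_class R M L g" "!!x. (\<lambda>j. f j x) \<longlonglongrightarrow> g x" for f g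
		unfolding \<Phi>_def
		by (rule lip_class_integral_tendsto[OF that R(2) _ wi wm, of "\<lambda>t. t"]) (use M in auto)
	have \<Phi>_bd: "\<Phi> f <= (\<integral>x. M * (w x * indicator (cball 0 R) x) \<partial>hyp_vol)" if "lip_class R M L f" for f
		unfolding \<Phi>_def
	proof (rule integral_mono_AE[OF \<Phi>_int[OF that]])
		show "AE x in hyp_vol. w x * f x <= M * (w x * indicator (cball 0 R) x)"
			using AE_hyp_vol
		proof eventually_elim
			case (elim x)
			then have "w x >= 0" using one_minus_norm_pos[OF elim] by (simp add: w_def)
			then show ?case using lip_classD(3)[OF that, of x] mult_left_mono[OF lip_classD(2)[OF that, of x], of "w x"]
				by (cases "R < norm x") (auto simp: mult.commute)
		qed
	qed (use wi in simp)
	define S where "S = Sup (\<Phi> ` {f. admissible R M L W p v f})"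
	have bdd: "bdd_above (\<Phi> ` {f. admissible R M L W p v f})"
		using \<Phi>_bd lc by (auto intro!: bdd_aboveI)
	have up: "\<Phi> f <= S" if "admissible R M L W p v f" for f
		unfolding S_def using that by (intro cSup_upper[OF _ bdd]) auto
	have "\<exists>f. admissible R M L W p v f \<and> S - inverse (real (Suc j)) < \<Phi> f" for j
	proof -
		have "S - inverse (real (Suc j)) < S" by simp
		then show ?thesis
			using less_cSup_iff[OF _ bdd, of "S - inverse (real (Suc j))"] f0 unfolding S_def[symmetric] by auto
	qed
	then obtain h where h: "!!j. admissible R M L W p v (h j)" "!!j. S - inverse (real (Suc j)) < \<Phi> (h j)"
		by metis
	have R2: "1 - R\<^sup>2 > 0" using R by (simp add: power_less_one_iff abs_square_less_1)
	have eq: "norm (h j x - h j y) <= L / (1 - R\<^sup>2) * norm (x - y)" if "norm x <= R" "norm y <= R" for j x y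
	proof -
		have "norm (h j x - h j y) <= L * sqrt (hyp_delta x y)"
			using lip_classD(4)[OF lc[OF h(1)], of x y] that R by simp
		also have "... <= L * (norm (x - y) / (1 - R\<^sup>2))"
			using hyp_delta_le[OF R(2) that] L by (rule mult_left_mono)
		finally show ?thesis by simp
	qed
	\<comment> \<open>On the compact ball \<open>cball 0 R\<close> the bound by
	  \<open>hyp_delta\<close> is a Euclidean Lipschitz bound with constant
	  \<open>L / (1 - R^2)\<close>, so the maximizing sequence is equicontinuous; outside the ball all
	  its members vanish.\<close>
	obtain g0 :: "'a => real" and k where k: "strict_mono (k :: nat => nat)"
		"!!e. 0 < e ==> \<exists>N. \<forall>n x. n >= N \<and> x \<in> cball 0 R --> norm (h (k n) x - g0 x) < e"
	proof (rule Arzela_Ascoli[of "cball 0 R" h M])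
		show "norm (h j x) <= M" for j x
			using lip_classD(1,2)[OF lc[OF h(1)], of j x] by simp
		fix x :: 'a and e :: real assume x: "x \<in> cball 0 R" and e: "0 < e"
		define D where "D = L / (1 - R\<^sup>2) + 1"
		have D: "D > 0" using L R2 by (simp add: D_def add_nonneg_pos)
		have "norm (h j x - h j y) < e" if y: "y \<in> cball 0 R" "norm (x - y) < e / D" for j y
		proof -
			have "norm (h j x - h j y) <= D * norm (x - y)"
				using eq[of x y j] x y by (simp add: D_def algebra_simps) (smt (verit) norm_ge_zero)
			also have "... < D * (e / D)" using y(2) D by (rule mult_strict_left_mono)
			finally show ?thesis using D by simp
		qed
		then show "\<exists>d. 0 < d \<and> (\<forall>n y. y \<in> cball 0 R \<and> norm (x - y) < d --> norm (h n x - h n y) < e)"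
			using D e by (intro exI[of _ "e / D"]) auto
	qed auto
	define g where "g x = (if norm x <= R then g0 x else 0)" for x
	have lim: "(\<lambda>j. h (k j) x) \<longlonglongrightarrow> g x" for x
	proof (cases "norm x <= R")
		case True
		then show ?thesis
			using k(2) unfolding LIMSEQ_iff by (fastforce simp: g_def)
	next
		case False
		then show ?thesis using lip_classD(3)[OF lc[OF h(1)]] by (simp add: g_def)
	qed
	have glc: "lip_class R M L g"
		unfolding lip_class_def
	proof (intro conjI allI impI ballI)
		fix x
		show "0 <= g x" by (rule LIMSEQ_le_const[OF lim]) (use lip_classD(1)[OF lc[OF h(1)]] in auto)
		show "g x <= M" by (rule LIMSEQ_le_const2[OF lim]) (use lip_classD(2)[OF lc[OF h(1)]] in auto)
		show "R < norm x ==> g x = 0" by (simp add: g_def)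
	next
		fix x y :: 'a assume xy: "x \<in> hyp_space" "y \<in> hyp_space"
		have "(\<lambda>j. \<bar>h (k j) x - h (k j) y\<bar>) \<longlonglongrightarrow> \<bar>g x - g y\<bar>" by (intro tendsto_intros lim)
		then show "\<bar>g x - g y\<bar> <= L * sqrt (hyp_delta x y)"
			by (rule LIMSEQ_le_const2) (use lip_classD(4)[OF lc[OF h(1)] xy] in auto)
	qed
	have "(\<lambda>j. \<Phi> (h (k j))) \<longlonglongrightarrow> \<Phi> g"
		by (rule \<Phi>_tendsto[OF lc[OF h(1)] glc lim])
	moreover have "(\<lambda>j. \<Phi> (h (k j))) \<longlonglongrightarrow> S"
	proof (rule LIMSEQ_subseq_LIMSEQ[OF _ k(1), unfolded o_def], rule tendsto_sandwich)
		show "(\<lambda>j. S - inverse (real (Suc j))) \<longlonglongrightarrow> S"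
			using tendsto_diff[OF tendsto_const LIMSEQ_inverse_real_of_nat, of S] by simp
		show "\<forall>\<^sub>F j in sequentially. S - inverse (real (Suc j)) <= \<Phi> (h j)"
			using h(2) by (intro always_eventually) (simp add: less_imp_le)
	qed (use up[OF h(1)] in auto)
	ultimately have \<Phi>g: "\<Phi> g = S" by (rule LIMSEQ_unique)
	have inv: "polarize c g x = g x" if c: "norm c > 1" and x: "x \<in> hyp_space" for c x
	proof -
		let ?I = "inversion c" and ?P = "polarize c g"
		have Plc: "lip_class R M L ?P" by (rule polarize_lip_class[OF c glc R(2) L])
		have "(\<lambda>j. polarize c (h (k j)) x) \<longlonglongrightarrow> ?P x" for x
			unfolding polarize_def by (auto intro!: tendsto_max tendsto_min lim)
		from \<Phi>_tendsto[OF polarize_lip_class[OF c lc[OF h(1)] R(2) L] Plc this]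
		have "\<Phi> ?P <= S"
			by (rule LIMSEQ_le_const2) (use up[OF polarize_admissible[OF c h(1) R(2) L p W]] in auto)
		then have le: "\<Phi> ?P <= \<Phi> g" using \<Phi>g by simp
		note i1 = \<Phi>_int[OF glc] and i2 = \<Phi>_int[OF Plc]
		note j1 = integrable_hyp_vol_inversion[OF c i1] and j2 = integrable_hyp_vol_inversion[OF c i2]
		\<comment> \<open>Pairing points with their mirror images, the excess of the polarized functional
		  becomes the integral of a nonnegative function, which must vanish almost everywhere. As
		  \<open>w\<close> depends strictly on the norm, equality in the two-point inequality means that
		  polarization changed nothing.\<close>
		define H where "H x = (w x * ?P x + w (?I x) * ?P (?I x)) - (w x * g x + w (?I x) * g (?I x))" for x
		have Hi: "integrable hyp_vol H"
			unfolding H_def[abs_def] using i1 i2 j1 j2 by (intro Bochner_Integration.integrable_diff Bochner_Integration.integrable_add)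
		have "(\<integral>x. H x \<partial>hyp_vol) = (\<Phi> ?P + \<Phi> ?P) - (\<Phi> g + \<Phi> g)"
			unfolding H_def[abs_def] \<Phi>_def
			using i1 i2 j1 j2 integral_hyp_vol_inversion[OF c, of "\<lambda>x. w x * ?P x"] integral_hyp_vol_inversion[OF c, of "\<lambda>x. w x * g x"]
			by simp
		then have H0: "(\<integral>x. H x \<partial>hyp_vol) <= 0" using le by simp
		have Hnn: "AE x in hyp_vol. 0 <= H x"
			using AE_inversion_pair[OF c]
		proof eventually_elim
			case (elim x)
			have "w x * g x + w (?I x) * g (?I x) <= w x * ?P x + w (?I x) * ?P (?I x)"
				by (rule weighted_pair_le[OF c, where \<Psi>="\<lambda>t. t"])
					(use elim lip_classD(1)[OF glc] in \<open>auto simp: w_def mono_on_def power_mono\<close>)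
			then show ?case by (simp add: H_def)
		qed
		have "(\<integral>x. H x \<partial>hyp_vol) = 0" using H0 integral_nonneg_AE[OF Hnn] by simp
		then have "AE x in hyp_vol. H x = 0"
			using integral_nonneg_eq_0_iff_AE[OF Hi Hnn] by simp
		then have "AE x in hyp_vol. ?P x = g x"
			using AE_hyp_vol
		proof eventually_elim
			case (elim x)
			show ?case
			proof (rule ccontr)
				assume ne: "?P x ~= g x"
				then have sw: "?P x = g (?I x)" "?P (?I x) = g x" using polarize_pair[OF c elim(2), of g] by auto
				have "(w x - w (?I x)) * (g (?I x) - g x) = 0"
					using elim(1) unfolding H_def sw by (simp add: algebra_simps)
				then have "norm (?I x) = norm x" using ne sw by (simp add: w_def)
				then show False using norm_inversion_eq_imp[OF c elim(2)] ne sw by simp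
			qed
		qed
		then show ?thesis
			by (rule AE_hyp_vol_eqD[OF _ lip_class_isCont[OF Plc] lip_class_isCont[OF glc] x])
	qed
	show ?thesis by (rule that[of "\<lambda>j. h (k j)" g, OF h(1) glc lim inv])
qed

text \<open>The centre lies on the line through \<open>x\<close> and \<open>y\<close>, and by
  \<open>one_minus_norm_inversion\<close> the scaling factor at \<open>x\<close> must be
  \<open>b / a\<close>; this leads to \<open>c\<close>. For equal norms the mirror would be a
  hyperplane through the origin, which has no centre.\<close>

lemma inversion_swapping:
	fixes x y :: "'a::euclidean_space"
	assumes x: "x \<in> hyp_space" and y: "y \<in> hyp_space" and xy: "norm x < norm y"
	obtains c where "norm c > 1" "inversion c x = y"
proof -
	define a b where "a = 1 - (norm x)\<^sup>2" and "b = 1 - (norm y)\<^sup>2"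
	have ab: "0 < a" "0 < b" using one_minus_norm_pos x y by (auto simp: a_def b_def)
	have ba: "b - a < 0" using xy power_strict_mono[OF xy norm_ge_zero, of 2] by (simp add: a_def b_def)
	define c where "c = (1 / (b - a)) *\<^sub>R (b *\<^sub>R x - a *\<^sub>R y)"
	have lin: "(b - a) *\<^sub>R c = b *\<^sub>R x - a *\<^sub>R y" using ba by (simp add: c_def)
	have xc: "x - c = (a / (b - a)) *\<^sub>R (y - x)" and yc: "y - c = (b / (b - a)) *\<^sub>R (y - x)"
	proof -
		have "(b - a) *\<^sub>R (x - c) = a *\<^sub>R (y - x)" "(b - a) *\<^sub>R (y - c) = b *\<^sub>R (y - x)"
			unfolding scaleR_diff_right[of "b - a"] lin by (simp_all add: algebra_simps)
		then have "(1 / (b - a)) *\<^sub>R ((b - a) *\<^sub>R (x - c)) = (1 / (b - a)) *\<^sub>R (a *\<^sub>R (y - x))"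
			"(1 / (b - a)) *\<^sub>R ((b - a) *\<^sub>R (y - c)) = (1 / (b - a)) *\<^sub>R (b *\<^sub>R (y - x))" by simp_all
		then show "x - c = (a / (b - a)) *\<^sub>R (y - x)" "y - c = (b / (b - a)) *\<^sub>R (y - x)" using ba by simp_all
	qed
	have ne: "norm (y - x) > 0" using xy by auto
	have nx: "x \<bullet> x = 1 - a" "y \<bullet> y = 1 - b" by (simp_all add: a_def b_def power2_norm_eq_inner)
	have "(b - a)\<^sup>2 * (norm c)\<^sup>2 = (norm ((b - a) *\<^sub>R c))\<^sup>2" by (simp add: power_mult_distrib)
	also have "... = b\<^sup>2 * (1 - a) + a\<^sup>2 * (1 - b) - 2 * a * b * (x \<bullet> y)"
		unfolding lin power2_norm_eq_inner nx[symmetric] by (simp add: inner_diff inner_commute power2_eq_square algebra_simps)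
	finally have 1: "(b - a)\<^sup>2 * (norm c)\<^sup>2 = b\<^sup>2 * (1 - a) + a\<^sup>2 * (1 - b) - 2 * a * b * (x \<bullet> y)" .
	have 2: "(norm (y - x))\<^sup>2 = (1 - b) + (1 - a) - 2 * (x \<bullet> y)"
		unfolding power2_norm_eq_inner nx[symmetric] by (simp add: inner_diff inner_commute)
	have "(b - a)\<^sup>2 * ((norm c)\<^sup>2 - 1) = a * b * (norm (y - x))\<^sup>2"
		unfolding right_diff_distrib 1 2 by (simp add: power2_eq_square algebra_simps)
	then have kc: "(norm c)\<^sup>2 - 1 = a * b * (norm (y - x))\<^sup>2 / (b - a)\<^sup>2"
		using ba by (simp add: field_simps)
	have "(norm c)\<^sup>2 - 1 > 0" unfolding kc using ab ba ne by (intro divide_pos_pos mult_pos_pos) auto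
	then have c: "norm c > 1" using power_le_one[of "norm c" 2] by force
	have "((norm c)\<^sup>2 - 1) / (norm (x - c))\<^sup>2 = b / a"
	proof -
		have "(a * b * N / D) / (a\<^sup>2 / D * N) = b / a" if "D > 0" "N > 0" for D N
			using that ab by (simp add: power2_eq_square)
		moreover have "(norm (x - c))\<^sup>2 = a\<^sup>2 / (b - a)\<^sup>2 * (norm (y - x))\<^sup>2"
			unfolding xc by (simp add: power_mult_distrib power_divide)
		ultimately show ?thesis unfolding kc using ba ne ab by (simp add: power2_eq_square)
	qed
	then have "inversion c x = c + (b / a) *\<^sub>R ((a / (b - a)) *\<^sub>R (y - x))"
		unfolding inversion_def xc[symmetric] by simp
	also have "... = c + (y - c)" unfolding yc using ab by simp
	finally show ?thesis using that[OF c] by simp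
qed

text \<open>Reflections exchanging two points are available for different norms only, and give that
  \<open>g\<close> decreases with the norm. Points of equal norm are compared by approaching one of
  them along its ray and using continuity.\<close>

lemma polarize_invariant_radial:
	assumes g: "lip_class R M L g" and inv: "!!c x. norm c > 1 ==> x \<in> hyp_space ==> polarize c g x = g x"
		and x: "x \<in> hyp_space" and y: "y \<in> hyp_space" and eq: "norm x = norm y"
	shows "g x = g y"
proof -
	have mono: "g y <= g x" if x: "x \<in> hyp_space" and y: "y \<in> hyp_space" and lt: "norm x < norm y" for x y
	proof -
		obtain c where c: "norm c > 1" "inversion c x = y" using inversion_swapping[OF x y lt] by blast
		then have "g x = max (g x) (g y)" using inv[OF c(1) x] lt by (simp add: polarize_def)
		then show ?thesis by simp
	qed
	have le: "g y <= g x" if x: "x \<in> hyp_space" and y: "y \<in> hyp_space" and eq: "norm x = norm y" for x y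
	proof (cases "x = 0")
		case False
		have "((\<lambda>s. s *\<^sub>R x) \<longlongrightarrow> 1 *\<^sub>R x) (at_left 1)" by (intro tendsto_intros)
		then have "((\<lambda>s. g (s *\<^sub>R x)) \<longlongrightarrow> g x) (at_left 1)"
			unfolding scaleR_one by (rule isCont_tendsto_compose[OF lip_class_isCont[OF g x]])
		moreover have "\<forall>\<^sub>F s in at_left (1::real). g y <= g (s *\<^sub>R x)"
		proof (rule eventually_at_leftI[of 0])
			fix s :: real assume s: "s \<in> {0<..<1}"
			then have "s * norm x < norm x" using False by simp
			then show "g y <= g (s *\<^sub>R x)" using s x y eq by (intro mono) auto
		qed simp
		ultimately show ?thesis by (intro tendsto_lowerbound) auto
	qed (use eq in simp)
	show ?thesis using le[OF x y eq] le[OF y x eq[symmetric]] by simp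
qed

text \<open>Radial Dirichlet energy with the derivative replaced by a difference quotient in
  \<open>z\<close>: the factor \<open>exp (- \<delta>)\<close> is the shift by
  \<open>\<delta>\<close>, and the power of \<open>sinh z\<close> cancels the volume density. It
  depends continuously on the values of \<open>f\<close>, so Fatou's lemma gives semicontinuity
  without a derivative of the limit. The weight is taken at the far end \<open>z + \<delta>\<close>,
  where it is smallest on the window.\<close>

definition shift_energy :: "real => ('a::euclidean_space => real) => 'a => real" where
	"shift_energy \<delta> f x = rwt (\<lambda>z. rad_w DIM('a) (z + \<delta>) * sinh z ^ DIM('a)) x * ((f (exp (- \<delta>) *\<^sub>R x) - f x) / \<delta>)\<^sup>2"

lemma rad_w_measurable [measurable]: "rad_w n \<in> borel_measurable borel"
	unfolding rad_w_def[abs_def] by measurable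

lemma rad_w_antimono:
	assumes "0 < s" "s <= t"
	shows "rad_w n t <= rad_w n s"
proof -
	have "sinh s ^ (n - 2) <= sinh t ^ (n - 2)" using assms by (intro power_mono) auto
	then show ?thesis unfolding rad_w_def using assms by (intro divide_left_mono) auto
qed

lemma shift_energy_polar:
	fixes \<theta> :: "'a::euclidean_space"
	assumes \<theta>: "norm \<theta> = 1" and \<delta>: "\<delta> > 0"
	shows "ennreal (hyp_density DIM('a) z) * ennreal (shift_energy \<delta> f (ray \<theta> z)) =
		ennreal (indicator {0<..} z * (rad_w DIM('a) (z + \<delta>) * ((f (ray \<theta> (z + \<delta>)) - f (ray \<theta> z)) / \<delta>)\<^sup>2))"
proof (cases "z > 0")
	case True
	have "exp (- (z + \<delta>)) = exp (- \<delta>) * exp (- z)" by (simp add: exp_add[symmetric])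
	then have "hyp_density DIM('a) z * shift_energy \<delta> f (ray \<theta> z) =
			rad_w DIM('a) (z + \<delta>) * ((f (ray \<theta> (z + \<delta>)) - f (ray \<theta> z)) / \<delta>)\<^sup>2"
		using True by (simp add: shift_energy_def rwt_polar[OF \<theta> True] hyp_density_def)
	then show ?thesis
		using True hyp_density_nonneg by (simp add: ennreal_mult'[symmetric])
qed (simp add: hyp_density_def)

lemma shift_energy_measurable:
	fixes f :: "'a::euclidean_space => real"
	assumes [measurable]: "f \<in> borel_measurable borel" and "\<delta> > 0"
	shows "shift_energy \<delta> f \<in> borel_measurable borel"
proof -
	have "continuous_on {0<..} (\<lambda>z. rad_w DIM('a) (z + \<delta>) * sinh z ^ DIM('a))"
		using assms(2) by (intro continuous_intros continuous_on_compose2[OF rad_w_continuous]) auto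
	note [measurable] = rwt_measurable[OF this]
	show ?thesis unfolding shift_energy_def[abs_def] by measurable
qed

lemma lip_class_ray:
	assumes f: "lip_class R M L f" and L: "L >= 0" and \<theta>: "norm \<theta> = 1" and a: "a > 0" and s: "s >= a" and t: "t >= a"
	shows "\<bar>f (ray \<theta> s) - f (ray \<theta> t)\<bar> <= L / (1 - (exp (- a))\<^sup>2) * \<bar>s - t\<bar>"
proof -
	have exp_le: "\<bar>exp (- s) - exp (- t)\<bar> <= t - s" if "0 <= s" "s <= t" for s t :: real
	proof -
		have e: "1 - exp (- (t - s)) <= t - s" using exp_ge_add_one_self[of "s - t"] unfolding minus_diff_eq by linarith
		have "exp (- s) - exp (- t) = exp (- s) * (1 - exp (- (t - s)))" by (simp add: right_diff_distrib exp_add[symmetric])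
		also have "... <= 1 * (t - s)"
			using that e by (intro mult_mono) auto
		finally show ?thesis using that by simp
	qed
	have *: "\<bar>exp (- s) - exp (- t)\<bar> <= \<bar>s - t\<bar>"
		using exp_le[of s t] exp_le[of t s] a s t by linarith
	have r: "exp (- a) < 1" using a by simp
	have n: "norm (ray \<theta> s) <= exp (- a)" "norm (ray \<theta> t) <= exp (- a)"
		using s t \<theta> by auto
	have "\<bar>f (ray \<theta> s) - f (ray \<theta> t)\<bar> <= L * sqrt (hyp_delta (ray \<theta> s) (ray \<theta> t))"
		by (rule lip_classD(4)[OF f]) (use \<theta> a s t in auto)
	also have "... <= L * (norm (ray \<theta> s - ray \<theta> t) / (1 - (exp (- a))\<^sup>2))"
		by (rule mult_left_mono[OF hyp_delta_le[OF r n] L])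
	also have "norm (ray \<theta> s - ray \<theta> t) = \<bar>exp (- s) - exp (- t)\<bar>"
		unfolding scaleR_diff_left[symmetric] norm_scaleR \<theta> by simp
	also have "L * (\<bar>exp (- s) - exp (- t)\<bar> / (1 - (exp (- a))\<^sup>2)) <= L * (\<bar>s - t\<bar> / (1 - (exp (- a))\<^sup>2))"
		using * L r by (intro mult_left_mono divide_right_mono) (auto simp: abs_square_le_1)
	finally show ?thesis by simp
qed

lemma admissible_shift_energy:
	fixes v :: "'a::euclidean_space => real"
	assumes f: "admissible R M L W p v f" and R: "R < 1" and L: "L >= 0" and \<delta>: "\<delta> > 0" and n: "DIM('a) >= 2"
	shows "(\<integral>\<^sup>+x. ennreal (shift_energy \<delta> f x) \<partial>hyp_vol) <= (\<integral>\<^sup>+x. ennreal ((hyp_grad_norm v x)\<^sup>2) \<partial>hyp_vol)"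
proof -
	let ?n = "DIM('a)"
	have lc: "lip_class R M L f" using f by (simp add: admissible_def)
	obtain G where [measurable]: "G \<in> borel_measurable borel" and G0: "!!x. G x >= 0" and Gu: "upper_grad f G"
		and GE: "(\<integral>\<^sup>+x. ennreal ((G x)\<^sup>2) \<partial>hyp_vol) <= (\<integral>\<^sup>+x. ennreal ((hyp_grad_norm v x)\<^sup>2) \<partial>hyp_vol)"
		using f unfolding admissible_def by blast
	have fm [measurable]: "f \<in> borel_measurable borel" by (rule lip_class_measurable[OF lc R])
	note [measurable] = shift_energy_measurable[OF fm \<delta>]
	have ray: "(\<integral>\<^sup>+z. ennreal (hyp_density ?n z) * ennreal (shift_energy \<delta> f (ray \<theta> z)) \<partial>lborel) <=
			(\<integral>\<^sup>+z. ennreal (hyp_density ?n z) * ennreal ((G (ray \<theta> z))\<^sup>2) \<partial>lborel)" if \<theta>: "norm \<theta> = 1" for \<theta>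
	proof -
		define \<phi> where "\<phi> t = f (ray \<theta> t)" for t
		\<comment> \<open>Parametrized by \<open>z\<close>, a ray has hyperbolic speed
		  \<open>1 / sinh z\<close>, which converts the upper gradient into a bound for the derivative in
		  \<open>z\<close>.\<close>
		define H where "H t = G (ray \<theta> t) / sinh t" for t
		have [measurable]: "H \<in> borel_measurable borel" unfolding H_def[abs_def] by measurable
		have in_ball: "ray \<theta> t \<in> hyp_space" if "t > 0" for t using \<theta> that by simp
		obtain K where K: "countable K" "!!t. t > 0 ==> t \<notin> K ==> \<exists>d. (\<phi> has_real_derivative d) (at t) \<and>
				\<bar>d\<bar> <= G (ray \<theta> t) * (conf_factor (ray \<theta> t) * norm (- (ray \<theta> t)))"
			using Gu[unfolded upper_grad_def, rule_format, of "\<lambda>t. ray \<theta> t" "\<lambda>t. - (ray \<theta> t)"]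
				in_ball exp_ray_deriv[of \<theta>] unfolding \<phi>_def[abs_def] by auto
		have dK: "\<exists>d. (\<phi> has_real_derivative d) (at t) \<and> \<bar>d\<bar> <= H t" if "t > 0" "t \<notin> K" for t
			using K(2)[OF that] that(1) \<theta> by (simp add: conf_factor_ray[OF \<theta> that(1)] H_def)
		have inc: "ennreal \<bar>\<phi> b - \<phi> a\<bar> <= (\<integral>\<^sup>+t. ennreal (H t) * indicator {a..b} t \<partial>lborel)" if "0 < a" "a <= b" for a b
		proof (rule lipschitz_increment_le[of "a / 2" \<phi> "L / (1 - (exp (- (a / 2)))\<^sup>2)" a b K H])
			show "\<bar>\<phi> s - \<phi> t\<bar> <= L / (1 - (exp (- (a / 2)))\<^sup>2) * \<bar>s - t\<bar>" if "a / 2 <= s" "a / 2 <= t" for s t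
				unfolding \<phi>_def by (rule lip_class_ray[OF lc L \<theta> _ that]) (use \<open>0 < a\<close> in simp)
		qed (use that K(1) dK in auto)
		have "(\<integral>\<^sup>+z. ennreal (hyp_density ?n z) * ennreal (shift_energy \<delta> f (ray \<theta> z)) \<partial>lborel) <=
				(\<integral>\<^sup>+t. indicator {0<..} t * (ennreal (rad_w ?n t) * (ennreal (H t))\<^sup>2) \<partial>lborel)"
			unfolding shift_energy_polar[OF \<theta> \<delta>] \<phi>_def[symmetric]
			by (rule difference_quotient_energy_le[OF _ _ inc _ _ \<delta>])
				(auto intro: rad_w_antimono less_imp_le[OF rad_w_pos])
		also have "... = (\<integral>\<^sup>+z. ennreal (hyp_density ?n z) * ennreal ((G (ray \<theta> z))\<^sup>2) \<partial>lborel)"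
		proof (rule nn_integral_cong)
			fix t
			show "indicator {0<..} t * (ennreal (rad_w ?n t) * (ennreal (H t))\<^sup>2) =
					ennreal (hyp_density ?n t) * ennreal ((G (ray \<theta> t))\<^sup>2)"
			proof (cases "t > 0")
				case True
				have "(ennreal (H t))\<^sup>2 = ennreal ((H t)\<^sup>2)" using True G0 by (simp add: H_def ennreal_power)
				moreover have "rad_w ?n t * (H t)\<^sup>2 = hyp_density ?n t * (G (ray \<theta> t))\<^sup>2"
					unfolding hyp_density_rad_w[OF True n, symmetric] H_def using True by (simp add: power_divide)
				ultimately show ?thesis
					using True rad_w_pos[OF True, of ?n] hyp_density_nonneg[of ?n t] by (simp add: ennreal_mult[symmetric])
			qed (simp add: hyp_density_def)
		qed
		finally show ?thesis .
	qed
	have "(\<integral>\<^sup>+x. ennreal (shift_energy \<delta> f x) \<partial>hyp_vol) <= (\<integral>\<^sup>+x. ennreal ((G x)\<^sup>2) \<partial>hyp_vol)"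
		by (subst (1 2) nn_integral_hyp_vol)
			(measurable, rule nn_integral_mono_AE, rule eventually_mono[OF AE_angular_norm], rule ray)
	then show ?thesis using GE by (rule order_trans)
qed

lemma rwt_decreasing:
	fixes x y :: "'a::euclidean_space"
	assumes \<omega>: "!!s t. 0 < s ==> s <= t ==> \<omega> s <= \<omega> t"
		and "x \<in> hyp_space" "y \<in> hyp_space" "x ~= 0" "y ~= 0" "norm x <= norm y"
	shows "rwt \<omega> y <= rwt \<omega> x"
	using assms(2-) by (auto simp: rwt_def ln_less_zero intro!: \<omega>)

lemma symmetrization:
	fixes v :: "'a::euclidean_space => real"
	assumes v: "v \<in> hyp_test_functions" and n: "DIM('a) >= 3" and p: "2 < p" "p <= 2 * real DIM('a) / (real DIM('a) - 2)"
	obtains \<gamma> z0 M where "z0 > 0" "continuous_on {0<..} \<gamma>" "!!z. z > 0 ==> 0 <= \<gamma> z" "!!z. z > 0 ==> \<gamma> z <= M"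
		"!!z. 0 < z ==> z < z0 ==> \<gamma> z = 0"
		"(\<integral>x. (v x)\<^sup>2 \<partial>hyp_vol) = measure (angular :: 'a measure) UNIV * (square_norm DIM('a) \<gamma>)"
		"(\<integral>x. rwt (S_weight DIM('a) p) x * \<bar>v x\<bar> powr p \<partial>hyp_vol) <=
			 measure (angular :: 'a measure) UNIV * (\<integral>z. hyp_density DIM('a) z * (S_weight DIM('a) p z * \<gamma> z powr p) \<partial>lborel)"
		"!!\<delta>. \<delta> > 0 ==> ennreal (measure (angular :: 'a measure) UNIV) *
			 (\<integral>\<^sup>+z. ennreal (indicator {0<..} z * (rad_w DIM('a) (z + \<delta>) * ((\<gamma> (z + \<delta>) - \<gamma> z) / \<delta>)\<^sup>2)) \<partial>lborel) <=
			 ennreal (\<integral>x. (hyp_grad_norm v x)\<^sup>2 \<partial>hyp_vol)"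
proof -
	let ?n = "DIM('a)"
	define W where "W = (rwt (S_weight ?n p) :: 'a => real)"
	have p0: "p > 0" using p by simp
	have Wm [measurable]: "W \<in> borel_measurable borel"
		unfolding W_def by (rule rwt_measurable[OF S_weight_props(1)[OF n p(1)]])
	have W0: "W x >= 0" for x by (simp add: W_def rwt_def S_weight_def)
	\<comment> \<open>The upper bound on \<open>p\<close> is equivalent to this sign, which makes the
	  weight increasing in \<open>z\<close> and hence decreasing in the radius.\<close>
	have e: "- (p * (real ?n - 2) / 2 - real ?n) >= 0"
		using p(2) n by (simp add: pos_le_divide_eq)
	have Wd: "W y <= W x" if "x \<in> hyp_space" "y \<in> hyp_space" "x ~= 0" "y ~= 0" "norm x <= norm y" for x y
		unfolding W_def
		by (rule rwt_decreasing[OF _ that]) (use e in \<open>auto simp: S_weight_def intro!: powr_mono2\<close>)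
	obtain R M L where R: "0 < R" "R < 1" and L: "L >= 0" and M: "M > 0"
		and f0: "admissible R M L W p v (\<lambda>x. \<bar>v x\<bar>)"
		using admissible_abs[OF v] by metis
	obtain f g where f: "!!j::nat. admissible R M L W p v (f j)" and g: "lip_class R M L g" and lim: "!!x. (\<lambda>j. f j x) \<longlonglongrightarrow> g x"
		and inv: "!!c x. norm c > 1 ==> x \<in> hyp_space ==> polarize c g x = g x"
		using symmetric_extremal[OF f0 R L M p0 Wm W0 Wd] by blast
	have flc: "lip_class R M L (f j)" for j using f by (simp add: admissible_def)
	have fm: "f j \<in> borel_measurable borel" for j by (rule lip_class_measurable[OF flc R(2)])
	have gm: "g \<in> borel_measurable borel" by (rule lip_class_measurable[OF g R(2)])
	note [measurable] = fm gm test_measurable[OF v]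
	have M0: "M >= 0" using M by simp
	obtain b :: 'a where b: "b \<in> Basis" using nonempty_Basis by blast
	have nb: "norm b = 1" by (rule norm_Basis[OF b])
	define \<gamma> where "\<gamma> z = g (ray b z)" for z
	have in_ball: "ray \<theta> z \<in> hyp_space" if "norm \<theta> = 1" "z > 0" for z and \<theta> :: 'a using that by simp
	have rad: "g (ray \<theta> z) = \<gamma> z" if "norm \<theta> = 1" "z > 0" for z \<theta>
		unfolding \<gamma>_def
		by (rule polarize_invariant_radial[OF g inv in_ball[OF that] in_ball[OF nb that(2)]]) (simp_all add: that nb)
	have g_rwt: "AE x in hyp_vol. F (g x) (rwt \<omega> x) = rwt (\<lambda>z. F (\<gamma> z) (\<omega> z)) x" for F :: "real => real => real" and \<omega>
		using AE_hyp_vol AE_hyp_vol_nonzero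
	proof eventually_elim
		case (elim x)
		obtain z \<theta> where z: "z > 0" "norm \<theta> = 1" "x = ray \<theta> z"
			using polar_decomposition[of x] elim by auto
		show ?case unfolding z(3) rwt_polar[OF z(2,1)] rad[OF z(2,1)] ..
	qed
	have radial: "(\<integral>x. F (g x) (rwt \<omega> x) \<partial>hyp_vol) =
			measure (angular :: 'a measure) UNIV * (\<integral>z. hyp_density ?n z * F (\<gamma> z) (\<omega> z) \<partial>lborel)"
		if int: "integrable hyp_vol (\<lambda>x. F (g x) (rwt \<omega> x))" and \<omega>: "continuous_on {0<..} (\<lambda>z. F (\<gamma> z) (\<omega> z))"
		for F :: "real => real => real" and \<omega>
	proof -
		have m: "rwt (\<lambda>z. F (\<gamma> z) (\<omega> z)) \<in> borel_measurable (hyp_vol :: 'a measure)"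
			unfolding measurable_cong_sets[OF sets_hyp_vol refl] by (rule rwt_measurable[OF \<omega>])
		have "(\<integral>x. F (g x) (rwt \<omega> x) \<partial>hyp_vol) = (\<integral>x. rwt (\<lambda>z. F (\<gamma> z) (\<omega> z)) (x::'a) \<partial>hyp_vol)"
		proof (rule integral_cong_AE)
			show "(\<lambda>x. F (g x) (rwt \<omega> x)) \<in> borel_measurable hyp_vol" using int by (rule borel_measurable_integrable)
			show "rwt (\<lambda>z. F (\<gamma> z) (\<omega> z)) \<in> borel_measurable (hyp_vol :: 'a measure)" by (rule m)
			show "AE x in hyp_vol. F (g x) (rwt \<omega> x) = rwt (\<lambda>z. F (\<gamma> z) (\<omega> z)) x" by (rule g_rwt)
		qed
		moreover have "integrable hyp_vol (rwt (\<lambda>z. F (\<gamma> z) (\<omega> z)) :: 'a => real)"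
			using int integrable_cong_AE[OF borel_measurable_integrable[OF int] m g_rwt[of F \<omega>]] by simp
		ultimately show ?thesis using integral_rwt by simp
	qed
	have \<gamma>_cont: "continuous_on {0<..} \<gamma>"
	proof (intro continuous_at_imp_continuous_on ballI)
		fix z :: real assume "z \<in> {0<..}"
		then have "isCont g (ray b z)" using in_ball[OF nb] lip_class_isCont[OF g] by simp
		moreover have "isCont (\<lambda>z. ray b z) z" by (intro continuous_intros)
		ultimately show "isCont \<gamma> z" unfolding \<gamma>_def[abs_def] by (rule isCont_o2[rotated])
	qed
	have [measurable]: "cball (0::'a) R \<in> sets borel" by simp
	have k1: "integrable hyp_vol (\<lambda>x::'a. 1 * indicator (cball 0 R) x :: real)"
		by (rule integrable_hyp_vol_bounded[where C=1 and R=R]) (use R in \<open>auto split: split_indicator\<close>)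
	have kW: "integrable hyp_vol (\<lambda>x::'a. W x * indicator (cball 0 R) x)"
		unfolding W_def
		by (rule integrable_rwt[OF _ _ R(2) _ S_weight_props[OF n p(1)], where C=1])
			(auto split: split_indicator)
	have sq: "continuous_on {0..M} (\<lambda>t::real. t\<^sup>2)" "(0::real)\<^sup>2 = 0" "(\<lambda>t::real. t\<^sup>2) \<in> borel_measurable borel"
		by (auto intro!: continuous_intros)
	have pw: "continuous_on {0..M} (\<lambda>t::real. t powr p)" "(0::real) powr p = 0" "(\<lambda>t::real. t powr p) \<in> borel_measurable borel"
	proof -
		show "continuous_on {0..M} (\<lambda>t::real. t powr p)"
			using p0 by (intro continuous_on_powr' continuous_on_id continuous_on_const) auto
	qed (use p0 in simp_all)
	have A: "(\<integral>x. (v x)\<^sup>2 \<partial>hyp_vol) = measure (angular :: 'a measure) UNIV * (square_norm ?n \<gamma>)"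
	proof -
		have "(\<integral>x. 1 * (f j x)\<^sup>2 \<partial>hyp_vol) = (\<integral>x. (v x)\<^sup>2 \<partial>hyp_vol)" for j
			using f[of j] unfolding admissible_def by (simp add: integral_eq_nn_integral)
		then have "(\<lambda>j. \<integral>x. (v x)\<^sup>2 \<partial>hyp_vol) \<longlonglongrightarrow> (\<integral>x. 1 * (g x)\<^sup>2 \<partial>hyp_vol)"
			using lip_class_integral_tendsto[OF flc g lim R(2) M0 k1 _ sq] by simp
		then have "(\<integral>x. (v x)\<^sup>2 \<partial>hyp_vol) = (\<integral>x. 1 * (g x)\<^sup>2 \<partial>hyp_vol)"
			by (rule LIMSEQ_unique[OF tendsto_const])
		also have "... = measure (angular :: 'a measure) UNIV * (square_norm ?n \<gamma>)"
			using radial[of "\<lambda>t _. t\<^sup>2"] lip_class_integrable(2)[OF g R(2) M0 k1 _ sq] \<gamma>_cont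
			by (simp add: continuous_on_power)
		finally show ?thesis .
	qed
	have B: "(\<integral>x. W x * \<bar>v x\<bar> powr p \<partial>hyp_vol) <=
		 measure (angular :: 'a measure) UNIV * (\<integral>z. hyp_density ?n z * (S_weight ?n p z * \<gamma> z powr p) \<partial>lborel)"
	proof -
		have le: "(\<integral>x. W x * \<bar>v x\<bar> powr p \<partial>hyp_vol) <= (\<integral>x. W x * f j x powr p \<partial>hyp_vol)" for j
		proof -
			have "(\<integral>\<^sup>+x. ennreal (W x * \<bar>v x\<bar> powr p) \<partial>hyp_vol) <= (\<integral>\<^sup>+x. ennreal (W x * f j x powr p) \<partial>hyp_vol)"
				using f[of j] unfolding admissible_def by blast
			moreover have "integrable hyp_vol (\<lambda>x. W x * \<bar>v x\<bar> powr p)"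
				unfolding W_def by (rule integrable_weight[OF v p0 S_weight_props[OF n p(1)]])
			moreover have "integrable hyp_vol (\<lambda>x. W x * f j x powr p)"
				by (rule lip_class_integrable(2)[OF flc R(2) M0 kW Wm pw])
			ultimately show ?thesis
				using W0 by (simp add: nn_integral_eq_integral integral_nonneg_AE)
		qed
		have "(\<integral>x. W x * \<bar>v x\<bar> powr p \<partial>hyp_vol) <= (\<integral>x. W x * g x powr p \<partial>hyp_vol)"
			by (rule LIMSEQ_le_const[OF lip_class_integral_tendsto[OF flc g lim R(2) M0 kW Wm pw]]) (use le in blast)
		also have "... = measure (angular :: 'a measure) UNIV * (\<integral>z. hyp_density ?n z * (S_weight ?n p z * \<gamma> z powr p) \<partial>lborel)"
		proof -
			have c: "continuous_on {0<..} (\<lambda>z. S_weight ?n p z * \<gamma> z powr p)"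
				using lip_classD(1)[OF g] p0 \<gamma>_cont
				by (intro continuous_on_mult S_weight_props(1)[OF n p(1)] continuous_on_powr' continuous_on_const) (auto simp: \<gamma>_def)
			show ?thesis
				using radial[of "\<lambda>t w. w * t powr p", OF lip_class_integrable(2)[OF g R(2) M0 kW Wm pw, unfolded W_def] c]
				by (simp add: W_def)
		qed
		finally show ?thesis .
	qed
	have C: "ennreal (measure (angular :: 'a measure) UNIV) *
			 (\<integral>\<^sup>+z. ennreal (indicator {0<..} z * (rad_w ?n (z + \<delta>) * ((\<gamma> (z + \<delta>) - \<gamma> z) / \<delta>)\<^sup>2)) \<partial>lborel) <=
			 ennreal (\<integral>x. (hyp_grad_norm v x)\<^sup>2 \<partial>hyp_vol)" if \<delta>: "\<delta> > 0" for \<delta>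
	proof -
		let ?E = "\<integral>\<^sup>+z. ennreal (indicator {0<..} z * (rad_w ?n (z + \<delta>) * ((\<gamma> (z + \<delta>) - \<gamma> z) / \<delta>)\<^sup>2)) \<partial>lborel"
		note [measurable] = shift_energy_measurable[OF fm \<delta>] shift_energy_measurable[OF gm \<delta>]
		have ray: "(\<integral>\<^sup>+z. ennreal (hyp_density ?n z) * ennreal (shift_energy \<delta> g (ray \<theta> z)) \<partial>lborel) = ?E"
			if \<theta>: "norm \<theta> = 1" for \<theta> :: 'a
			unfolding shift_energy_polar[OF \<theta> \<delta>]
		proof (rule nn_integral_cong)
			fix z
			show "ennreal (indicator {0<..} z * (rad_w ?n (z + \<delta>) * ((g (ray \<theta> (z + \<delta>)) - g (ray \<theta> z)) / \<delta>)\<^sup>2)) =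
				 ennreal (indicator {0<..} z * (rad_w ?n (z + \<delta>) * ((\<gamma> (z + \<delta>) - \<gamma> z) / \<delta>)\<^sup>2))"
				using rad[OF \<theta>, of z] rad[OF \<theta>, of "z + \<delta>"] \<delta> by (cases "z > 0") auto
		qed
		have "ennreal (measure (angular :: 'a measure) UNIV) * ?E = (\<integral>\<^sup>+(\<theta>::'a). ?E \<partial>angular)"
			using finite_measure.emeasure_eq_measure[OF finite_measure_angular, of "UNIV :: 'a set"]
			by (simp add: mult.commute)
		also have "... = (\<integral>\<^sup>+(\<theta>::'a). (\<integral>\<^sup>+z. ennreal (hyp_density ?n z) * ennreal (shift_energy \<delta> g (ray \<theta> z)) \<partial>lborel) \<partial>angular)"
			by (rule nn_integral_cong_AE, rule eventually_mono[OF AE_angular_norm]) (simp add: ray)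
		also have "... = (\<integral>\<^sup>+x. ennreal (shift_energy \<delta> g x) \<partial>hyp_vol)"
			by (rule nn_integral_hyp_vol[symmetric]) measurable
		\<comment> \<open>From here on Fatou's lemma transfers the energy bound of the admissible
		  approximants to their limit \<open>g\<close>.\<close>
		also have "... = (\<integral>\<^sup>+x. liminf (\<lambda>j. ennreal (shift_energy \<delta> (f j) x)) \<partial>hyp_vol)"
		proof (rule nn_integral_cong)
			fix x
			have "(\<lambda>j. ennreal (shift_energy \<delta> (f j) x)) \<longlonglongrightarrow> ennreal (shift_energy \<delta> g x)"
				unfolding shift_energy_def by (intro tendsto_ennrealI tendsto_intros lim) (use \<delta> in simp)
			then show "ennreal (shift_energy \<delta> g x) = liminf (\<lambda>j. ennreal (shift_energy \<delta> (f j) x))"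
				by (simp add: lim_imp_Liminf)
		qed
		also have "... <= liminf (\<lambda>j. \<integral>\<^sup>+x. ennreal (shift_energy \<delta> (f j) x) \<partial>hyp_vol)"
			by (rule nn_integral_liminf) measurable
		also have "... <= (\<integral>\<^sup>+x. ennreal ((hyp_grad_norm v x)\<^sup>2) \<partial>hyp_vol)"
			using n by (intro Liminf_le always_eventually allI admissible_shift_energy[OF f R(2) L \<delta>]) auto
		also have "... = ennreal (\<integral>x. (hyp_grad_norm v x)\<^sup>2 \<partial>hyp_vol)"
			by (rule nn_integral_eq_integral[OF integrable_hyp_grad_norm[OF v]]) simp
		finally show ?thesis .
	qed
	show ?thesis
	proof (rule that[of "- ln R" \<gamma> M])
		show "- ln R > 0" using R by simp
		show "\<gamma> z = 0" if "0 < z" "z < - ln R" for z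
		proof -
			have "R < exp (- z)" using that(2) R(1) by (metis exp_less_cancel_iff exp_ln less_minus_iff)
			then show ?thesis using lip_classD(3)[OF g] by (simp add: \<gamma>_def nb)
		qed
		show "ennreal (measure (angular :: 'a measure) UNIV) *
			 (\<integral>\<^sup>+z. ennreal (indicator {0<..} z * (rad_w ?n (z + \<delta>) * ((\<gamma> (z + \<delta>) - \<gamma> z) / \<delta>)\<^sup>2)) \<partial>lborel) <=
			 ennreal (\<integral>x. (hyp_grad_norm v x)\<^sup>2 \<partial>hyp_vol)" if "\<delta> > 0" for \<delta> by (rule C[OF that])
	qed (use A B \<gamma>_cont lip_classD(1,2)[OF g] in \<open>auto simp: \<gamma>_def W_def\<close>)
qed

subsection \<open>Radial test functions\<close>

lemma egrad_rwt:
	fixes \<theta> :: "'a::euclidean_space"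
	assumes \<theta>: "norm \<theta> = 1" and z: "z > 0" and \<phi>: "(\<phi> has_real_derivative \<phi>') (at z)"
	shows "egrad (rwt \<phi>) (ray \<theta> z) = (- (\<phi>' * exp z)) *\<^sub>R \<theta>"
proof (rule egrad_unique)
	let ?x = "ray \<theta> z"
	have x: "?x ~= 0" "norm ?x = exp (- z)" "?x \<in> hyp_space" "sgn ?x = \<theta>" using \<theta> z by (auto simp: sgn_div_norm)
	have "(norm has_derivative (\<lambda>h. h \<bullet> sgn ?x)) (at ?x)" by (rule has_derivative_norm[OF x(1)])
	moreover have "((\<lambda>r. \<phi> (- ln r)) has_real_derivative \<phi>' * (- (1 / norm ?x))) (at (norm ?x))"
	proof (rule DERIV_chain2[where f=\<phi> and g="\<lambda>r. - ln r"])
		show "(\<phi> has_real_derivative \<phi>') (at (- ln (norm ?x)))" unfolding x(2) using \<phi> by simp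
		show "((\<lambda>r. - ln r) has_real_derivative - (1 / norm ?x)) (at (norm ?x))"
			unfolding x(2) by (auto intro!: derivative_eq_intros simp: divide_inverse)
	qed
	ultimately have "((\<lambda>x. \<phi> (- ln (norm x))) has_derivative (\<lambda>h. \<phi>' * (- (1 / norm ?x)) * (h \<bullet> sgn ?x))) (at ?x)"
		unfolding has_field_derivative_def by (rule has_derivative_compose)
	then have "(rwt \<phi> has_derivative (\<lambda>h. \<phi>' * (- (1 / norm ?x)) * (h \<bullet> sgn ?x))) (at ?x)"
		by (rule has_derivative_transform_within_open[where s="hyp_space - {0}"]) (use x in \<open>auto simp: rwt_def\<close>)
	moreover have "(\<lambda>h. \<phi>' * (- (1 / norm ?x)) * (h \<bullet> sgn ?x)) = (\<lambda>h. ((- (\<phi>' * exp z)) *\<^sub>R \<theta>) \<bullet> h)"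
		unfolding x(2,4) by (simp add: fun_eq_iff exp_minus divide_inverse inner_commute)
	ultimately show "(rwt \<phi> has_derivative (\<lambda>h. ((- (\<phi>' * exp z)) *\<^sub>R \<theta>) \<bullet> h)) (at ?x)" by simp
qed

lemma radial_form_integral:
	assumes \<phi>: "C1c a b \<phi> \<phi>'" and u: "punctured_test (rwt \<phi> :: 'a::euclidean_space => real)" and n: "DIM('a) >= 3"
	shows "(\<integral>x. hyp_form m (rwt \<phi> :: 'a => real) x \<partial>hyp_vol) =
		measure (angular :: 'a measure) UNIV * (\<integral>z. rad_form DIM('a) m \<phi> \<phi>' z \<partial>lborel)"
proof -
	let ?u = "rwt \<phi> :: 'a => real"
	have u': "?u \<in> hyp_test_functions" using u by (simp add: punctured_test_def)
	note int = integrable_hyp_form(3)[OF u' n, where m=m]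
	have "(total_form m ?u) = (\<integral>(\<theta>::'a). (\<integral>z. rad_form DIM('a) m \<phi> \<phi>' z \<partial>lborel) \<partial>angular)"
		unfolding integral_hyp_vol(1)[OF int]
	proof (rule integral_cong_AE)
		show "(\<lambda>\<theta>. \<integral>z. hyp_density DIM('a) z * hyp_form m ?u (ray \<theta> z) \<partial>lborel) \<in> borel_measurable angular"
			by (rule borel_measurable_integrable[OF integral_hyp_vol(2)[OF int]])
		show "AE \<theta> in angular. (\<integral>z. hyp_density DIM('a) z * hyp_form m ?u (ray \<theta> z) \<partial>lborel) =
				(\<integral>z. rad_form DIM('a) m \<phi> \<phi>' z \<partial>lborel)"
		proof (rule eventually_mono[OF AE_angular_norm])
			fix \<theta> :: 'a assume \<theta>: "norm \<theta> = 1"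
			have "hyp_density DIM('a) z * hyp_form m ?u (ray \<theta> z) = rad_form DIM('a) m \<phi> \<phi>' z" for z
			proof (cases "z > 0")
				case True
				have g: "egrad ?u (ray \<theta> z) = (- (\<phi>' z * exp z)) *\<^sub>R \<theta>"
					by (rule egrad_rwt[OF \<theta> True C1cD(3)[OF \<phi> True]])
				have tt: "\<theta> \<bullet> \<theta> = 1" using \<theta> by (simp add: norm_eq_1)
				have "ray' ?u \<theta> z = \<phi>' z" unfolding ray'_def g by (simp add: tt exp_minus)
				moreover have "ray_tang ?u \<theta> z = 0" unfolding ray_tang_def g by (simp add: tang_def tt \<theta> power_mult_distrib)
				moreover have "hyp_density DIM('a) z * hyp_form m ?u (ray \<theta> z) =
						rad_form DIM('a) m (\<lambda>z. ?u (ray \<theta> z)) (ray' ?u \<theta>) z + rad_w DIM('a) z * ray_tang ?u \<theta> z"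
					using hyp_form_ray[OF u' \<theta>, of z m] n True by simp
				ultimately show ?thesis by (simp add: rad_form_def rwt_polar[OF \<theta> True])
			next
				case False
				then show ?thesis using C1cD(1)[OF \<phi>] C1cD(5,6)[OF \<phi>, of z] by (simp add: hyp_density_def rad_form_def)
			qed
			then show "(\<integral>z. hyp_density DIM('a) z * hyp_form m ?u (ray \<theta> z) \<partial>lborel) = (\<integral>z. rad_form DIM('a) m \<phi> \<phi>' z \<partial>lborel)"
				by (simp only:)
		qed
	qed simp
	then show ?thesis by simp
qed

text \<open>On radial functions the transplantation is inverted: \<open>\<psi>0\<close> is the
  profile whose transplant is \<open>\<phi>\<close>. Without angular energy the two forms coincide,
  so the inequality with the weight \<open>Y\<close> turns into one without it, at the cost of the
  power of \<open>n - 2\<close>.\<close>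

lemma radial_ineq:
	fixes T :: "'a::euclidean_space itself"
	assumes Y: "Y_ineq T p C" and n: "DIM('a) >= 3" and p: "p > 2"
		and \<phi>: "!!k. Ck_on k {0<..} \<phi>" "C1c a b \<phi> \<phi>'"
	shows "C * (real DIM('a) - 2) powr ((p + 2) / p) * (measure (angular :: 'a measure) UNIV *
			(weighted_norm DIM('a) p \<phi>)) powr (2 / p) <=
		measure (angular :: 'a measure) UNIV * (\<integral>z. rad_form DIM('a) (hm DIM('a)) \<phi> \<phi>' z \<partial>lborel)"
proof -
	let ?n = "DIM('a)"
	let ?s = "measure (angular :: 'a measure) UNIV"
	define y where "y = tr_y ?n"
	define x where "x = leg_tr (hm ?n) (- (1/2))"
	have xy: "x (y z) = z" "y (x z) = z" "x z > 0" "y z > 0" if "z > 0" for z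
		using that by (simp_all add: x_def y_def leg_tr_inverse leg_tr_pos)
	define \<psi> where "\<psi> z = \<phi> (x z) / tr_a ?n (x z)" for z
	note ab = C1cD(1,2)[OF \<phi>(2)]
	have x_smooth: "Ck_on k {0<..} x" for k unfolding x_def by (rule leg_tr_smooth)
	have xi: "x ` {0<..} \<subseteq> {0<..}" using xy by auto
	have \<psi>_smooth: "Ck_on k {0<..} \<psi>" for k
		unfolding \<psi>_def[abs_def]
		by (intro Ck_on_divide Ck_on_compose_real[OF _ _ xi \<phi>(1) x_smooth] Ck_on_compose_real[OF _ _ xi tr_a_smooth x_smooth])
			(use tr_a_pos xy in \<open>auto simp: less_imp_neq[symmetric]\<close>)
	have y_cont: "continuous_on {a..b} y"
		unfolding y_def by (rule continuous_on_subset[OF Ck_on_imp_continuous_on[OF leg_tr_smooth[of 0]]]) (use ab in auto)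
	have "compact (y ` {a..b})" by (rule compact_continuous_image[OF y_cont]) simp
	moreover have "y ` {a..b} ~= {}" using ab by simp
	ultimately obtain s t where s: "s \<in> y ` {a..b}" "!!r. r \<in> y ` {a..b} ==> s <= r" and t: "!!r. r \<in> y ` {a..b} ==> r <= t"
		using compact_attains_inf compact_attains_sup by metis
	have s0: "s > 0" using s(1) xy ab by auto
	define \<psi>' where "\<psi>' z = (if z > 0 then frechet_derivative \<psi> (at z) 1 else 0)" for z
	have d\<psi>: "(\<psi> has_real_derivative \<psi>' z) (at z)" if "z > 0" for z
		using Ck_on_real_SucD[OF \<psi>_smooth[of "Suc 0"], of z] that by (simp add: \<psi>'_def)
	\<comment> \<open>\<open>C1c\<close> asks for vanishing outside an interval of the whole line,
	  whereas \<open>\<psi>\<close> is under control for positive arguments only.\<close>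
	define \<psi>0 where "\<psi>0 z = (if z > 0 then \<psi> z else 0)" for z
	have \<psi>0_smooth: "Ck_on k {0<..} \<psi>0" for k
		by (rule Ck_on_cong[THEN iffD1, OF _ _ \<psi>_smooth]) (auto simp: \<psi>0_def)
	have d\<psi>0: "(\<psi>0 has_real_derivative \<psi>' z) (at z)" if "z > 0" for z
		by (rule has_field_derivative_transform_within_open[OF d\<psi>[OF that], of "{0<..}"]) (use that in \<open>auto simp: \<psi>0_def\<close>)
	have out: "\<psi>0 z = 0" if "z \<notin> {s..t + 1}" for z
	proof (cases "z > 0")
		case True
		have "x z \<notin> {a..b}"
		proof
			assume "x z \<in> {a..b}"
			then have "y (x z) \<in> y ` {a..b}" by blast
			then show False using s(2) t that xy(2)[OF True] by fastforce
		qed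
		then show ?thesis using C1cD(5)[OF \<phi>(2)] True by (simp add: \<psi>0_def \<psi>_def)
	qed (simp add: \<psi>0_def)
	have out': "\<psi>' z = 0" if z: "z \<notin> {s..t + 1}" for z
	proof (cases "z > 0")
		case True
		have "open (- {s..t + 1})" by (intro open_Compl) simp
		have "((\<lambda>_. 0) has_real_derivative 0) (at z)" by simp
		then have "(\<psi>0 has_real_derivative 0) (at z)"
			by (rule has_field_derivative_transform_within_open[OF _ \<open>open (- {s..t + 1})\<close>]) (use z out in auto)
		then show ?thesis using d\<psi>0[OF True] by (rule DERIV_unique[symmetric])
	qed (simp add: \<psi>'_def)
	\<comment> \<open>The right end is enlarged by 1 because \<open>C1c\<close> asks for a
	  nondegenerate interval, and from the extrema of \<open>y\<close> only \<open>s <= t\<close> is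
	  known.\<close>
	have st: "s < t + 1" using s(1) t by force
	have c\<psi>: "C1c s (t + 1) \<psi>0 \<psi>'"
		unfolding C1c_def
	proof (intro conjI allI impI s0 st d\<psi>0 out out')
		have "continuous_on {0<..} (\<lambda>z. frechet_derivative \<psi> (at z) 1)"
			using \<psi>_smooth[of "Suc 0"] by (simp add: Ck_on.simps)
		then show "continuous_on {0<..} \<psi>'" by (rule continuous_on_eq) (simp add: \<psi>'_def)
	qed auto
	let ?u = "rwt \<psi>0 :: 'a => real" and ?v = "rwt \<phi> :: 'a => real"
	have u: "punctured_test ?u" by (rule rwt_test[OF \<psi>0_smooth s0 out])
	have v: "punctured_test ?v" by (rule rwt_test[OF \<phi>(1) ab(1) C1cD(5)[OF \<phi>(2)]])
	have \<phi>_eq: "tr_a ?n z * \<psi>0 (y z) = \<phi> z" if "z > 0" for z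
		using xy[OF that] tr_a_pos[OF that, of ?n] by (simp add: \<psi>0_def \<psi>_def)
	have tr: "transplant ?u = ?v"
	proof
		fix w :: 'a
		show "transplant ?u w = ?v w"
		proof (cases "w ~= 0 \<and> norm w < 1")
			case True
			obtain z \<theta> where z: "z > 0" "norm \<theta> = 1" "w = ray \<theta> z"
				using polar_decomposition[of w] True by auto
			show ?thesis
				unfolding z(3) transplant_polar[OF z(2,1)] rwt_polar[OF z(2,1)]
				using rwt_polar[OF z(2) xy(4)[OF z(1)], of \<psi>0] \<phi>_eq[OF z(1)] by (simp add: y_def)
		next
			case False
			then show ?thesis by (auto simp: transplant_def radial_tr_def rwt_def)
		qed
	qed
	let ?F = "\<lambda>z. rad_w ?n z * (\<psi>' z - ground_log ?n (- (1/2)) z * \<psi>0 z)\<^sup>2"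
	have n2: "?n >= 2" using n by simp
	have "(\<integral>z. rad_form ?n (hm ?n) \<phi> \<phi>' z \<partial>lborel) = (\<integral>z. rad_w ?n z * (\<phi>' z - ground_log ?n (hm ?n) z * \<phi> z)\<^sup>2 \<partial>lborel)"
		by (rule ground_state_representation[OF \<phi>(2) n2])
	also have "... = (\<integral>z. indicator {0<..} z * (leg_w (- (1/2)) (tr_y ?n z) / leg_w (hm ?n) z * ?F (tr_y ?n z)) \<partial>lborel)"
	proof (rule Bochner_Integration.integral_cong[OF refl])
		fix z :: real
		show "rad_w ?n z * (\<phi>' z - ground_log ?n (hm ?n) z * \<phi> z)\<^sup>2 =
			 indicator {0<..} z * (leg_w (- (1/2)) (tr_y ?n z) / leg_w (hm ?n) z * ?F (tr_y ?n z))"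
		proof (cases "z > 0")
			case True
			have "((\<lambda>z. tr_a ?n z * \<psi>0 (tr_y ?n z)) has_real_derivative \<phi>' z) (at z)"
				by (rule has_field_derivative_transform_within_open[OF C1cD(3)[OF \<phi>(2) True], of "{0<..}"])
					(use True \<phi>_eq in \<open>auto simp: y_def\<close>)
			from transplant_square[OF True n2 d\<psi>0 this] xy(4)[OF True]
			show ?thesis using True \<phi>_eq[OF True] by (simp add: y_def tr_y'_def)
		next
			case False
			then show ?thesis using ab C1cD(5,6)[OF \<phi>(2), of z] by simp
		qed
	qed
	also have "... = (\<integral>z. ?F z \<partial>lborel)"
		by (rule lborel_integral_leg_tr(2)[OF rad_form_integrable(2)[OF c\<psi>]]) (use s0 out out' in simp)
	also have "... = (\<integral>z. rad_form ?n (- (1/2)) \<psi>0 \<psi>' z \<partial>lborel)"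
		by (rule ground_state_representation[OF c\<psi> n2, symmetric])
	finally have form: "?s * (\<integral>z. rad_form ?n (hm ?n) \<phi> \<phi>' z \<partial>lborel) = (total_form (- (1/2)) ?u)"
		using radial_form_integral[OF c\<psi> u n, of "- (1/2)"] by simp
	have p0: "p > 0" using p by simp
	define c where "c = real ?n - 2"
	have c: "c > 0" using n by (simp add: c_def)
	let ?N = "\<integral>x. rwt (S_weight ?n p) x * \<bar>?v x\<bar> powr p \<partial>hyp_vol"
	have N: "?N = ?s * (weighted_norm ?n p \<phi>)"
	proof -
		have eq: "rwt (S_weight ?n p) x * \<bar>?v x\<bar> powr p = rwt (\<lambda>z. S_weight ?n p z * \<bar>\<phi> z\<bar> powr p) x" for x :: 'a
			by (simp add: rwt_def)
		have "integrable hyp_vol (\<lambda>x. rwt (S_weight ?n p) x * \<bar>?v x\<bar> powr p)"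
			by (rule integrable_weight[OF _ p0 S_weight_props[OF n p]]) (use v in \<open>simp add: punctured_test_def\<close>)
		then show ?thesis unfolding eq by (rule integral_rwt)
	qed
	have N0: "?N >= 0" by (intro integral_nonneg_AE AE_I2) (auto simp: rwt_def S_weight_def)
	have "C * (c powr ((p + 2) / 2) * ?N) powr (2 / p) <= (total_form (- (1/2)) ?u)"
	proof -
		have "?u \<in> hyp_test_functions" using u by (simp add: punctured_test_def)
		from Y[unfolded Y_ineq_def, rule_format, OF this] show ?thesis
			unfolding transplant_Y_weight[OF u n p] tr c_def .
	qed
	also have "(c powr ((p + 2) / 2) * ?N) powr (2 / p) = c powr ((p + 2) / 2 * (2 / p)) * ?N powr (2 / p)"
		using N0 by (simp add: powr_mult powr_powr)
	also have "(p + 2) / 2 * (2 / p) = (p + 2) / p" using p0 by (simp add: field_simps)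
	finally show ?thesis unfolding form N[symmetric] c_def by (simp add: mult.assoc)
qed

subsection \<open>Approximation by smooth radial functions\<close>

lemma smooth_step_derivative_0:
	assumes "(smooth_step has_real_derivative d) (at x)" "x < 0 \<or> x > 1"
	shows "d = 0"
proof -
	have "(smooth_step has_real_derivative 0) (at x)"
	proof (cases "x < 0")
		case True
		show ?thesis
			by (rule has_field_derivative_transform_within_open[of "\<lambda>_. 0" _ _ "{..<0}"]) (use True in \<open>auto simp: smooth_step_eq_0\<close>)
	next
		case False
		show ?thesis
			by (rule has_field_derivative_transform_within_open[of "\<lambda>_. 1" _ _ "{1<..}"]) (use False assms in \<open>auto simp: smooth_step_eq_1\<close>)
	qed
	then show ?thesis using assms(1) DERIV_unique by blast
qed

text \<open>Weierstrass approximation is applied to the derivative, and the polynomial is then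
  integrated from \<open>c\<close>. This gives closeness of the function and its derivative by
  smooth functions with explicit antiderivatives; \<open>F c = 0\<close> fixes the constant.\<close>

lemma polynomial_antiderivative_approx:
	fixes f F :: "real => real"
	assumes F: "!!z. z \<in> {c..d} ==> (F has_real_derivative f z) (at z)" "F c = 0"
		and f: "continuous_on {c..d} f" and e: "e > 0"
	obtains Q q where "!!k. Ck_on k UNIV Q" "!!z. (Q has_real_derivative q z) (at z)"
		"!!z. z \<in> {c..d} ==> \<bar>f z - q z\<bar> < e" "!!z. z \<in> {c..d} ==> \<bar>F z - Q z\<bar> <= e * (z - c)"
proof -
	obtain q where q: "polynomial_function q" "!!x. x \<in> {c..d} ==> norm (f x - q x) < e"
		using Stone_Weierstrass_polynomial_function[OF compact_Icc f e] by blast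
	obtain a and m :: nat where a: "q = (\<lambda>x. \<Sum>i\<le>m. a i * x ^ i)"
		using q(1) unfolding real_polynomial_function_eq[symmetric] real_polynomial_function_iff_sum by blast
	define P where "P x = (\<Sum>i\<le>m. a i / real (Suc i) * x ^ Suc i)" for x
	have id: "Ck_on k UNIV (\<lambda>x::real. x)" for k using Ck_on_inner_left[of UNIV k "1::real"] by simp
	have P_smooth: "Ck_on k UNIV P" for k
		unfolding P_def[abs_def] by (intro Ck_on_sum Ck_on_mult Ck_on_power id Ck_on_const) auto
	have dP: "(P has_real_derivative q z) (at z)" for z
		unfolding P_def[abs_def] a
	proof (rule DERIV_sum)
		fix i
		have "((\<lambda>x. a i / real (Suc i) * x ^ Suc i) has_real_derivative a i / real (Suc i) * (real (Suc i) * z ^ i)) (at z)"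
			by (intro DERIV_cmult) (auto intro!: derivative_eq_intros simp del: power_Suc of_nat_Suc)
		then show "((\<lambda>x. a i / real (Suc i) * x ^ Suc i) has_real_derivative a i * z ^ i) (at z)"
			by (simp del: power_Suc of_nat_Suc)
	qed
	define Q where "Q x = P x - P c" for x
	have dQ: "(Q has_real_derivative q z) (at z)" for z
		using DERIV_diff[OF dP DERIV_const] by (simp add: Q_def[abs_def])
	have le: "\<bar>F z - Q z\<bar> <= e * (z - c)" if z: "z \<in> {c..d}" for z
	proof -
		have "norm ((F z - Q z) - (F c - Q c)) <= e * norm (z - c)"
		proof (rule field_differentiable_bound[of "{c..d}" "\<lambda>z. F z - Q z" "\<lambda>z. f z - q z"])
			show "((\<lambda>z. F z - Q z) has_field_derivative f x - q x) (at x within {c..d})" if "x \<in> {c..d}" for x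
				by (rule has_field_derivative_at_within[OF DERIV_diff[OF F(1)[OF that] dQ]])
		qed (use q(2) z in \<open>auto intro: less_imp_le\<close>)
		then show ?thesis using z F(2) by (simp add: Q_def)
	qed
	show ?thesis
	proof (rule that[of Q q])
		show "Ck_on k UNIV Q" for k unfolding Q_def[abs_def] by (intro Ck_on_diff P_smooth Ck_on_const) simp
	qed (use dQ q(2) le in auto)
qed

text \<open>The polynomial is localized by two smooth steps. The left one rises between
  \<open>a / 2\<close> and \<open>a\<close>, where \<open>V\<close> vanishes, so it leaves
  \<open>V\<close> unchanged; the right one falls between \<open>i\<close> and \<open>i + 1\<close>.
  Both have slopes bounded independently of \<open>i\<close>, which yields the uniform constant
  \<open>D\<close> for dominated convergence.\<close>

lemma smooth_radial_approx:
	fixes V V' :: "real => real"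
	assumes a: "a > 0" and V: "!!z. z > 0 ==> (V has_real_derivative V' z) (at z)" "continuous_on {0<..} V'"
		and V0: "!!z. 0 < z ==> z < a ==> V z = 0" and M: "!!z. z > 0 ==> \<bar>V z\<bar> <= M"
	obtains \<phi> \<phi>' :: "nat => real => real" and b D where "!!i k. Ck_on k {0<..} (\<phi> i)" "!!i. C1c (a / 2) (b i) (\<phi> i) (\<phi>' i)"
		"!!i z. \<bar>\<phi> i z\<bar> <= M + 1" "!!i z. z > 0 ==> \<bar>\<phi>' i z\<bar> <= \<bar>V' z\<bar> + D" "D >= 0"
		"!!z. z > 0 ==> (\<lambda>i. \<phi> i z) \<longlonglongrightarrow> V z" "!!z. z > 0 ==> (\<lambda>i. \<phi>' i z) \<longlonglongrightarrow> V' z"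
proof -
	define c where "c = a / 2"
	have c: "0 < c" "c < a" using a by (auto simp: c_def)
	have M0: "M >= 0" using M[of 1] by simp
	\<comment> \<open>The interval up to \<open>d i\<close> contains the support of the cutoffs, and
	  \<open>e i\<close> is chosen such that the error accumulated by integration over it is at most
	  \<open>e i * d i = 1 / (i + 1)\<close>.\<close>
	define d where "d i = real i + 1 + a" for i :: nat
	define e where "e i = 1 / (d i * (real i + 1))" for i :: nat
	have e: "e i > 0" "e i <= 1 / (real i + 1)" "e i * d i = 1 / (real i + 1)" for i
	proof -
		have d: "d i >= 1" using a by (simp add: d_def)
		then show "e i > 0" by (simp add: e_def)
		have "1 * (real i + 1) <= d i * (real i + 1)" using d by (rule mult_right_mono) simp
		then show "e i <= 1 / (real i + 1)" unfolding e_def by (intro divide_left_mono mult_pos_pos) (use d in auto)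
		show "e i * d i = 1 / (real i + 1)" using d by (simp add: e_def)
	qed
	obtain s D0 where s: "!!x. (smooth_step has_real_derivative s x) (at x)" "!!x. \<bar>s x\<bar> <= D0"
		using smooth_step_derivative_bounded by metis
	have D0: "D0 >= 0" using s(2)[of 0] by simp
	have "\<exists>Q q. (\<forall>k. Ck_on k UNIV Q) \<and> (\<forall>z. (Q has_real_derivative q z) (at z)) \<and>
			(\<forall>z\<in>{c..d i}. \<bar>V' z - q z\<bar> < e i) \<and> (\<forall>z\<in>{c..d i}. \<bar>V z - Q z\<bar> <= e i * (z - c))" for i
	proof -
		have F: "(V has_real_derivative V' z) (at z)" if "z \<in> {c..d i}" for z using V(1)[of z] that c by simp
		have f: "continuous_on {c..d i} V'" by (rule continuous_on_subset[OF V(2)]) (use c in auto)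
		have z: "V c = 0" using V0 c by simp
		show ?thesis by (rule polynomial_antiderivative_approx[OF F z f e(1)[of i]]) blast+
	qed
	then obtain Q q where Q: "!!i k. Ck_on k UNIV (Q i)" "!!i z. (Q i has_real_derivative q i z) (at z)"
		"!!i z. z \<in> {c..d i} ==> \<bar>V' z - q i z\<bar> < e i" "!!i z. z \<in> {c..d i} ==> \<bar>V z - Q i z\<bar> <= e i * (z - c)"
		by metis
	define s1 where "s1 z = smooth_step (z / c - 1)" for z
	define s2 where "s2 i z = smooth_step (real i + 1 - z)" for i :: nat and z
	define s1' where "s1' z = s (z / c - 1) * (1 / c)" for z
	define s2' where "s2' i z = s (real i + 1 - z) * (- 1)" for i :: nat and z
	have ds1: "(s1 has_real_derivative s1' z) (at z)" for z
		unfolding s1_def[abs_def] s1'_def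
		by (rule DERIV_chain2[where f=smooth_step and g="\<lambda>z. z / c - 1", OF s(1)]) (use c in \<open>auto intro!: derivative_eq_intros\<close>)
	have ds2: "(s2 i has_real_derivative s2' i z) (at z)" for i z
		unfolding s2_def[abs_def] s2'_def
		by (rule DERIV_chain2[where f=smooth_step and g="\<lambda>z. real i + 1 - z", OF s(1)]) (auto intro!: derivative_eq_intros)
	define \<phi> where "\<phi> i z = Q i z * (s1 z * s2 i z)" for i z
	define \<phi>' where "\<phi>' i z = q i z * (s1 z * s2 i z) + Q i z * (s1' z * s2 i z + s1 z * s2' i z)" for i z
	have d\<phi>: "(\<phi> i has_real_derivative \<phi>' i z) (at z)" for i z
		unfolding \<phi>_def[abs_def] \<phi>'_def
		using DERIV_mult[OF Q(2)[of i z] DERIV_mult[OF ds1[of z] ds2[of i z]]] by (simp add: algebra_simps)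
	have s12: "0 <= s1 z" "s1 z <= 1" "0 <= s2 i z" "s2 i z <= 1" for i z
		by (auto simp: s1_def s2_def smooth_step_nonneg smooth_step_le_1)
	have s1_0: "s1 z = 0" "z < c ==> s1' z = 0" if "z <= c" for z
		using that c smooth_step_derivative_0[OF s(1)] by (auto simp: s1_def s1'_def smooth_step_eq_0)
	have s2_0: "s2 i z = 0" "z > real i + 1 ==> s2' i z = 0" if "z >= real i + 1" for i z
		using that smooth_step_derivative_0[OF s(1)] by (auto simp: s2_def s2'_def smooth_step_eq_0)
	have s2_1: "s2 i z = 1" "s2' i z = 0" if "z < real i" for i z
		using that smooth_step_derivative_0[OF s(1)] by (auto simp: s2_def s2'_def smooth_step_eq_1)
	have outside: "\<phi> i z = 0 \<and> \<phi>' i z = 0" if "z < c \<or> z > real i + 1" for i z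
		using that s1_0[of z] s2_0[of i z] by (auto simp: \<phi>_def \<phi>'_def)
	have Vs: "V z * s1 z = V z" if "z > 0" for z
	proof (cases "z < a")
		case False
		then have "z / c - 1 >= 1" using c by (simp add: c_def field_simps)
		then show ?thesis by (simp add: s1_def smooth_step_eq_1)
	qed (use V0 that in simp)
	have V's: "V' z * s1 z + V z * s1' z = V' z" if z: "z > 0" for z
	proof -
		have "((\<lambda>z. V z * s1 z) has_real_derivative V' z * s1 z + s1' z * V z) (at z)"
			by (rule DERIV_mult[OF V(1)[OF z] ds1])
		then have "(V has_real_derivative V' z * s1 z + s1' z * V z) (at z)"
			by (rule has_field_derivative_transform_within_open[of _ _ _ "{0<..}"]) (use z Vs in auto)
		from DERIV_unique[OF V(1)[OF z] this] show ?thesis by (simp add: mult.commute)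
	qed
	have id: "Ck_on k UNIV (\<lambda>x::real. x)" for k using Ck_on_inner_left[of UNIV k "1::real"] by simp
	have smooth: "Ck_on k UNIV (\<phi> i)" for i k
		unfolding \<phi>_def[abs_def] s1_def s2_def
		by (intro Ck_on_mult Q(1) Ck_on_compose_real[OF _ _ _ Ck_on_smooth_step] Ck_on_diff Ck_on_divide id Ck_on_const)
			(use c in auto)
	have near: "\<bar>V' z - q i z\<bar> <= 1 / (real i + 1)" "\<bar>V z - Q i z\<bar> <= 1 / (real i + 1)" if "z \<in> {c..d i}" for i z
	proof -
		show "\<bar>V' z - q i z\<bar> <= 1 / (real i + 1)" using Q(3)[OF that] e(2)[of i] by simp
		have "e i * (z - c) <= e i * d i" using e(1)[of i] that c by (intro mult_left_mono) auto
		then show "\<bar>V z - Q i z\<bar> <= 1 / (real i + 1)" using Q(4)[OF that] e(3)[of i] by simp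
	qed
	have in_d: "z \<in> {c..d i}" if "\<not> (z < c \<or> z > real i + 1)" for i z using that a by (auto simp: d_def)
	have le1: "1 / (real i + 1) <= 1" for i :: nat by simp
	have Qle: "\<bar>Q i z\<bar> <= M + 1" if "z \<in> {c..d i}" for i z
	proof -
		have "z > 0" using that c by simp
		then show ?thesis using near(2)[OF that] M[of z] le1[of i] by linarith
	qed
	define D where "D = 1 + (M + 1) * (D0 * (1 / c) + D0)"
	have D: "D >= 0" using M0 D0 c by (simp add: D_def add_nonneg_nonneg)
	have bd: "\<bar>\<phi> i z\<bar> <= M + 1" for i z
	proof (cases "z < c \<or> z > real i + 1")
		case True
		then show ?thesis using outside[OF True] M0 by simp
	next
		case False
		have "\<bar>\<phi> i z\<bar> = \<bar>Q i z\<bar> * (s1 z * s2 i z)" using s12 by (simp add: \<phi>_def abs_mult)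
		also have "... <= (M + 1) * (1 * 1)" using Qle[OF in_d[OF False]] s12 by (intro mult_mono) auto
		finally show ?thesis by simp
	qed
	have bd': "\<bar>\<phi>' i z\<bar> <= \<bar>V' z\<bar> + D" for i z
	proof (cases "z < c \<or> z > real i + 1")
		case True
		then show ?thesis using outside[OF True] D by simp
	next
		case False
		have 1: "\<bar>q i z * (s1 z * s2 i z)\<bar> <= (\<bar>V' z\<bar> + 1) * (1 * 1)"
		proof -
			have "\<bar>q i z\<bar> <= \<bar>V' z\<bar> + 1" using near(1)[OF in_d[OF False]] le1[of i] by linarith
			then show ?thesis unfolding abs_mult using s12 by (intro mult_mono) auto
		qed
		have "\<bar>s1' z * s2 i z\<bar> <= D0 * (1 / c) * 1" "\<bar>s1 z * s2' i z\<bar> <= 1 * (D0 * 1)"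
			unfolding abs_mult s1'_def s2'_def using s(2) s12 D0 c by (intro mult_mono; simp)+
		then have "\<bar>s1' z * s2 i z + s1 z * s2' i z\<bar> <= D0 * (1 / c) + D0" by linarith
		then have 2: "\<bar>Q i z * (s1' z * s2 i z + s1 z * s2' i z)\<bar> <= (M + 1) * (D0 * (1 / c) + D0)"
			unfolding abs_mult[of "Q i z"] using Qle[OF in_d[OF False]] M0 by (intro mult_mono) auto
		show ?thesis
			unfolding \<phi>'_def D_def using order_trans[OF abs_triangle_ineq add_mono[OF 1 2]] by (simp only: mult_1_right add.assoc)
	qed
	have lim0: "(\<lambda>i. 1 / (real i + 1)) \<longlonglongrightarrow> 0"
		using LIMSEQ_inverse_real_of_nat by (simp add: inverse_eq_divide add.commute)
	have ev: "\<forall>\<^sub>F i in sequentially. z < real i" for z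
		using filterlim_real_sequentially unfolding filterlim_at_top_dense by blast
	have lim: "(\<lambda>i. \<phi> i z) \<longlonglongrightarrow> V z \<and> (\<lambda>i. \<phi>' i z) \<longlonglongrightarrow> V' z" if z: "z > 0" for z
	proof (cases "z < c")
		case True
		then have *: "\<phi> i z = 0" "\<phi>' i z = 0" for i using outside by auto
		have "V z = 0" using V0 z True c by simp
		moreover have "V' z = 0" using V's[OF z] s1_0[of z] True \<open>V z = 0\<close> by simp
		ultimately show ?thesis by (simp add: *)
	next
		case False
		have ind: "\<forall>\<^sub>F i in sequentially. z \<in> {c..d i} \<and> z < real i"
			using ev[of z] by eventually_elim (use False a in \<open>auto simp: d_def\<close>)
		have "(\<lambda>i. Q i z - V z) \<longlonglongrightarrow> 0"
			by (rule Lim_null_comparison[OF eventually_mono[OF ind] lim0]) (use near(2) in \<open>simp add: abs_minus_commute\<close>)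
		then have QV: "(\<lambda>i. Q i z) \<longlonglongrightarrow> V z" by (rule LIM_zero_cancel)
		have "(\<lambda>i. q i z - V' z) \<longlonglongrightarrow> 0"
			by (rule Lim_null_comparison[OF eventually_mono[OF ind] lim0]) (use near(1) in \<open>simp add: abs_minus_commute\<close>)
		then have qV: "(\<lambda>i. q i z) \<longlonglongrightarrow> V' z" by (rule LIM_zero_cancel)
		have "(\<lambda>i. Q i z * s1 z) \<longlonglongrightarrow> V z * s1 z" by (intro tendsto_intros QV)
		then have 1: "(\<lambda>i. \<phi> i z) \<longlonglongrightarrow> V z * s1 z"
			by (rule Lim_transform_eventually) (use ind in \<open>eventually_elim, simp add: \<phi>_def s2_1\<close>)
		have "(\<lambda>i. q i z * s1 z + Q i z * s1' z) \<longlonglongrightarrow> V' z * s1 z + V z * s1' z" by (intro tendsto_intros QV qV)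
		then have 2: "(\<lambda>i. \<phi>' i z) \<longlonglongrightarrow> V' z * s1 z + V z * s1' z"
			by (rule Lim_transform_eventually) (use ind in \<open>eventually_elim, simp add: \<phi>'_def s2_1\<close>)
		show ?thesis using 1 2 Vs[OF z] V's[OF z] by simp
	qed
	have c1: "C1c (a / 2) (d i) (\<phi> i) (\<phi>' i)" for i
		unfolding C1c_def c_def[symmetric]
	proof (intro conjI allI impI c(1) d\<phi>)
		show "c < d i" using a by (simp add: c_def d_def)
		have "continuous_on {0<..} (\<lambda>z. frechet_derivative (\<phi> i) (at z) 1)"
			using smooth[of "Suc 0" i] continuous_on_subset[OF _ subset_UNIV] unfolding Ck_on.simps by blast
		moreover have "frechet_derivative (\<phi> i) (at z) 1 = \<phi>' i z" for z
			using DERIV_unique[OF Ck_on_real_SucD[OF smooth[of "Suc 0" i]] d\<phi>] by simp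
		ultimately show "continuous_on {0<..} (\<phi>' i)" by simp
		fix z assume "z \<notin> {c..d i}"
		then have "z < c \<or> z > real i + 1" using a by (auto simp: d_def)
		then show "\<phi> i z = 0" "\<phi>' i z = 0" using outside by auto
	qed
	show ?thesis
		using that[of \<phi> d \<phi>' D] Ck_on_subset[OF smooth] c1 bd bd' D lim by blast
qed

text \<open>From dimension 3 on there is at least one factor \<open>1 / sinh z\<close>, which decays
  exponentially; the remaining \<open>n - 3\<close> factors are bounded by their value at
  \<open>a\<close>.\<close>

lemma rad_w_tail_integrable:
	assumes n: "n >= 3" and a: "a > 0"
	shows "integrable lborel (\<lambda>z. indicator {a..} z * rad_w n z)"
proof -
	define K where "K = 2 / (1 - exp (- 2 * a)) * (1 / sinh a ^ (n - 3))"
	have k: "1 - exp (- 2 * a) > 0" using a by simp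
	have K: "K >= 0" using a k by (auto simp: K_def intro!: mult_nonneg_nonneg divide_nonneg_nonneg)
	have le: "rad_w n z <= K * exp (- z)" if z: "z >= a" for z
	proof -
		have z0: "sinh z > 0" "sinh a > 0" using z a by auto
		have "exp (- 2 * z) <= exp (- 2 * a)" using z by simp
		then have "(1 - exp (- 2 * a)) * exp z / 2 <= (1 - exp (- 2 * z)) * exp z / 2"
			by (intro divide_right_mono mult_right_mono) auto
		also have "... = sinh z" by (simp add: sinh_field_def field_simps exp_add[symmetric])
		finally have s: "(1 - exp (- 2 * a)) * exp z / 2 <= sinh z" .
		have "1 / sinh z <= 1 / ((1 - exp (- 2 * a)) * exp z / 2)"
		proof -
			have "(1 - exp (- 2 * a)) * exp z / 2 > 0" using k by simp
			then show ?thesis by (intro divide_left_mono[OF s] mult_pos_pos z0(1)) simp_all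
		qed
		also have "... = 2 / (1 - exp (- 2 * a)) * exp (- z)"
		proof -
			have "1 / (K * E / 2) = 2 / K * inverse E" for K E :: real by (simp add: inverse_eq_divide)
			then show ?thesis unfolding exp_minus[of z] .
		qed
		finally have 1: "1 / sinh z <= 2 / (1 - exp (- 2 * a)) * exp (- z)" .
		have "sinh a ^ (n - 3) <= sinh z ^ (n - 3)" using z z0 by (intro power_mono) auto
		then have 2: "1 / sinh z ^ (n - 3) <= 1 / sinh a ^ (n - 3)"
			using z0 by (intro divide_left_mono mult_pos_pos) auto
		have "n - 2 = Suc (n - 3)" using n by simp
		then have "rad_w n z = (1 / sinh z) * (1 / sinh z ^ (n - 3))" by (simp add: rad_w_def)
		also have "... <= (2 / (1 - exp (- 2 * a)) * exp (- z)) * (1 / sinh a ^ (n - 3))"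
			using 1 2 z0 k by (intro mult_mono) auto
		finally show ?thesis by (simp add: K_def mult_ac)
	qed
	have "(\<integral>\<^sup>+z. ennreal (K * exp (- z)) * indicator {a..} z \<partial>lborel) = ennreal (0 - - (K * exp (- a)))"
	proof (rule nn_integral_FTC_atLeast)
		have "((\<lambda>z. - (K * exp (- z))) \<longlongrightarrow> - (K * 0)) at_top"
			by (intro tendsto_minus tendsto_mult tendsto_const filterlim_compose[OF exp_at_bot filterlim_uminus_at_bot_at_top])
		then show "((\<lambda>z. - (K * exp (- z))) \<longlongrightarrow> 0) at_top" by simp
	qed (use K in \<open>auto intro!: derivative_eq_intros\<close>)
	then have fin: "(\<integral>\<^sup>+z. ennreal (K * exp (- z)) * indicator {a..} z \<partial>lborel) < \<infinity>" by simp
	show ?thesis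
	proof (rule integrableI_bounded)
		have "(\<integral>\<^sup>+z. ennreal (norm (indicator {a..} z * rad_w n z)) \<partial>lborel) <=
				(\<integral>\<^sup>+z. ennreal (K * exp (- z)) * indicator {a..} z \<partial>lborel)"
		proof (rule nn_integral_mono)
			fix z :: real
			show "ennreal (norm (indicator {a..} z * rad_w n z)) <= ennreal (K * exp (- z)) * indicator {a..} z"
				using le[of z] rad_w_pos[of z n] a by (auto split: split_indicator intro!: ennreal_leI)
		qed
		also note fin
		finally show "(\<integral>\<^sup>+z. ennreal (norm (indicator {a..} z * rad_w n z)) \<partial>lborel) < \<infinity>" .
	qed measurable
qed

text \<open>Away from \<open>z = 0\<close> the densities of the square norm and of the weighted norm
  are dominated by the energy weight, so one integrable majorant serves all the integrals.\<close>

lemma weight_tail_bounds: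
	assumes n: "n >= 3" and p: "p > 2" and a: "a > 0" and z: "z >= a"
	shows "\<bar>hyp_density n z\<bar> <= 1 / (sinh a)\<^sup>2 * rad_w n z"
		"\<bar>hyp_density n z * S_weight n p z\<bar> <= rad_w n a powr (p / 2 - 1) * rad_w n z"
proof -
	have z0: "z > 0" using a z by simp
	have s: "(sinh a)\<^sup>2 <= (sinh z)\<^sup>2" using a z by (intro power_mono) auto
	have "hyp_density n z * (sinh a)\<^sup>2 <= hyp_density n z * (sinh z)\<^sup>2"
		using s hyp_density_nonneg by (rule mult_left_mono)
	then have "hyp_density n z * (sinh a)\<^sup>2 <= rad_w n z" using hyp_density_rad_w[OF z0, of n] n by simp
	then show "\<bar>hyp_density n z\<bar> <= 1 / (sinh a)\<^sup>2 * rad_w n z"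
		using a hyp_density_nonneg[of n z] by (simp add: pos_le_divide_eq)
	have "hyp_density n z * S_weight n p z = rad_w n z powr (p / 2)"
		unfolding S_weight_def using n by (intro rad_w_powr[OF z0]) simp
	also have "... = rad_w n z powr (p / 2 - 1) * rad_w n z"
		using rad_w_pos[OF z0, of n] by (simp add: powr_diff)
	also have "... <= rad_w n a powr (p / 2 - 1) * rad_w n z"
		using rad_w_antimono[OF a z, of n] rad_w_pos[OF z0, of n] p by (intro mult_right_mono powr_mono2) auto
	finally show "\<bar>hyp_density n z * S_weight n p z\<bar> <= rad_w n a powr (p / 2 - 1) * rad_w n z"
		using hyp_density_nonneg[of n z] by (simp add: S_weight_def)
qed

lemma tail_integral_tendsto:
	fixes V :: "nat => real => real" and k \<Psi> :: "real => real"
	assumes n: "n >= 3" and a: "a > 0"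
		and k: "continuous_on {0<..} k" "!!z. z <= 0 ==> k z = 0" "!!z. z >= a ==> \<bar>k z\<bar> <= K * rad_w n z"
		and \<Psi>: "continuous_on UNIV \<Psi>" "\<Psi> 0 = 0"
		and V: "!!i. continuous_on {0<..} (V i)" "!!i z. z > 0 ==> \<bar>V i z\<bar> <= M" "!!i z. 0 < z ==> z < a ==> V i z = 0"
		and W: "continuous_on {0<..} W" "!!z. z > 0 ==> (\<lambda>i. V i z) \<longlonglongrightarrow> W z"
	shows "(\<lambda>i. \<integral>z. k z * \<Psi> (V i z) \<partial>lborel) \<longlonglongrightarrow> (\<integral>z. k z * \<Psi> (W z) \<partial>lborel)"
		and "integrable lborel (\<lambda>z. k z * \<Psi> (V i z))"
proof -
	have "compact (\<Psi> ` {-M..M})" by (rule compact_continuous_image[OF continuous_on_subset[OF \<Psi>(1)]]) auto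
	then obtain B where B: "!!t. t \<in> {-M..M} ==> \<bar>\<Psi> t\<bar> <= B"
		using compact_imp_bounded[of "\<Psi> ` {-M..M}"] unfolding bounded_iff real_norm_def ball_simps by blast
	have meas: "(\<lambda>z. k z * \<Psi> (f z)) \<in> borel_measurable lborel" if "continuous_on {0<..} f" for f
	proof -
		have "continuous_on {0<..} (\<lambda>z. k z * \<Psi> (f z))"
			by (intro continuous_on_mult k(1) continuous_on_compose2[OF \<Psi>(1) that]) auto
		then have "(\<lambda>z. indicator {0<..} z *\<^sub>R (k z * \<Psi> (f z))) \<in> borel_measurable borel"
			by (intro borel_measurable_continuous_on_indicator) auto
		moreover have "(\<lambda>z. indicator {0<..} z *\<^sub>R (k z * \<Psi> (f z))) = (\<lambda>z. k z * \<Psi> (f z))"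
			using k(2) by (auto simp: fun_eq_iff split: split_indicator)
		ultimately show ?thesis by simp
	qed
	let ?w = "\<lambda>z. K * B * (indicator {a..} z * rad_w n z)"
	have w: "integrable lborel ?w" using rad_w_tail_integrable[OF n a] by simp
	have bd: "norm (k z * \<Psi> (V i z)) <= ?w z" for i z
	proof -
		consider "z <= 0" | "0 < z" "z < a" | "a <= z" by linarith
		then show ?thesis
		proof cases
			case 3
			have "\<bar>\<Psi> (V i z)\<bar> <= B" using B[of "V i z"] V(2)[of z i] 3 a by (simp add: abs_le_iff)
			then have "\<bar>k z\<bar> * \<bar>\<Psi> (V i z)\<bar> <= (K * rad_w n z) * B"
				using k(3)[OF 3] by (intro mult_mono) auto
			then show ?thesis using 3 by (simp add: abs_mult mult_ac)
		qed (use k(2) V(3) \<Psi>(2) a in auto)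
	qed
	have lim: "AE z in lborel. (\<lambda>i. k z * \<Psi> (V i z)) \<longlonglongrightarrow> k z * \<Psi> (W z)"
	proof (rule AE_I2)
		fix z :: real
		show "(\<lambda>i. k z * \<Psi> (V i z)) \<longlonglongrightarrow> k z * \<Psi> (W z)"
		proof (cases "z > 0")
			case True
			then show ?thesis
				by (intro tendsto_mult tendsto_const continuous_on_tendsto_compose[OF \<Psi>(1) W(2)]) auto
		qed (use k(2) in simp)
	qed
	show "(\<lambda>i. \<integral>z. k z * \<Psi> (V i z) \<partial>lborel) \<longlonglongrightarrow> (\<integral>z. k z * \<Psi> (W z) \<partial>lborel)"
		by (rule integral_dominated_convergence[OF meas[OF W(1)] meas[OF V(1)] w lim]) (use bd in auto)
	show "integrable lborel (\<lambda>z. k z * \<Psi> (V i z))"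
		by (rule Bochner_Integration.integrable_bound[OF w meas[OF V(1)]])
			(use bd order_trans[OF bd abs_ge_self] in auto)
qed

lemma hyp_density_continuous: "continuous_on {0<..} (hyp_density n)"
proof -
	have "continuous_on {0<..} (\<lambda>z::real. 1 / sinh z ^ n)" by (intro continuous_intros) auto
	then show ?thesis by (rule continuous_on_eq) (simp add: hyp_density_def)
qed

lemma weight_integrals_tendsto:
	fixes V :: "nat => real => real"
	assumes n: "n >= 3" and a: "a > 0" and p: "p > 2"
		and V: "!!i. continuous_on {0<..} (V i)" "!!i z. z > 0 ==> \<bar>V i z\<bar> <= M" "!!i z. 0 < z ==> z < a ==> V i z = 0"
		and W: "continuous_on {0<..} W" "!!z. z > 0 ==> (\<lambda>i. V i z) \<longlonglongrightarrow> W z"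
	shows "(\<lambda>i. \<integral>z. hyp_density n z * (V i z)\<^sup>2 \<partial>lborel) \<longlonglongrightarrow> (square_norm n W)"
		"integrable lborel (\<lambda>z. hyp_density n z * (V i z)\<^sup>2)"
		"(\<lambda>i. \<integral>z. hyp_density n z * (S_weight n p z * \<bar>V i z\<bar> powr p) \<partial>lborel) \<longlonglongrightarrow>
			(weighted_norm n p W)"
proof -
	have sq: "continuous_on UNIV (\<lambda>t::real. t\<^sup>2)" "(0::real)\<^sup>2 = 0" by (auto intro!: continuous_intros)
	note T = tail_integral_tendsto[OF n a hyp_density_continuous _ weight_tail_bounds(1)[OF n p a] sq V W]
	show "(\<lambda>i. \<integral>z. hyp_density n z * (V i z)\<^sup>2 \<partial>lborel) \<longlonglongrightarrow> (square_norm n W)"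
		"integrable lborel (\<lambda>z. hyp_density n z * (V i z)\<^sup>2)"
		by (rule T; simp add: hyp_density_def)+
	have pw: "continuous_on UNIV (\<lambda>t::real. \<bar>t\<bar> powr p)" "\<bar>0::real\<bar> powr p = 0"
		using p by (auto intro!: continuous_on_powr' continuous_on_rabs continuous_on_id continuous_on_const)
	have "continuous_on {0<..} (\<lambda>z. hyp_density n z * S_weight n p z)"
		by (intro continuous_on_mult hyp_density_continuous S_weight_props(1)[OF n p])
	from tail_integral_tendsto(1)[OF n a this _ weight_tail_bounds(2)[OF n p a] pw V W]
	show "(\<lambda>i. \<integral>z. hyp_density n z * (S_weight n p z * \<bar>V i z\<bar> powr p) \<partial>lborel) \<longlonglongrightarrow>
			(weighted_norm n p W)"
		by (simp add: mult.assoc hyp_density_def)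
qed

lemma rad_form_split:
	assumes "C1c a b \<phi> \<phi>'" "n >= 3"
	shows "rad_form n (hm n) \<phi> \<phi>' z =
		indicator {0<..} z * (rad_w n z * (\<phi>' z)\<^sup>2) - ((real n - 1) / 2)\<^sup>2 * (hyp_density n z * (\<phi> z)\<^sup>2)"
proof (cases "z > 0")
	case True
	have "hm n + 1 / 2 = (real n - 2) / 2" by (simp add: field_simps)
	then show ?thesis
		using True hyp_density_rad_w[OF True, of n] assms(2)
		by (simp add: rad_form_def field_simps)
next
	case False
	then show ?thesis using C1cD(1)[OF assms(1)] C1cD(5,6)[OF assms(1), of z] by (simp add: rad_form_def)
qed

text \<open>The profile may now stay away from 0 as \<open>z\<close> tends to infinity, that is, at
  the origin. The cutoff there adds the constant \<open>D\<close> to the derivative, which is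
  harmless because \<open>rad_w\<close> is integrable on the tail.\<close>

lemma radial_ineq_C1:
	fixes V V' :: "real => real"
	assumes ineq: "!!\<phi> \<phi>' a b. (!!k. Ck_on k {0<..} \<phi>) ==> C1c a b \<phi> \<phi>' ==>
			C * (s * (weighted_norm n p \<phi>)) powr (2 / p) <=
			s * (\<integral>z. rad_form n (hm n) \<phi> \<phi>' z \<partial>lborel)"
		and n: "n >= 3" and p: "p > 2" and s: "s >= 0" and a: "a > 0"
		and V: "!!z. z > 0 ==> (V has_real_derivative V' z) (at z)" "continuous_on {0<..} V'"
		and V0: "!!z. 0 < z ==> z < a ==> V z = 0" and M: "!!z. z > 0 ==> \<bar>V z\<bar> <= M"
		and int: "integrable lborel (\<lambda>z. indicator {0<..} z * (rad_w n z * (V' z)\<^sup>2))"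
	shows "C * (s * (weighted_norm n p V)) powr (2 / p) <=
		s * ((\<integral>z. indicator {0<..} z * (rad_w n z * (V' z)\<^sup>2) \<partial>lborel)
			- ((real n - 1) / 2)\<^sup>2 * (square_norm n V))"
proof -
	obtain \<phi> \<phi>' :: "nat => real => real" and b D where \<phi>: "!!i k. Ck_on k {0<..} (\<phi> i)" "!!i. C1c (a / 2) (b i) (\<phi> i) (\<phi>' i)"
		"!!i z. \<bar>\<phi> i z\<bar> <= M + 1" "!!i z. z > 0 ==> \<bar>\<phi>' i z\<bar> <= \<bar>V' z\<bar> + D" "D >= 0"
		"!!z. z > 0 ==> (\<lambda>i. \<phi> i z) \<longlonglongrightarrow> V z" "!!z. z > 0 ==> (\<lambda>i. \<phi>' i z) \<longlonglongrightarrow> V' z"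
		by (rule smooth_radial_approx[OF a V V0 M]) (assumption | rule that)+
	have a2: "a / 2 > 0" using a by simp
	have Vc: "continuous_on {0<..} V" by (intro continuous_at_imp_continuous_on) (use V(1) DERIV_isCont in auto)
	have \<phi>0: "\<phi> i z = 0" "\<phi>' i z = 0" if "z < a / 2" for i z using C1cD(5,6)[OF \<phi>(2)] that by auto
	note wt = weight_integrals_tendsto[where V=\<phi> and M="M + 1" and W=V, OF n a2 p C1cD(7)[OF \<phi>(2)] \<phi>(3) \<phi>0(1) Vc \<phi>(6)]
	let ?I = "\<lambda>f z. indicator {0<..} z * (rad_w n z * (f z)\<^sup>2)"
	let ?w = "\<lambda>z. 2 * ?I V' z + 2 * D\<^sup>2 * (indicator {a / 2..} z * rad_w n z)"
	have w: "integrable lborel ?w" using int rad_w_tail_integrable[OF n a2] by simp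
	have bd: "norm (?I (\<phi>' i) z) <= ?w z" for i z
	proof (cases "z >= a / 2")
		case True
		then have z: "z > 0" using a by simp
		have "(\<phi>' i z)\<^sup>2 <= (\<bar>V' z\<bar> + D)\<^sup>2" using \<phi>(4)[OF z, of i] by (intro power2_le_iff_abs_le[THEN iffD2]) (use \<phi>(5) in auto)
		also have "... <= 2 * (V' z)\<^sup>2 + 2 * D\<^sup>2"
			using sum_squares_bound[of "\<bar>V' z\<bar>" D] by (simp add: power2_sum)
		finally have "rad_w n z * (\<phi>' i z)\<^sup>2 <= rad_w n z * (2 * (V' z)\<^sup>2 + 2 * D\<^sup>2)"
			using rad_w_pos[OF z, of n] by (intro mult_left_mono) auto
		then show ?thesis using True z rad_w_pos[OF z, of n] by (simp add: algebra_simps)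
	next
		case False
		then show ?thesis using \<phi>0(2)[of z i] rad_w_pos[of z n] by (auto split: split_indicator)
	qed
	have meas: "?I f \<in> borel_measurable lborel" if "continuous_on {0<..} f" for f
	proof -
		have "(\<lambda>z. indicator {0<..} z *\<^sub>R (rad_w n z * (f z)\<^sup>2)) \<in> borel_measurable borel"
			by (intro borel_measurable_continuous_on_indicator continuous_on_mult continuous_on_power rad_w_continuous that) auto
		then show ?thesis by simp
	qed
	have lim: "AE z in lborel. (\<lambda>i. ?I (\<phi>' i) z) \<longlonglongrightarrow> ?I V' z"
	proof (rule AE_I2)
		fix z :: real
		show "(\<lambda>i. ?I (\<phi>' i) z) \<longlonglongrightarrow> ?I V' z"
		proof (cases "z > 0")
			case True
			then show ?thesis by (intro tendsto_intros \<phi>(7))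
		qed simp
	qed
	have en: "(\<lambda>i. \<integral>z. ?I (\<phi>' i) z \<partial>lborel) \<longlonglongrightarrow> (\<integral>z. ?I V' z \<partial>lborel)"
		by (rule integral_dominated_convergence[OF meas[OF V(2)] meas[OF C1cD(4)[OF \<phi>(2)]] w lim]) (use bd in auto)
	have ei: "integrable lborel (?I (\<phi>' i))" for i
		by (rule Bochner_Integration.integrable_bound[OF w meas[OF C1cD(4)[OF \<phi>(2)]]])
			(use bd order_trans[OF bd abs_ge_self] in auto)
	have form: "(\<integral>z. rad_form n (hm n) (\<phi> i) (\<phi>' i) z \<partial>lborel) =
		 (\<integral>z. ?I (\<phi>' i) z \<partial>lborel) - ((real n - 1) / 2)\<^sup>2 * (square_norm n (\<phi> i))" for i
		unfolding rad_form_split[OF \<phi>(2) n] using ei wt(2) by simp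
	have nn: "(weighted_norm n p f) >= 0" for f
		by (intro integral_nonneg_AE AE_I2) (simp add: S_weight_def hyp_density_nonneg)
	show ?thesis
	proof (rule LIMSEQ_le)
		show "(\<lambda>i. C * (s * (weighted_norm n p (\<phi> i))) powr (2 / p)) \<longlonglongrightarrow>
			C * (s * (weighted_norm n p V)) powr (2 / p)"
			using p nn s by (intro tendsto_mult tendsto_const tendsto_powr' wt(3)) (auto intro!: always_eventually)
		show "(\<lambda>i. s * ((\<integral>z. ?I (\<phi>' i) z \<partial>lborel) - ((real n - 1) / 2)\<^sup>2 * (square_norm n (\<phi> i)))) \<longlonglongrightarrow>
			s * ((\<integral>z. ?I V' z \<partial>lborel) - ((real n - 1) / 2)\<^sup>2 * (square_norm n V))"
			by (intro tendsto_intros en wt(1))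
	qed (use ineq[OF \<phi>(1,2)] form in auto)
qed

text \<open>A continuous profile with bounded difference quotient energies is approximated by its
  averages over windows of length \<open>\<delta>\<close>. These are continuously differentiable,
  and their derivatives are exactly the difference quotients whose energy is controlled.\<close>

lemma radial_ineq_averaged:
	fixes \<gamma> :: "real => real"
	assumes ineq: "!!\<phi> \<phi>' a b. (!!k. Ck_on k {0<..} \<phi>) ==> C1c a b \<phi> \<phi>' ==>
			C * (s * (weighted_norm n p \<phi>)) powr (2 / p) <=
			s * (\<integral>z. rad_form n (hm n) \<phi> \<phi>' z \<partial>lborel)"
		and n: "n >= 3" and p: "p > 2" and s: "s > 0" and z0: "z0 > 0"
		and \<gamma>: "continuous_on {0<..} \<gamma>" "!!z. z > 0 ==> 0 <= \<gamma> z" "!!z. z > 0 ==> \<gamma> z <= M" "!!z. 0 < z ==> z < z0 ==> \<gamma> z = 0"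
		and E: "E >= 0" "!!\<delta>. \<delta> > 0 ==> ennreal s *
			 (\<integral>\<^sup>+z. ennreal (indicator {0<..} z * (rad_w n (z + \<delta>) * ((\<gamma> (z + \<delta>) - \<gamma> z) / \<delta>)\<^sup>2)) \<partial>lborel) <= ennreal E"
	shows "C * (s * (weighted_norm n p \<gamma>)) powr (2 / p) <=
		E - ((real n - 1) / 2)\<^sup>2 * (s * (square_norm n \<gamma>))"
proof -
	\<comment> \<open>With windows of length at most \<open>a\<close>, an average starting below
	  \<open>a\<close> only sees arguments below \<open>z0\<close>, where \<open>\<gamma>\<close>
	  vanishes.\<close>
	define a where "a = z0 / 2"
	have a: "a > 0" "a < z0" "a + a = z0" using z0 by (auto simp: a_def)
	define P where "P z = integral {a..z} \<gamma>" for z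
	have dP: "(P has_real_derivative \<gamma> z) (at z)" if z: "z > 0" for z
	proof (cases "z > a")
		case True
		have "((\<lambda>x. integral {a..x} \<gamma>) has_real_derivative \<gamma> z) (at z within {a..z + 1})"
			using True a by (intro integral_has_real_derivative continuous_on_subset[OF \<gamma>(1)]) auto
		moreover have "at z within {a..z + 1} = at z"
			using True by (intro at_within_interior) (auto simp: interior_atLeastAtMost_real)
		ultimately show ?thesis by (simp add: P_def[abs_def])
	next
		case False
		have P0: "P y = 0" if y: "y \<in> {0<..<z0}" for y
		proof -
			have "integral {a..y} \<gamma> = integral {a..y} (\<lambda>_. 0)"
				by (rule integral_cong) (use y a \<gamma>(4) in auto)
			then show ?thesis by (simp add: P_def)
		qed
		have "((\<lambda>_. 0) has_real_derivative 0) (at z)" by simp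
		then have "(P has_real_derivative 0) (at z)"
			by (rule has_field_derivative_transform_within_open[of _ _ _ "{0<..<z0}"]) (use False z a P0 in auto)
		then show ?thesis using \<gamma>(4)[OF z] False a by simp
	qed
	define \<delta> where "\<delta> i = a / (real i + 1)" for i :: nat
	have \<delta>: "\<delta> i > 0" "\<delta> i <= a" for i using a by (auto simp: \<delta>_def pos_divide_le_eq)
	have \<delta>_lim: "\<delta> \<longlonglongrightarrow> 0"
		using tendsto_mult[OF tendsto_const LIMSEQ_inverse_real_of_nat, of a]
		by (simp add: \<delta>_def[abs_def] divide_inverse add.commute)
	define V where "V i z = (P (z + \<delta> i) - P z) / \<delta> i" for i z
	define V' where "V' i z = (\<gamma> (z + \<delta> i) - \<gamma> z) / \<delta> i" for i z
	have dV: "(V i has_real_derivative V' i z) (at z)" if z: "z > 0" for i z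
	proof -
		have "(P has_real_derivative \<gamma> (z + \<delta> i)) (at (z + \<delta> i))" using z \<delta>(1)[of i] by (intro dP) simp
		then have "((\<lambda>z. P (z + \<delta> i)) has_real_derivative \<gamma> (z + \<delta> i)) (at z)" by (simp add: DERIV_shift)
		then show ?thesis unfolding V_def[abs_def] V'_def by (intro DERIV_cdivide DERIV_diff dP z)
	qed
	have V'c: "continuous_on {0<..} (V' i)" for i
		unfolding V'_def[abs_def] using \<delta>(1)[of i]
		by (intro continuous_intros \<gamma>(1) continuous_on_compose2[OF \<gamma>(1)]) auto
	have mv: "\<exists>\<xi>. z < \<xi> \<and> \<xi> < z + \<delta> i \<and> V i z = \<gamma> \<xi>" if z: "z > 0" for i z
	proof -
		obtain \<xi> where "z < \<xi>" "\<xi> < z + \<delta> i" "P (z + \<delta> i) - P z = (z + \<delta> i - z) * \<gamma> \<xi>"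
			using MVT2[of z "z + \<delta> i" P \<gamma>] \<delta>(1)[of i] dP z by (metis less_add_same_cancel1 less_le_trans)
		then show ?thesis using \<delta>(1)[of i] by (auto simp: V_def)
	qed
	have Vle: "\<bar>V i z\<bar> <= M" if z: "z > 0" for i z
	proof -
		obtain \<xi> where \<xi>: "z < \<xi>" "V i z = \<gamma> \<xi>" using mv[OF z] by blast
		then show ?thesis using \<gamma>(2)[of \<xi>] \<gamma>(3)[of \<xi>] z by simp
	qed
	have V0: "V i z = 0" if z: "0 < z" "z < a" for i z
	proof -
		obtain \<xi> where \<xi>: "z < \<xi>" "\<xi> < z + \<delta> i" "V i z = \<gamma> \<xi>" using mv[OF z(1)] by blast
		then show ?thesis using \<gamma>(4)[of \<xi>] z \<delta>(2)[of i] a by simp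
	qed
	have V'0: "V' i z = 0" if z: "0 < z" "z < a" for i z
		using \<gamma>(4)[of z] \<gamma>(4)[of "z + \<delta> i"] z \<delta>[of i] a by (simp add: V'_def)
	have Vlim: "(\<lambda>i. V i z) \<longlonglongrightarrow> \<gamma> z" if z: "z > 0" for z
	proof -
		have "((\<lambda>h. (P (z + h) - P z) / h) \<longlongrightarrow> \<gamma> z) (at 0)"
			using dP[OF z] by (simp add: DERIV_def)
		moreover have "filterlim \<delta> (at 0) sequentially"
			unfolding filterlim_at using \<delta>_lim \<delta>(1) by (auto intro!: always_eventually simp: less_imp_neq[symmetric])
		ultimately show ?thesis unfolding V_def by (rule filterlim_compose)
	qed
	have Vc: "continuous_on {0<..} (V i)" for i
		by (intro continuous_at_imp_continuous_on) (auto intro: DERIV_isCont[OF dV])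
	note wt = weight_integrals_tendsto[where V=V and M=M and W=\<gamma>, OF n a(1) p Vc Vle V0 \<gamma>(1) Vlim]
	\<comment> \<open>The energy bound has the weight at \<open>z + \<delta>\<close> instead of
	  \<open>z\<close>. By the addition theorem, and since the hyperbolic cotangent decreases,
	  \<open>sinh (z + \<delta>)\<close> is at most \<open>r\<close> times \<open>sinh z\<close> for
	  \<open>z >= a\<close>; the resulting factor tends to 1.\<close>
	define r where "r i = cosh (\<delta> i) + cosh a / sinh a * sinh (\<delta> i)" for i
	have r0: "r i > 0" for i using a \<delta>(1)[of i] by (simp add: r_def add_pos_nonneg)
	have rw: "rad_w n z <= r i ^ (n - 2) * rad_w n (z + \<delta> i)" if z: "z >= a" for i z
	proof -
		have sz: "sinh z > 0" "sinh a > 0" "sinh (\<delta> i) > 0" "sinh (z + \<delta> i) > 0" using z a \<delta>(1)[of i] by auto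
		have "sinh (z - a) >= 0" using z by simp
		then have "cosh z * sinh a <= cosh a * sinh z" by (simp add: sinh_diff mult.commute)
		then have "cosh z <= cosh a / sinh a * sinh z" using sz by (simp add: pos_le_divide_eq)
		then have "cosh z * sinh (\<delta> i) <= cosh a / sinh a * sinh z * sinh (\<delta> i)" using sz by (intro mult_right_mono) auto
		then have "sinh (z + \<delta> i) <= r i * sinh z" by (simp add: r_def sinh_add algebra_simps)
		then have "sinh (z + \<delta> i) ^ (n - 2) <= (r i * sinh z) ^ (n - 2)" using sz by (intro power_mono) auto
		then have "sinh (z + \<delta> i) ^ (n - 2) <= r i ^ (n - 2) * sinh z ^ (n - 2)" by (simp add: power_mult_distrib)
		then have "1 <= r i ^ (n - 2) * sinh z ^ (n - 2) / sinh (z + \<delta> i) ^ (n - 2)" using sz by (simp add: pos_le_divide_eq)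
		then have "1 / sinh z ^ (n - 2) <= r i ^ (n - 2) * sinh z ^ (n - 2) / sinh (z + \<delta> i) ^ (n - 2) / sinh z ^ (n - 2)"
			using sz by (intro divide_right_mono) auto
		then show ?thesis using sz by (simp add: rad_w_def)
	qed
	let ?I = "\<lambda>i z. indicator {0<..} z * (rad_w n z * (V' i z)\<^sup>2)"
	let ?J = "\<lambda>i z. indicator {0<..} z * (rad_w n (z + \<delta> i) * ((\<gamma> (z + \<delta> i) - \<gamma> z) / \<delta> i)\<^sup>2)"
	have IJ: "?I i z <= r i ^ (n - 2) * ?J i z" for i z
	proof -
		consider "z <= 0" | "0 < z" "z < a" | "a <= z" by linarith
		then show ?thesis
		proof cases
			case 2
			then show ?thesis using V'0[OF 2] by (simp add: V'_def[symmetric])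
		next
			case 3
			have "rad_w n z * (V' i z)\<^sup>2 <= (r i ^ (n - 2) * rad_w n (z + \<delta> i)) * (V' i z)\<^sup>2"
				by (rule mult_right_mono[OF rw[OF 3]]) simp
			then show ?thesis using 3 a by (simp add: V'_def[symmetric] mult_ac)
		qed simp
	qed
	have Im: "?I i \<in> borel_measurable lborel" for i
	proof -
		have "(\<lambda>z. indicator {0<..} z *\<^sub>R (rad_w n z * (V' i z)\<^sup>2)) \<in> borel_measurable borel"
			by (intro borel_measurable_continuous_on_indicator continuous_on_mult continuous_on_power rad_w_continuous V'c) auto
		then show ?thesis by simp
	qed
	have Jm: "(\<lambda>z. ennreal (?J i z)) \<in> borel_measurable lborel" for i
	proof -
		have "continuous_on {0<..} (\<lambda>z. rad_w n (z + \<delta> i) * (V' i z)\<^sup>2)"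
			using \<delta>(1)[of i] by (intro continuous_on_mult continuous_on_power V'c continuous_on_compose2[OF rad_w_continuous] continuous_intros) auto
		then have "(\<lambda>z. indicator {0<..} z *\<^sub>R (rad_w n (z + \<delta> i) * (V' i z)\<^sup>2)) \<in> borel_measurable borel"
			by (intro borel_measurable_continuous_on_indicator) auto
		then show ?thesis unfolding V'_def by simp
	qed
	have I0: "?I i z >= 0" for i z
		using rad_w_pos[of z n] by (cases "z > 0") (auto intro: less_imp_le)
	have nnI: "ennreal s * (\<integral>\<^sup>+z. ennreal (?I i z) \<partial>lborel) <= ennreal (r i ^ (n - 2) * E)" for i
	proof -
		have rn: "r i ^ (n - 2) >= 0" using r0[of i] by simp
		have "(\<integral>\<^sup>+z. ennreal (?I i z) \<partial>lborel) <= (\<integral>\<^sup>+z. ennreal (r i ^ (n - 2)) * ennreal (?J i z) \<partial>lborel)"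
			unfolding ennreal_mult'[OF rn, symmetric] by (intro nn_integral_mono ennreal_leI IJ)
		also have "... = ennreal (r i ^ (n - 2)) * (\<integral>\<^sup>+z. ennreal (?J i z) \<partial>lborel)"
			by (rule nn_integral_cmult[OF Jm])
		finally have "ennreal s * (\<integral>\<^sup>+z. ennreal (?I i z) \<partial>lborel) <= ennreal s * (ennreal (r i ^ (n - 2)) * (\<integral>\<^sup>+z. ennreal (?J i z) \<partial>lborel))"
			by (rule mult_left_mono) simp
		also have "... = ennreal (r i ^ (n - 2)) * (ennreal s * (\<integral>\<^sup>+z. ennreal (?J i z) \<partial>lborel))"
			by (simp only: mult_ac)
		also have "... <= ennreal (r i ^ (n - 2)) * ennreal E"
			by (rule mult_left_mono[OF E(2)[OF \<delta>(1)]]) simp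
		also have "... = ennreal (r i ^ (n - 2) * E)" using rn by (simp add: ennreal_mult')
		finally show ?thesis .
	qed
	have int: "integrable lborel (?I i)" for i
	proof (rule integrableI_bounded[OF Im])
		have "(\<integral>\<^sup>+z. ennreal (?I i z) \<partial>lborel) ~= top"
		proof
			assume "(\<integral>\<^sup>+z. ennreal (?I i z) \<partial>lborel) = top"
			then have "ennreal s * (\<integral>\<^sup>+z. ennreal (?I i z) \<partial>lborel) = top"
				using s by (simp only:) (simp add: ennreal_mult_top)
			then show False using nnI[of i] by (simp add: top_unique)
		qed
		then show "(\<integral>\<^sup>+z. ennreal (norm (?I i z)) \<partial>lborel) < \<infinity>"
			using I0 by (simp add: less_top)
	qed
	have Ile: "s * (\<integral>z. ?I i z \<partial>lborel) <= r i ^ (n - 2) * E" for i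
	proof -
		have "ennreal (s * (\<integral>z. ?I i z \<partial>lborel)) = ennreal s * (\<integral>\<^sup>+z. ennreal (?I i z) \<partial>lborel)"
			using s I0 by (subst nn_integral_eq_integral[OF int]) (auto simp: ennreal_mult')
		then have "ennreal (s * (\<integral>z. ?I i z \<partial>lborel)) <= ennreal (r i ^ (n - 2) * E)" using nnI[of i] by (simp only:)
		then show ?thesis using E(1) r0[of i] by (subst (asm) ennreal_le_iff) auto
	qed
	have nn: "(weighted_norm n p f) >= 0" for f
		by (intro integral_nonneg_AE AE_I2) (simp add: S_weight_def hyp_density_nonneg)
	show ?thesis
	proof (rule LIMSEQ_le)
		show "(\<lambda>i. C * (s * (weighted_norm n p (V i))) powr (2 / p)) \<longlonglongrightarrow>
			C * (s * (weighted_norm n p \<gamma>)) powr (2 / p)"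
			using p nn s by (intro tendsto_mult tendsto_const tendsto_powr' wt(3)) (auto intro!: always_eventually)
		have "r \<longlonglongrightarrow> cosh 0 + cosh a / sinh a * sinh 0" unfolding r_def[abs_def] by (intro tendsto_intros \<delta>_lim)
		then have "r \<longlonglongrightarrow> 1" by simp
		then have "(\<lambda>i. r i ^ (n - 2) * E - ((real n - 1) / 2)\<^sup>2 * (s * (square_norm n (V i)))) \<longlonglongrightarrow>
			1 ^ (n - 2) * E - ((real n - 1) / 2)\<^sup>2 * (s * (square_norm n \<gamma>))"
			by (intro tendsto_intros wt(1))
		then show "(\<lambda>i. r i ^ (n - 2) * E - ((real n - 1) / 2)\<^sup>2 * (s * (square_norm n (V i)))) \<longlonglongrightarrow>
			E - ((real n - 1) / 2)\<^sup>2 * (s * (square_norm n \<gamma>))" by simp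
		have "C * (s * (weighted_norm n p (V i))) powr (2 / p) <=
			 r i ^ (n - 2) * E - ((real n - 1) / 2)\<^sup>2 * (s * (square_norm n (V i)))" for i
		proof -
			have "C * (s * (weighted_norm n p (V i))) powr (2 / p) <=
					s * ((\<integral>z. ?I i z \<partial>lborel) - ((real n - 1) / 2)\<^sup>2 * (square_norm n (V i)))"
			proof (rule radial_ineq_C1[where V'="V' i" and a=a and M=M])
				show "C * (s * (weighted_norm n p \<phi>)) powr (2 / p) <=
						s * (\<integral>z. rad_form n (hm n) \<phi> \<phi>' z \<partial>lborel)"
					if "!!k. Ck_on k {0<..} \<phi>" "C1c a b \<phi> \<phi>'" for \<phi> \<phi>' a b by (rule ineq[OF that])
			qed (use n p s a dV V'c V0 Vle int in auto)
			then show ?thesis using Ile[of i] unfolding right_diff_distrib[of s] mult.left_commute[of s "((real n - 1) / 2)\<^sup>2"] by linarith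
		qed
		then show "\<exists>N. \<forall>i\<ge>N. C * (s * (weighted_norm n p (V i))) powr (2 / p) <=
			 r i ^ (n - 2) * E - ((real n - 1) / 2)\<^sup>2 * (s * (square_norm n (V i)))" by blast
	qed
qed

subsection \<open>Sharpness\<close>

text \<open>The symmetrized profile has the same square norm, no larger gradient integral and no
  smaller weighted norm, so the inequality for radial profiles passes back to
  \<open>v\<close>.\<close>

lemma S_ineq_of_Y_ineq:
	fixes T :: "'a::euclidean_space itself"
	assumes n: "DIM('a) >= 3" and p: "2 < p" "p <= 2 * real DIM('a) / (real DIM('a) - 2)" and Y: "Y_ineq T p C"
	shows "S_ineq T p (C * (real DIM('a) - 2) powr ((p + 2) / p))"
	unfolding S_ineq_def
proof
	fix v :: "'a => real" assume v: "v \<in> hyp_test_functions"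
	let ?n = "DIM('a)" and ?s = "measure (angular :: 'a measure) UNIV"
	let ?C = "C * (real DIM('a) - 2) powr ((p + 2) / p)"
	let ?N = "\<integral>x. rwt (S_weight ?n p) x * \<bar>v x\<bar> powr p \<partial>hyp_vol"
	show "?C * ?N powr (2 / p) <= (total_form (hm ?n) v)"
	\<comment> \<open>The increase of the weighted norm under symmetrization helps only for a positive
	  constant; for the others the Poincare inequality suffices.\<close>
	proof (cases "?C <= 0")
		case True
		have "?C * ?N powr (2 / p) <= 0" using True by (rule mult_nonpos_nonneg) simp
		then show ?thesis using poincare[OF v n, of "hm ?n"] by linarith
	next
		case False
		obtain \<gamma> z0 M where \<gamma>: "z0 > 0" "continuous_on {0<..} \<gamma>" "!!z. z > 0 ==> 0 <= \<gamma> z" "!!z. z > 0 ==> \<gamma> z <= M"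
			"!!z. 0 < z ==> z < z0 ==> \<gamma> z = 0"
			and Q: "(\<integral>x. (v x)\<^sup>2 \<partial>hyp_vol) = ?s * (square_norm ?n \<gamma>)"
			and N: "?N <= ?s * (\<integral>z. hyp_density ?n z * (S_weight ?n p z * \<gamma> z powr p) \<partial>lborel)"
			and E: "!!\<delta>. \<delta> > 0 ==> ennreal ?s *
			 (\<integral>\<^sup>+z. ennreal (indicator {0<..} z * (rad_w ?n (z + \<delta>) * ((\<gamma> (z + \<delta>) - \<gamma> z) / \<delta>)\<^sup>2)) \<partial>lborel) <=
			 ennreal (\<integral>x. (hyp_grad_norm v x)\<^sup>2 \<partial>hyp_vol)"
			by (rule symmetrization[OF v n p]) (assumption | rule that)+
		have "(\<integral>z. hyp_density ?n z * (S_weight ?n p z * \<gamma> z powr p) \<partial>lborel) =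
				(weighted_norm ?n p \<gamma>)"
			using \<gamma>(3) by (intro Bochner_Integration.integral_cong refl) (simp add: hyp_density_def split: split_indicator)
		note N = N[unfolded this]
		have N0: "?N >= 0" by (intro integral_nonneg_AE AE_I2) (simp add: rwt_def S_weight_def)
		have "?N powr (2 / p) <= (?s * (weighted_norm ?n p \<gamma>)) powr (2 / p)"
			using N N0 p by (intro powr_mono2) auto
		then have "?C * ?N powr (2 / p) <=
				?C * (?s * (weighted_norm ?n p \<gamma>)) powr (2 / p)"
			using False by (intro mult_left_mono) auto
		also have "... <= (\<integral>x. (hyp_grad_norm v x)\<^sup>2 \<partial>hyp_vol) - ((real ?n - 1) / 2)\<^sup>2 * (?s * (square_norm ?n \<gamma>))"
			by (rule radial_ineq_averaged[OF radial_ineq[OF Y n p(1)] n p(1) angular_UNIV_pos \<gamma> _ E])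
				(auto intro!: integral_nonneg_AE)
		also have "... = (total_form (hm ?n) v)"
		proof -
			have hm: "hm ?n + 1 / 2 = (real ?n - 2) / 2" by (simp add: field_simps)
			show ?thesis unfolding integrable_hyp_form(4)[OF v n] Q hm by simp
		qed
		finally show ?thesis .
	qed
qed

text \<open>The hyperbolic reflection exchanging \<open>x0\<close> and the origin reduces everything to the base point \<open>0\<close>.\<close>

lemma base_point_irrelevant:
	fixes x0 :: "'a::euclidean_space" and \<Psi> \<Psi>' :: "real => real => real" and Q :: "real => real => real => real => bool"
	defines "Q' \<equiv> \<lambda>x0 v. Q (\<integral>x. (hyp_grad_norm v x)\<^sup>2 \<partial>hyp_vol) (\<integral>x. (v x)\<^sup>2 \<partial>hyp_vol)
		(\<integral>x. \<Psi> (hyp_dist x x0) (v x) \<partial>hyp_vol) (\<integral>x. \<Psi>' (hyp_dist x x0) (v x) \<partial>hyp_vol)"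
	assumes x0: "x0 \<in> hyp_space"
	shows "(\<forall>v\<in>hyp_test_functions. Q' x0 v) \<longleftrightarrow> (\<forall>v\<in>hyp_test_functions. Q' 0 v)"
proof (cases "x0 = 0")
	case False
	define c where "c = x0 /\<^sub>R (norm x0)\<^sup>2"
	note I = integral_weight_inversion[OF x0 False c_def]
	note c = I(1)
	have eq: "Q' x0 v \<longleftrightarrow> Q' 0 (\<lambda>x. v (inversion c x))" if v: "v \<in> hyp_test_functions" for v
		unfolding Q'_def I(4)[of \<Psi> v] I(4)[of \<Psi>' v] hyp_grad_norm_integral_inversion[OF c v]
			integral_hyp_vol_inversion[OF c, of "\<lambda>x. (v x)\<^sup>2"] ..
	show ?thesis
	proof (intro iffI ballI)
		fix v :: "'a => real" assume *: "\<forall>v\<in>hyp_test_functions. Q' x0 v" and v: "v \<in> hyp_test_functions"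
		have w: "(\<lambda>x. v (inversion c x)) \<in> hyp_test_functions" by (rule test_inversion[OF c v])
		show "Q' 0 v" using eq[OF w] * w by (simp add: inversion_inversion[OF c])
	qed (use eq test_inversion[OF c] in blast)
qed simp

lemma S_ineq_iff:
	fixes x0 :: "'a::euclidean_space"
	assumes n: "DIM('a) >= 3" and x0: "x0 \<in> hyp_space"
	shows "(\<forall>v\<in>hyp_test_functions. (\<integral>x. (hyp_grad_norm v x)\<^sup>2 \<partial>hyp_vol) >=
			 ((real DIM('a) - 1) / 2)\<^sup>2 * (\<integral>x. (v x)\<^sup>2 \<partial>hyp_vol)
			 + C * (\<integral>x. sinh (hyp_dist x x0) powr (p * (real DIM('a) - 2) / 2 - real DIM('a))
									* \<bar>v x\<bar> powr p \<partial>hyp_vol) powr (2 / p)) \<longleftrightarrow> S_ineq TYPE('a) p C"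
proof -
	have hm: "hm DIM('a) + 1 / 2 = (real DIM('a) - 2) / 2" by (simp add: field_simps)
	show ?thesis
		unfolding base_point_irrelevant[OF x0, of "\<lambda>g q w _. g >= ((real DIM('a) - 1) / 2)\<^sup>2 * q + C * w powr (2 / p)"
				"\<lambda>d t. sinh d powr (p * (real DIM('a) - 2) / 2 - real DIM('a)) * \<bar>t\<bar> powr p"] S_ineq_def
	proof (rule ball_cong[OF refl])
		fix v :: "'a => real" assume v: "v \<in> hyp_test_functions"
		obtain R where R: "R < 1" "!!x. R < norm x ==> v x = 0" using test_support[OF v] by metis
		have v0: "v x = 0" if "norm x >= 1" for x using R that by (meson less_le_trans)
		have w: "sinh (hyp_dist x 0) powr \<alpha> * \<bar>v x\<bar> powr p = rwt (\<lambda>z. sinh z powr (- \<alpha>)) x * \<bar>v x\<bar> powr p" for x \<alpha>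
			by (rule weight_eq(1)) (rule v0)
		show "((real DIM('a) - 1) / 2)\<^sup>2 * (\<integral>x. (v x)\<^sup>2 \<partial>hyp_vol)
			 + C * (\<integral>x. sinh (hyp_dist x 0) powr (p * (real DIM('a) - 2) / 2 - real DIM('a)) * \<bar>v x\<bar> powr p \<partial>hyp_vol) powr (2 / p)
			 <= (\<integral>x. (hyp_grad_norm v x)\<^sup>2 \<partial>hyp_vol) \<longleftrightarrow>
			C * (\<integral>x. rwt (S_weight DIM('a) p) x * \<bar>v x\<bar> powr p \<partial>hyp_vol) powr (2 / p) <= (total_form (hm DIM('a)) v)"
			unfolding w integrable_hyp_form(4)[OF v n] S_weight_def[abs_def] hm by auto
	qed
qed

lemma Y_ineq_iff:
	fixes x0 :: "'a::euclidean_space"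
	assumes n: "DIM('a) >= 3" and x0: "x0 \<in> hyp_space"
	shows "(\<forall>v\<in>hyp_test_functions. (\<integral>x. (hyp_grad_norm v x)\<^sup>2 \<partial>hyp_vol) >=
			 ((real DIM('a) - 1) / 2)\<^sup>2 * (\<integral>x. (v x)\<^sup>2 \<partial>hyp_vol)
				+ ((real DIM('a) - 2) / 2)\<^sup>2 * (\<integral>x. (v x)\<^sup>2 / (sinh (hyp_dist x x0))\<^sup>2 \<partial>hyp_vol)
				+ C * (\<integral>x. sinh (hyp_dist x x0) powr (p * (real DIM('a) - 2) / 2 - real DIM('a))
								* Y_fun DIM('a) (hyp_dist x x0) powr ((p + 2) / 2)
								* \<bar>v x\<bar> powr p \<partial>hyp_vol) powr (2 / p)) \<longleftrightarrow> Y_ineq TYPE('a) p C"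
	unfolding base_point_irrelevant[OF x0, of "\<lambda>g q h w. g >= ((real DIM('a) - 1) / 2)\<^sup>2 * q + ((real DIM('a) - 2) / 2)\<^sup>2 * h + C * w powr (2 / p)"
			"\<lambda>d t. t\<^sup>2 / (sinh d)\<^sup>2" "\<lambda>d t. sinh d powr (p * (real DIM('a) - 2) / 2 - real DIM('a)) * Y_fun DIM('a) d powr ((p + 2) / 2) * \<bar>t\<bar> powr p"] Y_ineq_def
proof (rule ball_cong[OF refl])
	fix v :: "'a => real" assume v: "v \<in> hyp_test_functions"
	obtain R where R: "R < 1" "!!x. R < norm x ==> v x = 0" using test_support[OF v] by metis
	have v0: "v x = 0" if "norm x >= 1" for x using R that by (meson less_le_trans)
	have w: "sinh (hyp_dist x 0) powr \<alpha> * Y_fun m (hyp_dist x 0) powr q * \<bar>v x\<bar> powr p =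
			rwt (\<lambda>z. sinh z powr (- \<alpha>) * Y_log m z powr q) x * \<bar>v x\<bar> powr p" for x \<alpha> m q
		by (rule weight_eq(2)) (rule v0)
	have h: "(v x)\<^sup>2 / (sinh (hyp_dist x 0))\<^sup>2 = rwt (\<lambda>z. (sinh z)\<^sup>2) x * (v x)\<^sup>2" for x
		by (rule hardy_weight_eq) (rule v0)
	show "((real DIM('a) - 1) / 2)\<^sup>2 * (\<integral>x. (v x)\<^sup>2 \<partial>hyp_vol)
		 + ((real DIM('a) - 2) / 2)\<^sup>2 * (\<integral>x. (v x)\<^sup>2 / (sinh (hyp_dist x 0))\<^sup>2 \<partial>hyp_vol)
		 + C * (\<integral>x. sinh (hyp_dist x 0) powr (p * (real DIM('a) - 2) / 2 - real DIM('a)) * Y_fun DIM('a) (hyp_dist x 0) powr ((p + 2) / 2) * \<bar>v x\<bar> powr p \<partial>hyp_vol) powr (2 / p)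
		 <= (\<integral>x. (hyp_grad_norm v x)\<^sup>2 \<partial>hyp_vol) \<longleftrightarrow>
		C * (\<integral>x. rwt (Y_weight DIM('a) p) x * \<bar>v x\<bar> powr p \<partial>hyp_vol) powr (2 / p) <= (total_form (- (1/2)) v)"
		unfolding w h integrable_hyp_form(4)[OF v n] Y_weight_def[abs_def] by auto
qed

theorem theorem2:
  fixes x0 :: "'a::euclidean_space" and n :: nat and p :: real
  assumes "n = DIM('a)" and "n \<ge> 3"
    and "x0 \<in> hyp_space"
    and "2 < p" and "p \<le> 2 * real n / (real n - 2)"
  shows "(\<forall>v\<in>hyp_test_functions.
      (\<integral>x. (hyp_grad_norm v x)\<^sup>2 \<partial>hyp_vol) \<ge>
        ((real n - 1) / 2)\<^sup>2 * (\<integral>x. (v x)\<^sup>2 \<partial>hyp_vol)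
        + ((real n - 2) / 2)\<^sup>2 * (\<integral>x. (v x)\<^sup>2 / (sinh (hyp_dist x x0))\<^sup>2 \<partial>hyp_vol)
        + (real n - 2) powr (- ((p + 2) / p)) * S_bar x0 p
          * (\<integral>x. sinh (hyp_dist x x0) powr (p * (real n - 2) / 2 - real n)
                * Y_fun n (hyp_dist x x0) powr ((p + 2) / 2)
                * \<bar>v x\<bar> powr p \<partial>hyp_vol) powr (2 / p))
    \<and> (\<forall>C > (real n - 2) powr (- ((p + 2) / p)) * S_bar x0 p.
      \<not> (\<forall>v\<in>hyp_test_functions.
        (\<integral>x. (hyp_grad_norm v x)\<^sup>2 \<partial>hyp_vol) \<ge>
          ((real n - 1) / 2)\<^sup>2 * (\<integral>x. (v x)\<^sup>2 \<partial>hyp_vol)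
          + ((real n - 2) / 2)\<^sup>2 * (\<integral>x. (v x)\<^sup>2 / (sinh (hyp_dist x x0))\<^sup>2 \<partial>hyp_vol)
          + C
            * (\<integral>x. sinh (hyp_dist x x0) powr (p * (real n - 2) / 2 - real n)
                  * Y_fun n (hyp_dist x x0) powr ((p + 2) / 2)
                  * \<bar>v x\<bar> powr p \<partial>hyp_vol) powr (2 / p)))"
proof -
	let ?T = "TYPE('a)"
	have n: "DIM('a) >= 3" and p: "2 < p" "p <= 2 * real DIM('a) / (real DIM('a) - 2)"
		using assms by auto
	obtain L where L: "Greatest (S_ineq ?T p) = L" "S_ineq ?T p L" "!!C. S_ineq ?T p C ==> C <= L" "L >= 0"
		using greatest_S_ineq[OF n p(1)] by metis
	\<comment> \<open>After the reduction to the origin the predicate no longer contains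
	  \<open>x0\<close>, so \<open>L\<close> is the value for every base point.\<close>
	have S: "S_bar x0 p = L"
		unfolding S_bar_def S_ineq_iff[OF n assms(3)] using L(1) by simp
	define k where "k = (real DIM('a) - 2) powr ((p + 2) / p)"
	have k: "k > 0" "(real DIM('a) - 2) powr (- ((p + 2) / p)) = 1 / k"
		using n by (auto simp: k_def powr_minus_divide)
	\<comment> \<open>A larger constant would translate back, through the factor \<open>k\<close>, into
	  a constant above the greatest one for the inequality without the Hardy term.\<close>
	have not: "\<not> Y_ineq ?T p C" if "C > (real DIM('a) - 2) powr (- ((p + 2) / p)) * L" for C
	proof
		assume "Y_ineq ?T p C"
		then have "C * k <= L" unfolding k_def by (intro L(3) S_ineq_of_Y_ineq n p)
		then show False using that k by (simp add: pos_divide_less_eq)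
	qed
	show ?thesis
		unfolding assms(1) S Y_ineq_iff[OF n assms(3)]
		using Y_ineq_of_S_ineq[OF n p(1) L(2)] not by blast
qed

end
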